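(* Let $\mathfrak{g}=\mathfrak{sl}_3$ and $\lambda\in\Lambda^+$. There are the following decompositions into indecomposable $\mathfrak{b}$-modules (isomorphisms of $\mathfrak{b}$-modules): $$M(s_\alpha\cdot\lambda)\cong\bigl(M(s_\alpha\cdot\lambda)/M(s_\alpha s_\beta\cdot\lambda)\bigr)\oplus L(s_\alpha s_\beta\cdot\lambda)\oplus M(w_0\cdot\lambda),$$ $$M(s_\beta\cdot\lambda)\cong\bigl(M(s_\beta\cdot\lambda)/M(s_\beta s_\alpha\cdot\lambda)\bigr)\oplus L(s_\beta s_\alpha\cdot\lambda)\oplus M(w_0\cdot\lambda),$$ $$M(s_\alpha s_\beta\cdot\lambda)\cong L(s_\alpha s_\beta\cdot\lambda)\oplus M(w_0\cdot\lambda),$$ $$M(s_\beta s_\alpha\cdot\lambda)\cong L(s_\beta s_\alpha\cdot\lambda)\oplus M(w_0\cdot\lambda).$$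
   Context: $\mathfrak{g}=\mathfrak{sl}_3(\mathbb{C})$ with Cartan decomposition $\mathfrak{n}^-\oplus\mathfrak{h}\oplus\mathfrak{n}$, Borel subalgebra $\mathfrak{b}=\mathfrak{h}\oplus\mathfrak{n}$, and simple roots $\alpha,\beta$. $W$ is the Weyl group, generated by the simple reflections $s_\alpha,s_\beta$, with longest element $w_0$; $\rho$ is the half-sum of positive roots and $w\cdot\lambda=w(\lambda+\rho)-\rho$. $\Lambda^+$ is the set of dominant integral weights. $M(\nu)=\operatorname{Ind}_{\mathfrak{b}}^{\mathfrak{g}}\mathbb{C}_\nu$ is the Verma module of highest weight $\nu$ and $L(\nu)$ its simple quotient. The Verma modules $M(w\cdot\lambda)$, $w\in W$, are regarded as submodules of $M(\lambda)$ via the (unique up to scalar) embeddings; in particular $M(s_\alpha s_\beta\cdot\lambda)\subset M(s_\alpha\cdot\lambda)$ and $M(s_\beta s_\alpha\cdot\lambda)\subset M(s_\beta\cdot\lambda)$. All modules are viewed as $\mathfrak{b}$-modules by restriction. *)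

theory Defs
  imports "HOL-Analysis.Analysis" "HOL-Library.Poly_Mapping"
begin

section \<open>Complex Lie algebras and their universal enveloping algebras\<close>

class complex_lie_algebra = ab_group_add +
  fixes lscale :: "complex \<Rightarrow> 'a \<Rightarrow> 'a"
    and bracket :: "'a \<Rightarrow> 'a \<Rightarrow> 'a"
  assumes lscale_add_right: "lscale c (x + y) = lscale c x + lscale c y"
    and lscale_add_left: "lscale (c + d) x = lscale c x + lscale d x"
    and lscale_lscale: "lscale c (lscale d x) = lscale (c * d) x"
    and lscale_one: "lscale 1 x = x"
    and bracket_add_left: "bracket (x + y) z = bracket x z + bracket y z"
    and bracket_add_right: "bracket x (y + z) = bracket x y + bracket x z"
    and bracket_scale_left: "bracket (lscale c x) y = lscale c (bracket x y)"
    and bracket_scale_right: "bracket x (lscale c y) = lscale c (bracket x y)"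
    and bracket_self: "bracket x x = 0"
    and jacobi: "bracket x (bracket y z) + bracket y (bracket z x) + bracket z (bracket x y) = 0"

text \<open>The free monoid on \<open>'g\<close>. With concatenation as addition, the convolution product of
  \<open>Poly_Mapping\<close> makes \<open>'g word \<Rightarrow>\<^sub>0 complex\<close> the free associative unital algebra on the set \<open>'g\<close>.\<close>

datatype 'g word = Word (letters: "'g list")

instantiation word :: (type) monoid_add
begin

definition zero_word :: "'a word" where "0 = Word []"

definition plus_word :: "'a word \<Rightarrow> 'a word \<Rightarrow> 'a word" where
  "v + w = Word (letters v @ letters w)"

instance
  by standard (simp_all add: zero_word_def plus_word_def)

end

type_synonym 'g free_alg = "'g word \<Rightarrow>\<^sub>0 complex"

definition fgen :: "'g \<Rightarrow> 'g free_alg" where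
  "fgen x = Poly_Mapping.single (Word [x]) 1"

definition fconst :: "complex \<Rightarrow> 'g free_alg" where
  "fconst c = Poly_Mapping.single 0 c"

text \<open>The first two families of relations turn the free algebra on the set \<open>'g\<close> into the tensor
  algebra of the vector space \<open>'g\<close>.\<close>

definition uea_relators :: "'g::complex_lie_algebra free_alg set" where
  "uea_relators =
     {fgen (x + y) - fgen x - fgen y | x y. True}
   \<union> {fgen (lscale c x) - fconst c * fgen x | c x. True}
   \<union> {fgen x * fgen y - fgen y * fgen x - fgen (bracket x y) | x y. True}"

inductive_set uea_ideal :: "'g::complex_lie_algebra free_alg set" where
  zero: "0 \<in> uea_ideal"
| add: "p \<in> uea_ideal \<Longrightarrow> r \<in> uea_relators \<Longrightarrow> p + a * r * b \<in> uea_ideal"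

lemma uea_ideal_add: "q \<in> uea_ideal \<Longrightarrow> p \<in> uea_ideal \<Longrightarrow> p + q \<in> uea_ideal"
  by (induction q rule: uea_ideal.induct)
    (auto simp: add.assoc [symmetric] intro: uea_ideal.intros)

lemma uea_ideal_mult_left: "p \<in> uea_ideal \<Longrightarrow> a * p \<in> uea_ideal"
  by (induction p rule: uea_ideal.induct)
    (auto simp: distrib_left mult.assoc [symmetric] intro: uea_ideal.intros)

lemma uea_ideal_mult_right: "p \<in> uea_ideal \<Longrightarrow> p * b \<in> uea_ideal"
proof (induction p rule: uea_ideal.induct)
  case (add p r a c)
  then show ?case
    using uea_ideal.add [of "p * b" r a "c * b"] by (simp add: distrib_right mult.assoc)
qed (simp add: uea_ideal.zero)

lemma uea_ideal_uminus: "p \<in> uea_ideal \<Longrightarrow> - p \<in> uea_ideal"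
  using uea_ideal_mult_left [of p "-1"] by simp

lemma uea_ideal_diff: "p \<in> uea_ideal \<Longrightarrow> q \<in> uea_ideal \<Longrightarrow> p - q \<in> uea_ideal"
  using uea_ideal_add [of p "- q"] uea_ideal_uminus [of q] by simp

lemma word_eq_zero_iff: "v + w = 0 \<longleftrightarrow> v = 0 \<and> w = (0 :: 'g word)"
  by (cases v; cases w) (auto simp: zero_word_def plus_word_def)

lemma lookup_mult_zero_word:
  "Poly_Mapping.lookup (p * q) 0 = Poly_Mapping.lookup p 0 * Poly_Mapping.lookup q (0 :: 'g word)"
  for p q :: "'g free_alg"
proof -
  have "(\<Sum>m. Poly_Mapping.lookup q m when (0 :: 'g word) = l + m)
      = (Poly_Mapping.lookup q 0 when l = 0)" for l
  proof (cases "l = 0")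
    case True
    then show ?thesis by (simp add: when_def)
  next
    case False
    then have "0 \<noteq> l + m" for m using word_eq_zero_iff [of l m] by auto
    then show ?thesis using False by simp
  qed
  then show ?thesis by (simp add: lookup_mult mult_when)
qed

lemma lookup_fgen_zero: "Poly_Mapping.lookup (fgen x) 0 = 0"
  by (simp add: fgen_def lookup_single zero_word_def)

lemma uea_ideal_lookup_zero: "p \<in> uea_ideal \<Longrightarrow> Poly_Mapping.lookup p 0 = 0"
proof (induction p rule: uea_ideal.induct)
  case (add p r a b)
  then have "Poly_Mapping.lookup r 0 = 0"
    by (auto simp: uea_relators_def lookup_minus lookup_mult_zero_word lookup_fgen_zero)
  with add show ?case by (simp add: lookup_add lookup_mult_zero_word)
qed simp

definition uea_cong :: "'g::complex_lie_algebra free_alg \<Rightarrow> 'g free_alg \<Rightarrow> bool" where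
  "uea_cong p q \<longleftrightarrow> p - q \<in> uea_ideal"

quotient_type (overloaded) 'g uea = "'g::complex_lie_algebra free_alg" / uea_cong
proof (rule equivpI)
  show "reflp uea_cong"
    by (auto simp: reflp_def uea_cong_def uea_ideal.zero)
  show "symp uea_cong"
    using uea_ideal_uminus by (fastforce simp: symp_def uea_cong_def)
  show "transp uea_cong"
    using uea_ideal_add by (fastforce simp: transp_def uea_cong_def)
qed

instantiation uea :: (complex_lie_algebra) ring_1
begin

lift_definition zero_uea :: "'a uea" is 0 .
lift_definition one_uea :: "'a uea" is 1 .
lift_definition plus_uea :: "'a uea \<Rightarrow> 'a uea \<Rightarrow> 'a uea" is "(+)"
proof -
  fix p p' q q' :: "'a free_alg"
  assume "uea_cong p p'" "uea_cong q q'"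
  moreover have "p + q - (p' + q') = (p - p') + (q - q')" by simp
  ultimately show "uea_cong (p + q) (p' + q')"
    unfolding uea_cong_def by (metis uea_ideal_add)
qed
lift_definition minus_uea :: "'a uea \<Rightarrow> 'a uea \<Rightarrow> 'a uea" is "(-)"
proof -
  fix p p' q q' :: "'a free_alg"
  assume "uea_cong p p'" "uea_cong q q'"
  moreover have "p - q - (p' - q') = (p - p') - (q - q')" by simp
  ultimately show "uea_cong (p - q) (p' - q')"
    unfolding uea_cong_def by (metis uea_ideal_diff)
qed
lift_definition uminus_uea :: "'a uea \<Rightarrow> 'a uea" is uminus
  unfolding uea_cong_def using uea_ideal_uminus by fastforce
lift_definition times_uea :: "'a uea \<Rightarrow> 'a uea \<Rightarrow> 'a uea" is "(*)"
proof -
  fix p p' q q' :: "'a free_alg"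
  assume "uea_cong p p'" "uea_cong q q'"
  then have "p * (q - q') + (p - p') * q' \<in> uea_ideal"
    unfolding uea_cong_def
    by (intro uea_ideal_add uea_ideal_mult_left uea_ideal_mult_right)
  then show "uea_cong (p * q) (p' * q')"
    by (simp add: uea_cong_def algebra_simps)
qed

instance
proof
  show "(0 :: 'a uea) \<noteq> 1"
  proof (transfer, rule notI)
    assume "uea_cong 0 (1 :: 'a free_alg)"
    then show False
      using uea_ideal_lookup_zero [of "0 - 1 :: 'a free_alg"]
      by (simp add: uea_cong_def lookup_minus lookup_one)
  qed
qed (transfer; simp add: uea_cong_def algebra_simps uea_ideal.zero)+

end

lift_definition ugen :: "'g::complex_lie_algebra \<Rightarrow> 'g uea" is fgen .

lift_definition uconst :: "complex \<Rightarrow> 'g::complex_lie_algebra uea" is fconst .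


section \<open>Modules over Lie algebras\<close>

record ('g, 'v) lmod =
  mcarrier :: "'v set"
  mzero :: 'v
  madd :: "'v \<Rightarrow> 'v \<Rightarrow> 'v"
  mscale :: "complex \<Rightarrow> 'v \<Rightarrow> 'v"
  mact :: "'g \<Rightarrow> 'v \<Rightarrow> 'v"

text \<open>All notions below are relative to a Lie subalgebra \<open>s\<close> of \<open>'g\<close>: only the action of elements
  of \<open>s\<close> is taken into account, so that restriction from \<open>UNIV\<close> to \<open>s\<close> does not change the record.\<close>

locale lie_module =
  fixes s :: "'g::complex_lie_algebra set" and M :: "('g, 'v) lmod"
  assumes zero_closed: "mzero M \<in> mcarrier M"
    and add_closed: "\<lbrakk>u \<in> mcarrier M; v \<in> mcarrier M\<rbrakk> \<Longrightarrow> madd M u v \<in> mcarrier M"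
    and scale_closed: "u \<in> mcarrier M \<Longrightarrow> mscale M c u \<in> mcarrier M"
    and act_closed: "\<lbrakk>x \<in> s; u \<in> mcarrier M\<rbrakk> \<Longrightarrow> mact M x u \<in> mcarrier M"
    and add_assoc: "\<lbrakk>u \<in> mcarrier M; v \<in> mcarrier M; w \<in> mcarrier M\<rbrakk>
      \<Longrightarrow> madd M (madd M u v) w = madd M u (madd M v w)"
    and add_commute: "\<lbrakk>u \<in> mcarrier M; v \<in> mcarrier M\<rbrakk> \<Longrightarrow> madd M u v = madd M v u"
    and add_zero: "u \<in> mcarrier M \<Longrightarrow> madd M (mzero M) u = u"
    and add_inverse: "u \<in> mcarrier M \<Longrightarrow> madd M u (mscale M (- 1) u) = mzero M"
    and scale_add_right: "\<lbrakk>u \<in> mcarrier M; v \<in> mcarrier M\<rbrakk>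
      \<Longrightarrow> mscale M c (madd M u v) = madd M (mscale M c u) (mscale M c v)"
    and scale_add_left: "u \<in> mcarrier M
      \<Longrightarrow> mscale M (c + d) u = madd M (mscale M c u) (mscale M d u)"
    and scale_scale: "u \<in> mcarrier M \<Longrightarrow> mscale M c (mscale M d u) = mscale M (c * d) u"
    and scale_one: "u \<in> mcarrier M \<Longrightarrow> mscale M 1 u = u"
    and act_add: "\<lbrakk>x \<in> s; u \<in> mcarrier M; v \<in> mcarrier M\<rbrakk>
      \<Longrightarrow> mact M x (madd M u v) = madd M (mact M x u) (mact M x v)"
    and act_scale: "\<lbrakk>x \<in> s; u \<in> mcarrier M\<rbrakk>
      \<Longrightarrow> mact M x (mscale M c u) = mscale M c (mact M x u)"
    and act_add_left: "\<lbrakk>x \<in> s; y \<in> s; u \<in> mcarrier M\<rbrakk>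
      \<Longrightarrow> mact M (x + y) u = madd M (mact M x u) (mact M y u)"
    and act_scale_left: "\<lbrakk>x \<in> s; u \<in> mcarrier M\<rbrakk>
      \<Longrightarrow> mact M (lscale c x) u = mscale M c (mact M x u)"
    and act_bracket: "\<lbrakk>x \<in> s; y \<in> s; u \<in> mcarrier M\<rbrakk>
      \<Longrightarrow> madd M (mact M (bracket x y) u) (mact M y (mact M x u)) = mact M x (mact M y u)"

definition submodule :: "'g set \<Rightarrow> ('g, 'v) lmod \<Rightarrow> 'v set \<Rightarrow> bool" where
  "submodule s M N \<longleftrightarrow> N \<subseteq> mcarrier M \<and> mzero M \<in> N
     \<and> (\<forall>u\<in>N. \<forall>v\<in>N. madd M u v \<in> N)
     \<and> (\<forall>c. \<forall>u\<in>N. mscale M c u \<in> N)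
     \<and> (\<forall>x\<in>s. \<forall>u\<in>N. mact M x u \<in> N)"

definition module_hom :: "'g set \<Rightarrow> ('g, 'v) lmod \<Rightarrow> ('g, 'w) lmod \<Rightarrow> ('v \<Rightarrow> 'w) \<Rightarrow> bool" where
  "module_hom s M N f \<longleftrightarrow> f ` mcarrier M \<subseteq> mcarrier N
     \<and> (\<forall>u\<in>mcarrier M. \<forall>v\<in>mcarrier M. f (madd M u v) = madd N (f u) (f v))
     \<and> (\<forall>c. \<forall>u\<in>mcarrier M. f (mscale M c u) = mscale N c (f u))
     \<and> (\<forall>x\<in>s. \<forall>u\<in>mcarrier M. f (mact M x u) = mact N x (f u))"

definition module_embedding ::
    "'g set \<Rightarrow> ('g, 'v) lmod \<Rightarrow> ('g, 'w) lmod \<Rightarrow> ('v \<Rightarrow> 'w) \<Rightarrow> bool" where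
  "module_embedding s M N f \<longleftrightarrow> module_hom s M N f \<and> inj_on f (mcarrier M)"

definition module_iso :: "'g set \<Rightarrow> ('g, 'v) lmod \<Rightarrow> ('g, 'w) lmod \<Rightarrow> bool" where
  "module_iso s M N \<longleftrightarrow>
     (\<exists>f. module_hom s M N f \<and> bij_betw f (mcarrier M) (mcarrier N))"

definition coset :: "('g, 'v) lmod \<Rightarrow> 'v set \<Rightarrow> 'v \<Rightarrow> 'v set" where
  "coset M N u = {madd M u n | n. n \<in> N}"

text \<open>The operations on cosets are given by sets of representatives; adding \<open>N\<close> makes the result of
  scaling (in particular by 0) and of the action a full coset.\<close>

definition quotient_module :: "('g, 'v) lmod \<Rightarrow> 'v set \<Rightarrow> ('g, 'v set) lmod"
    (infixl "'/'/\<^sub>m" 75) where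
  "M //\<^sub>m N =
     \<lparr>mcarrier = coset M N ` mcarrier M,
      mzero = N,
      madd = \<lambda>A B. {madd M a b | a b. a \<in> A \<and> b \<in> B},
      mscale = \<lambda>c A. {madd M (mscale M c a) n | a n. a \<in> A \<and> n \<in> N},
      mact = \<lambda>x A. {madd M (mact M x a) n | a n. a \<in> A \<and> n \<in> N}\<rparr>"

definition direct_sum :: "('g, 'v) lmod \<Rightarrow> ('g, 'w) lmod \<Rightarrow> ('g, 'v \<times> 'w) lmod"
    (infixr "\<oplus>\<^sub>m" 70) where
  "M \<oplus>\<^sub>m N =
     \<lparr>mcarrier = mcarrier M \<times> mcarrier N,
      mzero = (mzero M, mzero N),
      madd = \<lambda>(u, v) (u', v'). (madd M u u', madd N v v'),
      mscale = \<lambda>c (u, v). (mscale M c u, mscale N c v),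
      mact = \<lambda>x (u, v). (mact M x u, mact N x v)\<rparr>"

definition simple_module :: "'g::complex_lie_algebra set \<Rightarrow> ('g, 'v) lmod \<Rightarrow> bool" where
  "simple_module s M \<longleftrightarrow> lie_module s M \<and> mcarrier M \<noteq> {mzero M}
     \<and> (\<forall>N. submodule s M N \<longrightarrow> N = {mzero M} \<or> N = mcarrier M)"

definition indecomposable :: "'g::complex_lie_algebra set \<Rightarrow> ('g, 'v) lmod \<Rightarrow> bool" where
  "indecomposable s M \<longleftrightarrow> lie_module s M \<and> mcarrier M \<noteq> {mzero M}
     \<and> \<not> (\<exists>A B. submodule s M A \<and> submodule s M B
            \<and> A \<noteq> {mzero M} \<and> B \<noteq> {mzero M} \<and> A \<inter> B = {mzero M}
            \<and> mcarrier M = {madd M a b | a b. a \<in> A \<and> b \<in> B})"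

text \<open>The quotient by the unique submodule with simple quotient (for modules, such as Verma modules,
  that have exactly one such submodule).\<close>

definition simple_quotient :: "('g::complex_lie_algebra, 'v) lmod \<Rightarrow> ('g, 'v set) lmod" where
  "simple_quotient M =
     M //\<^sub>m (THE N. submodule UNIV M N \<and> simple_module UNIV (M //\<^sub>m N))"


section \<open>Induced modules\<close>

definition pm_scale :: "complex \<Rightarrow> ('k \<Rightarrow>\<^sub>0 complex) \<Rightarrow> ('k \<Rightarrow>\<^sub>0 complex)" where
  "pm_scale c p = Poly_Mapping.map ((*) c) p"

lemma lookup_pm_scale [simp]: "Poly_Mapping.lookup (pm_scale c p) k = c * Poly_Mapping.lookup p k"
  by (simp add: pm_scale_def Poly_Mapping.map.rep_eq when_def)

global_interpretation pm: vector_space "pm_scale :: complex \<Rightarrow> ('k \<Rightarrow>\<^sub>0 complex) \<Rightarrow> _"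
  by standard (rule poly_mapping_eqI; simp add: lookup_add algebra_simps)+

text \<open>The tensor product \<open>U(g) \<otimes> V\<close> over \<open>U(s)\<close> is the quotient of the free vector space on the pairs
  \<open>(u, v)\<close> by the span of the relations below. As \<open>U(s)\<close> is generated by \<open>s\<close>, it is
  enough to move elements of \<open>s\<close> across the tensor sign.\<close>

definition pure :: "'g::complex_lie_algebra uea \<Rightarrow> 'v \<Rightarrow> ('g uea \<times> 'v) \<Rightarrow>\<^sub>0 complex" where
  "pure u v = Poly_Mapping.single (u, v) 1"

definition tensor_relators ::
    "'g::complex_lie_algebra set \<Rightarrow> ('g, 'v) lmod \<Rightarrow> (('g uea \<times> 'v) \<Rightarrow>\<^sub>0 complex) set" where
  "tensor_relators s V =
     {pure (u + u') v - pure u v - pure u' v | u u' v. v \<in> mcarrier V}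
   \<union> {pure u (madd V v v') - pure u v - pure u v' | u v v'. v \<in> mcarrier V \<and> v' \<in> mcarrier V}
   \<union> {pure (uconst c * u) v - pm_scale c (pure u v) | c u v. v \<in> mcarrier V}
   \<union> {pure u (mscale V c v) - pm_scale c (pure u v) | c u v. v \<in> mcarrier V}
   \<union> {pure (u * ugen x) v - pure u (mact V x v) | u x v. x \<in> s \<and> v \<in> mcarrier V}"

definition free_tensor_module ::
    "('g::complex_lie_algebra, 'v) lmod \<Rightarrow> ('g, ('g uea \<times> 'v) \<Rightarrow>\<^sub>0 complex) lmod" where
  "free_tensor_module V =
     \<lparr>mcarrier = {p. Poly_Mapping.keys p \<subseteq> UNIV \<times> mcarrier V},
      mzero = 0,
      madd = (+),
      mscale = pm_scale,
      mact = \<lambda>x p. \<Sum>(u, v)\<in>Poly_Mapping.keys p.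
               pm_scale (Poly_Mapping.lookup p (u, v)) (pure (ugen x * u) v)\<rparr>"

definition induced_module ::
    "'g::complex_lie_algebra set \<Rightarrow> ('g, 'v) lmod \<Rightarrow> ('g, (('g uea \<times> 'v) \<Rightarrow>\<^sub>0 complex) set) lmod"
  where
  "induced_module s V = free_tensor_module V //\<^sub>m pm.span (tensor_relators s V)"


section \<open>The Lie algebra of traceless complex 3 by 3 matrices\<close>

typedef sl3 = "{A :: complex^3^3. trace A = 0}"
  morphisms mat_of sl3_of
  by (rule exI [of _ 0]) (simp add: trace_def)

setup_lifting type_definition_sl3

instantiation sl3 :: complex_lie_algebra
begin

lift_definition zero_sl3 :: sl3 is 0 by (simp add: trace_def)
lift_definition plus_sl3 :: "sl3 \<Rightarrow> sl3 \<Rightarrow> sl3" is "(+)" by (simp add: trace_add)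
lift_definition minus_sl3 :: "sl3 \<Rightarrow> sl3 \<Rightarrow> sl3" is "(-)" by (simp add: trace_sub)
lift_definition uminus_sl3 :: "sl3 \<Rightarrow> sl3" is uminus
  by (simp add: trace_def sum_negf)
lift_definition lscale_sl3 :: "complex \<Rightarrow> sl3 \<Rightarrow> sl3" is "\<lambda>c A. \<chi> i j. c * A $ i $ j"
  by (simp add: trace_def sum_distrib_left [symmetric])
lift_definition bracket_sl3 :: "sl3 \<Rightarrow> sl3 \<Rightarrow> sl3" is "\<lambda>A B. A ** B - B ** A"
  by (simp add: trace_sub) (rule trace_mul_sym)

instance
proof
  have distrib: "(A + B) ** C = A ** C + B ** C" "C ** (A + B) = C ** A + C ** B"
    "(A - B) ** C = A ** C - B ** C" "C ** (A - B) = C ** A - C ** B" for A B C :: "complex^3^3"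
    by (simp_all add: vec_eq_iff matrix_matrix_mult_def distrib_left distrib_right
        left_diff_distrib right_diff_distrib sum.distrib sum_subtractf)
  have scale: "(\<chi> i j. c * A $ i $ j) ** B = (\<chi> i j. c * (A ** B) $ i $ j)"
    "B ** (\<chi> i j. c * A $ i $ j) = (\<chi> i j. c * (B ** A) $ i $ j)"
    for A B :: "complex^3^3" and c
    by (simp_all add: vec_eq_iff matrix_matrix_mult_def sum_distrib_left mult.assoc
        mult.left_commute)
  fix x y z :: sl3 and c d :: complex
  show "bracket (x + y) z = bracket x z + bracket y z"
    by transfer (simp add: distrib)
  show "bracket x (y + z) = bracket x y + bracket x z"
    by transfer (simp add: distrib)
  show "bracket (lscale c x) y = lscale c (bracket x y)"
    by transfer (simp only: scale, simp add: vec_eq_iff right_diff_distrib)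
  show "bracket x (lscale c y) = lscale c (bracket x y)"
    by transfer (simp only: scale, simp add: vec_eq_iff right_diff_distrib)
  show "bracket x (bracket y z) + bracket y (bracket z x) + bracket z (bracket x y) = 0"
    by transfer (simp add: distrib matrix_mul_assoc)
qed (transfer; simp add: vec_eq_iff algebra_simps)+

end

text \<open>The order of the index type \<open>3\<close> is that of the residues 0, 1, 2, so \<open>3 < 1\<close> there. The upper
  triangular matrices are therefore described entry by entry.\<close>

definition cartan :: "sl3 set" where
  "cartan = {x. \<forall>i j. i \<noteq> j \<longrightarrow> mat_of x $ i $ j = 0}"

definition borel_sl3 :: "sl3 set" where
  "borel_sl3 = {x. mat_of x $ 2 $ 1 = 0 \<and> mat_of x $ 3 $ 1 = 0 \<and> mat_of x $ 3 $ 2 = 0}"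

text \<open>Projection onto the Cartan subalgebra along the strictly triangular matrices.\<close>

lift_definition cartan_part :: "sl3 \<Rightarrow> sl3" is "\<lambda>A. \<chi> i j. if i = j then A $ i $ j else 0"
  by (simp add: trace_def)


section \<open>Weights and the Weyl group\<close>

text \<open>A weight is a linear functional on \<open>cartan\<close>; its values elsewhere are irrelevant.\<close>

type_synonym weight = "sl3 \<Rightarrow> complex"

definition is_weight :: "weight \<Rightarrow> bool" where
  "is_weight \<nu> \<longleftrightarrow> (\<forall>x\<in>cartan. \<forall>y\<in>cartan. \<nu> (x + y) = \<nu> x + \<nu> y)
     \<and> (\<forall>c. \<forall>x\<in>cartan. \<nu> (lscale c x) = c * \<nu> x)"

definition root_alpha :: weight where
  "root_alpha x = mat_of x $ 1 $ 1 - mat_of x $ 2 $ 2"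

definition root_beta :: weight where
  "root_beta x = mat_of x $ 2 $ 2 - mat_of x $ 3 $ 3"

lift_definition coroot_alpha :: sl3
  is "\<chi> i j. if i = j then (if i = 1 then 1 else if i = 2 then - 1 else 0) else 0"
  by (simp add: trace_def sum_3)

lift_definition coroot_beta :: sl3
  is "\<chi> i j. if i = j then (if i = 2 then 1 else if i = 3 then - 1 else 0) else 0"
  by (simp add: trace_def sum_3)

definition dominant_integral :: "weight \<Rightarrow> bool" where
  "dominant_integral \<nu> \<longleftrightarrow> is_weight \<nu> \<and> \<nu> coroot_alpha \<in> \<nat> \<and> \<nu> coroot_beta \<in> \<nat>"

definition s_alpha :: "weight \<Rightarrow> weight" where
  "s_alpha \<nu> = (\<lambda>x. \<nu> x - \<nu> coroot_alpha * root_alpha x)"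

definition s_beta :: "weight \<Rightarrow> weight" where
  "s_beta \<nu> = (\<lambda>x. \<nu> x - \<nu> coroot_beta * root_beta x)"

text \<open>The Weyl group generated by \<open>s_alpha\<close> and \<open>s_beta\<close> is the symmetric group on three letters;
  its longest element has exactly the two reduced expressions below.\<close>

definition w0 :: "weight \<Rightarrow> weight" where
  "w0 = s_alpha \<circ> s_beta \<circ> s_alpha"

lemma w0_alt: "w0 = s_beta \<circ> s_alpha \<circ> s_beta"
proof -
  have "root_alpha coroot_alpha = 2" "root_beta coroot_beta = 2"
       "root_alpha coroot_beta = - 1" "root_beta coroot_alpha = - 1"
    unfolding root_alpha_def root_beta_def by (transfer; simp)+
  then show ?thesis
    by (simp add: w0_def s_alpha_def s_beta_def fun_eq_iff algebra_simps)
qed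

text \<open>The positive roots are \<open>\<alpha>\<close>, \<open>\<beta>\<close> and \<open>\<alpha> + \<beta>\<close>.\<close>

definition weyl_rho :: weight where
  "weyl_rho x = (root_alpha x + root_beta x + (root_alpha x + root_beta x)) / 2"

definition dot :: "(weight \<Rightarrow> weight) \<Rightarrow> weight \<Rightarrow> weight" (infixr "\<cdot>\<^sub>W" 80) where
  "w \<cdot>\<^sub>W \<nu> = (\<lambda>x. w (\<lambda>y. \<nu> y + weyl_rho y) x - weyl_rho x)"


section \<open>Verma modules\<close>

definition weight_module :: "weight \<Rightarrow> (sl3, complex) lmod" where
  "weight_module \<nu> =
     \<lparr>mcarrier = UNIV, mzero = 0, madd = (+), mscale = (*), mact = \<lambda>x v. \<nu> (cartan_part x) * v\<rparr>"

type_synonym verma_elt = "((sl3 uea \<times> complex) \<Rightarrow>\<^sub>0 complex) set"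

definition verma :: "weight \<Rightarrow> (sl3, verma_elt) lmod" where
  "verma \<nu> = induced_module borel_sl3 (weight_module \<nu>)"

definition simple_hw_module :: "weight \<Rightarrow> (sl3, verma_elt set) lmod" where
  "simple_hw_module \<nu> = simple_quotient (verma \<nu>)"

text \<open>The copy of \<open>M(\<nu>)\<close> inside \<open>M(\<mu>)\<close>. Embeddings of Verma modules are unique up to a scalar, so
  there is at most one such submodule.\<close>

definition verma_submodule :: "weight \<Rightarrow> weight \<Rightarrow> verma_elt set" where
  "verma_submodule \<nu> \<mu> =
     (THE N. \<exists>j. module_embedding UNIV (verma \<nu>) (verma \<mu>) j \<and> N = j ` mcarrier (verma \<nu>))"

end

theory Submission
  imports Defs
begin

text \<open>Write \<open>\<lambda> + \<rho> = (a, b)\<close> in the basis of fundamental weights, with \<open>a, b \<ge> 1\<close>, and let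
  \<open>\<nu> = s\<^sub>\<alpha> \<cdot> \<lambda>\<close>, \<open>\<mu> = s\<^sub>\<alpha> s\<^sub>\<beta> \<cdot> \<lambda>\<close>, \<open>\<omega> = w\<^sub>0 \<cdot> \<lambda>\<close>; shifted by \<open>\<rho>\<close> these are \<open>(-a, a+b)\<close>, \<open>(-a-b, a)\<close> and
  \<open>(-b, -a)\<close>. The statements about \<open>s\<^sub>\<beta> \<cdot> \<lambda>\<close> follow from those about \<open>\<nu>\<close> by the diagram automorphism of
  \<open>sl\<^sub>3\<close>, so every module below carries an involution \<open>t\<close> through which the Lie algebra acts.

  \<^bold>\<open>The splitting.\<close> The module \<open>M(\<omega>)\<close> is simple, and \<open>L(\<mu>) = M(\<mu>)/M(\<omega>)\<close> is a simple parabolic Verma module. For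
  such a module \<open>T\<close>, with highest weight vector \<open>v\<close> and dual functional \<open>v\<^sup>*\<close>, the map sending \<open>x\<close> to the functional
  \<open>X \<mapsto> v\<^sup>*(X x)\<close> on \<open>U(n)\<close> is injective, because its kernel contains no singular vector; comparing
  dimensions of weight spaces, it identifies \<open>T\<close> with the functionals of finite support on \<open>U(n)\<close> (for \<open>L(\<mu>)\<close>: on
  \<open>U(n)/e\<^sub>\<beta>\<^sup>a U(n)\<close>). So \<open>T\<close> is coinduced as a module over the Borel subalgebra, and a homomorphism from
  a weight module \<open>E\<close> to \<open>T\<close> is the same as a linear functional on one weight space of \<open>E\<close> (for \<open>L(\<mu>)\<close>: one that vanishes
  on the image of \<open>e\<^sub>\<beta>\<^sup>a\<close>). This is \<open>coinduced_hom\<close>. Applied to \<open>E = M(\<nu>)\<close> with a functional that does not vanish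
  on the singular vector of weight \<open>\<mu>\<close>, respectively \<open>\<omega>\<close>, it gives homomorphisms \<open>r\<^sub>1\<close> to \<open>L(\<mu>)\<close> and \<open>r\<^sub>2\<close> to \<open>M(\<omega>)\<close>
  whose restrictions to \<open>M(\<mu>) \<subseteq> M(\<nu>)\<close> and \<open>M(\<omega>) \<subseteq> M(\<nu>)\<close> are the canonical ones. Hence \<open>(r\<^sub>1, r\<^sub>2)\<close> is
  bijective on \<open>M(\<mu>)\<close>, and adding the projection to \<open>M(\<nu>)/M(\<mu>)\<close> gives both isomorphisms.

  \<^bold>\<open>Indecomposability.\<close> A module over the Borel subalgebra on which \<open>n\<close> acts locally nilpotently, and which has a single
  line of singular vectors, is indecomposable; this covers \<open>L(\<mu>)\<close> and \<open>M(\<omega>)\<close>. The quotient \<open>M(\<nu>)/M(\<mu>)\<close> has two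
  such lines, spanned by its highest weight vector \<open>v\<^sub>0\<close> and by \<open>v\<^sub>1 = f\<^sub>\<beta>\<^bsup>a+b\<^esup> v\<^sub>0\<close>. In a decomposition
  \<open>A \<oplus> B\<close> with \<open>v\<^sub>0 \<in> A\<close> and \<open>B \<noteq> 0\<close> the singular vectors force \<open>B\<close> to be the submodule generated by \<open>v\<^sub>1\<close>. But
  \<open>u = f\<^sub>\<beta>\<^bsup>a+b\<^esup> f\<^sub>\<alpha>\<^sup>b v\<^sub>0\<close> satisfies \<open>e\<^sub>\<alpha>\<^sup>b u = c v\<^sub>1\<close> with \<open>c \<noteq> 0\<close>, whereas \<open>e\<^sub>\<alpha>\<^sup>b\<close> kills the vectors of the weight
  of \<open>u\<close> in that submodule, and so \<open>v\<^sub>1\<close> would lie in \<open>A\<close> (\<open>complement_trivial\<close>).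

  \<^bold>\<open>The model.\<close> All of this is computed in explicit coordinates: \<open>M(\<nu>)\<close> has the basis
  \<open>f\<^sub>\<alpha>\<^sup>i f\<^sub>\<beta>\<^sup>j f\<^sub>\<alpha>\<^sub>+\<^sub>\<beta>\<^sup>l v\<^sub>0\<close>, on which the Lie algebra acts by second order difference operators. The operators
  satisfy the relations of \<open>sl\<^sub>3\<close>, so the induced module maps onto the model, and the ordered monomials span the induced
  module, so this map is an isomorphism (\<open>verma_iso\<close>).\<close>

section \<open>Modules, quotients and direct sums\<close>

text \<open>The axioms of a module in which the operators need not represent the Lie bracket. The induced module is a quotient of a
  space that satisfies only these axioms, since there an element \<open>x\<close> acts by left multiplication on formal symbols.\<close>

locale lin_module =
  fixes s :: "'g::complex_lie_algebra set" and M :: "('g, 'v) lmod"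
  assumes zero_closed [intro, simp]: "mzero M \<in> mcarrier M"
    and add_closed [intro, simp]: "\<lbrakk>u \<in> mcarrier M; v \<in> mcarrier M\<rbrakk> \<Longrightarrow> madd M u v \<in> mcarrier M"
    and scale_closed [intro, simp]: "u \<in> mcarrier M \<Longrightarrow> mscale M c u \<in> mcarrier M"
    and act_closed [intro, simp]: "\<lbrakk>x \<in> s; u \<in> mcarrier M\<rbrakk> \<Longrightarrow> mact M x u \<in> mcarrier M"
    and add_assoc: "\<lbrakk>u \<in> mcarrier M; v \<in> mcarrier M; w \<in> mcarrier M\<rbrakk>
      \<Longrightarrow> madd M (madd M u v) w = madd M u (madd M v w)"
    and add_commute: "\<lbrakk>u \<in> mcarrier M; v \<in> mcarrier M\<rbrakk> \<Longrightarrow> madd M u v = madd M v u"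
    and add_zero [simp]: "u \<in> mcarrier M \<Longrightarrow> madd M (mzero M) u = u"
    and add_inverse [simp]: "u \<in> mcarrier M \<Longrightarrow> madd M u (mscale M (- 1) u) = mzero M"
    and scale_add_right: "\<lbrakk>u \<in> mcarrier M; v \<in> mcarrier M\<rbrakk>
      \<Longrightarrow> mscale M c (madd M u v) = madd M (mscale M c u) (mscale M c v)"
    and scale_add_left: "u \<in> mcarrier M
      \<Longrightarrow> mscale M (c + d) u = madd M (mscale M c u) (mscale M d u)"
    and scale_scale: "u \<in> mcarrier M \<Longrightarrow> mscale M c (mscale M d u) = mscale M (c * d) u"
    and scale_one [simp]: "u \<in> mcarrier M \<Longrightarrow> mscale M 1 u = u"
    and act_add: "\<lbrakk>x \<in> s; u \<in> mcarrier M; v \<in> mcarrier M\<rbrakk>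
      \<Longrightarrow> mact M x (madd M u v) = madd M (mact M x u) (mact M x v)"
    and act_scale: "\<lbrakk>x \<in> s; u \<in> mcarrier M\<rbrakk>
      \<Longrightarrow> mact M x (mscale M c u) = mscale M c (mact M x u)"

lemma lie_module_lin: "lie_module s M \<Longrightarrow> lin_module s M"
proof -
  assume "lie_module s M"
  then interpret lie_module s M .
  show ?thesis
    by (rule lin_module.intro) (fact zero_closed add_closed scale_closed act_closed add_assoc
      add_commute add_zero add_inverse scale_add_right scale_add_left scale_scale scale_one act_add act_scale)+
qed

lemma lie_module_restrict: "lie_module s M \<Longrightarrow> s' \<subseteq> s \<Longrightarrow> lie_module s' M"
proof -
  assume "lie_module s M" and s: "s' \<subseteq> s"
  then interpret lie_module s M by simp
  show ?thesis
    by (rule lie_module.intro; (rule zero_closed add_closed scale_closed act_closed add_assoc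
      add_commute add_zero add_inverse scale_add_right scale_add_left scale_scale scale_one act_add act_scale
      act_add_left act_scale_left act_bracket; (assumption | rule subsetD[OF s])))
qed

lemma module_hom_restrict: "module_hom s M N f \<Longrightarrow> s' \<subseteq> s \<Longrightarrow> module_hom s' M N f"
  unfolding module_hom_def by blast

lemma module_iso_restrict: "module_iso s M N \<Longrightarrow> s' \<subseteq> s \<Longrightarrow> module_iso s' M N"
  unfolding module_iso_def using module_hom_restrict by blast

lemma submodule_restrict: "submodule s M N \<Longrightarrow> s' \<subseteq> s \<Longrightarrow> submodule s' M N"
  unfolding submodule_def by blast

lemma module_hom_compose:
  "module_hom s L M f \<Longrightarrow> module_hom s M N g \<Longrightarrow> module_hom s L N (g \<circ> f)"
  unfolding module_hom_def by (auto simp: image_subset_iff)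

lemma module_iso_trans: "module_iso s L M \<Longrightarrow> module_iso s M N \<Longrightarrow> module_iso s L N"
  unfolding module_iso_def using module_hom_compose bij_betw_trans by metis

lemma (in lin_module) inv_hom:
  assumes "module_hom s M N f" "bij_betw f (mcarrier M) (mcarrier N)"
  shows "module_hom s N M (inv_into (mcarrier M) f)"
proof -
  let ?g = "inv_into (mcarrier M) f"
  have fg: "f (?g y) = y" if "y \<in> mcarrier N" for y
    using that assms(2) by (simp add: bij_betw_inv_into_right)
  have gf: "?g (f x) = x" if "x \<in> mcarrier M" for x
    using that assms(2) by (simp add: bij_betw_inv_into_left)
  have gc: "?g y \<in> mcarrier M" if "y \<in> mcarrier N" for y
    using that assms(2) by (metis bij_betw_def inv_into_into)
  note f = assms(1)[unfolded module_hom_def]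
  show ?thesis unfolding module_hom_def
  proof (intro conjI ballI allI)
    show "?g ` mcarrier N \<subseteq> mcarrier M" using gc by blast
  next
    fix u v assume uv: "u \<in> mcarrier N" "v \<in> mcarrier N"
    then have "madd N u v = f (madd M (?g u) (?g v))" using f gc fg by metis
    then show "?g (madd N u v) = madd M (?g u) (?g v)" using gf gc uv by simp
  next
    fix c u assume uv: "u \<in> mcarrier N"
    then have "mscale N c u = f (mscale M c (?g u))" using f gc fg by metis
    then show "?g (mscale N c u) = mscale M c (?g u)" using gf gc uv by simp
  next
    fix x u assume uv: "x \<in> s" "u \<in> mcarrier N"
    then have "mact N x u = f (mact M x (?g u))" using f gc fg by metis
    then show "?g (mact N x u) = mact M x (?g u)" using gf gc uv by simp
  qed
qed

lemma (in lin_module) module_iso_sym: "module_iso s M N \<Longrightarrow> module_iso s N M"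
  unfolding module_iso_def using inv_hom bij_betw_inv_into by blast

lemma direct_sum_simps [simp]:
  "mcarrier (M \<oplus>\<^sub>m N) = mcarrier M \<times> mcarrier N"
  "mzero (M \<oplus>\<^sub>m N) = (mzero M, mzero N)"
  "madd (M \<oplus>\<^sub>m N) (u, v) (u', v') = (madd M u u', madd N v v')"
  "mscale (M \<oplus>\<^sub>m N) c (u, v) = (mscale M c u, mscale N c v)"
  "mact (M \<oplus>\<^sub>m N) x (u, v) = (mact M x u, mact N x v)"
  by (simp_all add: direct_sum_def)

lemma module_iso_direct_sum:
  assumes "module_iso s M M'" "module_iso s N N'"
  shows "module_iso s (M \<oplus>\<^sub>m N) (M' \<oplus>\<^sub>m N')"
proof -
  obtain f g where f: "module_hom s M M' f" "bij_betw f (mcarrier M) (mcarrier M')"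
    and g: "module_hom s N N' g" "bij_betw g (mcarrier N) (mcarrier N')"
    using assms unfolding module_iso_def by blast
  have "module_hom s (M \<oplus>\<^sub>m N) (M' \<oplus>\<^sub>m N') (map_prod f g)"
    using f(1) g(1) unfolding module_hom_def by (auto simp: image_subset_iff)
  moreover have "bij_betw (map_prod f g) (mcarrier (M \<oplus>\<^sub>m N)) (mcarrier (M' \<oplus>\<^sub>m N'))"
    using f(2) g(2) by (simp add: bij_betw_map_prod)
  ultimately show ?thesis unfolding module_iso_def by blast
qed

context lin_module begin

lemma add_zero_right [simp]: "u \<in> mcarrier M \<Longrightarrow> madd M u (mzero M) = u"
  using add_commute by fastforce

lemma add_left_commute: "\<lbrakk>u \<in> mcarrier M; v \<in> mcarrier M; w \<in> mcarrier M\<rbrakk>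
   \<Longrightarrow> madd M u (madd M v w) = madd M v (madd M u w)"
  by (metis add_assoc add_commute)

lemma add_inverse_cancel' [simp]: 
  "\<lbrakk>u \<in> mcarrier M; v \<in> mcarrier M\<rbrakk> \<Longrightarrow> madd M (mscale M (-1) u) (madd M u v) = v"
  by (simp add: add_assoc[symmetric]) (simp add: add_commute)

lemma scale_zero_left [simp]: "u \<in> mcarrier M \<Longrightarrow> mscale M 0 u = mzero M"
  by (metis add_inverse right_minus scale_add_left scale_one)

lemma scale_zero_right [simp]: "mscale M c (mzero M) = mzero M"
  by (metis mult_zero_right scale_scale scale_zero_left zero_closed)

lemma act_zero [simp]: "x \<in> s \<Longrightarrow> mact M x (mzero M) = mzero M"
  by (metis act_scale scale_zero_left act_closed zero_closed)

lemma add_eq_zero_iff: 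
  "\<lbrakk>u \<in> mcarrier M; v \<in> mcarrier M\<rbrakk> \<Longrightarrow> madd M u (mscale M (-1) v) = mzero M \<longleftrightarrow> u = v"
  by (metis add_commute add_inverse add_inverse_cancel' add_zero_right scale_closed)

lemma hom_zero: "module_hom s M N f \<Longrightarrow> lin_module s N \<Longrightarrow> f (mzero M) = mzero N"
  by (metis image_subset_iff lin_module.scale_zero_left module_hom_def scale_zero_left zero_closed)

lemma submodule_kernel:
  assumes "module_hom s M N f" "lin_module s N"
  shows "submodule s M {u \<in> mcarrier M. f u = mzero N}"
proof -
  interpret N: lin_module s N by fact
  show ?thesis using assms hom_zero[OF assms] unfolding submodule_def module_hom_def by auto
qed

lemma submodule_image:
  assumes "module_hom s M N f" "lin_module s N" "submodule s M A"
  shows "submodule s N (f ` A)"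
  unfolding submodule_def
proof (intro conjI ballI allI)
  have A: "A \<subseteq> mcarrier M" using assms(3) by (simp add: submodule_def)
  note f = assms(1)[unfolded module_hom_def] and a = assms(3)[unfolded submodule_def]
  show "f ` A \<subseteq> mcarrier N" using A f by blast
  show "mzero N \<in> f ` A" using hom_zero[OF assms(1,2)] a by (metis image_eqI)
  fix u assume "u \<in> f ` A"
  then obtain u' where u: "u = f u'" "u' \<in> A" by blast
  { fix v assume "v \<in> f ` A"
    then obtain v' where v: "v = f v'" "v' \<in> A" by blast
    have "madd N u v = f (madd M u' v')" using u v f A by (metis subsetD)
    then show "madd N u v \<in> f ` A" using a u v by blast }
  { fix c have "mscale N c u = f (mscale M c u')" using u f A by (metis subsetD)
    then show "mscale N c u \<in> f ` A" using a u by blast }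
  { fix x assume x: "x \<in> s" then have "mact N x u = f (mact M x u')" using u f A by (metis subsetD)
    then show "mact N x u \<in> f ` A" using a u x by blast }
qed

lemma submodule_vimage:
  assumes "module_hom s M N f" "lin_module s N" "submodule s N A"
  shows "submodule s M {u \<in> mcarrier M. f u \<in> A}"
  using assms hom_zero[OF assms(1,2)] unfolding submodule_def module_hom_def
  by auto

end

lemma submoduleD:
  assumes "submodule s M N"
  shows "u \<in> N \<Longrightarrow> u \<in> mcarrier M" "mzero M \<in> N" "u \<in> N \<Longrightarrow> v \<in> N \<Longrightarrow> madd M u v \<in> N"
   "u \<in> N \<Longrightarrow> mscale M c u \<in> N" "x \<in> s \<Longrightarrow> u \<in> N \<Longrightarrow> mact M x u \<in> N"
  using assms unfolding submodule_def by blast+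

text \<open>Calculations in a quotient record are reduced here to calculations with representatives: the operations on cosets were
  given as operations on sets.\<close>

locale sub_lin_module = lin_module +
  fixes N assumes sub: "submodule s M N"
begin

lemmas subD [simp] = submoduleD[OF sub]

lemma coset_self [simp]: "u \<in> mcarrier M \<Longrightarrow> u \<in> coset M N u"
proof -
  assume "u \<in> mcarrier M"
  then have "u = madd M u (mzero M)" by simp
  then show ?thesis unfolding coset_def using subD(2) by blast
qed

lemma mem_coset_iff: "\<lbrakk>u \<in> mcarrier M; v \<in> mcarrier M\<rbrakk> \<Longrightarrow>
   v \<in> coset M N u \<longleftrightarrow> madd M v (mscale M (-1) u) \<in> N"
proof
  assume u: "u \<in> mcarrier M" and v: "v \<in> mcarrier M"
  { assume "v \<in> coset M N u"
    then obtain n where n: "n \<in> N" "v = madd M u n" unfolding coset_def by blast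
    then have "madd M v (mscale M (-1) u) = n" using u
      by (simp add: add_commute[of "madd M u n"])
    then show "madd M v (mscale M (-1) u) \<in> N" using n by simp }
  { assume n: "madd M v (mscale M (-1) u) \<in> N"
    have "v = madd M u (madd M v (mscale M (-1) u))" using u v
      by (simp add: add_left_commute[of u])
    then show "v \<in> coset M N u" unfolding coset_def using n by blast }
qed

lemma coset_add_N: "\<lbrakk>u \<in> mcarrier M; n \<in> N\<rbrakk> \<Longrightarrow> coset M N (madd M u n) = coset M N u"
proof -
  have *: "coset M N (madd M u n) \<subseteq> coset M N u" if "u \<in> mcarrier M" "n \<in> N" for u n
  proof
    fix x assume "x \<in> coset M N (madd M u n)"
    then obtain n' where "n' \<in> N" "x = madd M (madd M u n) n'" unfolding coset_def by blast
    then have "x = madd M u (madd M n n')" "madd M n n' \<in> N" using that by (auto simp: add_assoc)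
    then show "x \<in> coset M N u" unfolding coset_def by blast
  qed
  assume a: "u \<in> mcarrier M" "n \<in> N"
  have "madd M (madd M u n) (mscale M (-1) n) = u" using a by (simp add: add_assoc)
  then have "coset M N u \<subseteq> coset M N (madd M u n)"
    using *[of "madd M u n" "mscale M (-1) n"] a by auto
  then show ?thesis using *[OF a] by auto
qed

lemma coset_eq_iff: "\<lbrakk>u \<in> mcarrier M; v \<in> mcarrier M\<rbrakk> \<Longrightarrow>
   coset M N u = coset M N v \<longleftrightarrow> madd M u (mscale M (-1) v) \<in> N"
proof
  assume a: "u \<in> mcarrier M" "v \<in> mcarrier M"
  { assume "coset M N u = coset M N v"
    then have "u \<in> coset M N v" using coset_self a(1) by metis
    then show "madd M u (mscale M (-1) v) \<in> N" using mem_coset_iff[OF a(2,1)] by metis }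
  { assume "madd M u (mscale M (-1) v) \<in> N"
    then have "u \<in> coset M N v" using mem_coset_iff[OF a(2,1)] by metis
    then obtain n where "n \<in> N" "u = madd M v n" unfolding coset_def by blast
    then show "coset M N u = coset M N v" using coset_add_N a(2) by metis }
qed

lemma coset_eqI: "\<lbrakk>A \<subseteq> coset M N u; A \<noteq> {}; \<And>a n. a \<in> A \<Longrightarrow> n \<in> N \<Longrightarrow> madd M a n \<in> A; u \<in> mcarrier M\<rbrakk>
   \<Longrightarrow> A = coset M N u"
proof (rule antisym)
  assume A: "A \<subseteq> coset M N u" "A \<noteq> {}" and cl: "\<And>a n. a \<in> A \<Longrightarrow> n \<in> N \<Longrightarrow> madd M a n \<in> A" and u: "u \<in> mcarrier M"
  obtain a where a: "a \<in> A" "a \<in> coset M N u" using A by blast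
  then obtain n where n: "n \<in> N" "a = madd M u n" unfolding coset_def by blast
  then have "coset M N u = coset M N a" using coset_add_N u by simp
  also have "\<dots> \<subseteq> A" using cl a unfolding coset_def by blast
  finally show "coset M N u \<subseteq> A" .
qed

abbreviation "Q \<equiv> M //\<^sub>m N"

lemma Q_carrier: "mcarrier Q = coset M N ` mcarrier M" by (simp add: quotient_module_def)
lemma Q_zero': "mzero Q = N" by (simp add: quotient_module_def)
lemma Q_zero: "mzero Q = coset M N (mzero M)"
  unfolding Q_zero' by (force simp: coset_def)

lemma coset_zero_iff: "u \<in> mcarrier M \<Longrightarrow> coset M N u = mzero Q \<longleftrightarrow> u \<in> N"
  by (simp add: Q_zero coset_eq_iff)

lemma Q_add:
  assumes "u \<in> mcarrier M" "v \<in> mcarrier M"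
  shows "madd Q (coset M N u) (coset M N v) = coset M N (madd M u v)"
proof (rule coset_eqI)
  have eq: "madd Q (coset M N u) (coset M N v) = {madd M a b |a b. a \<in> coset M N u \<and> b \<in> coset M N v}"
    by (simp add: quotient_module_def)
  have c: "madd M (madd M u n) (madd M v n') = madd M (madd M u v) (madd M n n')" if "n \<in> N" "n' \<in> N" for n n'
    using that assms by (simp add: add_assoc add_left_commute)
  show "madd Q (coset M N u) (coset M N v) \<subseteq> coset M N (madd M u v)"
    unfolding eq unfolding coset_def using c subD(3) by blast
  show "madd Q (coset M N u) (coset M N v) \<noteq> {}" unfolding eq using coset_self assms by blast
  fix a n assume a: "a \<in> madd Q (coset M N u) (coset M N v)" and n: "n \<in> N"
  then obtain n1 n2 where "n1 \<in> N" "n2 \<in> N" "a = madd M (madd M u n1) (madd M v n2)"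
    unfolding eq unfolding coset_def by blast
  then have "madd M a n = madd M (madd M u n1) (madd M v (madd M n2 n))" "madd M n2 n \<in> N" "n1 \<in> N"
    using n assms by (auto simp: add_assoc)
  then show "madd M a n \<in> madd Q (coset M N u) (coset M N v)" unfolding eq unfolding coset_def by blast
qed (use assms in auto)

lemma Q_scale:
  assumes "u \<in> mcarrier M"
  shows "mscale Q c (coset M N u) = coset M N (mscale M c u)"
proof (rule coset_eqI)
  have eq: "mscale Q c (coset M N u) = {madd M (mscale M c a) n |a n. a \<in> coset M N u \<and> n \<in> N}"
    by (simp add: quotient_module_def)
  have c: "madd M (mscale M c (madd M u n)) n' = madd M (mscale M c u) (madd M (mscale M c n) n')" if "n \<in> N" "n' \<in> N" for n n'
    using that assms by (simp add: add_assoc scale_add_right)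
  show "mscale Q c (coset M N u) \<subseteq> coset M N (mscale M c u)"
    unfolding eq unfolding coset_def using c subD(3,4) by blast
  show "mscale Q c (coset M N u) \<noteq> {}" unfolding eq using coset_self[OF assms] subD(2) by blast
  fix a n assume a: "a \<in> mscale Q c (coset M N u)" and n: "n \<in> N"
  then obtain n1 n2 where n12: "n1 \<in> N" "n2 \<in> N" "a = madd M (mscale M c (madd M u n1)) n2"
    unfolding eq unfolding coset_def by blast
  then have "madd M a n = madd M (mscale M c (madd M u n1)) (madd M n2 n)" "madd M n2 n \<in> N" "n1 \<in> N"
    using n assms by (simp_all add: add_assoc)
  then show "madd M a n \<in> mscale Q c (coset M N u)" unfolding eq unfolding coset_def by blast
qed (use assms in auto)

lemma Q_act:
  assumes "u \<in> mcarrier M" "x \<in> s"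
  shows "mact Q x (coset M N u) = coset M N (mact M x u)"
proof (rule coset_eqI)
  have eq: "mact Q x (coset M N u) = {madd M (mact M x a) n |a n. a \<in> coset M N u \<and> n \<in> N}"
    by (simp add: quotient_module_def)
  have c: "madd M (mact M x (madd M u n)) n' = madd M (mact M x u) (madd M (mact M x n) n')" if "n \<in> N" "n' \<in> N" for n n'
    using that assms by (simp add: add_assoc act_add)
  show "mact Q x (coset M N u) \<subseteq> coset M N (mact M x u)"
    unfolding eq unfolding coset_def using c subD(3) subD(5)[OF assms(2)] by blast
  show "mact Q x (coset M N u) \<noteq> {}" unfolding eq using coset_self[OF assms(1)] subD(2) by blast
  fix a n assume a: "a \<in> mact Q x (coset M N u)" and n: "n \<in> N"
  then obtain n1 n2 where n12: "n1 \<in> N" "n2 \<in> N" "a = madd M (mact M x (madd M u n1)) n2"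
    unfolding eq unfolding coset_def by blast
  then have "madd M a n = madd M (mact M x (madd M u n1)) (madd M n2 n)" "madd M n2 n \<in> N" "n1 \<in> N"
    using n assms by (simp_all add: add_assoc)
  then show "madd M a n \<in> mact Q x (coset M N u)" unfolding eq unfolding coset_def by blast
qed (use assms in auto)

lemma Q_lin_module: "lin_module s Q"
  by (unfold_locales;
    auto simp: Q_carrier Q_add Q_scale Q_act Q_zero act_add act_scale scale_add_right scale_add_left[symmetric]
      scale_scale add_assoc; metis add_commute)

lemma Q_lie_module:
  assumes "lie_module s M"
    and closed: "\<And>x y. x \<in> s \<Longrightarrow> y \<in> s \<Longrightarrow> x + y \<in> s \<and> bracket x y \<in> s" "\<And>c x. x \<in> s \<Longrightarrow> lscale c x \<in> s"
  shows "lie_module s Q"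
proof -
  interpret L: lie_module s M by fact
  interpret Q: lin_module s Q by (rule Q_lin_module)
  show ?thesis
  proof (rule lie_module.intro; (rule Q.zero_closed Q.add_closed Q.scale_closed Q.act_closed Q.add_assoc
      Q.add_commute Q.add_zero Q.add_inverse Q.scale_add_right Q.scale_add_left Q.scale_scale Q.scale_one
      Q.act_add Q.act_scale; assumption)?)
    fix x y u assume "x \<in> s" "y \<in> s" "u \<in> mcarrier Q"
    then show "madd Q (mact Q (bracket x y) u) (mact Q y (mact Q x u)) = mact Q x (mact Q y u)"
      by (auto simp: Q_carrier Q_add Q_act closed L.act_bracket)
  qed (auto simp: Q_carrier Q_add Q_scale Q_act L.act_add_left L.act_scale_left closed)
qed

lemma hom_coset: "module_hom s M Q (coset M N)"
  unfolding module_hom_def by (auto simp: Q_carrier Q_add Q_scale Q_act)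

text \<open>The isomorphism is produced together with its values on cosets, which later identify preimages of submodules.\<close>

lemma first_iso:
  assumes f: "module_hom s M M' f" and l: "lin_module s M'"
    and surj: "f ` mcarrier M = mcarrier M'"
    and ker: "\<And>u. u \<in> mcarrier M \<Longrightarrow> f u = mzero M' \<longleftrightarrow> u \<in> N"
  obtains g where "module_hom s Q M' g" "bij_betw g (mcarrier Q) (mcarrier M')"
    "\<And>u. u \<in> mcarrier M \<Longrightarrow> g (coset M N u) = f u"
proof -
  interpret M': lin_module s M' by fact
  note f' = f[unfolded module_hom_def]
  have eq: "f u = f v \<longleftrightarrow> coset M N u = coset M N v" if uv: "u \<in> mcarrier M" "v \<in> mcarrier M" for u v
  proof -
    have "coset M N u = coset M N v \<longleftrightarrow> f (madd M u (mscale M (-1) v)) = mzero M'"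
      using uv by (simp add: coset_eq_iff ker)
    also have "f (madd M u (mscale M (-1) v)) = madd M' (f u) (mscale M' (-1) (f v))"
      using f' uv by auto
    finally show ?thesis using f' uv M'.add_eq_zero_iff[of "f u" "f v"] by auto
  qed
  define g where "g A = f (SOME a. a \<in> mcarrier M \<and> coset M N a = A)" for A
  have g: "g (coset M N u) = f u" if "u \<in> mcarrier M" for u
  proof -
    have "\<exists>a. a \<in> mcarrier M \<and> coset M N a = coset M N u" using that by blast
    from someI_ex[OF this] show ?thesis unfolding g_def using eq that by blast
  qed
  have "module_hom s Q M' g"
    using f' unfolding module_hom_def by (auto simp: Q_carrier Q_add Q_scale Q_act g)
  moreover have "bij_betw g (mcarrier Q) (mcarrier M')"
    unfolding bij_betw_def inj_on_def Q_carrier using surj by (auto simp: g eq image_image)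
  ultimately show ?thesis using that g by blast
qed

end

lemma first_iso_theorem:
  assumes "lin_module s M" "lin_module s M'" "module_hom s M M' f" "f ` mcarrier M = mcarrier M'"
  shows "module_iso s (M //\<^sub>m {u \<in> mcarrier M. f u = mzero M'}) M'"
proof -
  interpret lin_module s M by fact
  interpret sub_lin_module s M "{u \<in> mcarrier M. f u = mzero M'}"
    by unfold_locales (rule submodule_kernel[OF assms(3,2)])
  obtain g where "module_hom s Q M' g" "bij_betw g (mcarrier Q) (mcarrier M')"
    using first_iso[OF assms(3,2,4)] by blast
  then show ?thesis unfolding module_iso_def by blast
qed

lemma indecomposableD:
  assumes ind: "indecomposable s M" and "submodule s M A" "submodule s M B" "A \<inter> B = {mzero M}"
    "mcarrier M = {madd M a b |a b. a \<in> A \<and> b \<in> B}"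
  shows "A = {mzero M} \<or> B = {mzero M}"
proof (rule ccontr)
  assume "\<not> (A = {mzero M} \<or> B = {mzero M})"
  then have "\<exists>A B. submodule s M A \<and> submodule s M B \<and> A \<noteq> {mzero M} \<and> B \<noteq> {mzero M} \<and>
          A \<inter> B = {mzero M} \<and> mcarrier M = {madd M a b |a b. a \<in> A \<and> b \<in> B}"
    using assms(2-) by (intro exI[of _ A] exI[of _ B] conjI) simp_all
  with ind show False unfolding indecomposable_def by (elim conjE) (erule notE)
qed

lemma indecomposable_iso:
  assumes "lie_module s M" "module_iso s M M'" "indecomposable s M'"
  shows "indecomposable s M"
proof -
  interpret M: lin_module s M using assms(1) by (rule lie_module_lin)
  have l': "lie_module s M'" using assms(3) by (simp add: indecomposable_def)
  then interpret M': lin_module s M' by (rule lie_module_lin)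
  obtain f where f: "module_hom s M M' f" "bij_betw f (mcarrier M) (mcarrier M')"
    using assms(2) unfolding module_iso_def by blast
  note f' = f(1)[unfolded module_hom_def]
  have inj: "inj_on f (mcarrier M)" and im: "f ` mcarrier M = mcarrier M'"
    using f(2) by (auto simp: bij_betw_def)
  have f0: "f (mzero M) = mzero M'" using M.hom_zero[OF f(1)] M'.lin_module_axioms by simp
  have nz: "f ` A \<noteq> {mzero M'}" if "A \<noteq> {mzero M}" "submodule s M A" for A
  proof
    assume a: "f ` A = {mzero M'}"
    have "A \<subseteq> {mzero M}"
    proof
      fix x assume "x \<in> A"
      then have "x \<in> mcarrier M" "f x = f (mzero M)" using a f0 submoduleD(1)[OF that(2)] by auto
      then show "x \<in> {mzero M}" using inj_onD[OF inj] by auto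
    qed
    moreover have "mzero M \<in> A" using submoduleD(2)[OF that(2)] .
    ultimately show False using that by blast
  qed
  show ?thesis unfolding indecomposable_def
  proof (intro conjI notI)
    show "lie_module s M" by fact
    show False if "mcarrier M = {mzero M}"
    proof -
      have "mcarrier M' = {mzero M'}" using im that f0 by (metis image_empty image_insert)
      then show False using assms(3) by (simp add: indecomposable_def)
    qed
    assume "\<exists>A B. submodule s M A \<and> submodule s M B \<and> A \<noteq> {mzero M} \<and> B \<noteq> {mzero M} \<and>
          A \<inter> B = {mzero M} \<and> mcarrier M = {madd M a b |a b. a \<in> A \<and> b \<in> B}"
    then obtain A B where A: "submodule s M A" "A \<noteq> {mzero M}" and B: "submodule s M B" "B \<noteq> {mzero M}"
      and AB: "A \<inter> B = {mzero M}" "mcarrier M = {madd M a b |a b. a \<in> A \<and> b \<in> B}" by blast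
    have sub: "A \<subseteq> mcarrier M" "B \<subseteq> mcarrier M" using A(1) B(1) by (auto simp: submodule_def)
    have "f ` A \<inter> f ` B = f ` (A \<inter> B)" using inj sub by (rule inj_on_image_Int[symmetric])
    then have 1: "f ` A \<inter> f ` B = {mzero M'}" using AB f0 by simp
    have 2: "mcarrier M' = {madd M' a b |a b. a \<in> f ` A \<and> b \<in> f ` B}"
    proof (rule set_eqI)
      fix y
      have "y \<in> mcarrier M' \<longleftrightarrow> (\<exists>x\<in>mcarrier M. y = f x)" using im by blast
      also have "\<dots> \<longleftrightarrow> (\<exists>a\<in>A. \<exists>b\<in>B. y = f (madd M a b))" unfolding AB(2) by blast
      also have "\<dots> \<longleftrightarrow> (\<exists>a\<in>A. \<exists>b\<in>B. y = madd M' (f a) (f b))" using f' sub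
        by (metis subsetD)
      finally show "y \<in> mcarrier M' \<longleftrightarrow> y \<in> {madd M' a b |a b. a \<in> f ` A \<and> b \<in> f ` B}" by blast
    qed
    have "submodule s M' (f ` A)" "submodule s M' (f ` B)"
      using M.submodule_image[OF f(1) M'.lin_module_axioms] A B by auto
    from indecomposableD[OF assms(3) this 1 2] nz[OF A(2,1)] nz[OF B(2,1)] show False by simp
  qed
qed

text \<open>Submodules of a quotient correspond to submodules above \<open>S\<close>, so indecomposability of the quotient is a statement about
  pairs of submodules of \<open>M\<close> that meet in \<open>S\<close>; no cosets occur in it.\<close>

lemma indecomposable_quotient:
  assumes l: "lie_module s M" and S: "submodule s M S" "S \<noteq> mcarrier M"
    and closed: "\<And>x y. x \<in> s \<Longrightarrow> y \<in> s \<Longrightarrow> x + y \<in> s \<and> bracket x y \<in> s" "\<And>c x. x \<in> s \<Longrightarrow> lscale c x \<in> s"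
    and *: "\<And>A B. submodule s M A \<Longrightarrow> submodule s M B \<Longrightarrow> A \<inter> B = S \<Longrightarrow>
      mcarrier M = {madd M a b | a b. a \<in> A \<and> b \<in> B} \<Longrightarrow> A = S \<or> B = S"
  shows "indecomposable s (M //\<^sub>m S)"
proof -
  interpret M: lin_module s M using l by (rule lie_module_lin)
  interpret sub_lin_module s M S by unfold_locales fact
  interpret Q: lin_module s Q by (rule Q_lin_module)
  show ?thesis unfolding indecomposable_def
  proof (intro conjI notI)
    show "lie_module s Q" using Q_lie_module[OF l closed] by blast
    show False if "mcarrier Q = {mzero Q}"
    proof -
      have "u \<in> S" if "u \<in> mcarrier M" for u
        using \<open>mcarrier Q = {mzero Q}\<close> that coset_zero_iff unfolding Q_carrier by blast
      then show False using S by (auto simp: submodule_def)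
    qed
    assume "\<exists>A B. submodule s Q A \<and> submodule s Q B \<and> A \<noteq> {mzero Q} \<and> B \<noteq> {mzero Q} \<and>
          A \<inter> B = {mzero Q} \<and> mcarrier Q = {madd Q a b |a b. a \<in> A \<and> b \<in> B}"
    then obtain A B where A: "submodule s Q A" "A \<noteq> {mzero Q}" and B: "submodule s Q B" "B \<noteq> {mzero Q}"
      and AB: "A \<inter> B = {mzero Q}" "mcarrier Q = {madd Q a b |a b. a \<in> A \<and> b \<in> B}" by blast
    define A' where "A' = {u \<in> mcarrier M. coset M S u \<in> A}"
    define B' where "B' = {u \<in> mcarrier M. coset M S u \<in> B}"
    have 1: "submodule s M A'" "submodule s M B'" unfolding A'_def B'_def
      using M.submodule_vimage[OF hom_coset Q_lin_module] A B by auto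
    have 2: "A' \<inter> B' = S"
    proof (rule set_eqI)
      fix u show "u \<in> A' \<inter> B' \<longleftrightarrow> u \<in> S"
        using AB(1) coset_zero_iff[of u] subD(1)[of u] unfolding A'_def B'_def by blast
    qed
    have sub: "A \<subseteq> mcarrier Q" "B \<subseteq> mcarrier Q" using A(1) B(1) by (auto simp: submodule_def)
    have 3: "mcarrier M = {madd M a b |a b. a \<in> A' \<and> b \<in> B'}"
    proof (rule antisym)
      show "{madd M a b |a b. a \<in> A' \<and> b \<in> B'} \<subseteq> mcarrier M" by (auto simp: A'_def B'_def)
      show "mcarrier M \<subseteq> {madd M a b |a b. a \<in> A' \<and> b \<in> B'}"
      proof
        fix u assume u: "u \<in> mcarrier M"
        then have "coset M S u \<in> mcarrier Q" by (auto simp: Q_carrier)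
        then obtain X Y where XY: "X \<in> A" "Y \<in> B" "coset M S u = madd Q X Y" using AB(2) by blast
        then have "X \<in> mcarrier Q" "Y \<in> mcarrier Q" using sub by auto
        then obtain x y where xy: "X = coset M S x" "Y = coset M S y" "x \<in> mcarrier M" "y \<in> mcarrier M"
          by (auto simp: Q_carrier)
        then have "coset M S u = coset M S (madd M x y)" using XY by (simp add: Q_add)
        then have "u \<in> coset M S (madd M x y)" using coset_self[OF u] by simp
        then obtain n where n: "n \<in> S" "u = madd M (madd M x y) n" unfolding coset_def by blast
        then have "u = madd M x (madd M y n)" using xy by (simp add: M.add_assoc)
        moreover have "x \<in> A'" using xy XY by (simp add: A'_def)
        moreover have "madd M y n \<in> B'" using xy XY n by (simp add: B'_def coset_add_N)
        ultimately show "u \<in> {madd M a b |a b. a \<in> A' \<and> b \<in> B'}" by blast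
      qed
    qed
    have ne: "A' = S \<Longrightarrow> A = {mzero Q}"
    proof -
      assume "A' = S"
      then have "A \<subseteq> {mzero Q}" using sub coset_zero_iff unfolding A'_def Q_carrier by blast
      then show "A = {mzero Q}" using submoduleD(2)[OF A(1)] by blast
    qed
    have ne': "B' = S \<Longrightarrow> B = {mzero Q}"
    proof -
      assume "B' = S"
      then have "B \<subseteq> {mzero Q}" using sub coset_zero_iff unfolding B'_def Q_carrier by blast
      then show "B = {mzero Q}" using submoduleD(2)[OF B(1)] by blast
    qed
    from *[OF 1 2 3] ne ne' A B show False by blast
  qed
qed

lemma simple_module_iso:
  assumes "lie_module s M" "module_iso s M M'" "simple_module s M'"
  shows "simple_module s M"
proof -
  interpret M: lin_module s M using assms(1) by (rule lie_module_lin)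
  have l': "lie_module s M'" using assms(3) by (simp add: simple_module_def)
  then interpret M': lin_module s M' by (rule lie_module_lin)
  obtain f where f: "module_hom s M M' f" "bij_betw f (mcarrier M) (mcarrier M')"
    using assms(2) unfolding module_iso_def by blast
  have inj: "inj_on f (mcarrier M)" and im: "f ` mcarrier M = mcarrier M'"
    using f(2) by (auto simp: bij_betw_def)
  have f0: "f (mzero M) = mzero M'" using M.hom_zero[OF f(1)] M'.lin_module_axioms by simp
  show ?thesis unfolding simple_module_def
  proof (intro conjI allI impI)
    show "lie_module s M" by fact
    show "mcarrier M \<noteq> {mzero M}"
      using im f0 assms(3) unfolding simple_module_def by (metis image_empty image_insert)
    fix N assume N: "submodule s M N"
    then have sub: "N \<subseteq> mcarrier M" by (simp add: submodule_def)
    have "f ` N = {mzero M'} \<or> f ` N = mcarrier M'"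
      using assms(3) M.submodule_image[OF f(1) M'.lin_module_axioms N] unfolding simple_module_def by blast
    then have "f ` N = f ` {mzero M} \<or> f ` N = f ` mcarrier M" using f0 im by auto
    then show "N = {mzero M} \<or> N = mcarrier M"
      using inj_on_image_eq_iff[OF inj] sub M.zero_closed by (metis empty_subsetI insert_subset order_refl)
  qed
qed

text \<open>If every proper submodule lies in the kernel \<open>K\<close> of a surjection onto a simple module, then \<open>K\<close> is the only submodule
  with a simple quotient: for another one, \<open>N \<subset> K\<close>, the image of \<open>K\<close> in \<open>M/N\<close> would be a submodule that is neither zero nor
  everything. This makes the definite description in \<open>simple_quotient\<close> denote \<open>K\<close>.\<close>

lemma simple_quotient_iso:
  fixes M :: "('g::complex_lie_algebra, 'v) lmod"
  assumes l: "lie_module UNIV M" and T: "simple_module UNIV T"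
    and f: "module_hom UNIV M T f" "f ` mcarrier M = mcarrier T"
    and max: "\<And>N. submodule UNIV M N \<Longrightarrow> N \<noteq> mcarrier M \<Longrightarrow> N \<subseteq> {u \<in> mcarrier M. f u = mzero T}"
  shows "module_iso UNIV (simple_quotient M) T" "lie_module UNIV (simple_quotient M)"
proof -
  interpret M: lin_module UNIV M using l by (rule lie_module_lin)
  have lT: "lie_module UNIV T" using T by (simp add: simple_module_def)
  then interpret T: lin_module UNIV T by (rule lie_module_lin)
  define K where "K = {u \<in> mcarrier M. f u = mzero T}"
  have K: "submodule UNIV M K" unfolding K_def using M.submodule_kernel[OF f(1)] T.lin_module_axioms by simp
  interpret K: sub_lin_module UNIV M K by unfold_locales fact
  have iso: "module_iso UNIV (M //\<^sub>m K) T"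
    unfolding K_def using first_iso_theorem[OF M.lin_module_axioms T.lin_module_axioms f] .
  have lK: "lie_module UNIV (M //\<^sub>m K)" using K.Q_lie_module[OF l] by simp
  have sK: "simple_module UNIV (M //\<^sub>m K)" using simple_module_iso[OF lK iso T] .
  have "(THE N. submodule UNIV M N \<and> simple_module UNIV (M //\<^sub>m N)) = K"
  proof (rule the_equality)
    show "submodule UNIV M K \<and> simple_module UNIV (M //\<^sub>m K)" using K sK by simp
    fix N assume N: "submodule UNIV M N \<and> simple_module UNIV (M //\<^sub>m N)"
    then interpret N: sub_lin_module UNIV M N by unfold_locales simp
    have "N \<noteq> mcarrier M"
    proof
      assume "N = mcarrier M"
      then have "mcarrier (M //\<^sub>m N) \<subseteq> {mzero (M //\<^sub>m N)}"
        unfolding N.Q_carrier using N.coset_zero_iff by auto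
      moreover have "mzero (M //\<^sub>m N) \<in> mcarrier (M //\<^sub>m N)" unfolding N.Q_carrier N.Q_zero by simp
      ultimately show False using N unfolding simple_module_def by auto
    qed
    with max N have NK: "N \<subseteq> K" unfolding K_def by blast
    interpret NQ: lin_module UNIV "M //\<^sub>m N" by (rule N.Q_lin_module)
    have "submodule UNIV (M //\<^sub>m N) (coset M N ` K)"
      using M.submodule_image[OF N.hom_coset N.Q_lin_module K] .
    then have "coset M N ` K = {mzero (M //\<^sub>m N)} \<or> coset M N ` K = mcarrier (M //\<^sub>m N)"
      using N unfolding simple_module_def by blast
    then show "N = K"
    proof
      assume a: "coset M N ` K = {mzero (M //\<^sub>m N)}"
      have "u \<in> N" if "u \<in> K" for u
        using N.coset_zero_iff[OF K.subD(1)[OF that]] imageI[OF that, of "coset M N"] unfolding a by simp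
      then show ?thesis using NK by blast
    next
      assume a: "coset M N ` K = mcarrier (M //\<^sub>m N)"
      have "mcarrier M \<subseteq> K"
      proof
        fix u assume u: "u \<in> mcarrier M"
        then have "coset M N u \<in> coset M N ` K" using a N.Q_carrier by blast
        then obtain k where k: "k \<in> K" "coset M N u = coset M N k" by blast
        then have "u \<in> coset M N k" using N.coset_self[OF u] by simp
        then obtain n where n: "n \<in> N" "u = madd M k n" unfolding coset_def by blast
        show "u \<in> K" unfolding n(2) by (rule K.subD(3)[OF k(1) subsetD[OF NK n(1)]])
      qed
      then have "f u = mzero T" if "u \<in> mcarrier M" for u using that unfolding K_def by blast
      then have "mcarrier T \<subseteq> {mzero T}" unfolding f(2)[symmetric] by blast
      then have "mcarrier T = {mzero T}" using T.zero_closed by blast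
      then show ?thesis using T unfolding simple_module_def by blast
    qed
  qed
  then have eq: "simple_quotient M = M //\<^sub>m K" by (simp add: simple_quotient_def)
  show "module_iso UNIV (simple_quotient M) T" "lie_module UNIV (simple_quotient M)"
    using iso lK by (auto simp: eq)
qed

lemma quotient_iso_quotient:
  assumes l: "lie_module s M" "lie_module s M'" and f: "module_hom s M M' f" "bij_betw f (mcarrier M) (mcarrier M')"
    and S: "submodule s M' S"
    and closed: "\<And>x y. x \<in> s \<Longrightarrow> y \<in> s \<Longrightarrow> x + y \<in> s \<and> bracket x y \<in> s" "\<And>c x. x \<in> s \<Longrightarrow> lscale c x \<in> s"
  shows "module_iso s (M //\<^sub>m {u \<in> mcarrier M. f u \<in> S}) (M' //\<^sub>m S)"
proof -
  interpret M: lin_module s M using l(1) by (rule lie_module_lin)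
  interpret M': lin_module s M' using l(2) by (rule lie_module_lin)
  interpret S: sub_lin_module s M' S by unfold_locales fact
  have "module_hom s M S.Q (coset M' S \<circ> f)" using module_hom_compose[OF f(1) S.hom_coset] .
  moreover have "(coset M' S \<circ> f) ` mcarrier M = mcarrier S.Q"
    using f(2) unfolding bij_betw_def S.Q_carrier image_comp[symmetric] by simp
  ultimately have "module_iso s (M //\<^sub>m {u \<in> mcarrier M. (coset M' S \<circ> f) u = mzero S.Q}) S.Q"
    by (intro first_iso_theorem M.lin_module_axioms S.Q_lin_module)
  moreover have "{u \<in> mcarrier M. (coset M' S \<circ> f) u = mzero S.Q} = {u \<in> mcarrier M. f u \<in> S}"
  proof -
    have "(coset M' S \<circ> f) u = mzero S.Q \<longleftrightarrow> f u \<in> S" if "u \<in> mcarrier M" for u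
      using S.coset_zero_iff[of "f u"] bij_betwE[OF f(2)] that by simp
    then show ?thesis by blast
  qed
  ultimately show ?thesis by simp
qed

section \<open>The polynomial model of a Verma module\<close>

text \<open>A function \<open>c\<close> stands for the formal sum of \<open>c(i,j,l) f\<^sub>\<alpha>\<^sup>i f\<^sub>\<beta>\<^sup>j f\<^sub>\<alpha>\<^sub>+\<^sub>\<beta>\<^sup>l v\<^sub>0\<close>. Indices run over
  all integers: the coefficients of the operators vanish exactly where an index would become negative, so the commutation relations
  are identities without case distinctions. The parameters \<open>N\<close> and \<open>K\<close> are the values of \<open>\<nu> + \<rho>\<close> on the simple coroots,
  and \<open>f\<^sub>\<alpha> = E\<^sub>2\<^sub>1\<close>, \<open>f\<^sub>\<beta> = E\<^sub>3\<^sub>2\<close>, \<open>f\<^sub>\<alpha>\<^sub>+\<^sub>\<beta> = E\<^sub>3\<^sub>1\<close>.\<close>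

type_synonym fvec = "int \<times> int \<times> int \<Rightarrow> complex"

definition opF1 :: "fvec \<Rightarrow> fvec" where "opF1 c = (\<lambda>(i, j, l). c (i - 1, j, l))"
definition opF2 :: "fvec \<Rightarrow> fvec" where "opF2 c = (\<lambda>(i, j, l). c (i, j - 1, l) + (of_int i + 1) * c (i + 1, j, l - 1))"
definition opF3 :: "fvec \<Rightarrow> fvec" where "opF3 c = (\<lambda>(i, j, l). c (i, j, l - 1))"
definition opE1 :: "complex \<Rightarrow> fvec \<Rightarrow> fvec" where
  "opE1 N c = (\<lambda>(i, j, l). (N - 1 + of_int (j - l - i)) * (of_int i + 1) * c (i + 1, j, l)
    - (of_int l + 1) * c (i, j - 1, l + 1))"
definition opE2 :: "complex \<Rightarrow> fvec \<Rightarrow> fvec" where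
  "opE2 K c = (\<lambda>(i, j, l). (K - 1 - of_int j) * (of_int j + 1) * c (i, j + 1, l)
    + (of_int l + 1) * c (i - 1, j, l + 1))"
definition opE3 :: "complex \<Rightarrow> complex \<Rightarrow> fvec \<Rightarrow> fvec" where
  "opE3 N K c = (\<lambda>(i, j, l). (of_int l + 1) * (N + K - 2 - of_int (l + j + i)) * c (i, j, l + 1)
          - (of_int i + 1) * (of_int j + 1) * (K - 1 - of_int j) * c (i + 1, j + 1, l))"
definition opH1 :: "complex \<Rightarrow> fvec \<Rightarrow> fvec" where
  "opH1 N c = (\<lambda>(i, j, l). (N - 1 + of_int (j - l - 2 * i)) * c (i, j, l))"
definition opH2 :: "complex \<Rightarrow> fvec \<Rightarrow> fvec" where
  "opH2 K c = (\<lambda>(i, j, l). (K - 1 + of_int (i - l - 2 * j)) * c (i, j, l))"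

lemmas op_defs = opF1_def opF2_def opF3_def opE1_def opE2_def opE3_def opH1_def opH2_def

lemma op_lin:
  shows "opF1 (\<lambda>k. u k + v k) k = opF1 u k + opF1 v k"
    "opF1 (\<lambda>k. u k - v k) k = opF1 u k - opF1 v k"
    "opF1 (\<lambda>k. a * u k) k = a * opF1 u k"
    "opF2 (\<lambda>k. u k + v k) k = opF2 u k + opF2 v k"
    "opF2 (\<lambda>k. u k - v k) k = opF2 u k - opF2 v k"
    "opF2 (\<lambda>k. a * u k) k = a * opF2 u k"
    "opF3 (\<lambda>k. u k + v k) k = opF3 u k + opF3 v k"
    "opF3 (\<lambda>k. u k - v k) k = opF3 u k - opF3 v k"
    "opF3 (\<lambda>k. a * u k) k = a * opF3 u k"
    "opE1 N (\<lambda>k. u k + v k) k = opE1 N u k + opE1 N v k"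
    "opE1 N (\<lambda>k. u k - v k) k = opE1 N u k - opE1 N v k"
    "opE1 N (\<lambda>k. a * u k) k = a * opE1 N u k"
    "opE2 K (\<lambda>k. u k + v k) k = opE2 K u k + opE2 K v k"
    "opE2 K (\<lambda>k. u k - v k) k = opE2 K u k - opE2 K v k"
    "opE2 K (\<lambda>k. a * u k) k = a * opE2 K u k"
    "opE3 N K (\<lambda>k. u k + v k) k = opE3 N K u k + opE3 N K v k"
    "opE3 N K (\<lambda>k. u k - v k) k = opE3 N K u k - opE3 N K v k"
    "opE3 N K (\<lambda>k. a * u k) k = a * opE3 N K u k"
    "opH1 N (\<lambda>k. u k + v k) k = opH1 N u k + opH1 N v k"
    "opH1 N (\<lambda>k. u k - v k) k = opH1 N u k - opH1 N v k"
    "opH1 N (\<lambda>k. a * u k) k = a * opH1 N u k"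
    "opH2 K (\<lambda>k. u k + v k) k = opH2 K u k + opH2 K v k"
    "opH2 K (\<lambda>k. u k - v k) k = opH2 K u k - opH2 K v k"
    "opH2 K (\<lambda>k. a * u k) k = a * opH2 K u k"
  by (cases k; simp add: op_defs algebra_simps; fail)+

text \<open>The relations are oriented so that they rewrite a product into the order \<open>F1, F2, F3, E1, E2, E3, H1, H2\<close> read from the
  inside; used as rewrite rules they decide bracket identities.\<close>

lemma op_comm:
  shows "opF1 (opF2 c) k = opF2 (opF1 c) k - opF3 c k"
    "opF1 (opF3 c) k = opF3 (opF1 c) k"
    "opF1 (opE1 N c) k = opE1 N (opF1 c) k - opH1 N c k"
    "opF1 (opE2 K c) k = opE2 K (opF1 c) k"
    "opF1 (opE3 N K c) k = opE3 N K (opF1 c) k + opE2 K c k"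
    "opF1 (opH1 N c) k = opH1 N (opF1 c) k + 2 * opF1 c k"
    "opF1 (opH2 K c) k = opH2 K (opF1 c) k - opF1 c k"
    "opF2 (opF3 c) k = opF3 (opF2 c) k"
    "opF2 (opE1 N c) k = opE1 N (opF2 c) k"
    "opF2 (opE2 K c) k = opE2 K (opF2 c) k - opH2 K c k"
    "opF2 (opE3 N K c) k = opE3 N K (opF2 c) k - opE1 N c k"
    "opF2 (opH1 N c) k = opH1 N (opF2 c) k - opF2 c k"
    "opF2 (opH2 K c) k = opH2 K (opF2 c) k + 2 * opF2 c k"
    "opF3 (opE1 N c) k = opE1 N (opF3 c) k + opF2 c k"
    "opF3 (opE2 K c) k = opE2 K (opF3 c) k - opF1 c k"
    "opF3 (opE3 N K c) k = opE3 N K (opF3 c) k - opH1 N c k - opH2 K c k"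
    "opF3 (opH1 N c) k = opH1 N (opF3 c) k + opF3 c k"
    "opF3 (opH2 K c) k = opH2 K (opF3 c) k + opF3 c k"
    "opE1 N (opE2 K c) k = opE2 K (opE1 N c) k + opE3 N K c k"
    "opE1 N (opE3 N K c) k = opE3 N K (opE1 N c) k"
    "opE1 N (opH1 N c) k = opH1 N (opE1 N c) k - 2 * opE1 N c k"
    "opE1 N (opH2 K c) k = opH2 K (opE1 N c) k + opE1 N c k"
    "opE2 K (opE3 N K c) k = opE3 N K (opE2 K c) k"
    "opE2 K (opH1 N c) k = opH1 N (opE2 K c) k + opE2 K c k"
    "opE2 K (opH2 K c) k = opH2 K (opE2 K c) k - 2 * opE2 K c k"
    "opE3 N K (opH1 N c) k = opH1 N (opE3 N K c) k - opE3 N K c k"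
    "opE3 N K (opH2 K c) k = opH2 K (opE3 N K c) k - opE3 N K c k"
    "opH1 N (opH2 K c) k = opH2 K (opH1 N c) k"
  by (cases k; simp add: op_defs; simp add: algebra_simps; fail)+

text \<open>A traceless diagonal matrix with entries \<open>x\<^sub>1, x\<^sub>2, x\<^sub>3\<close> is \<open>x\<^sub>1\<close> times the first simple coroot minus \<open>x\<^sub>3\<close> times the
  second one.\<close>

definition actf :: "complex \<Rightarrow> complex \<Rightarrow> complex^3^3 \<Rightarrow> fvec \<Rightarrow> fvec" where
  "actf N K x c = (\<lambda>k.
    x$2$1 * opF1 c k + x$3$2 * opF2 c k + x$3$1 * opF3 c k
    + x$1$2 * opE1 N c k + x$2$3 * opE2 K c k + x$1$3 * opE3 N K c k
    + x$1$1 * opH1 N c k - x$3$3 * opH2 K c k)"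

lemma actf_bracket:
  assumes "trace x = 0" "trace y = 0"
  shows "actf N K (x ** y - y ** x) c k + actf N K y (actf N K x c) k = actf N K x (actf N K y c) k"
proof -
  have 1: "x$2$2 = - x$1$1 - x$3$3" "y$2$2 = - y$1$1 - y$3$3"
    using assms unfolding trace_def sum_3 by (simp_all add: algebra_simps eq_neg_iff_add_eq_0)
  show ?thesis unfolding actf_def op_lin op_comm matrix_matrix_mult_def sum_3 vec_lambda_beta vector_minus_component 1
    apply (simp only: ring_distribs mult.assoc)
 apply algebra done
qed

type_synonym wvec = "(int \<times> int \<times> int) \<Rightarrow>\<^sub>0 complex"

abbreviation lk :: "('a \<Rightarrow>\<^sub>0 complex) \<Rightarrow> 'a \<Rightarrow> complex" where "lk \<equiv> Poly_Mapping.lookup"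

text \<open>Each operator moves an index by at most one.\<close>

lemma finite_actf:
  assumes "finite {k. c k \<noteq> 0}"
  shows "finite {k. actf N K x c k \<noteq> 0}"
proof -
  let ?D = "{-1, 0, 1 :: int}"
  let ?g = "\<lambda>((i, j, l), (d, e, f)). (i + d, j + e, l + f)"
  have "k \<in> ?g ` ({k. c k \<noteq> 0} \<times> (?D \<times> ?D \<times> ?D))" if "actf N K x c k \<noteq> 0" for k
  proof (rule ccontr)
    assume no: "k \<notin> ?g ` ({k. c k \<noteq> 0} \<times> (?D \<times> ?D \<times> ?D))"
    obtain i j l where k: "k = (i, j, l)" by (cases k rule: prod_cases3)
    have z: "c (i + d, j + e, l + f) = 0" if "d \<in> ?D" "e \<in> ?D" "f \<in> ?D" for d e f
    proof (rule ccontr)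
      assume nz: "c (i + d, j + e, l + f) \<noteq> 0"
      have D: "- d \<in> ?D" "- e \<in> ?D" "- f \<in> ?D" using that by auto
      have "k = ?g ((i + d, j + e, l + f), (- d, - e, - f))" by (simp add: k)
      moreover have "((i + d, j + e, l + f), (- d, - e, - f)) \<in> {k. c k \<noteq> 0} \<times> (?D \<times> ?D \<times> ?D)"
        using D nz by blast
      ultimately show False using no by blast
    qed
    have "actf N K x c k = 0"
      using z[of 0 0 0] z[of 0 0 1] z[of 0 0 "-1"] z[of 0 "-1" 0] z[of "-1" 0 0] z[of 1 0 0]
        z[of 1 0 "-1"] z[of 0 "-1" 1] z[of 0 1 0] z[of "-1" 0 1] z[of 1 1 0]
      unfolding actf_def op_defs k by simp
    with that show False by simp
  qed
  then have "{k. actf N K x c k \<noteq> 0} \<subseteq> ?g ` ({k. c k \<noteq> 0} \<times> (?D \<times> ?D \<times> ?D))" by blast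
  moreover have "finite (?g ` ({k. c k \<noteq> 0} \<times> (?D \<times> ?D \<times> ?D)))"
    using assms by (intro finite_imageI finite_cartesian_product) auto
  ultimately show ?thesis by (rule finite_subset)
qed

definition act :: "complex \<Rightarrow> complex \<Rightarrow> sl3 \<Rightarrow> wvec \<Rightarrow> wvec" where
  "act N K x c = Abs_poly_mapping (actf N K (mat_of x) (lk c))"

lemma lookup_act: "lk (act N K x c) = actf N K (mat_of x) (lk c)"
  unfolding act_def by (rule lookup_Abs_poly_mapping) (rule finite_actf, simp)

lemma lookup_add_fun: "lk (u + v) = (\<lambda>k. lk u k + lk v k)"
  by (simp add: lookup_add fun_eq_iff)

lemma lookup_scale_fun: "lk (pm_scale c u) = (\<lambda>k. c * lk u k)"
  by (simp add: fun_eq_iff)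

lemma act_add: "act N K x (u + v) = act N K x u + act N K x v"
  by (rule poly_mapping_eqI) (simp add: lookup_act lookup_add_fun actf_def op_lin algebra_simps)

lemma act_scale: "act N K x (pm_scale c u) = pm_scale c (act N K x u)"
  by (rule poly_mapping_eqI) (simp add: lookup_act lookup_scale_fun actf_def op_lin algebra_simps)

lemma mat_of_simps: "mat_of (x + y) $ i $ j = mat_of x $ i $ j + mat_of y $ i $ j"
  "mat_of (lscale c x) $ i $ j = c * mat_of x $ i $ j"
  "mat_of (- x) $ i $ j = - mat_of x $ i $ j"
  "mat_of 0 $ i $ j = 0"
  by (transfer; simp)+

lemma mat_of_trace: "mat_of x $ 1 $ 1 + mat_of x $ 2 $ 2 + mat_of x $ 3 $ 3 = 0"
  using mat_of[of x] by (simp add: trace_def sum_3)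

lemma mat_of_bracket: "mat_of (bracket x y) = mat_of x ** mat_of y - mat_of y ** mat_of x"
  by (transfer; simp)

lemma act_add_left: "act N K (x + y) u = act N K x u + act N K y u"
  by (rule poly_mapping_eqI) (simp add: lookup_act lookup_add_fun actf_def mat_of_simps algebra_simps)

lemma act_scale_left: "act N K (lscale c x) u = pm_scale c (act N K x u)"
  by (rule poly_mapping_eqI) (simp add: lookup_act lookup_scale_fun actf_def mat_of_simps algebra_simps)

lemma act_bracket: "act N K (bracket x y) u + act N K y (act N K x u) = act N K x (act N K y u)"
  using mat_of[of x] mat_of[of y]
  by (intro poly_mapping_eqI) (simp add: lookup_act lookup_add mat_of_bracket actf_bracket)

definition octant :: "int set \<Rightarrow> (int \<times> int \<times> int) set" where
  "octant R = {(i, j, l). 0 \<le> i \<and> 0 \<le> j \<and> 0 \<le> l \<and> j \<in> R}"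

text \<open>The span of the basis vectors with \<open>j \<ge> J\<close> is a submodule exactly when \<open>e\<^sub>\<beta>\<close> does not lead from \<open>j = J\<close> to
  \<open>j = J - 1\<close>, and there its coefficient is a multiple of \<open>K - J\<close>.\<close>

definition admissible :: "complex \<Rightarrow> int set \<Rightarrow> bool" where
  "admissible K R \<longleftrightarrow> R = UNIV \<or> (\<exists>J > 0. R = {..<J} \<and> K = of_int J)"

text \<open>Dropping the coefficients with \<open>j\<close> outside \<open>R\<close> realises the quotient by the submodule \<open>j \<ge> J\<close> on the remaining basis
  vectors.\<close>

definition cut :: "int set \<Rightarrow> wvec \<Rightarrow> wvec" where
  "cut R c = Abs_poly_mapping (\<lambda>(i, j, l). if j \<in> R then lk c (i, j, l) else 0)"

lemma lookup_cut: "lk (cut R c) = (\<lambda>(i, j, l). if j \<in> R then lk c (i, j, l) else 0)"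
  unfolding cut_def
proof (rule lookup_Abs_poly_mapping)
  have "finite {k. lk c k \<noteq> 0}" by simp
  then show "finite {k. (case k of (i, j, l) \<Rightarrow> if j \<in> R then lk c (i, j, l) else 0) \<noteq> 0}"
    by (rule rev_finite_subset) (auto split: if_splits)
qed

lemma cut_UNIV [simp]: "cut UNIV c = c"
  by (rule poly_mapping_eqI) (auto simp: lookup_cut)

lemma cut_add: "cut R (u + v) = cut R u + cut R v"
  by (rule poly_mapping_eqI) (auto simp: lookup_cut lookup_add)

lemma cut_scale: "cut R (pm_scale c u) = pm_scale c (cut R u)"
  by (rule poly_mapping_eqI) (auto simp: lookup_cut)

lemma cut_zero [simp]: "cut R 0 = 0"
  by (rule poly_mapping_eqI) (auto simp: lookup_cut)

lemma cut_act_cut: "admissible K R \<Longrightarrow> cut R (act N K x (cut R c)) = cut R (act N K x c)"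
proof (rule poly_mapping_eqI)
  fix k :: "int \<times> int \<times> int" assume R: "admissible K R"
  obtain i j l where k: "k = (i, j, l)" by (cases k rule: prod_cases3)
  show "lk (cut R (act N K x (cut R c))) k = lk (cut R (act N K x c)) k"
  proof (cases "R = UNIV")
    case False
    then obtain J where J: "R = {..<J}" "K = of_int J" using R unfolding admissible_def by auto
    show ?thesis
    proof (cases "j = J - 1")
      case True
      then have "K - 1 - of_int j = 0" using J by simp
      then show ?thesis unfolding k using True by (simp add: lookup_cut lookup_act actf_def op_defs J)
    next
      case False
      then show ?thesis unfolding k by (auto simp add: lookup_cut lookup_act actf_def op_defs J)
    qed
  qed simp
qed

lemma keys_octant_iff: "Poly_Mapping.keys c \<subseteq> octant R \<longleftrightarrow>
  (\<forall>i j l. i < 0 \<or> j < 0 \<or> l < 0 \<or> j \<notin> R \<longrightarrow> lk c (i, j, l) = 0)"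
  unfolding octant_def subset_eq Ball_def in_keys_iff split_paired_All mem_Collect_eq prod.case not_le[symmetric]
  by blast

text \<open>A term that would leave the octant carries a factor such as \<open>i + 1\<close> with \<open>i = -1\<close>.\<close>

lemma keys_act: "Poly_Mapping.keys c \<subseteq> octant UNIV \<Longrightarrow> Poly_Mapping.keys (act N K x c) \<subseteq> octant UNIV"
proof -
  have z: "a + 1 = 0 \<or> a + 1 < 0" if "a < 0" for a :: int using that by auto
  have o: "a + 1 = 0 \<Longrightarrow> of_int a + 1 = (0::complex)" for a by (metis of_int_0 of_int_1 of_int_add)
  assume "Poly_Mapping.keys c \<subseteq> octant UNIV"
  then have c: "i < 0 \<or> j < 0 \<or> l < 0 \<Longrightarrow> lk c (i, j, l) = 0" for i j l
    unfolding keys_octant_iff by auto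
  have "lk (act N K x c) (i, j, l) = 0" if "i < 0 \<or> j < 0 \<or> l < 0" for i j l
    using that
  proof (elim disjE)
    assume i: "i < 0" show ?thesis using z[OF i] by (elim disjE) (use i in \<open>simp_all add: lookup_act actf_def op_defs c o\<close>)
  next
    assume i: "j < 0" show ?thesis using z[OF i] by (elim disjE) (use i in \<open>simp_all add: lookup_act actf_def op_defs c o\<close>)
  next
    assume i: "l < 0" show ?thesis using z[OF i] by (elim disjE) (use i in \<open>simp_all add: lookup_act actf_def op_defs c o\<close>)
  qed
  then show ?thesis unfolding keys_octant_iff by auto
qed

lemma keys_cut: "Poly_Mapping.keys c \<subseteq> octant UNIV \<Longrightarrow> Poly_Mapping.keys (cut R c) \<subseteq> octant R"
  unfolding keys_octant_iff by (auto simp: lookup_cut)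

lemma cut_id: "Poly_Mapping.keys c \<subseteq> octant R \<Longrightarrow> cut R c = c"
  unfolding keys_octant_iff by (intro poly_mapping_eqI) (auto simp: lookup_cut)

definition vspace :: "int set \<Rightarrow> wvec set" where "vspace R = {c. Poly_Mapping.keys c \<subseteq> octant R}"

definition ract :: "complex \<Rightarrow> complex \<Rightarrow> int set \<Rightarrow> sl3 \<Rightarrow> wvec \<Rightarrow> wvec" where
  "ract N K R x c = cut R (act N K x c)"

text \<open>For \<open>R = UNIV\<close> the model of a Verma module, for \<open>R = {..<J}\<close> the model of its quotient, a parabolic Verma module. The Lie
  algebra acts through \<open>t\<close>, which is the identity or the diagram automorphism.\<close>

definition vmod :: "(sl3 \<Rightarrow> sl3) \<Rightarrow> complex \<Rightarrow> complex \<Rightarrow> int set \<Rightarrow> (sl3, wvec) lmod" where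
  "vmod t N K R = \<lparr>mcarrier = vspace R, mzero = 0, madd = (+), mscale = pm_scale,
     mact = \<lambda>x c. ract N K R (t x) c\<rparr>"

lemma vmod_simps [simp]: "mcarrier (vmod t N K R) = vspace R" "mzero (vmod t N K R) = 0"
  "madd (vmod t N K R) = (+)" "mscale (vmod t N K R) = pm_scale"
  "mact (vmod t N K R) x c = ract N K R (t x) c"
  by (simp_all add: vmod_def)

lemma vspaceI: "(\<And>i j l. i < 0 \<or> j < 0 \<or> l < 0 \<or> j \<notin> R \<Longrightarrow> lk c (i, j, l) = 0) \<Longrightarrow> c \<in> vspace R"
  unfolding vspace_def keys_octant_iff by auto
lemma vspaceD: "c \<in> vspace R \<Longrightarrow> i < 0 \<or> j < 0 \<or> l < 0 \<or> j \<notin> R \<Longrightarrow> lk c (i, j, l) = 0"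
  unfolding vspace_def keys_octant_iff by auto

lemma vspace_add: "u \<in> vspace R \<Longrightarrow> v \<in> vspace R \<Longrightarrow> u + v \<in> vspace R"
  by (rule vspaceI) (auto simp: lookup_add simp: vspaceD)
lemma vspace_diff: "u \<in> vspace R \<Longrightarrow> v \<in> vspace R \<Longrightarrow> u - v \<in> vspace R"
  by (rule vspaceI) (auto simp: lookup_minus simp: vspaceD)
lemma vspace_scale: "u \<in> vspace R \<Longrightarrow> pm_scale c u \<in> vspace R"
  by (rule vspaceI) (auto simp: vspaceD)
lemma vspace_0 [simp]: "0 \<in> vspace R" by (rule vspaceI) auto
lemma vspace_UNIV: "u \<in> vspace R \<Longrightarrow> u \<in> vspace UNIV" 
  by (rule vspaceI) (auto simp: vspaceD)
lemma vspace_cut: "u \<in> vspace UNIV \<Longrightarrow> cut R u \<in> vspace R"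
  unfolding vspace_def using keys_cut by auto
lemma vspace_cut_id: "u \<in> vspace R \<Longrightarrow> cut R u = u"
  unfolding vspace_def using cut_id by auto
lemma vspace_act: "u \<in> vspace UNIV \<Longrightarrow> act N K x u \<in> vspace UNIV"
  unfolding vspace_def using keys_act by auto
lemma vspace_ract: "u \<in> vspace R \<Longrightarrow> ract N K R x u \<in> vspace R"
  unfolding ract_def by (intro vspace_cut vspace_act vspace_UNIV)

lemma ract_add: "ract N K R x (u + v) = ract N K R x u + ract N K R x v"
  by (simp add: ract_def act_add cut_add)
lemma ract_scale: "ract N K R x (pm_scale c u) = pm_scale c (ract N K R x u)"
  by (simp add: ract_def act_scale cut_scale)
lemma ract_add_left: "ract N K R (x + y) u = ract N K R x u + ract N K R y u"
  by (simp add: ract_def act_add_left cut_add)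
lemma ract_scale_left: "ract N K R (lscale c x) u = pm_scale c (ract N K R x u)"
  by (simp add: ract_def act_scale_left cut_scale)
lemma ract_cut: "admissible K R \<Longrightarrow> ract N K R x (cut R u) = cut R (act N K x u)"
  by (simp add: ract_def cut_act_cut)
lemma ract_bracket: "admissible K R \<Longrightarrow> 
   ract N K R (bracket x y) u + ract N K R y (ract N K R x u) = ract N K R x (ract N K R y u)"
  unfolding ract_def cut_act_cut cut_add[symmetric] act_bracket ..

locale sl3_involution =
  fixes t :: "sl3 \<Rightarrow> sl3"
  assumes t_add: "t (x + y) = t x + t y"
    and t_scale: "t (lscale c x) = lscale c (t x)"
    and t_bracket: "t (bracket x y) = bracket (t x) (t y)"
    and t_t [simp]: "t (t x) = x"
    and t_borel: "x \<in> borel_sl3 \<Longrightarrow> t x \<in> borel_sl3"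

context sl3_involution begin

lemma lie_module_vmod: 
  assumes "admissible K R"
  shows "lie_module s (vmod t N K R)"
  by unfold_locales
    (simp_all add: vspace_add vspace_scale vspace_ract ract_add ract_scale t_add t_scale ract_add_left
      ract_scale_left ract_bracket[OF assms] t_bracket add_ac pm.scale_right_distrib pm.scale_left_distrib)

end

section \<open>Weights and singular vectors\<close>

lift_definition elem :: "3 \<Rightarrow> 3 \<Rightarrow> sl3" is "\<lambda>a b. \<chi> i j. if i = a \<and> j = b \<and> a \<noteq> b then 1 else 0"
  by (auto simp: trace_def intro!: sum.neutral)

lemma mat_of_elem: "mat_of (elem a b) $ i $ j = (if i = a \<and> j = b \<and> a \<noteq> b then 1 else 0)"
  by transfer simp

lemma lookup_act_elem:
  "lk (act N K (elem 2 1) c) = opF1 (lk c)"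
  "lk (act N K (elem 3 2) c) = opF2 (lk c)"
  "lk (act N K (elem 3 1) c) = opF3 (lk c)"
  "lk (act N K (elem 1 2) c) = opE1 N (lk c)"
  "lk (act N K (elem 2 3) c) = opE2 K (lk c)"
  "lk (act N K (elem 1 3) c) = opE3 N K (lk c)"
  unfolding lookup_act fun_eq_iff actf_def by (simp_all add: mat_of_elem)

text \<open>All weights that occur are integral; integer parameters make the vanishing of coefficients a question about integers.\<close>

abbreviation sact :: "int \<Rightarrow> int \<Rightarrow> int set \<Rightarrow> sl3 \<Rightarrow> wvec \<Rightarrow> wvec" where
  "sact n k R x c \<equiv> ract (of_int n) (of_int k) R x c"

lemma lookup_ract: "lk (ract N K R x c) (i, j, l) = (if j \<in> R then lk (act N K x c) (i, j, l) else 0)"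
  by (simp add: ract_def lookup_cut)

lemmas lookup_op = lookup_ract lookup_act_elem op_defs

text \<open>The vector has weight \<open>\<nu> - p \<alpha> - q \<beta>\<close>, since \<open>f\<^sub>\<alpha>\<^sub>+\<^sub>\<beta>\<close> lowers by both simple roots.\<close>

definition homog :: "int \<Rightarrow> int \<Rightarrow> wvec \<Rightarrow> bool" where
  "homog p q c \<longleftrightarrow> (\<forall>i j l. lk c (i, j, l) \<noteq> 0 \<longrightarrow> i + l = p \<and> j + l = q)"

definition wproj :: "int \<Rightarrow> int \<Rightarrow> wvec \<Rightarrow> wvec" where
  "wproj p q c = Abs_poly_mapping (\<lambda>(i, j, l). if i + l = p \<and> j + l = q then lk c (i, j, l) else 0)"

lemma lookup_wproj: "lk (wproj p q c) (i, j, l) = (if i + l = p \<and> j + l = q then lk c (i, j, l) else 0)"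
proof -
  have "finite {k. lk c k \<noteq> 0}" by simp
  then have "finite {k. (case k of (i, j, l) \<Rightarrow> if i + l = p \<and> j + l = q then lk c (i, j, l) else 0) \<noteq> 0}"
    by (rule rev_finite_subset) (auto split: if_splits)
  then show ?thesis unfolding wproj_def by (subst lookup_Abs_poly_mapping) auto
qed

lemma wvec_eqI: "(\<And>i j l. lk u (i, j, l) = lk v (i, j, l)) \<Longrightarrow> u = (v :: wvec)"
  by (rule poly_mapping_eqI) auto

lemma homog_wproj: "homog p q (wproj p q c)"
  by (auto simp: homog_def lookup_wproj)

lemma homogD: "homog p q c \<Longrightarrow> \<not> (i + l = p \<and> j + l = q) \<Longrightarrow> lk c (i, j, l) = 0"
  by (auto simp: homog_def)

lemma wproj_homog: "homog p q c \<Longrightarrow> wproj p q c = c"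
  by (rule wvec_eqI) (auto simp: lookup_wproj homogD)

lemma wproj_homog_other: "homog p q c \<Longrightarrow> (p', q') \<noteq> (p, q) \<Longrightarrow> wproj p' q' c = 0"
  by (rule wvec_eqI) (auto simp: lookup_wproj homogD)

lemma wproj_add: "wproj p q (u + v) = wproj p q u + wproj p q v"
  by (rule wvec_eqI) (auto simp: lookup_wproj lookup_add)

lemma wproj_scale: "wproj p q (pm_scale a u) = pm_scale a (wproj p q u)"
  by (rule wvec_eqI) (auto simp: lookup_wproj)

lemma wproj_0 [simp]: "wproj p q 0 = 0"
  by (rule wvec_eqI) (auto simp: lookup_wproj)

lemma wproj_vspace: "c \<in> vspace R \<Longrightarrow> wproj p q c \<in> vspace R"
  by (rule vspaceI) (auto simp: lookup_wproj vspaceD)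

lemma exists_wproj: "c \<noteq> 0 \<Longrightarrow> \<exists>p q. wproj p q c \<noteq> 0"
proof -
  assume "c \<noteq> 0"
  then obtain i j l where "lk c (i, j, l) \<noteq> 0" using wvec_eqI[of c 0] by auto
  then have "lk (wproj (i + l) (j + l) c) (i, j, l) \<noteq> 0" by (simp add: lookup_wproj)
  then show ?thesis by (metis lookup_zero)
qed

lemma wproj_ract:
  "ract N K R (elem 1 2) (wproj p q c) = wproj (p - 1) q (ract N K R (elem 1 2) c)"
  "ract N K R (elem 2 3) (wproj p q c) = wproj p (q - 1) (ract N K R (elem 2 3) c)"
  "ract N K R (elem 1 3) (wproj p q c) = wproj (p - 1) (q - 1) (ract N K R (elem 1 3) c)"
  "ract N K R (elem 2 1) (wproj p q c) = wproj (p + 1) q (ract N K R (elem 2 1) c)"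
  "ract N K R (elem 3 2) (wproj p q c) = wproj p (q + 1) (ract N K R (elem 3 2) c)"
  "ract N K R (elem 3 1) (wproj p q c) = wproj (p + 1) (q + 1) (ract N K R (elem 3 1) c)"
  by (rule wvec_eqI; simp add: lookup_op lookup_wproj; auto)+

lemma ract_0 [simp]: "ract N K R x 0 = 0"
  using ract_scale[of N K R x 0 0] by simp

lemma homog_ract:
  assumes "homog p q c"
  shows "homog (p - 1) q (ract N K R (elem 1 2) c)" "homog p (q - 1) (ract N K R (elem 2 3) c)"
    "homog (p - 1) (q - 1) (ract N K R (elem 1 3) c)" "homog (p + 1) q (ract N K R (elem 2 1) c)"
    "homog p (q + 1) (ract N K R (elem 3 2) c)" "homog (p + 1) (q + 1) (ract N K R (elem 3 1) c)"
  using homog_wproj wproj_ract wproj_homog[OF assms] by metis+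

definition wt_char :: "complex \<Rightarrow> complex \<Rightarrow> sl3 \<Rightarrow> complex" where
  "wt_char N K x = (N - 1) * mat_of x $ 1 $ 1 - (K - 1) * mat_of x $ 3 $ 3"

lemma lookup_act_cartan:
  assumes "x \<in> cartan"
  shows "lk (act N K x c) (i, j, l) = (wt_char N K x - of_int (i + l) * root_alpha x - of_int (j + l) * root_beta x) * lk c (i, j, l)"
proof -
  have z: "mat_of x $ a $ b = 0" if "a \<noteq> b" for a b using assms that by (simp add: cartan_def)
  have t: "mat_of x $ 2 $ 2 = - mat_of x $ 1 $ 1 - mat_of x $ 3 $ 3" using mat_of_trace[of x]
    by (simp add: algebra_simps eq_neg_iff_add_eq_0)
  show ?thesis unfolding lookup_act actf_def wt_char_def root_alpha_def root_beta_def op_defs t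
    by (simp add: z algebra_simps)
qed

text \<open>An element of the Cartan subalgebra on which the simple roots take the values \<open>1\<close> and \<open>\<i>\<close>, so that its eigenvalues
  separate all weights \<open>(p, q)\<close>.\<close>

lift_definition hsep :: sl3 is "\<chi> a b. if a = b then (if a = 1 then (2 + \<i>) / 3 else if a = 2 then (\<i> - 1) / 3 else (- 1 - 2 * \<i>) / 3) else 0"
  by (simp add: trace_def sum_3 add_divide_distrib[symmetric])

lemma mat_of_hsep: "mat_of hsep $ a $ b =
    (if a = b then (if a = 1 then (2 + \<i>) / 3 else if a = 2 then (\<i> - 1) / 3 else (- 1 - 2 * \<i>) / 3) else 0)"
  by transfer simp

lemma hsep_cartan: "hsep \<in> cartan"
  by (simp add: cartan_def mat_of_hsep)

lemma hsep_borel: "hsep \<in> borel_sl3"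
  by (simp add: borel_sl3_def mat_of_hsep)

lemma hsep_roots: "root_alpha hsep = 1" "root_beta hsep = \<i>"
  by (simp_all add: root_alpha_def root_beta_def mat_of_hsep diff_divide_distrib[symmetric])

lemma sep_inj: "of_int p + of_int q * \<i> = of_int p' + of_int q' * \<i> \<longleftrightarrow> p = p' \<and> q = (q' :: int)"
  by (auto simp: complex_eq_iff)

lemma lookup_ract_hsep:
  assumes "c \<in> vspace R"
  shows "lk (ract N K R hsep c) (i, j, l) =
    (wt_char N K hsep - (of_int (i + l) + of_int (j + l) * \<i>)) * lk c (i, j, l)"
  using vspaceD[OF assms, of i j l] by (auto simp: lookup_ract lookup_act_cartan[OF hsep_cartan] hsep_roots algebra_simps)

text \<open>A submodule contains the weight components of its elements: interpolate at the finitely many eigenvalues of \<open>hsep\<close>.\<close>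

lemma wproj_in_stable:
  assumes A: "A \<subseteq> vspace R" and add: "\<And>u v. u \<in> A \<Longrightarrow> v \<in> A \<Longrightarrow> u + v \<in> A"
    and scale: "\<And>a u. u \<in> A \<Longrightarrow> pm_scale a u \<in> A"
    and h: "\<And>u. u \<in> A \<Longrightarrow> ract N K R hsep u \<in> A" and c: "c \<in> A"
  shows "wproj p q c \<in> A"
proof -
  let ?wt = "\<lambda>(i, j, l). (i + l, j + l)"
  let ?ev = "\<lambda>(p, q). of_int p + of_int q * \<i> :: complex"
  have ev: "?ev \<theta> = ?ev \<theta>' \<longleftrightarrow> \<theta> = \<theta>'" for \<theta> \<theta>' by (cases \<theta>; cases \<theta>'; simp add: sep_inj)
  \<comment> \<open>The factors for all other weights in \<open>S\<close> kill the unwanted components and are normalised to keep the wanted one.\<close>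
  have main: "\<exists>c'\<in>A. \<exists>g. (\<forall>k. lk c' k = g (?wt k) * lk c k) \<and> g (p, q) = 1 \<and> (\<forall>\<theta>\<in>S. g \<theta> = 0)"
    if "finite S" "(p, q) \<notin> S" for S
    using that
  proof (induction S rule: finite_induct)
    case empty
    show ?case using c by (intro bexI[of _ c] exI[of _ "\<lambda>_. 1"]) auto
  next
    case (insert \<theta> S)
    then have "\<exists>c'\<in>A. \<exists>g. (\<forall>k. lk c' k = g (?wt k) * lk c k) \<and> g (p, q) = 1 \<and> (\<forall>\<theta>\<in>S. g \<theta> = 0)" by simp
    then obtain c' g where c': "c' \<in> A" and g: "\<And>k. lk c' k = g (?wt k) * lk c k" "g (p, q) = 1" "\<And>\<theta>. \<theta> \<in> S \<Longrightarrow> g \<theta> = 0"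
      by blast
    have ne: "?ev \<theta> - ?ev (p, q) \<noteq> 0" using ev[of \<theta> "(p, q)"] insert.prems by auto
    let ?s = "1 / (?ev \<theta> - ?ev (p, q))"
    define c'' where "c'' = pm_scale ?s (ract N K R hsep c' + pm_scale (?ev \<theta> - wt_char N K hsep) c')"
    have "c'' \<in> A" unfolding c''_def by (intro scale add h c')
    moreover have "lk c'' k = (?s * (?ev \<theta> - ?ev (?wt k)) * g (?wt k)) * lk c k" for k
    proof -
      obtain i j l where k: "k = (i, j, l)" by (cases k rule: prod_cases3)
      have c'R: "c' \<in> vspace R" using A c' by auto
      have "lk c'' k = ?s * ((wt_char N K hsep - ?ev (?wt k)) * lk c' k + (?ev \<theta> - wt_char N K hsep) * lk c' k)"
        unfolding c''_def k lookup_pm_scale lookup_add lookup_ract_hsep[OF c'R] by simp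
      also have "\<dots> = ?s * (?ev \<theta> - ?ev (?wt k)) * lk c' k" by (simp add: algebra_simps)
      finally show ?thesis unfolding g(1) by simp
    qed
    ultimately show ?case using ne g
      by (intro bexI[of _ c''] exI[of _ "\<lambda>\<theta>'. ?s * (?ev \<theta> - ?ev \<theta>') * g \<theta>'"]) auto
  qed
  define S where "S = ?wt ` Poly_Mapping.keys c - {(p, q)}"
  have "finite S" "(p, q) \<notin> S" by (auto simp: S_def)
  from main[OF this] obtain c' g where c': "c' \<in> A" and g: "\<And>k. lk c' k = g (?wt k) * lk c k" "g (p, q) = 1" "\<And>\<theta>. \<theta> \<in> S \<Longrightarrow> g \<theta> = 0"
    by blast
  have "wproj p q c = c'"
  proof (rule wvec_eqI)
    fix i j l
    show "lk (wproj p q c) (i, j, l) = lk c' (i, j, l)"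
    proof (cases "lk c (i, j, l) = 0 \<or> (i + l, j + l) = (p, q)")
      case True then show ?thesis using g(1)[of "(i, j, l)"] g(2) by (auto simp: lookup_wproj)
    next
      case False
      then have "(i + l, j + l) \<in> S" unfolding S_def by (auto simp: in_keys_iff image_iff intro!: bexI[of _ "(i, j, l)"])
      then show ?thesis using False g(1)[of "(i, j, l)"] g(3) by (auto simp: lookup_wproj)
    qed
  qed
  then show ?thesis using c' by simp
qed

text \<open>In a fixed weight the vectors have one coordinate for each \<open>l\<close>, and being killed by \<open>e\<^sub>\<alpha>\<close> and \<open>e\<^sub>\<beta>\<close> amounts to two
  recursions in \<open>l\<close>.\<close>

lemma singular_eqs:
  assumes "homog p q c"
  shows "ract N K R (elem 1 2) c = 0 \<Longrightarrow> q - l \<in> R \<Longrightarrow>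
      (N + of_int (q - p - l)) * of_int (p - l) * lk c (p - l, q - l, l) = of_int (l + 1) * lk c (p - (l + 1), q - (l + 1), l + 1)"
    and "ract N K R (elem 2 3) c = 0 \<Longrightarrow> q - l - 1 \<in> R \<Longrightarrow>
      (K + of_int (l - q)) * of_int (q - l) * lk c (p - l, q - l, l) = - of_int (l + 1) * lk c (p - (l + 1), q - (l + 1), l + 1)"
proof -
  assume "ract N K R (elem 1 2) c = 0" "q - l \<in> R"
  then have "lk (ract N K R (elem 1 2) c) (p - l - 1, q - l, l) = 0" by simp
  then show "(N + of_int (q - p - l)) * of_int (p - l) * lk c (p - l, q - l, l) = of_int (l + 1) * lk c (p - (l + 1), q - (l + 1), l + 1)"
    using \<open>q - l \<in> R\<close> by (simp add: lookup_op diff_diff_eq algebra_simps)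
next
  assume "ract N K R (elem 2 3) c = 0" "q - l - 1 \<in> R"
  then have "lk (ract N K R (elem 2 3) c) (p - l, q - l - 1, l) = 0" by simp
  then show "(K + of_int (l - q)) * of_int (q - l) * lk c (p - l, q - l, l) = - of_int (l + 1) * lk c (p - (l + 1), q - (l + 1), l + 1)"
    using \<open>q - l - 1 \<in> R\<close> by (simp add: lookup_op diff_diff_eq algebra_simps eq_neg_iff_add_eq_0)
qed

definition topv :: wvec where "topv = Poly_Mapping.single (0, 0, 0) 1"

lemma lookup_topv: "lk topv k = (if k = (0, 0, 0) then 1 else 0)"
  by (simp add: topv_def lookup_single when_def)

lemma topv_vspace: "0 \<in> R \<Longrightarrow> topv \<in> vspace R"
  by (rule vspaceI) (auto simp: lookup_topv)

lemma homog_topv: "homog 0 0 topv"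
  by (auto simp: homog_def lookup_topv split: if_splits)

lemma topv_nz [simp]: "topv \<noteq> 0"
  by (metis lookup_topv lookup_zero zero_neq_one)

lemma homog_0: "c \<in> vspace R \<Longrightarrow> homog 0 0 c \<Longrightarrow> c = pm_scale (lk c (0, 0, 0)) topv"
proof (rule wvec_eqI)
  fix i j l assume c: "c \<in> vspace R" "homog 0 0 c"
  show "lk c (i, j, l) = lk (pm_scale (lk c (0, 0, 0)) topv) (i, j, l)"
  proof (cases "lk c (i, j, l) = 0")
    case False
    then have "i + l = 0" "j + l = 0" "\<not> i < 0" "\<not> j < 0" "\<not> l < 0" using c homogD[OF c(2), of i l j] vspaceD[OF c(1), of i j l] by auto
    then have "i = 0 \<and> j = 0 \<and> l = 0" by linarith
    then show ?thesis by (simp add: lookup_topv)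
  next
    case True then show ?thesis by (auto simp: lookup_topv)
  qed
qed

definition singular :: "int \<Rightarrow> int \<Rightarrow> int set \<Rightarrow> wvec \<Rightarrow> bool" where
  "singular n k R c \<longleftrightarrow> c \<in> vspace R \<and> sact n k R (elem 1 2) c = 0 \<and> sact n k R (elem 2 3) c = 0"

lemma homog_eq_zero: "homog p q c \<Longrightarrow> c \<in> vspace R \<Longrightarrow> (\<And>l. 0 \<le> l \<Longrightarrow> lk c (p - l, q - l, l) = 0) \<Longrightarrow> c = 0"
proof (rule wvec_eqI)
  fix i j l assume h: "homog p q c" "c \<in> vspace R" and z: "\<And>l. 0 \<le> l \<Longrightarrow> lk c (p - l, q - l, l) = 0"
  show "lk c (i, j, l) = lk 0 (i, j, l)"
  proof (cases "i + l = p \<and> j + l = q \<and> 0 \<le> l")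
    case True then show ?thesis using z[of l] by auto
  next
    case False then show ?thesis using homogD[OF h(1), of i l j] vspaceD[OF h(2), of i j l] by auto
  qed
qed

lemma singular_recursion:
  assumes "singular n k R c" "homog p q c"
  shows "q - l \<in> R \<Longrightarrow> of_int ((n + q - p - l) * (p - l)) * lk c (p - l, q - l, l) = of_int (l + 1) * lk c (p - (l + 1), q - (l + 1), l + 1)"
   and "q - l - 1 \<in> R \<Longrightarrow> of_int ((k + l - q) * (q - l)) * lk c (p - l, q - l, l) = - of_int (l + 1) * lk c (p - (l + 1), q - (l + 1), l + 1)"
  using singular_eqs[OF assms(2), where N = "of_int n" and K = "of_int k" and R = R and l = l] assms(1) unfolding singular_def
  by (simp_all add: algebra_simps)

lemma singular_next:
  assumes "singular n k R c" "homog p q c" "q - l - 1 \<in> R" "0 \<le> l"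
    and z: "(k + l - q) * (q - l) = 0 \<or> lk c (p - l, q - l, l) = 0"
  shows "lk c (p - (l + 1), q - (l + 1), l + 1) = 0"
proof -
  have "of_int (l + 1) * lk c (p - (l + 1), q - (l + 1), l + 1) = 0"
    using singular_recursion(2)[OF assms(1-3)] z by (auto simp del: of_int_mult of_int_add of_int_diff)
  moreover have "of_int (l + 1) \<noteq> (0 :: complex)" using \<open>0 \<le> l\<close> unfolding of_int_eq_0_iff by simp
  ultimately show ?thesis by (metis mult_eq_0_iff)
qed

text \<open>The recursion for \<open>e\<^sub>\<beta>\<close> propagates a zero upwards in \<open>l\<close>.\<close>

lemma singular_zero:
  assumes s: "singular n k R c" "homog p q c" and R: "\<And>l. l0 \<le> l \<Longrightarrow> q - l - 1 \<in> R"
    and z: "\<And>l. l \<le> l0 \<Longrightarrow> lk c (p - l, q - l, l) = 0" and l0: "0 \<le> l0"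
  shows "c = 0"
proof (rule homog_eq_zero[OF s(2)])
  show "c \<in> vspace R" using s(1) by (simp add: singular_def)
  have "lk c (p - (l0 + int m), q - (l0 + int m), l0 + int m) = 0" for m
  proof (induction m)
    case 0 show ?case using z[of l0] by simp
  next
    case (Suc m)
    have "lk c (p - (l0 + int m + 1), q - (l0 + int m + 1), l0 + int m + 1) = 0"
      using singular_next[OF s R[of "l0 + int m"]] l0 Suc by simp
    then show ?case by (simp add: algebra_simps)
  qed
  note * = this
  fix l :: int assume "0 \<le> l"
  show "lk c (p - l, q - l, l) = 0" 
  proof (cases "l \<le> l0")
    case False
    then have "l = l0 + int (nat (l - l0))" by simp
    then show ?thesis using *[of "nat (l - l0)"] by simp
  qed (rule z)
qed

lemma singular_nz_coeff:
  assumes s: "singular n k R c" "homog p q c" and R: "\<And>l. 0 \<le> l \<Longrightarrow> q - l - 1 \<in> R" and "c \<noteq> 0"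
  shows "lk c (p, q, 0) \<noteq> 0" "0 \<le> p" "0 \<le> q"
proof -
  have c: "c \<in> vspace R" using s(1) by (simp add: singular_def)
  show nz: "lk c (p, q, 0) \<noteq> 0"
  proof
    assume "lk c (p, q, 0) = 0"
    then have "lk c (p - l, q - l, l) = 0" if "l \<le> 0" for l using that vspaceD[OF c, of "p - l" "q - l" l] by (cases "l = 0") auto
    from singular_zero[OF s R this] \<open>c \<noteq> 0\<close> show False by auto
  qed
  then show "0 \<le> p" "0 \<le> q" using vspaceD[OF c, of p q 0] by (meson not_le)+
qed

text \<open>If no factor of the \<open>e\<^sub>\<beta>\<close>-recursion vanishes below \<open>l = q\<close>, all coordinates up to \<open>l = q\<close> are nonzero, so \<open>q \<le> p\<close>.
  There the recursion for \<open>e\<^sub>\<alpha>\<close> terminates, which gives \<open>p = q\<close>, and at \<open>l = 0\<close> the two recursions agree only if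
  \<open>q = n + k\<close>.\<close>

lemma singular_weight_low:
  assumes s: "singular n k R c" "homog p q c" and R: "\<And>l. 0 \<le> l \<Longrightarrow> q - l \<in> R" and nz: "c \<noteq> 0"
    and n: "n < 0" and k: "\<not> (1 \<le> k \<and> k \<le> q)"
  shows "p = 0 \<and> q = 0 \<or> p = q \<and> q = n + k"
proof -
  have c: "c \<in> vspace R" using s(1) by (simp add: singular_def)
  let ?d = "\<lambda>l. lk c (p - l, q - l, l)"
  have R1: "q - l - 1 \<in> R" if "0 \<le> l" for l using R[of "l + 1"] that by (simp add: diff_diff_eq)
  note nz0 = singular_nz_coeff[OF s R1 nz]
  have d: "int m \<le> q \<Longrightarrow> ?d (int m) \<noteq> 0" for m
  proof (induction m)
    case 0 then show ?case using nz0(1) by simp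
  next
    case (Suc m)
    have "(k + int m - q) * (q - int m) \<noteq> 0" using k Suc.prems by auto
    then have "of_int ((k + int m - q) * (q - int m)) * ?d (int m) \<noteq> 0" using Suc by (simp del: of_int_mult of_int_diff of_int_add)
    then have "?d (int m + 1) \<noteq> 0" using singular_recursion(2)[OF s R1[of "int m"]] by auto
    then show ?case by (simp add: algebra_simps)
  qed
  have q: "?d q \<noteq> 0" using d[of "nat q"] nz0(3) by simp
  then have pq: "0 \<le> p - q" using vspaceD[OF c, of "p - q" "q - q" q] by (meson not_le)
  have "?d (q + 1) = 0" using vspaceD[OF c] by simp
  then have "(n + q - p - q) * (p - q) = 0" using singular_recursion(1)[OF s R[OF nz0(3)]] q
    by (simp del: of_int_mult of_int_diff of_int_add)
  then have "p = q" using n nz0 by auto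
  show ?thesis
  proof (cases "q = 0")
    case False
    have e: "of_int ((n + q - p) * p) * lk c (p, q, 0) = ?d 1" "of_int ((k - q) * q) * lk c (p, q, 0) = - ?d 1"
      using singular_recursion[OF s, of 0] R[of 0] R1[of 0] by simp_all
    then have "of_int ((n + q - p) * p + (k - q) * q) * lk c (p, q, 0) = 0" by (simp add: algebra_simps)
    then have "(n + q - p) * p + (k - q) * q = 0" using nz0(1) by (metis mult_eq_0_iff of_int_eq_0_iff)
    then have "(n + k - q) * q = 0" using \<open>p = q\<close> by (simp add: algebra_simps)
    then show ?thesis using False \<open>p = q\<close> by auto
  qed (use \<open>p = q\<close> in simp)
qed

text \<open>The lowest coordinate that survives in the quotient is killed by the \<open>e\<^sub>\<beta>\<close>-recursion at the boundary.\<close>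

lemma singular_weight_cut:
  assumes s: "singular n k {..<k} c" "homog p q c" and k: "0 < k" "k \<le> q"
  shows "c = 0"
proof (rule singular_zero[OF s, of "q - k + 1"])
  have c: "c \<in> vspace {..<k}" using s(1) by (simp add: singular_def)
  have "lk c (p - (q - k), q - (q - k), q - k) = 0" using vspaceD[OF c] by simp
  then have "lk c (p - (q - k + 1), q - (q - k + 1), q - k + 1) = 0"
    using singular_next[OF s, of "q - k"] k by simp
  then show "lk c (p - l, q - l, l) = 0" if "l \<le> q - k + 1" for l
    using that vspaceD[OF c, of "p - l" "q - l" l] by (cases "l = q - k + 1") auto
qed (use k in auto)

text \<open>Now the \<open>e\<^sub>\<beta>\<close>-recursion stops at \<open>m = q - k\<close>: the coordinates are nonzero up to \<open>l = m\<close> and vanish beyond. For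
  \<open>m > 0\<close> the \<open>e\<^sub>\<alpha>\<close>-recursion at \<open>l = 0\<close> and \<open>l = m\<close> is contradictory when \<open>n < 0\<close>.\<close>

lemma singular_weight_high:
  assumes s: "singular n k UNIV c" "homog p q c" and k: "1 \<le> k" "k \<le> q" and nz: "c \<noteq> 0" and n: "n < 0"
  shows "q = k \<and> (p = 0 \<or> p = n + k)"
proof -
  have c: "c \<in> vspace UNIV" using s(1) by (simp add: singular_def)
  let ?d = "\<lambda>l. lk c (p - l, q - l, l)"
  have R1: "q - l - 1 \<in> UNIV" for l by simp
  note nz0 = singular_nz_coeff[OF s R1 nz]
  note eq1 = singular_recursion(1)[OF s UNIV_I] and eq2 = singular_recursion(2)[OF s UNIV_I]
  define m where "m = q - k"
  have m: "0 \<le> m" using k by (simp add: m_def)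
  have d: "int r \<le> m \<Longrightarrow> ?d (int r) \<noteq> 0" for r
  proof (induction r)
    case 0 then show ?case using nz0(1) by simp
  next
    case (Suc r)
    have "(k + int r - q) * (q - int r) \<noteq> 0" using k Suc.prems by (auto simp: m_def)
    then have "of_int ((k + int r - q) * (q - int r)) * ?d (int r) \<noteq> 0" using Suc by (simp del: of_int_mult of_int_diff of_int_add)
    then have "?d (int r + 1) \<noteq> 0" using eq2[of "int r"] by auto
    then show ?case by (simp add: algebra_simps)
  qed
  have dm: "?d m \<noteq> 0" using d[of "nat m"] m by simp
  then have pm: "m \<le> p" using vspaceD[OF c, of "p - m" "q - m" m] by (meson not_le diff_ge_0_iff_ge)
  have dm1: "?d (m + 1) = 0" using singular_next[OF s UNIV_I m] by (simp add: m_def)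
  have "of_int ((n + q - p) * p) * lk c (p, q, 0) = ?d 1" "of_int ((k - q) * q) * lk c (p, q, 0) = - ?d 1"
      using eq1[of 0] eq2[of 0] by simp_all
  then have "of_int ((n + q - p) * p + (k - q) * q) * lk c (p, q, 0) = 0" by (simp add: algebra_simps)
  then have e0: "(n + q - p) * p + (k - q) * q = 0" using nz0(1) by (metis mult_eq_0_iff of_int_eq_0_iff)
  have "of_int ((n + q - p - m) * (p - m)) * ?d m = 0" using eq1[of m] dm1 by simp
  then have em: "(n + q - p - m) * (p - m) = 0" using dm by (metis mult_eq_0_iff of_int_eq_0_iff)
  show ?thesis
  proof (cases "m = 0")
    case True
    then show ?thesis using em by (auto simp: m_def)
  next
    case False
    then have m0: "0 < m" using m by simp
    from em have "n + q - p = m \<or> p = m" by auto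
    then show ?thesis
    proof
      assume a: "n + q - p = m"
      have "m * p = m * q" using e0 a by (simp add: m_def algebra_simps)
      then show ?thesis using m0 n a by simp
    next
      assume a: "p = m"
      have "k - q = - m" by (simp add: m_def)
      then have "(n + q - p) * m + (- m) * q = 0" using e0 a by metis
      then have "m * (n + q - p) = m * q" by (simp add: mult.commute)
      then show ?thesis using m0 n a by simp
    qed
  qed
qed

lemma singular_wproj: "singular n k R c \<Longrightarrow> singular n k R (wproj p q c)"
  unfolding singular_def by (simp add: wproj_vspace wproj_ract)

text \<open>A sufficient condition for the highest weight vector to be the only singular vector: it covers the Verma modules of
  antidominant weight and the parabolic ones that occur as \<open>L(\<mu>)\<close>.\<close>

definition only_top :: "int \<Rightarrow> int \<Rightarrow> int set \<Rightarrow> bool" where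
  "only_top n k R \<longleftrightarrow> n < 0 \<and> n + k < 0 \<and> (R = UNIV \<and> k < 0 \<or> R = {..<k} \<and> 0 < k)"

lemma only_top_adm: "only_top n k R \<Longrightarrow> admissible (of_int k) R" "only_top n k R \<Longrightarrow> 0 \<in> R"
  by (auto simp: only_top_def admissible_def)

lemma only_top_singular:
  assumes ot: "only_top n k R" and s: "singular n k R c"
  shows "c = pm_scale (lk c (0, 0, 0)) topv"
proof -
  have c: "c \<in> vspace R" using s by (simp add: singular_def)
  have z: "wproj p q c = 0" if pq: "(p, q) \<noteq> (0, 0)" for p q
  proof (rule ccontr)
    assume nz: "wproj p q c \<noteq> 0"
    note s' = singular_wproj[OF s, of p q]
    have le: "\<not> (1 \<le> k \<and> k \<le> q)"
      using singular_weight_cut[OF _ homog_wproj, of n k p q c] s' nz ot unfolding only_top_def by auto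
    have "q - l \<in> R" if "0 \<le> l" for l using ot le that unfolding only_top_def by auto
    from singular_weight_low[OF s' homog_wproj this nz _ le] pq ot
    have "p = q" "q = n + k" by (auto simp: only_top_def)
    moreover have "0 \<le> q"
    proof -
      obtain i j l where "lk (wproj p q c) (i, j, l) \<noteq> 0" using nz wvec_eqI[of "wproj p q c" 0] by auto
      then have "j + l = q" "lk c (i, j, l) \<noteq> 0" by (auto simp: lookup_wproj split: if_splits)
      then show ?thesis using vspaceD[OF c, of i j l] by force
    qed
    ultimately show False using ot by (simp add: only_top_def)
  qed
  have "c = wproj 0 0 c"
  proof (rule wvec_eqI)
    fix i j l
    show "lk c (i, j, l) = lk (wproj 0 0 c) (i, j, l)"
    proof (cases "(i + l, j + l) = (0, 0)")
      case False
      then have "lk (wproj (i + l) (j + l) c) (i, j, l) = 0" by (subst z) auto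
      then show ?thesis using False by (auto simp: lookup_wproj)
    qed (simp add: lookup_wproj)
  qed
  then show ?thesis using homog_0[OF c] homog_wproj by metis
qed

lemma ract_degree:
  assumes "\<And>i j l. lk c (i, j, l) \<noteq> 0 \<Longrightarrow> i + j + 2 * l \<le> m"
  shows "lk (ract N K R (elem 1 2) c) (i, j, l) \<noteq> 0 \<Longrightarrow> i + j + 2 * l \<le> m - 1"
    "lk (ract N K R (elem 2 3) c) (i, j, l) \<noteq> 0 \<Longrightarrow> i + j + 2 * l \<le> m - 1"
    "lk (ract N K R (elem 1 3) c) (i, j, l) \<noteq> 0 \<Longrightarrow> i + j + 2 * l \<le> m - 2"
proof -
  have z: "m < i + j + 2 * l \<Longrightarrow> lk c (i, j, l) = 0" for i j l using assms[of i j l] by force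
  show "lk (ract N K R (elem 1 2) c) (i, j, l) \<noteq> 0 \<Longrightarrow> i + j + 2 * l \<le> m - 1"
    by (rule ccontr, cases "j \<in> R") (simp_all add: lookup_op z)
  show "lk (ract N K R (elem 2 3) c) (i, j, l) \<noteq> 0 \<Longrightarrow> i + j + 2 * l \<le> m - 1"
    by (rule ccontr, cases "j \<in> R") (simp_all add: lookup_op z)
  show "lk (ract N K R (elem 1 3) c) (i, j, l) \<noteq> 0 \<Longrightarrow> i + j + 2 * l \<le> m - 2"
    by (rule ccontr, cases "j \<in> R") (simp_all add: lookup_op z)
qed

lemma degree_bound: "\<exists>m::nat. \<forall>i j l. lk c (i, j, l) \<noteq> 0 \<longrightarrow> i + j + 2 * l \<le> int m"
proof -
  have "finite ((\<lambda>(i, j, l). nat (i + j + 2 * l)) ` Poly_Mapping.keys c)" by simp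
  then obtain m where m: "\<And>x. x \<in> (\<lambda>(i, j, l). nat (i + j + 2 * l)) ` Poly_Mapping.keys c \<Longrightarrow> x \<le> m"
    by (meson finite_nat_set_iff_bounded_le)
  have "i + j + 2 * l \<le> int m" if "lk c (i, j, l) \<noteq> 0" for i j l
  proof -
    have "nat (i + j + 2 * l) \<in> (\<lambda>(i, j, l). nat (i + j + 2 * l)) ` Poly_Mapping.keys c"
      using that by (intro image_eqI[of _ _ "(i, j, l)"]) (auto simp: in_keys_iff)
    from m[OF this] show ?thesis by simp
  qed
  then show ?thesis by blast
qed

text \<open>Raising operators lower the degree \<open>i + j + 2 l\<close>, so they act locally nilpotently.\<close>

lemma exists_singular:
  assumes A: "A \<subseteq> vspace R" and e: "\<And>u. u \<in> A \<Longrightarrow> sact n k R (elem 1 2) u \<in> A" "\<And>u. u \<in> A \<Longrightarrow> sact n k R (elem 2 3) u \<in> A"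
    and c: "c \<in> A" "c \<noteq> 0"
  obtains s where "s \<in> A" "s \<noteq> 0" "singular n k R s"
proof -
  obtain m where m: "\<And>i j l. lk c (i, j, l) \<noteq> 0 \<Longrightarrow> i + j + 2 * l \<le> int m" using degree_bound by blast
  have "\<exists>s\<in>A. s \<noteq> 0 \<and> singular n k R s" using m c
  proof (induction m arbitrary: c rule: less_induct)
    case (less m)
    show ?case
    proof (cases "singular n k R c")
      case True then show ?thesis using less by blast
    next
      case False
      then obtain a b where x: "sact n k R (elem a b) c \<noteq> 0" "(a, b) = (1, 2) \<or> (a, b) = (2, 3)"
        using less A unfolding singular_def by blast
      let ?c = "sact n k R (elem a b) c"
      have deg: "i + j + 2 * l \<le> int m - 1" if "lk ?c (i, j, l) \<noteq> 0" for i j l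
        using ract_degree(1,2)[where c = c and m = "int m"] less.prems(1) x(2) that by blast
      have A': "?c \<in> A" using e less x by auto
      obtain i j l where nz: "lk ?c (i, j, l) \<noteq> 0" using x(1) wvec_eqI[of ?c 0] by auto
      then have "0 \<le> i" "0 \<le> j" "0 \<le> l" using vspaceD A A' by (meson not_le subsetD)+
      then have "0 < m" using deg[OF nz] by linarith
      then show ?thesis using less.IH[of "m - 1" ?c] deg A' x(1) by auto
    qed
  qed
  then show ?thesis using that by blast
qed

lemma only_top_stable:
  assumes ot: "only_top n k R"
    and A: "A \<subseteq> vspace R" and e: "\<And>u. u \<in> A \<Longrightarrow> sact n k R (elem 1 2) u \<in> A" "\<And>u. u \<in> A \<Longrightarrow> sact n k R (elem 2 3) u \<in> A"
    and sc: "\<And>a u. u \<in> A \<Longrightarrow> pm_scale a u \<in> A"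
    and c: "c \<in> A" "c \<noteq> 0"
  shows "topv \<in> A"
proof -
  obtain s where s: "s \<in> A" "s \<noteq> 0" "singular n k R s" using exists_singular[OF A e c] by blast
  have eq: "s = pm_scale (lk s (0,0,0)) topv" using only_top_singular[OF ot s(3)] .
  then have "lk s (0,0,0) \<noteq> 0" using s(2) by auto
  then have "pm_scale (1 / lk s (0,0,0)) s = topv" by (subst eq) simp
  then show ?thesis using sc[OF s(1)] by metis
qed

lemma poly_mapping_decomp: "c = (\<Sum>k\<in>Poly_Mapping.keys c. pm_scale (lk c k) (Poly_Mapping.single k 1))"
proof (rule poly_mapping_eqI)
  fix k
  have "lk (\<Sum>k\<in>Poly_Mapping.keys c. pm_scale (lk c k) (Poly_Mapping.single k 1)) k
    = (\<Sum>k'\<in>Poly_Mapping.keys c. if k' = k then lk c k' else 0)"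
    unfolding lookup_sum lookup_pm_scale by (rule sum.cong) (auto simp: lookup_single when_def)
  also have "\<dots> = lk c k" by (simp add: sum.delta in_keys_iff)
  finally show "lk c k = lk (\<Sum>k\<in>Poly_Mapping.keys c. pm_scale (lk c k) (Poly_Mapping.single k 1)) k" by simp
qed

lemma ract_single:
  "ract N K R (elem 3 1) (Poly_Mapping.single (0, 0, l) 1) = (if 0 \<in> R then Poly_Mapping.single (0, 0, l + 1) 1 else 0)"
  "ract N K R (elem 3 2) (Poly_Mapping.single (0, j, l) 1) = (if j + 1 \<in> R then Poly_Mapping.single (0, j + 1, l) 1 else 0)"
  "ract N K R (elem 2 1) (Poly_Mapping.single (i, j, l) 1) = (if j \<in> R then Poly_Mapping.single (i + 1, j, l) 1 else 0)"
proof -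
  have o: "a + 1 = 0 \<Longrightarrow> of_int a + 1 = (0 :: complex)" for a :: int by (metis of_int_0 of_int_1 of_int_add)
  show "ract N K R (elem 3 1) (Poly_Mapping.single (0, 0, l) 1) = (if 0 \<in> R then Poly_Mapping.single (0, 0, l + 1) 1 else 0)"
    "ract N K R (elem 3 2) (Poly_Mapping.single (0, j, l) 1) = (if j + 1 \<in> R then Poly_Mapping.single (0, j + 1, l) 1 else 0)"
    "ract N K R (elem 2 1) (Poly_Mapping.single (i, j, l) 1) = (if j \<in> R then Poly_Mapping.single (i + 1, j, l) 1 else 0)"
    by (rule wvec_eqI; auto simp: lookup_op lookup_single when_def o)+
qed

text \<open>The basis vectors arise from \<open>topv\<close> by lowering in the order \<open>f\<^sub>\<alpha>\<^sub>+\<^sub>\<beta>\<close>, \<open>f\<^sub>\<beta>\<close>, \<open>f\<^sub>\<alpha>\<close>; in this order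
  each step yields a single basis vector.\<close>

lemma generated:
  assumes zero: "0 \<in> A" and add: "\<And>u v. u \<in> A \<Longrightarrow> v \<in> A \<Longrightarrow> u + v \<in> A" and sc: "\<And>a u. u \<in> A \<Longrightarrow> pm_scale a u \<in> A"
    and f: "\<And>u. u \<in> A \<Longrightarrow> ract N K R (elem 2 1) u \<in> A" "\<And>u. u \<in> A \<Longrightarrow> ract N K R (elem 3 2) u \<in> A"
      "\<And>u. u \<in> A \<Longrightarrow> ract N K R (elem 3 1) u \<in> A"
    and top: "topv \<in> A" and R: "R = UNIV \<or> (\<exists>J. R = {..<J} \<and> 0 < J)" and c: "c \<in> vspace R"
  shows "c \<in> A"
proof -
  have R': "0 \<in> R" "\<And>j. j + 1 \<in> R \<Longrightarrow> j \<in> R" using R by auto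
  have 1: "Poly_Mapping.single (0, 0, int l) 1 \<in> A" for l
  proof (induction l)
    case 0 then show ?case using top by (simp add: topv_def)
  next
    case (Suc l)
    then show ?case using f(3)[OF Suc] R' by (simp add: ract_single add.commute)
  qed
  have 2: "int j \<in> R \<Longrightarrow> Poly_Mapping.single (0, int j, int l) 1 \<in> A" for j l
  proof (induction j)
    case 0 then show ?case using 1 by simp
  next
    case (Suc j)
    then have jR: "int j + 1 \<in> R" "int j \<in> R" using R'(2)[of "int j"] by (auto simp: add.commute)
    show ?case using f(2)[OF Suc.IH[OF jR(2)]] jR by (simp add: ract_single add.commute)
  qed
  have 3: "int j \<in> R \<Longrightarrow> Poly_Mapping.single (int i, int j, int l) 1 \<in> A" for i j l
  proof (induction i)
    case 0 then show ?case using 2 by simp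
  next
    case (Suc i)
    show ?case using f(1)[OF Suc.IH[OF Suc.prems]] Suc.prems by (simp add: ract_single add.commute)
  qed
  have s: "pm_scale (lk c k) (Poly_Mapping.single k 1) \<in> A" if "k \<in> Poly_Mapping.keys c" for k
  proof -
    obtain i j l where k: "k = (i, j, l)" by (cases k rule: prod_cases3)
    then have "lk c (i, j, l) \<noteq> 0" using that by (simp add: in_keys_iff)
    then have "0 \<le> i" "0 \<le> j" "0 \<le> l" "j \<in> R" using vspaceD[OF c] by (meson not_le)+
    then show ?thesis using 3[of "nat j" "nat i" "nat l"] k sc by simp
  qed
  have "(\<Sum>k\<in>S. pm_scale (lk c k) (Poly_Mapping.single k 1)) \<in> A" if "finite S" "S \<subseteq> Poly_Mapping.keys c" for S
    using that by (induction S rule: finite_induct) (auto simp: zero add s)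
  from this[of "Poly_Mapping.keys c"] show ?thesis using poly_mapping_decomp[of c] by simp
qed

section \<open>Coinduction\<close>

lemma homogeneous_system:
  fixes B :: "'a \<Rightarrow> 'b \<Rightarrow> complex"
  assumes "finite S" "finite T" "card S < card T"
  shows "\<exists>x. (\<exists>j\<in>T. x j \<noteq> 0) \<and> (\<forall>i\<in>S. (\<Sum>j\<in>T. B i j * x j) = 0)"
  using assms
proof (induction S arbitrary: T B rule: finite_induct)
  case empty
  then obtain j where "j \<in> T" by fastforce
  then show ?case by (intro exI[of _ "\<lambda>_. 1"]) auto
next
  case (insert i S)
  show ?case
  proof (cases "\<forall>j\<in>T. B i j = 0")
    case True
    have "card S < card T" using insert by simp
    from insert.IH[OF insert.prems(1) this, of B] obtain x where "\<exists>j\<in>T. x j \<noteq> 0" "\<forall>i\<in>S. (\<Sum>j\<in>T. B i j * x j) = 0" by blast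
    then show ?thesis using True by (intro exI[of _ x]) auto
  next
    case False
    then obtain j0 where j0: "j0 \<in> T" "B i j0 \<noteq> 0" by blast
    let ?T = "T - {j0}"
    \<comment> \<open>Eliminate the unknown \<open>j0\<close> with equation \<open>i\<close>.\<close>
    let ?B = "\<lambda>i' j. B i' j - B i' j0 * B i j / B i j0"
    have "card S < card ?T" "finite ?T" using insert j0 by auto
    from insert.IH[OF this(2,1), of ?B] obtain x where x: "\<exists>j\<in>?T. x j \<noteq> 0" "\<And>i'. i' \<in> S \<Longrightarrow> (\<Sum>j\<in>?T. ?B i' j * x j) = 0" by blast
    define y where "y = x(j0 := - (\<Sum>j\<in>?T. B i j * x j) / B i j0)"
    have y: "(\<Sum>j\<in>T. B i' j * y j) = B i' j0 * y j0 + (\<Sum>j\<in>?T. B i' j * x j)" for i'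
      using insert.prems(1) j0(1) by (subst sum.remove[of T j0]) (auto simp: y_def intro!: sum.cong)
    have "(\<Sum>j\<in>T. B i j * y j) = 0" unfolding y using j0 by (simp add: y_def)
    moreover have "(\<Sum>j\<in>T. B i' j * y j) = 0" if "i' \<in> S" for i'
    proof -
      have "(\<Sum>j\<in>?T. B i' j * x j) = (\<Sum>j\<in>?T. B i' j0 * B i j / B i j0 * x j)"
        using x(2)[OF that] by (simp add: left_diff_distrib sum_subtractf)
      also have "\<dots> = B i' j0 / B i j0 * (\<Sum>j\<in>?T. B i j * x j)"
        by (simp add: sum_distrib_left mult_ac)
      finally show ?thesis unfolding y using j0 by (simp add: y_def)
    qed
    moreover have "\<exists>j\<in>T. y j \<noteq> 0" using x(1) by (auto simp: y_def)
    ultimately show ?thesis by (intro exI[of _ y]) auto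
  qed
qed

text \<open>The right-hand side is treated as one more unknown of a homogeneous system.\<close>

lemma square_system:
  fixes B :: "'a \<Rightarrow> 'a \<Rightarrow> complex"
  assumes S: "finite S"
    and inj: "\<And>x. (\<And>i. i \<in> S \<Longrightarrow> (\<Sum>j\<in>S. B i j * x j) = 0) \<Longrightarrow> \<forall>j\<in>S. x j = 0"
  shows "\<exists>x. \<forall>i\<in>S. (\<Sum>j\<in>S. B i j * x j) = y i"
proof -
  let ?T = "insert None (Some ` S)"
  let ?B = "\<lambda>i j. case j of None \<Rightarrow> - y i | Some j \<Rightarrow> B i j"
  have "card S < card ?T" using S by (simp add: card_image)
  from homogeneous_system[OF S _ this, of ?B] S obtain x where
    x: "\<exists>j\<in>?T. x j \<noteq> 0" "\<And>i. i \<in> S \<Longrightarrow> (\<Sum>j\<in>?T. ?B i j * x j) = 0" by auto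
  have eq: "(\<Sum>j\<in>S. B i j * x (Some j)) = y i * x None" if "i \<in> S" for i
    using x(2)[OF that] S by (simp add: sum.reindex)
  have "x None \<noteq> 0"
  proof
    assume "x None = 0"
    then have "\<forall>j\<in>S. x (Some j) = 0" using eq by (intro inj) simp
    then show False using x(1) \<open>x None = 0\<close> by auto
  qed
  then show ?thesis using eq by (intro exI[of _ "\<lambda>j. x (Some j) / x None"]) (simp add: sum_divide_distrib[symmetric])
qed

lemma sl3_eqI: "(\<And>i j. mat_of x $ i $ j = mat_of y $ i $ j) \<Longrightarrow> x = y"
  by (metis mat_of_inject vec_eq_iff)

lemma bracket_elem:
  "bracket (elem 1 2) (elem 2 3) = elem 1 3" "bracket (elem 1 2) (elem 1 3) = 0" "bracket (elem 2 3) (elem 1 3) = 0"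
  "bracket (elem 2 1) (elem 3 2) = - elem 3 1" "bracket (elem 2 1) (elem 3 1) = 0" "bracket (elem 3 2) (elem 3 1) = 0"
  by (rule sl3_eqI; simp add: mat_of_bracket matrix_matrix_mult_def sum_3 mat_of_elem mat_of_simps)+

lemma bracket_cartan_elem:
  assumes "x \<in> cartan"
  shows "bracket x (elem 1 2) = lscale (root_alpha x) (elem 1 2)" "bracket x (elem 2 3) = lscale (root_beta x) (elem 2 3)"
    "bracket x (elem 1 3) = lscale (root_alpha x + root_beta x) (elem 1 3)"
proof -
  have z: "mat_of x $ a $ b = 0" if "a \<noteq> b" for a b using assms that by (simp add: cartan_def)
  show "bracket x (elem 1 2) = lscale (root_alpha x) (elem 1 2)" "bracket x (elem 2 3) = lscale (root_beta x) (elem 2 3)"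
    "bracket x (elem 1 3) = lscale (root_alpha x + root_beta x) (elem 1 3)"
    by (rule sl3_eqI; auto simp: mat_of_bracket matrix_matrix_mult_def sum_3 mat_of_elem mat_of_simps root_alpha_def root_beta_def z; fail)+
qed

lemma ract_zero_left [simp]: "ract N K R 0 u = 0"
  by (rule wvec_eqI) (simp add: lookup_ract lookup_act actf_def mat_of_simps)

locale model =
  fixes n k :: int and R :: "int set"
  assumes adm: "admissible (of_int k) R"
begin

abbreviation "E1 \<equiv> sact n k R (elem 1 2)"
abbreviation "E2 \<equiv> sact n k R (elem 2 3)"
abbreviation "E3 \<equiv> sact n k R (elem 1 3)"

lemma E_comm: "E1 (E2 u) = E2 (E1 u) + E3 u" "E1 (E3 u) = E3 (E1 u)" "E2 (E3 u) = E3 (E2 u)"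
  using ract_bracket[OF adm, of "of_int n" "elem 1 2" "elem 2 3" u]
    ract_bracket[OF adm, of "of_int n" "elem 1 2" "elem 1 3" u] ract_bracket[OF adm, of "of_int n" "elem 2 3" "elem 1 3" u]
  by (simp_all add: bracket_elem add.commute)

lemma pow_add: "(sact n k R x ^^ m) (u + v) = (sact n k R x ^^ m) u + (sact n k R x ^^ m) v"
  by (induction m) (simp_all add: ract_add)

lemma pow_scale: "(sact n k R x ^^ m) (pm_scale a v) = pm_scale a ((sact n k R x ^^ m) v)"
  by (induction m) (simp_all add: ract_scale)

lemma pow_vspace: "u \<in> vspace R \<Longrightarrow> (sact n k R x ^^ m) u \<in> vspace R"
  by (induction m) (simp_all add: vspace_ract)

lemma pow_zero [simp]: "(sact n k R x ^^ m) 0 = 0"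
  by (induction m) simp_all

lemma pow_E3: "(E1 ^^ m) (E3 u) = E3 ((E1 ^^ m) u)" "(E2 ^^ m) (E3 u) = E3 ((E2 ^^ m) u)"
  "(E3 ^^ m) (E1 u) = E1 ((E3 ^^ m) u)" "(E3 ^^ m) (E2 u) = E2 ((E3 ^^ m) u)" 
  by (induction m) (simp_all add: E_comm)

lemma pow_E1_E2: "(E1 ^^ i) (E2 u) = E2 ((E1 ^^ i) u) + pm_scale (of_nat i) ((E1 ^^ (i - 1)) (E3 u))"
proof (induction i)
  case (Suc i)
  let ?X = "(E1 ^^ i) u" and ?Z = "(E1 ^^ i) (E3 u)"
  have "(E1 ^^ Suc i) (E2 u) = E1 (E2 ?X) + E1 (pm_scale (of_nat i) ((E1 ^^ (i - 1)) (E3 u)))"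
    using Suc by (simp add: ract_add)
  also have "E1 (pm_scale (of_nat i) ((E1 ^^ (i - 1)) (E3 u))) = pm_scale (of_nat i) ?Z"
    by (cases i) (simp_all add: ract_scale)
  also have "E1 (E2 ?X) = E2 (E1 ?X) + ?Z" unfolding E_comm(1) pow_E3 ..
  finally show ?case by (simp add: pm.scale_left_distrib add.assoc)
qed simp

text \<open>The values of the functional \<open>X \<mapsto> \<phi>(X c)\<close> on the ordered monomials of \<open>U(n)\<close>.\<close>

definition raising_coeff :: "(wvec \<Rightarrow> complex) \<Rightarrow> nat \<Rightarrow> nat \<Rightarrow> nat \<Rightarrow> wvec \<Rightarrow> complex" where
  "raising_coeff \<phi> i j l c = \<phi> ((E2 ^^ j) ((E1 ^^ i) ((E3 ^^ l) c)))"

context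
  fixes \<phi> :: "wvec \<Rightarrow> complex"
  assumes phi_add: "\<And>u v. \<phi> (u + v) = \<phi> u + \<phi> v" and phi_scale: "\<And>a u. \<phi> (pm_scale a u) = a * \<phi> u"
begin

lemma raising_coeff_add: "raising_coeff \<phi> i j l (u + v) = raising_coeff \<phi> i j l u + raising_coeff \<phi> i j l v"
  by (simp add: raising_coeff_def pow_add phi_add)

lemma raising_coeff_scale: "raising_coeff \<phi> i j l (pm_scale a u) = a * raising_coeff \<phi> i j l u"
  by (simp add: raising_coeff_def pow_scale phi_scale)

lemma raising_coeff_E1: "raising_coeff \<phi> i j l (E1 c) = raising_coeff \<phi> (Suc i) j l c"
  by (simp add: raising_coeff_def pow_E3 funpow_swap1)

lemma raising_coeff_E3: "raising_coeff \<phi> i j l (E3 c) = raising_coeff \<phi> i j (Suc l) c"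
  by (simp add: raising_coeff_def funpow_swap1)

text \<open>Together with the two preceding rules this shows that the coefficients of \<open>e c\<close> depend only on those of \<open>c\<close>, in the same
  way for every module: passing to coefficients is a homomorphism into a coinduced module.\<close>

lemma raising_coeff_E2: "raising_coeff \<phi> i j l (E2 c) = raising_coeff \<phi> i (Suc j) l c + of_nat i * raising_coeff \<phi> (i - 1) j (Suc l) c"
  by (simp add: raising_coeff_def pow_E3 pow_E1_E2 pow_add pow_scale phi_add phi_scale funpow_swap1)

lemma pow_cartan:
  assumes "x \<in> cartan"
  shows "sact n k R x ((E1 ^^ m) u) = (E1 ^^ m) (sact n k R x u) + pm_scale (of_nat m * root_alpha x) ((E1 ^^ m) u)"
   "sact n k R x ((E2 ^^ m) u) = (E2 ^^ m) (sact n k R x u) + pm_scale (of_nat m * root_beta x) ((E2 ^^ m) u)"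
   "sact n k R x ((E3 ^^ m) u) = (E3 ^^ m) (sact n k R x u) + pm_scale (of_nat m * (root_alpha x + root_beta x)) ((E3 ^^ m) u)"
proof -
  have 1: "sact n k R x (E1 u) = E1 (sact n k R x u) + pm_scale (root_alpha x) (E1 u)"
    "sact n k R x (E2 u) = E2 (sact n k R x u) + pm_scale (root_beta x) (E2 u)"
    "sact n k R x (E3 u) = E3 (sact n k R x u) + pm_scale (root_alpha x + root_beta x) (E3 u)" for u
    using ract_bracket[OF adm, of "of_int n" x "elem 1 2" u] ract_bracket[OF adm, of "of_int n" x "elem 2 3" u]
      ract_bracket[OF adm, of "of_int n" x "elem 1 3" u]
    by (simp_all add: bracket_cartan_elem[OF assms] ract_scale_left add.commute)
  show "sact n k R x ((E1 ^^ m) u) = (E1 ^^ m) (sact n k R x u) + pm_scale (of_nat m * root_alpha x) ((E1 ^^ m) u)"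
    by (induction m) (simp_all add: 1 ract_add ract_scale pm.scale_left_distrib ring_distribs add_ac)
  show "sact n k R x ((E2 ^^ m) u) = (E2 ^^ m) (sact n k R x u) + pm_scale (of_nat m * root_beta x) ((E2 ^^ m) u)"
    by (induction m) (simp_all add: 1 ract_add ract_scale pm.scale_left_distrib ring_distribs add_ac)
  show "sact n k R x ((E3 ^^ m) u) = (E3 ^^ m) (sact n k R x u) + pm_scale (of_nat m * (root_alpha x + root_beta x)) ((E3 ^^ m) u)"
    by (induction m) (simp_all add: 1 ract_add ract_scale pm.scale_left_distrib ring_distribs add_ac)
qed

lemma raising_coeff_cartan:
  assumes x: "x \<in> cartan" and c: "c \<in> vspace R"
    and wt: "\<And>c. c \<in> vspace R \<Longrightarrow> \<phi> (sact n k R x c) = cw * \<phi> c"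
  shows "raising_coeff \<phi> i j l (sact n k R x c) = (cw - of_nat i * root_alpha x - of_nat j * root_beta x - of_nat l * (root_alpha x + root_beta x)) * raising_coeff \<phi> i j l c"
proof -
  let ?u = "(E2 ^^ j) ((E1 ^^ i) ((E3 ^^ l) c))"
  have "sact n k R x ?u = (E2 ^^ j) ((E1 ^^ i) ((E3 ^^ l) (sact n k R x c)))
     + pm_scale (of_nat i * root_alpha x + of_nat j * root_beta x + of_nat l * (root_alpha x + root_beta x)) ?u"
    by (simp add: pow_cartan[OF x] pow_add pow_scale pm.scale_left_distrib add_ac)
  then have "\<phi> (sact n k R x ?u) = raising_coeff \<phi> i j l (sact n k R x c) + (of_nat i * root_alpha x + of_nat j * root_beta x + of_nat l * (root_alpha x + root_beta x)) * raising_coeff \<phi> i j l c"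
    by (simp add: phi_add phi_scale raising_coeff_def)
  moreover have "\<phi> (sact n k R x ?u) = cw * raising_coeff \<phi> i j l c"
    unfolding raising_coeff_def by (intro wt pow_vspace c)
  ultimately show ?thesis by (simp add: algebra_simps)
qed

end

lemma pow_degree:
  assumes "\<And>i j l. lk c (i, j, l) \<noteq> 0 \<Longrightarrow> i + j + 2 * l \<le> m"
  shows "lk ((E2 ^^ j') ((E1 ^^ i') ((E3 ^^ l') c))) (i, j, l) \<noteq> 0 \<Longrightarrow> i + j + 2 * l \<le> m - int (i' + j' + 2 * l')"
proof -
  have 3: "lk ((E3 ^^ l') c) (i, j, l) \<noteq> 0 \<Longrightarrow> i + j + 2 * l \<le> m - 2 * int l'" for i j l
  proof (induction l' arbitrary: i j l)
    case (Suc l') show ?case using ract_degree(3)[where c = "(E3 ^^ l') c" and m = "m - 2 * int l'" and N = "of_int n" and K = "of_int k" and R = R and i = i and j = j and l = l, OF Suc.IH] Suc.prems by simp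
  qed (use assms in simp)
  have 1: "lk ((E1 ^^ i') ((E3 ^^ l') c)) (i, j, l) \<noteq> 0 \<Longrightarrow> i + j + 2 * l \<le> m - 2 * int l' - int i'" for i j l
  proof (induction i' arbitrary: i j l)
    case (Suc i') show ?case using ract_degree(1)[where c = "(E1 ^^ i') ((E3 ^^ l') c)" and m = "m - 2 * int l' - int i'" and N = "of_int n" and K = "of_int k" and R = R and i = i and j = j and l = l, OF Suc.IH] Suc.prems by simp
  qed (use 3 in simp)
  have 2: "lk ((E2 ^^ j') ((E1 ^^ i') ((E3 ^^ l') c))) (i, j, l) \<noteq> 0 \<Longrightarrow> i + j + 2 * l \<le> m - 2 * int l' - int i' - int j'" for i j l
  proof (induction j' arbitrary: i j l)
    case (Suc j') show ?case using ract_degree(2)[where c = "(E2 ^^ j') ((E1 ^^ i') ((E3 ^^ l') c))" and m = "m - 2 * int l' - int i' - int j'" and N = "of_int n" and K = "of_int k" and R = R and i = i and j = j and l = l, OF Suc.IH] Suc.prems by simp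
  qed (use 1 in simp)
  show "lk ((E2 ^^ j') ((E1 ^^ i') ((E3 ^^ l') c))) (i, j, l) \<noteq> 0 \<Longrightarrow> i + j + 2 * l \<le> m - int (i' + j' + 2 * l')"
    using 2[of i j l] by simp
qed

lemma raising_coeff_finite: "c \<in> vspace R \<Longrightarrow> \<phi> 0 = 0 \<Longrightarrow> \<exists>m. \<forall>i j l. raising_coeff \<phi> i j l c \<noteq> 0 \<longrightarrow> i + j + 2 * l \<le> m"
proof -
  assume c: "c \<in> vspace R" and z: "\<phi> 0 = 0"
  obtain m where m: "\<And>i j l. lk c (i, j, l) \<noteq> 0 \<Longrightarrow> i + j + 2 * l \<le> int m" using degree_bound by blast
  have "i + j + 2 * l \<le> m" if "raising_coeff \<phi> i j l c \<noteq> 0" for i j l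
  proof (rule ccontr)
    assume a: "\<not> i + j + 2 * l \<le> m"
    let ?u = "(E2 ^^ j) ((E1 ^^ i) ((E3 ^^ l) c))"
    have u: "?u \<in> vspace R" by (intro pow_vspace c)
    have "?u = 0"
    proof (rule wvec_eqI, rule ccontr)
      fix i' j' l' assume "lk ?u (i', j', l') \<noteq> lk 0 (i', j', l')"
      then have nz: "lk ?u (i', j', l') \<noteq> 0" by simp
      then have "0 \<le> i'" "0 \<le> j'" "0 \<le> l'" using vspaceD[OF u] by (meson not_le)+
      then show False using pow_degree[OF m nz] a by simp
    qed
    then show False using that z by (simp add: raising_coeff_def)
  qed
  then show ?thesis by blast
qed

end

abbreviation topc :: "wvec \<Rightarrow> complex" where "topc c \<equiv> lk c (0, 0, 0)"

context model begin

lemma wproj_E: "E1 (wproj p q c) = wproj (p - 1) q (E1 c)" "E2 (wproj p q c) = wproj p (q - 1) (E2 c)"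
  "E3 (wproj p q c) = wproj (p - 1) (q - 1) (E3 c)"
  by (simp_all add: wproj_ract)

lemma homog_pow:
  assumes "homog p q c"
  shows "homog (p - int (i + l)) (q - int (j + l)) ((E2 ^^ j) ((E1 ^^ i) ((E3 ^^ l) c)))"
proof -
  have 3: "homog (p - int l) (q - int l) ((E3 ^^ l) c)"
    using assms by (induction l) (auto dest: homog_ract(3)[where R = R and N = "of_int n" and K = "of_int k"] simp: algebra_simps)
  then have 1: "homog (p - int l - int i) (q - int l) ((E1 ^^ i) ((E3 ^^ l) c))"
    by (induction i) (auto dest: homog_ract(1)[where R = R and N = "of_int n" and K = "of_int k"] simp: algebra_simps)
  then have "homog (p - int l - int i) (q - int l - int j) ((E2 ^^ j) ((E1 ^^ i) ((E3 ^^ l) c)))"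
    by (induction j) (auto dest: homog_ract(2)[where R = R and N = "of_int n" and K = "of_int k"] simp: algebra_simps)
  then show ?thesis by (simp add: algebra_simps)
qed

lemma raising_coeff_top_homog: "homog p q c \<Longrightarrow> (int (i + l), int (j + l)) \<noteq> (p, q) \<Longrightarrow> raising_coeff topc i j l c = 0"
  unfolding raising_coeff_def using homogD[OF homog_pow[of p q c i l j], of 0 0 0] by auto

text \<open>A vector of weight \<open>(0, j)\<close> is a multiple of \<open>f\<^sub>\<beta>\<^sup>j v\<^sub>0\<close>, which vanishes in the quotient.\<close>

lemma topc_pow_E2:
  assumes "c \<in> vspace R" "int j \<notin> R"
  shows "topc ((E2 ^^ j) c) = 0"
proof -
  have w: "wproj p (q - int m) ((E2 ^^ m) c) = (E2 ^^ m) (wproj p q c)" for p q m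
  proof (induction m)
    case (Suc m)
    have e: "q - int (Suc m) = q - int m - 1" by simp
    show ?case unfolding e using wproj_E(2)[of p "q - int m" "(E2 ^^ m) c"] Suc by simp
  qed simp
  have "wproj 0 (int j) c = 0"
  proof (rule wvec_eqI)
    fix i j' l
    have "lk c (i, j', l) = 0" if "i + l = 0" "j' + l = int j"
    proof (cases "i = 0 \<and> l = 0")
      case True then show ?thesis using that vspaceD[OF assms(1), of i j' l] assms(2) by auto
    next
      case False then show ?thesis using that vspaceD[OF assms(1), of i j' l] by fastforce
    qed
    then show "lk (wproj 0 (int j) c) (i, j', l) = lk 0 (i, j', l)" by (simp add: lookup_wproj)
  qed
  then have "wproj 0 0 ((E2 ^^ j) c) = 0" using w[of 0 "int j" j] by simp
  then have "lk (wproj 0 0 ((E2 ^^ j) c)) (0, 0, 0) = 0" by simp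
  then show ?thesis by (simp add: lookup_wproj)
qed

end

lemma vspace_sum: "(\<And>x. x \<in> S \<Longrightarrow> f x \<in> vspace R) \<Longrightarrow> sum f S \<in> vspace R"
  by (induction S rule: infinite_finite_induct) (simp_all add: vspace_add)

lemma topc_lin: "topc (u + v) = topc u + topc v" "topc (pm_scale a u) = a * topc u"
  by (simp_all add: lookup_add)

context model begin

text \<open>The vectors with all coefficients zero form a stable subspace; if it were nonzero it would contain the highest weight
  vector, whose coefficient at the empty monomial is \<open>1\<close>.\<close>

lemma raising_coeff_top_inj:
  assumes ot: "only_top n k R" and t: "t \<in> vspace R" and z: "\<And>i j l. raising_coeff topc i j l t = 0"
  shows "t = 0"
proof (rule ccontr)
  assume nz: "t \<noteq> 0"
  let ?A = "{t \<in> vspace R. \<forall>i j l. raising_coeff topc i j l t = 0}"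
  have "topv \<in> ?A"
    by (rule only_top_stable[OF ot, of ?A t])
      (auto simp: z t nz vspace_ract vspace_scale raising_coeff_E1[OF topc_lin] raising_coeff_E2[OF topc_lin] raising_coeff_scale[OF topc_lin])
  then have "raising_coeff topc 0 0 0 topv = 0" by blast
  then show False by (simp add: raising_coeff_def lookup_topv)
qed

lemma raising_coeff_top_sum: "raising_coeff topc i j l (\<Sum>x\<in>S. f x) = (\<Sum>x\<in>S. raising_coeff topc i j l (f x))"
  by (induction S rule: infinite_finite_induct)
    (simp_all add: raising_coeff_def pow_add lookup_add)

text \<open>In the weight \<open>(p, q)\<close> there are as many basis vectors as ordered monomials with \<open>j \<in> R\<close>, both indexed by \<open>l\<close>. The
  square matrix of coefficients is injective by the previous lemma and therefore surjective.\<close>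

lemma raising_coeff_top_delta:
  assumes ot: "only_top n k R" and j0: "int j0 \<in> R"
  shows "\<exists>t\<in>vspace R. \<forall>i j l. raising_coeff topc i j l t = (if (i, j, l) = (i0, j0, l0) then 1 else 0)"
proof -
  define p where "p = i0 + l0"
  define q where "q = j0 + l0"
  define S where "S = {l. l \<le> p \<and> l \<le> q \<and> int (q - l) \<in> R}"
  have fS: "finite S" by (rule finite_subset[of _ "{..p}"]) (auto simp: S_def)
  define b :: "nat \<Rightarrow> wvec" where "b l = Poly_Mapping.single (int (p - l), int (q - l), int l) 1" for l
  have lb: "lk (b l) k = (if k = (int (p - l), int (q - l), int l) then 1 else 0)" for l k
    by (auto simp: b_def lookup_single when_def)
  have bv: "b l \<in> vspace R" if "l \<in> S" for l
    using that by (intro vspaceI) (auto simp: lb S_def)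
  have bh: "homog (int p) (int q) (b l)" if "l \<in> S" for l
    using that unfolding homog_def lb by (auto simp: S_def split: if_splits)
  define comb where "comb x = (\<Sum>l\<in>S. pm_scale (x l) (b l))" for x
  have comb_v: "comb x \<in> vspace R" for x unfolding comb_def by (intro vspace_sum vspace_scale bv)
  have lcomb: "lk (comb x) (int (p - l), int (q - l), int l) = x l" if "l \<in> S" for x l
  proof -
    have "lk (comb x) (int (p - l), int (q - l), int l) = (\<Sum>l'\<in>S. if l' = l then x l' else 0)"
      unfolding comb_def lookup_sum by (intro sum.cong) (auto simp: lb)
    then show ?thesis using that fS by simp
  qed
  have psi_comb: "raising_coeff topc i j l (comb x) = (\<Sum>l'\<in>S. raising_coeff topc i j l (b l') * x l')" for i j l x
    unfolding comb_def raising_coeff_top_sum raising_coeff_scale[OF topc_lin] by (simp add: mult.commute)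
  \<comment> \<open>Outside the index set the coefficients vanish, for reasons of weight or because \<open>j\<close> lies beyond the cut.\<close>
  have psi_S: "raising_coeff topc i j l (comb x) = 0 \<or> (l \<in> S \<and> i = p - l \<and> j = q - l)" for i j l x
  proof (cases "(i + l, j + l) = (p, q)")
    case False
    then have "(int (i + l), int (j + l)) \<noteq> (int p, int q)" by auto
    then have "raising_coeff topc i j l (b l') = 0" if "l' \<in> S" for l' using raising_coeff_top_homog[OF bh[OF that]] by blast
    then show ?thesis unfolding psi_comb by simp
  next
    case True
    then have *: "i = p - l" "j = q - l" "l \<le> p" "l \<le> q" by auto
    show ?thesis
    proof (cases "int j \<in> R")
      case False
      then show ?thesis unfolding raising_coeff_def using topc_pow_E2[OF pow_vspace[OF pow_vspace[OF comb_v]]] by blast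
    qed (use * in \<open>auto simp: S_def\<close>)
  qed
  have "\<exists>x. \<forall>l'\<in>S. (\<Sum>l\<in>S. raising_coeff topc (p - l') (q - l') l' (b l) * x l) = (if l' = l0 then 1 else 0)"
  proof (rule square_system[OF fS])
    fix x :: "nat \<Rightarrow> complex" assume a: "\<And>l'. l' \<in> S \<Longrightarrow> (\<Sum>l\<in>S. raising_coeff topc (p - l') (q - l') l' (b l) * x l) = 0"
    have "raising_coeff topc i j l (comb x) = 0" for i j l
      using psi_S[of i j l x] a[of l] by (auto simp: psi_comb)
    then have "comb x = 0" by (intro raising_coeff_top_inj[OF ot comb_v])
    then show "\<forall>j\<in>S. x j = 0" using lcomb[of _ x] by simp
  qed
  then obtain x where x: "\<And>l'. l' \<in> S \<Longrightarrow> (\<Sum>l\<in>S. raising_coeff topc (p - l') (q - l') l' (b l) * x l) = (if l' = l0 then 1 else 0)" by blast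
  have "l0 \<in> S" using j0 by (simp add: S_def p_def q_def)
  have "raising_coeff topc i j l (comb x) = (if (i, j, l) = (i0, j0, l0) then 1 else 0)" for i j l
  proof (cases "l \<in> S \<and> i = p - l \<and> j = q - l")
    case True
    then have "raising_coeff topc i j l (comb x) = (if l = l0 then 1 else 0)" using x[of l] by (simp add: psi_comb)
    then show ?thesis using True by (auto simp: p_def q_def)
  next
    case False
    then have "raising_coeff topc i j l (comb x) = 0" using psi_S by blast
    moreover have "(i, j, l) \<noteq> (i0, j0, l0)" using False \<open>l0 \<in> S\<close> by (auto simp: p_def q_def)
    ultimately show ?thesis by simp
  qed
  then show ?thesis using comb_v by blast
qed

lemma raising_coeff_top_surj:
  assumes ot: "only_top n k R" and fin: "\<And>i j l. g i j l \<noteq> 0 \<Longrightarrow> i + j + 2 * l \<le> m"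
    and R: "\<And>i j l. int j \<notin> R \<Longrightarrow> g i j l = 0"
  shows "\<exists>t\<in>vspace R. \<forall>i j l. raising_coeff topc i j l t = g i j l"
proof -
  define T where "T = {(i, j, l). g i j l \<noteq> 0}"
  have "T \<subseteq> {..m} \<times> {..m} \<times> {..m}" using fin by (force simp: T_def)
  then have fT: "finite T" by (rule finite_subset) simp
  have "\<exists>t\<in>vspace R. \<forall>i j l. raising_coeff topc i j l t = (if (i, j, l) = \<kappa> then 1 else 0)" if "\<kappa> \<in> T" for \<kappa>
  proof -
    obtain i0 j0 l0 where \<kappa>: "\<kappa> = (i0, j0, l0)" by (cases \<kappa> rule: prod_cases3)
    have "int j0 \<in> R" using that R unfolding \<kappa> T_def by auto
    from raising_coeff_top_delta[OF ot this] show ?thesis unfolding \<kappa> .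
  qed
  then obtain t where t: "\<And>\<kappa>. \<kappa> \<in> T \<Longrightarrow> t \<kappa> \<in> vspace R"
    "\<And>\<kappa> i j l. \<kappa> \<in> T \<Longrightarrow> raising_coeff topc i j l (t \<kappa>) = (if (i, j, l) = \<kappa> then 1 else 0)" by metis
  define G where "G = (\<lambda>(i, j, l). g i j l)"
  define u where "u = (\<Sum>\<kappa>\<in>T. pm_scale (G \<kappa>) (t \<kappa>))"
  have "u \<in> vspace R" unfolding u_def by (intro vspace_sum vspace_scale t)
  moreover have "raising_coeff topc i j l u = g i j l" for i j l
  proof -
    have "raising_coeff topc i j l u = (\<Sum>\<kappa>\<in>T. G \<kappa> * raising_coeff topc i j l (t \<kappa>))"
      unfolding u_def raising_coeff_top_sum raising_coeff_scale[OF topc_lin] ..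
    also have "\<dots> = (\<Sum>\<kappa>\<in>T. if \<kappa> = (i, j, l) then G \<kappa> else 0)"
      by (intro sum.cong) (auto simp: t(2))
    also have "\<dots> = g i j l" using fT by (auto simp: G_def T_def)
    finally show ?thesis .
  qed
  ultimately show ?thesis by blast
qed

end

lemma mat_of_cartan_part: "mat_of (cartan_part x) $ i $ j = (if i = j then mat_of x $ i $ j else 0)"
  by transfer simp

lemma cartan_part_cartan: "cartan_part x \<in> cartan"
  by (simp add: cartan_def mat_of_cartan_part)

lemma borel_decomp:
  assumes "x \<in> borel_sl3"
  shows "x = lscale (mat_of x $ 1 $ 2) (elem 1 2) + lscale (mat_of x $ 2 $ 3) (elem 2 3)
    + lscale (mat_of x $ 1 $ 3) (elem 1 3) + cartan_part x"
proof (rule sl3_eqI)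
  fix i j :: 3
  let ?y = "lscale (mat_of x $ 1 $ 2) (elem 1 2) + lscale (mat_of x $ 2 $ 3) (elem 2 3)
    + lscale (mat_of x $ 1 $ 3) (elem 1 3) + cartan_part x"
  have z: "mat_of x $ 2 $ 1 = 0" "mat_of x $ 3 $ 1 = 0" "mat_of x $ 3 $ 2 = 0"
    using assms by (auto simp: borel_sl3_def)
  have "\<forall>i j. mat_of x $ i $ j = mat_of ?y $ i $ j"
    unfolding forall_3 by (simp add: mat_of_simps mat_of_elem mat_of_cartan_part z)
  then show "mat_of x $ i $ j = mat_of ?y $ i $ j" by blast
qed

lemma elem_borel: "elem 1 2 \<in> borel_sl3" "elem 2 3 \<in> borel_sl3" "elem 1 3 \<in> borel_sl3"
  by (simp_all add: borel_sl3_def mat_of_elem)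

lemma borel_hom_from_generators:
  assumes add: "\<And>u v. u \<in> vspace R' \<Longrightarrow> v \<in> vspace R' \<Longrightarrow> r (u + v) = r u + r v"
    and sc: "\<And>a u. u \<in> vspace R' \<Longrightarrow> r (pm_scale a u) = pm_scale a (r u)"
    and E: "\<And>u. u \<in> vspace R' \<Longrightarrow> r (ract N' K' R' (elem 1 2) u) = ract N K R (elem 1 2) (r u)"
      "\<And>u. u \<in> vspace R' \<Longrightarrow> r (ract N' K' R' (elem 2 3) u) = ract N K R (elem 2 3) (r u)"
      "\<And>u. u \<in> vspace R' \<Longrightarrow> r (ract N' K' R' (elem 1 3) u) = ract N K R (elem 1 3) (r u)"
    and h: "\<And>x u. x \<in> cartan \<Longrightarrow> u \<in> vspace R' \<Longrightarrow> r (ract N' K' R' x u) = ract N K R x (r u)"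
    and x: "x \<in> borel_sl3" and u: "u \<in> vspace R'"
  shows "r (ract N' K' R' x u) = ract N K R x (r u)"
proof -
  have decomp: "ract N K R x u = pm_scale (mat_of x $ 1 $ 2) (ract N K R (elem 1 2) u)
      + pm_scale (mat_of x $ 2 $ 3) (ract N K R (elem 2 3) u) + pm_scale (mat_of x $ 1 $ 3) (ract N K R (elem 1 3) u)
      + ract N K R (cartan_part x) u" for N K R u
    using arg_cong[OF borel_decomp[OF x], of "\<lambda>y. ract N K R y u"] by (simp only: ract_add_left ract_scale_left)
  show ?thesis unfolding decomp
    by (simp only: add sc E h u cartan_part_cartan vspace_ract vspace_add vspace_scale)
qed

text \<open>The universal property of a coinduced module: the coefficients of \<open>c\<close> with respect to \<open>\<phi>\<close> are those of a unique vector
  \<open>r c\<close> with respect to \<open>topc\<close>. The hypothesis \<open>van\<close> is what makes the coefficients of \<open>c\<close> attainable when \<open>R\<close> is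
  bounded; \<open>wt\<close> says that \<open>\<phi>\<close> lives on a single weight space.\<close>

lemma coinduced_hom:
  assumes ot: "only_top n k R"
    and phi_add: "\<And>u v. \<phi> (u + v) = \<phi> u + \<phi> v" and phi_scale: "\<And>a u. \<phi> (pm_scale a u) = a * \<phi> u"
    and van: "\<And>j c. c \<in> vspace UNIV \<Longrightarrow> int j \<notin> R \<Longrightarrow> \<phi> ((sact n' k' UNIV (elem 2 3) ^^ j) c) = 0"
    and wt: "\<And>x c. x \<in> cartan \<Longrightarrow> c \<in> vspace UNIV \<Longrightarrow> \<phi> (sact n' k' UNIV x c) = wt_char (of_int n) (of_int k) x * \<phi> c"
  obtains r where "\<And>c. c \<in> vspace UNIV \<Longrightarrow> r c \<in> vspace R"
    "\<And>u v. u \<in> vspace UNIV \<Longrightarrow> v \<in> vspace UNIV \<Longrightarrow> r (u + v) = r u + r v"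
    "\<And>a u. u \<in> vspace UNIV \<Longrightarrow> r (pm_scale a u) = pm_scale a (r u)"
    "\<And>x u. x \<in> borel_sl3 \<Longrightarrow> u \<in> vspace UNIV \<Longrightarrow> r (sact n' k' UNIV x u) = sact n k R x (r u)"
    "\<And>c. c \<in> vspace UNIV \<Longrightarrow> topc (r c) = \<phi> c"
proof -
  interpret E: model n' k' UNIV by unfold_locales (simp add: admissible_def)
  interpret T: model n k R by unfold_locales (rule only_top_adm[OF ot])
  have "\<exists>t\<in>vspace R. \<forall>i j l. T.raising_coeff topc i j l t = E.raising_coeff \<phi> i j l c" if c: "c \<in> vspace UNIV" for c
  proof -
    obtain m where m: "\<And>i j l. E.raising_coeff \<phi> i j l c \<noteq> 0 \<Longrightarrow> i + j + 2 * l \<le> m"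
      using E.raising_coeff_finite[OF c, of \<phi>] phi_scale[of 0 0] by auto
    show ?thesis
    proof (rule T.raising_coeff_top_surj[OF ot m])
      fix i j l :: nat assume j: "int j \<notin> R"
      show "E.raising_coeff \<phi> i j l c = 0" unfolding E.raising_coeff_def by (rule van[OF E.pow_vspace[OF E.pow_vspace[OF c]] j])
    qed
  qed
  then obtain r where r: "\<And>c. c \<in> vspace UNIV \<Longrightarrow> r c \<in> vspace R"
    and raising_coeff: "\<And>i j l c. c \<in> vspace UNIV \<Longrightarrow> T.raising_coeff topc i j l (r c) = E.raising_coeff \<phi> i j l c" by metis
  have eqI: "t = r c" if "t \<in> vspace R" "c \<in> vspace UNIV" "\<And>i j l. T.raising_coeff topc i j l t = E.raising_coeff \<phi> i j l c" for t c
  proof -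
    have "T.raising_coeff topc i j l (t + pm_scale (- 1) (r c)) = 0" for i j l
      unfolding T.raising_coeff_add[OF topc_lin] T.raising_coeff_scale[OF topc_lin] that(3) raising_coeff[OF that(2)] by simp
    then have "t + pm_scale (- 1) (r c) = 0" by (intro T.raising_coeff_top_inj[OF ot] vspace_add vspace_scale that r)
    then show ?thesis by (simp add: pm.scale_minus_left)
  qed
  note Tlin = T.raising_coeff_add[OF topc_lin] T.raising_coeff_scale[OF topc_lin] T.raising_coeff_E1[OF topc_lin] T.raising_coeff_E2[OF topc_lin] T.raising_coeff_E3[OF topc_lin]
  note Elin = E.raising_coeff_add[OF phi_add phi_scale] E.raising_coeff_scale[OF phi_add phi_scale] E.raising_coeff_E1[OF phi_add phi_scale]
    E.raising_coeff_E2[OF phi_add phi_scale] E.raising_coeff_E3[OF phi_add phi_scale]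
  have add: "r (u + v) = r u + r v" if "u \<in> vspace UNIV" "v \<in> vspace UNIV" for u v
    by (rule eqI[symmetric]) (simp_all add: vspace_add r that Tlin Elin raising_coeff)
  have sc: "r (pm_scale a u) = pm_scale a (r u)" if "u \<in> vspace UNIV" for a u
    by (rule eqI[symmetric]) (simp_all add: vspace_scale r that Tlin Elin raising_coeff)
  have E: "r (E.E1 u) = T.E1 (r u)" "r (E.E2 u) = T.E2 (r u)" "r (E.E3 u) = T.E3 (r u)" if "u \<in> vspace UNIV" for u
    by (rule eqI[symmetric]; simp add: vspace_ract r that Tlin Elin raising_coeff)+
  have topwt: "topc (sact n k R x c) = wt_char (of_int n) (of_int k) x * topc c" if "x \<in> cartan" "c \<in> vspace R" for x c
    using only_top_adm(2)[OF ot] by (simp add: lookup_ract lookup_act_cartan[OF that(1)])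
  have h: "r (sact n' k' UNIV x u) = sact n k R x (r u)" if "x \<in> cartan" "u \<in> vspace UNIV" for x u
    by (rule eqI[symmetric])
      (simp_all add: vspace_ract r that raising_coeff T.raising_coeff_cartan[OF topc_lin that(1) r[OF that(2)] topwt[OF that(1)]]
        E.raising_coeff_cartan[OF phi_add phi_scale that wt[OF that(1)]])
  have b: "r (sact n' k' UNIV x u) = sact n k R x (r u)" if "x \<in> borel_sl3" "u \<in> vspace UNIV" for x u
    by (rule borel_hom_from_generators[OF add sc E h that])
  have "topc (r c) = \<phi> c" if "c \<in> vspace UNIV" for c
    using raising_coeff[OF that, of 0 0 0] by (simp add: T.raising_coeff_def E.raising_coeff_def)
  with r add sc b show ?thesis using that by blast
qed

text \<open>Uniqueness in the universal property: the differences of values form a stable subspace without the highest weight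
  vector.\<close>

lemma hom_unique:
  assumes ot: "only_top n k R"
    and g: "\<And>c. c \<in> vspace R' \<Longrightarrow> g c \<in> vspace R" "\<And>c. c \<in> vspace R' \<Longrightarrow> g' c \<in> vspace R"
    and sc: "\<And>a u. u \<in> vspace R' \<Longrightarrow> g (pm_scale a u) = pm_scale a (g u)" "\<And>a u. u \<in> vspace R' \<Longrightarrow> g' (pm_scale a u) = pm_scale a (g' u)"
    and E: "\<And>x u. x \<in> borel_sl3 \<Longrightarrow> u \<in> vspace R' \<Longrightarrow> g (sact n' k' R' x u) = sact n k R x (g u)"
     "\<And>x u. x \<in> borel_sl3 \<Longrightarrow> u \<in> vspace R' \<Longrightarrow> g' (sact n' k' R' x u) = sact n k R x (g' u)"
    and top: "\<And>u. u \<in> vspace R' \<Longrightarrow> topc (g u) = topc (g' u)" and c: "c \<in> vspace R'"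
  shows "g c = g' c"
proof (rule ccontr)
  assume ne: "g c \<noteq> g' c"
  let ?d = "\<lambda>u. g u + pm_scale (- 1) (g' u)"
  have dE: "?d (sact n' k' R' x u) = sact n k R x (?d u)" if "x \<in> borel_sl3" "u \<in> vspace R'" for x u
    by (simp only: E that ract_add ract_scale)
  have dsc: "?d (pm_scale a u) = pm_scale a (?d u)" if "u \<in> vspace R'" for a u
    by (simp add: sc that pm.scale_right_diff_distrib)
  have "topv \<in> ?d ` vspace R'"
  proof (rule only_top_stable[OF ot, of _ "?d c"])
    show "?d ` vspace R' \<subseteq> vspace R" by (auto intro!: vspace_diff g)
    have st: "sact n k R x u \<in> ?d ` vspace R'" if x: "x \<in> borel_sl3" and u: "u \<in> ?d ` vspace R'" for x u
    proof -
      obtain v where v: "v \<in> vspace R'" "u = ?d v" using u by blast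
      show ?thesis by (rule image_eqI[of _ _ "sact n' k' R' x v"]) (simp_all only: v(2) dE[OF x v(1)] vspace_ract[OF v(1)])
    qed
    show "sact n k R (elem 1 2) u \<in> ?d ` vspace R'" "sact n k R (elem 2 3) u \<in> ?d ` vspace R'" if "u \<in> ?d ` vspace R'" for u
      by (rule st[OF elem_borel(1) that], rule st[OF elem_borel(2) that])
    show "pm_scale a u \<in> ?d ` vspace R'" if u: "u \<in> ?d ` vspace R'" for a u
    proof -
      obtain v where v: "v \<in> vspace R'" "u = ?d v" using u by blast
      show ?thesis by (rule image_eqI[of _ _ "pm_scale a v"]) (simp_all only: v(2) dsc[OF v(1)] vspace_scale[OF v(1)])
    qed
    show "?d c \<in> ?d ` vspace R'" using c by blast
    show "?d c \<noteq> 0" using ne by (simp add: pm.scale_minus_left)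
  qed
  then obtain u where u: "u \<in> vspace R'" "topv = ?d u" by blast
  have "topc topv = 0" unfolding u(2) by (simp add: lookup_minus top[OF u(1)])
  then show False by (simp add: lookup_topv)
qed

section \<open>Embeddings between models\<close>

lemma admissible_UNIV: "admissible K UNIV" by (simp add: admissible_def)

text \<open>A homomorphism between full models is determined by the image \<open>w\<close> of the highest weight vector. The normalisation
  \<open>lead_w\<close> makes \<open>w\<close> start with \<open>f\<^sub>\<alpha>\<^sup>p f\<^sub>\<beta>\<^sup>q v\<^sub>0\<close>.\<close>

locale verma_embedding =
  fixes n' k' n k :: int and \<iota> :: "wvec \<Rightarrow> wvec" and w :: wvec and p q :: int
  assumes closed: "c \<in> vspace UNIV \<Longrightarrow> \<iota> c \<in> vspace UNIV"
    and add: "u \<in> vspace UNIV \<Longrightarrow> v \<in> vspace UNIV \<Longrightarrow> \<iota> (u + v) = \<iota> u + \<iota> v"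
    and scale: "u \<in> vspace UNIV \<Longrightarrow> \<iota> (pm_scale a u) = pm_scale a (\<iota> u)"
    and equiv: "u \<in> vspace UNIV \<Longrightarrow> \<iota> (sact n' k' UNIV x u) = sact n k UNIV x (\<iota> u)"
    and top: "\<iota> topv = w"
    and homog_w: "homog p q w" and lead_w: "lk w (p, q, 0) = 1"
begin

lemma topv_U: "topv \<in> vspace UNIV" by (rule topv_vspace) simp
lemma w_vspace: "w \<in> vspace UNIV" using closed[OF topv_U] by (simp add: top)

lemma zero [simp]: "\<iota> 0 = 0" using scale[of 0 0] by simp

lemma wproj_image: "c \<in> vspace UNIV \<Longrightarrow> wproj (p + p') (q + q') (\<iota> c) = \<iota> (wproj p' q' c)"
proof -
  let ?A = "{c \<in> vspace UNIV. \<forall>p' q'. wproj (p + p') (q + q') (\<iota> c) = \<iota> (wproj p' q' c)}"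
  assume c: "c \<in> vspace UNIV"
  have "c \<in> ?A"
  proof (rule generated[where N = "of_int n'" and K = "of_int k'", OF _ _ _ _ _ _ _ _ c])
    show "0 \<in> ?A" by simp
    show "u + v \<in> ?A" if "u \<in> ?A" "v \<in> ?A" for u v
      using that by (simp add: vspace_add add wproj_add wproj_vspace)
    show "pm_scale a u \<in> ?A" if "u \<in> ?A" for a u
      using that by (simp add: vspace_scale scale wproj_scale wproj_vspace)
    have e: "p + p' = p + (p' - 1) + 1" "q + q' = q + (q' - 1) + 1" for p' q' by auto
    show "sact n' k' UNIV (elem 2 1) u \<in> ?A" if u: "u \<in> ?A" for u
    proof -
      have "wproj (p + p') (q + q') (sact n k UNIV (elem 2 1) (\<iota> u)) = sact n k UNIV (elem 2 1) (\<iota> (wproj (p' - 1) q' u))" for p' q'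
        using wproj_ract(4)[of "of_int n" "of_int k" UNIV "p + (p' - 1)" "q + q'" "\<iota> u"] u by (simp add: diff_add_eq)
      moreover have "\<iota> (wproj p' q' (sact n' k' UNIV (elem 2 1) u)) = sact n k UNIV (elem 2 1) (\<iota> (wproj (p' - 1) q' u))" for p' q'
        using wproj_ract(4)[of "of_int n'" "of_int k'" UNIV "p' - 1" q' u] u equiv[of "wproj (p' - 1) q' u" "elem 2 1"] by (simp add: wproj_vspace)
      ultimately show ?thesis using u by (simp add: vspace_ract equiv)
    qed
    show "sact n' k' UNIV (elem 3 2) u \<in> ?A" if u: "u \<in> ?A" for u
    proof -
      have "wproj (p + p') (q + q') (sact n k UNIV (elem 3 2) (\<iota> u)) = sact n k UNIV (elem 3 2) (\<iota> (wproj p' (q' - 1) u))" for p' q'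
        using wproj_ract(5)[of "of_int n" "of_int k" UNIV "p + p'" "q + (q' - 1)" "\<iota> u"] u by (simp add: diff_add_eq)
      moreover have "\<iota> (wproj p' q' (sact n' k' UNIV (elem 3 2) u)) = sact n k UNIV (elem 3 2) (\<iota> (wproj p' (q' - 1) u))" for p' q'
        using wproj_ract(5)[of "of_int n'" "of_int k'" UNIV p' "q' - 1" u] u equiv[of "wproj p' (q' - 1) u" "elem 3 2"] by (simp add: wproj_vspace)
      ultimately show ?thesis using u by (simp add: vspace_ract equiv)
    qed
    show "sact n' k' UNIV (elem 3 1) u \<in> ?A" if u: "u \<in> ?A" for u
    proof -
      have "wproj (p + p') (q + q') (sact n k UNIV (elem 3 1) (\<iota> u)) = sact n k UNIV (elem 3 1) (\<iota> (wproj (p' - 1) (q' - 1) u))" for p' q'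
        using wproj_ract(6)[of "of_int n" "of_int k" UNIV "p + (p' - 1)" "q + (q' - 1)" "\<iota> u"] u by (simp add: diff_add_eq)
      moreover have "\<iota> (wproj p' q' (sact n' k' UNIV (elem 3 1) u)) = sact n k UNIV (elem 3 1) (\<iota> (wproj (p' - 1) (q' - 1) u))" for p' q'
        using wproj_ract(6)[of "of_int n'" "of_int k'" UNIV "p' - 1" "q' - 1" u] u equiv[of "wproj (p' - 1) (q' - 1) u" "elem 3 1"] by (simp add: wproj_vspace)
      ultimately show ?thesis using u by (simp add: vspace_ract equiv)
    qed
    have "\<iota> (wproj p' q' topv) = (if (p', q') = (0, 0) then w else 0)" for p' q'
      using wproj_homog[OF homog_topv] wproj_homog_other[OF homog_topv, of p' q'] by (auto simp: top)
    moreover have "wproj (p + p') (q + q') w = (if (p', q') = (0, 0) then w else 0)" for p' q'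
      using wproj_homog[OF homog_w] wproj_homog_other[OF homog_w, of "p + p'" "q + q'"] by auto
    ultimately show "topv \<in> ?A" using topv_U by (simp add: top)
  qed simp
  then show ?thesis by blast
qed

lemma wproj_top: "c \<in> vspace UNIV \<Longrightarrow> wproj p q (\<iota> c) = pm_scale (topc c) w"
proof -
  assume c: "c \<in> vspace UNIV"
  have "wproj 0 0 c = pm_scale (topc c) topv"
    using homog_0[OF wproj_vspace[OF c] homog_wproj] by (simp add: lookup_wproj)
  then show ?thesis using wproj_image[OF c, of 0 0] scale[OF topv_U] by (simp add: top)
qed

text \<open>Since \<open>f\<^sub>\<alpha>\<^sub>+\<^sub>\<beta>\<close> is central in \<open>U(n\<^sup>-)\<close>, the filtration by the exponent \<open>l\<close> has a commutative associated graded
  algebra, in which multiplication by \<open>w\<close> is a shift of exponents.\<close>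

definition leading :: "int \<Rightarrow> int \<Rightarrow> int \<Rightarrow> wvec \<Rightarrow> bool" where
  "leading i j l v \<longleftrightarrow> (\<forall>i' j' l'. l' < l \<longrightarrow> lk v (i', j', l') = 0)
     \<and> (\<forall>i' j'. lk v (i', j', l) = (if i' = i + p \<and> j' = j + q then 1 else 0))"

lemma leading_w: "leading 0 0 0 w"
  using vspaceD[OF w_vspace] lead_w homogD[OF homog_w, of _ 0] by (auto simp: leading_def)

lemma leading_F:
  "leading i j l v \<Longrightarrow> leading (i + 1) j l (sact n k UNIV (elem 2 1) v)"
  "leading i j l v \<Longrightarrow> leading i (j + 1) l (sact n k UNIV (elem 3 2) v)"
  "leading i j l v \<Longrightarrow> leading i j (l + 1) (sact n k UNIV (elem 3 1) v)"
  unfolding leading_def by (auto simp: lookup_op)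

lemma leading_single: "leading (int i) (int j) (int l) (\<iota> (Poly_Mapping.single (int i, int j, int l) 1))"
proof -
  have v: "Poly_Mapping.single (int i, int j, int l) 1 \<in> vspace UNIV" for i j l
    by (rule vspaceI) (auto simp: lookup_single when_def)
  have 1: "leading 0 0 (int l) (\<iota> (Poly_Mapping.single (0, 0, int l) 1))"
  proof (induction l)
    case 0 show ?case using leading_w by (simp add: top[unfolded topv_def])
  next
    case (Suc l)
    have "\<iota> (Poly_Mapping.single (0, 0, int (Suc l)) 1) = sact n k UNIV (elem 3 1) (\<iota> (Poly_Mapping.single (0, 0, int l) 1))"
      using equiv[OF v[of 0 0 l], of "elem 3 1"] by (simp add: ract_single add.commute)
    then show ?case using leading_F(3)[OF Suc] by (simp add: add.commute)
  qed
  have 2: "leading 0 (int j) (int l) (\<iota> (Poly_Mapping.single (0, int j, int l) 1))"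
  proof (induction j)
    case 0 show ?case using 1 by simp
  next
    case (Suc j)
    have "\<iota> (Poly_Mapping.single (0, int (Suc j), int l) 1) = sact n k UNIV (elem 3 2) (\<iota> (Poly_Mapping.single (0, int j, int l) 1))"
      using equiv[OF v[of 0 j l], of "elem 3 2"] by (simp add: ract_single add.commute)
    then show ?case using leading_F(2)[OF Suc] by (simp add: add.commute)
  qed
  show ?thesis
  proof (induction i)
    case 0 show ?case using 2 by simp
  next
    case (Suc i)
    have "\<iota> (Poly_Mapping.single (int (Suc i), int j, int l) 1) = sact n k UNIV (elem 2 1) (\<iota> (Poly_Mapping.single (int i, int j, int l) 1))"
      using equiv[OF v[of i j l], of "elem 2 1"] by (simp add: ract_single add.commute)
    then show ?case using leading_F(1)[OF Suc] by (simp add: add.commute)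
  qed
qed

lemma image_sum: "finite S \<Longrightarrow> (\<And>x. x \<in> S \<Longrightarrow> f x \<in> vspace UNIV) \<Longrightarrow> sum f S \<in> vspace UNIV \<and> \<iota> (sum f S) = (\<Sum>x\<in>S. \<iota> (f x))"
  by (induction S rule: finite_induct) (simp_all add: vspace_add add)

lemma leading_image:
  assumes c: "c \<in> vspace UNIV" and low: "\<And>i j l. l < l0 \<Longrightarrow> lk c (i, j, l) = 0"
  shows "lk (\<iota> c) (i + p, j + q, l0) = lk c (i, j, l0)"
proof -
  let ?K = "Poly_Mapping.keys c" and ?s = "\<lambda>k. Poly_Mapping.single k (1 :: complex)"
  have nn: "0 \<le> i \<and> 0 \<le> j \<and> 0 \<le> l" if "(i, j, l) \<in> ?K" for i j l
    using that vspaceD[OF c, of i j l] by (auto simp: in_keys_iff not_le[symmetric])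
  have sv: "?s k \<in> vspace UNIV" if "k \<in> ?K" for k
  proof -
    obtain i j l where k: "k = (i, j, l)" by (cases k rule: prod_cases3)
    show ?thesis using nn[of i j l] that unfolding k by (intro vspaceI) (auto simp: lookup_single when_def)
  qed
  have "\<iota> c = \<iota> (\<Sum>k\<in>?K. pm_scale (lk c k) (?s k))" using poly_mapping_decomp[of c] by simp
  also have "\<dots> = (\<Sum>k\<in>?K. \<iota> (pm_scale (lk c k) (?s k)))" by (intro conjunct2[OF image_sum]) (auto intro: vspace_scale sv)
  also have "\<dots> = (\<Sum>k\<in>?K. pm_scale (lk c k) (\<iota> (?s k)))" by (intro sum.cong refl scale sv)
  finally have "lk (\<iota> c) (i + p, j + q, l0) = (\<Sum>k\<in>?K. lk c k * lk (\<iota> (?s k)) (i + p, j + q, l0))"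
    by (simp add: lookup_sum)
  also have "\<dots> = (\<Sum>k\<in>?K. if k = (i, j, l0) then lk c k else 0)"
  proof (rule sum.cong[OF refl])
    fix k assume k: "k \<in> ?K"
    obtain i' j' l' where k': "k = (i', j', l')" by (cases k rule: prod_cases3)
    have "l0 \<le> l'" using low[of l' i' j'] k unfolding k' by (force simp: in_keys_iff)
    moreover have "leading i' j' l' (\<iota> (?s k))" using leading_single[of "nat i'" "nat j'" "nat l'"] nn[of i' j' l'] k unfolding k' by simp
    ultimately show "lk c k * lk (\<iota> (?s k)) (i + p, j + q, l0) = (if k = (i, j, l0) then lk c k else 0)"
      unfolding leading_def k' by (cases "l0 = l'") auto
  qed
  also have "\<dots> = lk c (i, j, l0)" by (simp add: in_keys_iff)
  finally show ?thesis .
qed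

text \<open>The terms of \<open>c\<close> with the least exponent \<open>l\<close> survive in the image.\<close>

lemma inj_zero: "c \<in> vspace UNIV \<Longrightarrow> \<iota> c = 0 \<Longrightarrow> c = 0"
proof (rule ccontr)
  assume c: "c \<in> vspace UNIV" and z: "\<iota> c = 0" and nz: "c \<noteq> 0"
  let ?P = "\<lambda>l::nat. \<exists>i j. lk c (i, j, int l) \<noteq> 0"
  obtain i j l where ijl: "lk c (i, j, l) \<noteq> 0" using wvec_eqI[of c 0] nz by auto
  then have "0 \<le> l" using vspaceD[OF c, of i j l] by force
  then have "?P (nat l)" using ijl by auto
  then obtain l0 where l0: "?P l0" "\<And>m. m < l0 \<Longrightarrow> \<not> ?P m" using exists_least_iff[of ?P] by blast
  have "lk c (i, j, l) = 0" if "l < int l0" for i j l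
  proof (cases "l < 0")
    case False then show ?thesis using l0(2)[of "nat l"] that by force
  qed (simp add: vspaceD[OF c])
  then have "lk (\<iota> c) (i + p, j + q, int l0) = lk c (i, j, int l0)" for i j using leading_image[OF c] by blast
  then show False using l0(1) z by simp
qed

lemma inj: "inj_on \<iota> (vspace UNIV)"
proof (rule inj_onI)
  fix u v assume u: "u \<in> vspace UNIV" and v: "v \<in> vspace UNIV" and eq: "\<iota> u = \<iota> v"
  have "\<iota> (u + pm_scale (- 1) v) = 0" unfolding add[OF u vspace_scale[OF v]] scale[OF v] eq by simp
  then have "u + pm_scale (- 1) v = 0" by (rule inj_zero[OF vspace_add[OF u vspace_scale[OF v]]])
  then show "u = v" by simp
qed

lemma weights_image: "c \<in> vspace UNIV \<Longrightarrow> \<not> (p \<le> P \<and> q \<le> Q) \<Longrightarrow> wproj P Q (\<iota> c) = 0"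
proof -
  assume c: "c \<in> vspace UNIV" and no: "\<not> (p \<le> P \<and> q \<le> Q)"
  have "wproj (P - p) (Q - q) c = 0"
  proof (rule wvec_eqI)
    fix i j l show "lk (wproj (P - p) (Q - q) c) (i, j, l) = lk 0 (i, j, l)"
      using no vspaceD[OF c, of i j l] by (force simp: lookup_wproj)
  qed
  then show ?thesis using wproj_image[OF c, of "P - p" "Q - q"] by simp
qed

end

text \<open>Right multiplication by \<open>f\<^sub>\<beta>\<^sup>m\<close>. For \<open>m = k\<close> it is the embedding \<open>M(s\<^sub>\<beta> \<cdot> \<mu>) \<subseteq> M(\<mu>)\<close>, and its image is the kernel of
  the cut at \<open>k\<close>.\<close>

definition shift_j :: "int \<Rightarrow> wvec \<Rightarrow> wvec" where
  "shift_j m c = Abs_poly_mapping (\<lambda>(i, j, l). lk c (i, j - m, l))"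

lemma lookup_shift_j: "lk (shift_j m c) (i, j, l) = lk c (i, j - m, l)"
proof -
  have "{k. (case k of (i, j, l) \<Rightarrow> lk c (i, j - m, l)) \<noteq> 0} \<subseteq> (\<lambda>(i, j, l). (i, j + m, l)) ` {k. lk c k \<noteq> 0}"
  proof
    fix k assume a: "k \<in> {k. (case k of (i, j, l) \<Rightarrow> lk c (i, j - m, l)) \<noteq> 0}"
    obtain i j l where k: "k = (i, j, l)" by (cases k rule: prod_cases3)
    show "k \<in> (\<lambda>(i, j, l). (i, j + m, l)) ` {k. lk c k \<noteq> 0}"
      using a unfolding k by (intro image_eqI[of _ _ "(i, j - m, l)"]) auto
  qed
  then have "finite {k. (case k of (i, j, l) \<Rightarrow> lk c (i, j - m, l)) \<noteq> 0}" by (rule finite_subset) simp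
  then show ?thesis unfolding shift_j_def by (subst lookup_Abs_poly_mapping) auto
qed

lemma shift_j_scale: "shift_j m (pm_scale a u) = pm_scale a (shift_j m u)"
  by (rule wvec_eqI) (simp add: lookup_shift_j)

lemma shift_j_vspace: "0 \<le> m \<Longrightarrow> c \<in> vspace UNIV \<Longrightarrow> shift_j m c \<in> vspace UNIV"
  by (rule vspaceI) (auto simp: lookup_shift_j vspaceD)

lemma shift_j_equiv: "shift_j k (sact (n + k) (- k) UNIV x c) = sact n k UNIV x (shift_j k c)"
  by (rule wvec_eqI)
    (simp add: lookup_shift_j lookup_ract lookup_act actf_def op_defs algebra_simps)

lemma cut_shift_j: "c \<in> vspace UNIV \<Longrightarrow> cut {..<m} (shift_j m c) = 0"
  by (rule wvec_eqI) (auto simp: lookup_cut lookup_shift_j vspaceD)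

lemma cut_zero_shift_j:
  assumes "c \<in> vspace UNIV" "cut {..<m} c = 0"
  shows "shift_j (- m) c \<in> vspace UNIV" "shift_j m (shift_j (- m) c) = c"
proof -
  have z: "lk c (i, j, l) = 0" if "j < m" for i j l
    using arg_cong[OF assms(2), of "\<lambda>c. lk c (i, j, l)"] that by (simp add: lookup_cut)
  show "shift_j (- m) c \<in> vspace UNIV" using assms z by (intro vspaceI) (auto simp: lookup_shift_j vspaceD)
  show "shift_j m (shift_j (- m) c) = c" by (rule wvec_eqI) (simp add: lookup_shift_j)
qed

section \<open>The enveloping algebra and induced modules\<close>

text \<open>The linear extension of \<open>g\<close> from the basis elements.\<close>

definition lext :: "('a \<Rightarrow> 'b \<Rightarrow>\<^sub>0 complex) \<Rightarrow> ('a \<Rightarrow>\<^sub>0 complex) \<Rightarrow> ('b \<Rightarrow>\<^sub>0 complex)" where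
  "lext g p = (\<Sum>k\<in>Poly_Mapping.keys p. pm_scale (lk p k) (g k))"

lemma lext_superset: "finite S \<Longrightarrow> Poly_Mapping.keys p \<subseteq> S \<Longrightarrow> lext g p = (\<Sum>k\<in>S. pm_scale (lk p k) (g k))"
  unfolding lext_def by (rule sum.mono_neutral_left) (auto simp: in_keys_iff)

lemma lext_add: "lext g (p + q) = lext g p + lext g q"
proof -
  let ?S = "Poly_Mapping.keys p \<union> Poly_Mapping.keys q"
  have "lext g (p + q) = (\<Sum>k\<in>?S. pm_scale (lk (p + q) k) (g k))"
    by (rule lext_superset) (auto simp: in_keys_iff lookup_add)
  also have "\<dots> = (\<Sum>k\<in>?S. pm_scale (lk p k) (g k)) + (\<Sum>k\<in>?S. pm_scale (lk q k) (g k))"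
    by (simp add: lookup_add pm.scale_left_distrib sum.distrib)
  also have "\<dots> = lext g p + lext g q" by (subst (1 2) lext_superset[of ?S]) auto
  finally show ?thesis .
qed

lemma lext_scale: "lext g (pm_scale a p) = pm_scale a (lext g p)"
proof -
  have "lext g (pm_scale a p) = (\<Sum>k\<in>Poly_Mapping.keys p. pm_scale (lk (pm_scale a p) k) (g k))"
    by (rule lext_superset) (auto simp: in_keys_iff)
  then show ?thesis by (simp add: lext_def pm.scale_sum_right)
qed

lemma lext_single: "lext g (Poly_Mapping.single k a) = pm_scale a (g k)"
  by (subst lext_superset[of "{k}"]) (auto simp: lookup_single)

lemma lext_zero [simp]: "lext g 0 = 0" by (simp add: lext_def)

lemma lext_diff: "lext g (p - q) = lext g p - lext g q"
  using lext_add[of g "p - q" q] by (simp add: algebra_simps)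

lemma lext_pure: "lext g (pure u v) = g (u, v)"
  by (simp add: pure_def lext_single)

lemma pm_scale_single: "pm_scale a (Poly_Mapping.single k b) = Poly_Mapping.single k (a * b)"
  by (rule poly_mapping_eqI) (auto simp: lookup_single when_def)

lemma poly_mapping_single_induct:
  assumes single: "\<And>k a. P (Poly_Mapping.single k (a :: complex))" and add: "\<And>p q. P p \<Longrightarrow> P q \<Longrightarrow> P (p + q)"
  shows "P p"
proof -
  have z: "P 0" using single[of undefined 0] by simp
  have "P (\<Sum>k\<in>S. pm_scale (lk p k) (Poly_Mapping.single k 1))" if "finite S" for S
    using that by (induction S rule: finite_induct) (simp_all add: z add single pm_scale_single)
  from this[of "Poly_Mapping.keys p"] show ?thesis using poly_mapping_decomp[of p] by simp
qed

locale lie_rep =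
  fixes rho :: "'g::complex_lie_algebra \<Rightarrow> ('k \<Rightarrow>\<^sub>0 complex) \<Rightarrow> ('k \<Rightarrow>\<^sub>0 complex)"
  assumes rho_add: "rho x (u + v) = rho x u + rho x v"
    and rho_scale: "rho x (pm_scale a u) = pm_scale a (rho x u)"
    and rho_add_left: "rho (x + y) u = rho x u + rho y u"
    and rho_scale_left: "rho (lscale a x) u = pm_scale a (rho x u)"
    and rho_bracket: "rho (bracket x y) u = rho x (rho y u) - rho y (rho x u)"
begin

definition word_act :: "'g word \<Rightarrow> ('k \<Rightarrow>\<^sub>0 complex) \<Rightarrow> ('k \<Rightarrow>\<^sub>0 complex)" where
  "word_act w v = foldr rho (letters w) v"

lemma word_act_add: "word_act w (u + v) = word_act w u + word_act w v"
proof -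
  have "foldr rho xs (u + v) = foldr rho xs u + foldr rho xs v" for xs by (induction xs) (simp_all add: rho_add)
  then show ?thesis by (simp add: word_act_def)
qed

lemma word_act_scale: "word_act w (pm_scale a v) = pm_scale a (word_act w v)"
proof -
  have "foldr rho xs (pm_scale a v) = pm_scale a (foldr rho xs v)" for xs by (induction xs) (simp_all add: rho_scale)
  then show ?thesis by (simp add: word_act_def)
qed

lemma word_act_plus: "word_act (w + w') v = word_act w (word_act w' v)"
  by (simp add: word_act_def plus_word_def)

definition free_act :: "'g free_alg \<Rightarrow> ('k \<Rightarrow>\<^sub>0 complex) \<Rightarrow> ('k \<Rightarrow>\<^sub>0 complex)" where
  "free_act p v = lext (\<lambda>w. word_act w v) p"

lemma free_act_add_left: "free_act (p + q) v = free_act p v + free_act q v"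
  by (simp add: free_act_def lext_add)

lemma free_act_diff_left: "free_act (p - q) v = free_act p v - free_act q v"
  by (simp add: free_act_def lext_diff)

lemma free_act_single: "free_act (Poly_Mapping.single w a) v = pm_scale a (word_act w v)"
  by (simp add: free_act_def lext_single)

lemma free_act_add: "free_act p (u + v) = free_act p u + free_act p v"
  by (induction p rule: poly_mapping_single_induct)
    (simp_all add: free_act_single free_act_add_left word_act_add pm.scale_right_distrib)

lemma free_act_scale: "free_act p (pm_scale a v) = pm_scale a (free_act p v)"
  by (induction p rule: poly_mapping_single_induct)
    (simp_all add: free_act_single free_act_add_left word_act_scale pm.scale_right_distrib mult.commute)

lemma free_act_zero [simp]: "free_act p 0 = 0"
  using free_act_scale[of p 0 0] by simp

lemma free_act_mult: "free_act (p * q) v = free_act p (free_act q v)"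
proof (induction p rule: poly_mapping_single_induct)
  case (1 w a)
  show ?case
    by (induction q rule: poly_mapping_single_induct)
      (simp_all add: mult_single free_act_single word_act_plus word_act_scale distrib_left free_act_add_left word_act_add pm.scale_right_distrib)
next
  case (2 p p')
  then show ?case by (simp add: distrib_right free_act_add_left)
qed

lemma free_act_fgen: "free_act (fgen x) v = rho x v"
  by (simp add: fgen_def free_act_single word_act_def)

lemma free_act_fconst: "free_act (fconst c) v = pm_scale c v"
  by (simp add: fconst_def free_act_single word_act_def zero_word_def)

lemma free_act_relator: "r \<in> uea_relators \<Longrightarrow> free_act r v = 0"
  unfolding uea_relators_def
  by (auto simp: free_act_diff_left free_act_mult free_act_fgen free_act_fconst rho_add_left rho_scale_left rho_bracket)

text \<open>The action of the free algebra factors through the enveloping algebra because each family of relators is an axiom of a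
  representation.\<close>

lemma free_act_ideal: "p \<in> uea_ideal \<Longrightarrow> free_act p v = 0"
  by (induction p rule: uea_ideal.induct) (simp_all add: free_act_add_left free_act_mult free_act_relator, simp add: free_act_def)

definition uea_act :: "'g uea \<Rightarrow> ('k \<Rightarrow>\<^sub>0 complex) \<Rightarrow> ('k \<Rightarrow>\<^sub>0 complex)" where
  "uea_act u v = free_act (rep_uea u) v"

lemma uea_act_abs: "uea_act (abs_uea p) v = free_act p v"
proof -
  have "abs_uea (rep_uea (abs_uea p)) = abs_uea p" by (rule Quotient3_abs_rep[OF Quotient3_uea])
  then have "uea_cong (rep_uea (abs_uea p)) p" by (simp add: uea.abs_eq_iff)
  then have "free_act (rep_uea (abs_uea p) - p) v = 0" unfolding uea_cong_def by (rule free_act_ideal)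
  then show ?thesis by (simp add: uea_act_def free_act_diff_left)
qed

lemma uea_act_add_left: "uea_act (u + u') v = uea_act u v + uea_act u' v"
  by (induct u rule: uea.abs_induct; induct u' rule: uea.abs_induct)
    (simp add: plus_uea.abs_eq uea_act_abs free_act_add_left)

lemma uea_act_mult: "uea_act (u * u') v = uea_act u (uea_act u' v)"
  by (induct u rule: uea.abs_induct; induct u' rule: uea.abs_induct)
    (simp add: times_uea.abs_eq uea_act_abs free_act_mult)

lemma uea_act_ugen: "uea_act (ugen x) v = rho x v"
  by (simp add: ugen.abs_eq uea_act_abs free_act_fgen)

lemma uea_act_uconst: "uea_act (uconst c) v = pm_scale c v"
  by (simp add: uconst.abs_eq uea_act_abs free_act_fconst)

lemma uea_act_one: "uea_act 1 v = v"
  by (simp add: one_uea.abs_eq uea_act_abs single_one[symmetric] free_act_single word_act_def zero_word_def)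

lemma uea_act_add: "uea_act u (v + v') = uea_act u v + uea_act u v'"
  by (simp add: uea_act_def free_act_add)

lemma uea_act_scale: "uea_act u (pm_scale a v) = pm_scale a (uea_act u v)"
  by (simp add: uea_act_def free_act_scale)

end

lemma uconst_add: "uconst (a + b) = uconst a + uconst b"
  by (simp add: uconst.abs_eq plus_uea.abs_eq fconst_def single_add)

lemma uconst_mult: "uconst (a * b) = uconst a * uconst b"
  by (simp add: uconst.abs_eq times_uea.abs_eq fconst_def mult_single)

lemma uconst_zero [simp]: "uconst 0 = 0"
  by (simp add: uconst.abs_eq zero_uea.abs_eq fconst_def)

lemma uconst_one [simp]: "uconst 1 = 1"
  by (simp add: uconst.abs_eq one_uea.abs_eq fconst_def)

lemma uconst_commute: "uconst a * u = u * uconst a"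
proof (induct u rule: uea.abs_induct)
  case (1 p)
  have "fconst a * p = p * fconst a"
    by (induction p rule: poly_mapping_single_induct)
      (simp_all add: fconst_def mult_single distrib_left distrib_right mult.commute)
  then show ?case by (simp add: uconst.abs_eq times_uea.abs_eq)
qed

lemma uea_relator_zero: "r \<in> uea_relators \<Longrightarrow> abs_uea r = 0"
  unfolding zero_uea.abs_eq uea.abs_eq_iff uea_cong_def using uea_ideal.add[OF uea_ideal.zero, of r 1 1] by simp

lemma ugen_add: "ugen (x + y) = ugen x + ugen y"
proof -
  have "abs_uea (fgen (x + y) - fgen x - fgen y) = 0" by (rule uea_relator_zero) (auto simp: uea_relators_def)
  then have "ugen (x + y) - ugen x - ugen y = 0" by (simp add: ugen.abs_eq minus_uea.abs_eq)
  then show ?thesis by (simp add: algebra_simps)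
qed

lemma ugen_scale: "ugen (lscale c x) = uconst c * ugen x"
proof -
  have "abs_uea (fgen (lscale c x) - fconst c * fgen x) = 0" by (rule uea_relator_zero) (auto simp: uea_relators_def)
  then have "ugen (lscale c x) - uconst c * ugen x = 0" by (simp add: ugen.abs_eq minus_uea.abs_eq uconst.abs_eq times_uea.abs_eq)
  then show ?thesis by simp
qed

lemma ugen_bracket: "ugen x * ugen y = ugen y * ugen x + ugen (bracket x y)"
proof -
  have "abs_uea (fgen x * fgen y - fgen y * fgen x - fgen (bracket x y)) = 0" by (rule uea_relator_zero) (auto simp: uea_relators_def)
  then have "ugen x * ugen y - ugen y * ugen x - ugen (bracket x y) = 0" by (simp add: ugen.abs_eq minus_uea.abs_eq times_uea.abs_eq)
  then show ?thesis by (simp add: algebra_simps)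
qed

lemma uea_induct:
  assumes one: "P 1" and add: "\<And>u v. P u \<Longrightarrow> P v \<Longrightarrow> P (u + v)" and sc: "\<And>c u. P u \<Longrightarrow> P (uconst c * u)"
    and gen: "\<And>x u. P u \<Longrightarrow> P (ugen x * u)"
  shows "P u"
proof (induct u rule: uea.abs_induct)
  case (1 p)
  show ?case
  proof (induction p rule: poly_mapping_single_induct)
    case (1 w a)
    have word: "P (abs_uea (Poly_Mapping.single (Word xs) 1))" for xs
    proof (induction xs)
      case Nil
      have "Poly_Mapping.single (Word []) 1 = (1 :: 'a free_alg)" by (simp add: zero_word_def[symmetric])
      then show ?case using one by (simp add: one_uea.abs_eq)
    next
      case (Cons x xs)
      have "Poly_Mapping.single (Word (x # xs)) 1 = fgen x * Poly_Mapping.single (Word xs) 1"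
        by (simp add: fgen_def mult_single plus_word_def)
      then show ?case using gen[OF Cons, of x] by (simp add: ugen.abs_eq times_uea.abs_eq)
    qed
    have "Poly_Mapping.single w a = fconst a * Poly_Mapping.single (Word (letters w)) 1"
      by (simp add: fconst_def mult_single)
    then show ?case using sc[OF word[of "letters w"], of a] by (simp add: uconst.abs_eq times_uea.abs_eq)
  next
    case (2 p q)
    show ?case using add[OF 2] by (simp add: plus_uea.abs_eq)
  qed
qed

definition left_mult :: "'g::complex_lie_algebra uea \<Rightarrow> (('g uea \<times> 'v) \<Rightarrow>\<^sub>0 complex) \<Rightarrow> (('g uea \<times> 'v) \<Rightarrow>\<^sub>0 complex)" where
  "left_mult a p = lext (\<lambda>(u, v). pure (a * u) v) p"

lemma left_mult_pure: "left_mult a (pure u v) = pure (a * u) v"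
  by (simp add: left_mult_def lext_pure)

lemma left_mult_lin: "left_mult a (p + q) = left_mult a p + left_mult a q"
  "left_mult a (p - q) = left_mult a p - left_mult a q"
  "left_mult a (pm_scale c p) = pm_scale c (left_mult a p)"
  by (simp_all add: left_mult_def lext_add lext_diff lext_scale)

text \<open>The relations of the tensor product involve \<open>u\<close> only from the right, so left multiplication
  maps relations to relations.\<close>

lemma left_mult_relator: "r \<in> tensor_relators s V \<Longrightarrow> left_mult a r \<in> tensor_relators s V"
proof -
  have c: "a * (uconst c * u) = uconst c * (a * u)" for c u
    using uconst_commute[of c a] by (simp add: mult.assoc[symmetric])
  assume "r \<in> tensor_relators s V"
  then consider
      (1) u u' v where "v \<in> mcarrier V" "r = pure (u + u') v - pure u v - pure u' v"
    | (2) u v v' where "v \<in> mcarrier V" "v' \<in> mcarrier V" "r = pure u (madd V v v') - pure u v - pure u v'"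
    | (3) c u v where "v \<in> mcarrier V" "r = pure (uconst c * u) v - pm_scale c (pure u v)"
    | (4) c u v where "v \<in> mcarrier V" "r = pure u (mscale V c v) - pm_scale c (pure u v)"
    | (5) x u v where "x \<in> s" "v \<in> mcarrier V" "r = pure (u * ugen x) v - pure u (mact V x v)"
    unfolding tensor_relators_def by blast
  then show ?thesis
  proof cases
    case 1
    then have "left_mult a r = pure (a * u + a * u') v - pure (a * u) v - pure (a * u') v"
      by (simp add: left_mult_lin left_mult_pure distrib_left)
    then show ?thesis using 1(1) unfolding tensor_relators_def by blast
  next
    case 2
    then have "left_mult a r = pure (a * u) (madd V v v') - pure (a * u) v - pure (a * u) v'"
      by (simp add: left_mult_lin left_mult_pure)
    then show ?thesis using 2(1,2) unfolding tensor_relators_def by blast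
  next
    case 3
    then have "left_mult a r = pure (uconst c * (a * u)) v - pm_scale c (pure (a * u) v)"
      by (simp add: left_mult_lin left_mult_pure c)
    then show ?thesis using 3(1) unfolding tensor_relators_def by blast
  next
    case 4
    then have "left_mult a r = pure (a * u) (mscale V c v) - pm_scale c (pure (a * u) v)"
      by (simp add: left_mult_lin left_mult_pure)
    then show ?thesis using 4(1) unfolding tensor_relators_def by blast
  next
    case 5
    then have "left_mult a r = pure ((a * u) * ugen x) v - pure (a * u) (mact V x v)"
      by (simp add: left_mult_lin left_mult_pure mult.assoc)
    then show ?thesis using 5(1,2) unfolding tensor_relators_def by blast
  qed
qed

lemma left_mult_span: "p \<in> pm.span (tensor_relators s V) \<Longrightarrow> left_mult a p \<in> pm.span (tensor_relators s V)"
proof (induction rule: pm.span_induct_alt)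
  case base then show ?case by (simp add: left_mult_def pm.span_zero)
next
  case (step c x y)
  show ?case unfolding left_mult_lin
    by (rule pm.span_add[OF pm.span_scale[OF pm.span_base[OF left_mult_relator[OF step(1)]]] step(2)])
qed

lemma free_tensor_simps [simp]:
  "mcarrier (free_tensor_module (weight_module \<nu>)) = UNIV"
  "mzero (free_tensor_module V) = 0" "madd (free_tensor_module V) = (+)" "mscale (free_tensor_module V) = pm_scale"
  "mact (free_tensor_module V) x p = left_mult (ugen x) p"
  by (simp_all add: free_tensor_module_def weight_module_def left_mult_def lext_def case_prod_unfold)

lemma weight_module_simps [simp]: "mcarrier (weight_module \<nu>) = UNIV" "mzero (weight_module \<nu>) = 0"
  "madd (weight_module \<nu>) = (+)" "mscale (weight_module \<nu>) = (*)" "mact (weight_module \<nu>) x v = \<nu> (cartan_part x) * v"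
  by (simp_all add: weight_module_def)

lemma lin_module_free: "lin_module UNIV (free_tensor_module (weight_module \<nu>))"
  by unfold_locales (simp_all add: add_ac pm.scale_right_distrib pm.scale_left_distrib left_mult_lin)

abbreviation verma_relations :: "weight \<Rightarrow> ((sl3 uea \<times> complex) \<Rightarrow>\<^sub>0 complex) set" where
  "verma_relations \<nu> \<equiv> pm.span (tensor_relators borel_sl3 (weight_module \<nu>))"

lemma sub_free: "sub_lin_module UNIV (free_tensor_module (weight_module \<nu>)) (verma_relations \<nu>)"
proof -
  interpret lin_module UNIV "free_tensor_module (weight_module \<nu>)" by (rule lin_module_free)
  show ?thesis
    by unfold_locales (auto simp: submodule_def pm.span_zero pm.span_add pm.span_scale left_mult_span)
qed

lemma verma_eq: "verma \<nu> = free_tensor_module (weight_module \<nu>) //\<^sub>m verma_relations \<nu>"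
  by (simp add: verma_def induced_module_def)

context lie_rep begin

definition tensor_map :: "('k \<Rightarrow>\<^sub>0 complex) \<Rightarrow> (('g uea \<times> complex) \<Rightarrow>\<^sub>0 complex) \<Rightarrow> ('k \<Rightarrow>\<^sub>0 complex)" where
  "tensor_map w p = lext (\<lambda>(u, z). pm_scale z (uea_act u w)) p"

lemma tensor_map_lin: "tensor_map w (p + q) = tensor_map w p + tensor_map w q"
  "tensor_map w (p - q) = tensor_map w p - tensor_map w q"
  "tensor_map w (pm_scale c p) = pm_scale c (tensor_map w p)"
  by (simp_all add: tensor_map_def lext_add lext_diff lext_scale)

lemma tensor_map_pure: "tensor_map w (pure u z) = pm_scale z (uea_act u w)"
  by (simp add: tensor_map_def lext_pure)

lemma tensor_map_left_mult: "tensor_map w (left_mult a p) = uea_act a (tensor_map w p)"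
proof (induction p rule: poly_mapping_single_induct)
  case (1 k b)
  obtain u z where k: "k = (u, z)" by (cases k)
  have e: "Poly_Mapping.single k b = pm_scale b (pure u z)" by (simp add: k pure_def pm_scale_single)
  show ?case unfolding e left_mult_lin tensor_map_lin left_mult_pure tensor_map_pure uea_act_mult uea_act_scale ..
next
  case (2 p q)
  then show ?case by (simp add: left_mult_lin tensor_map_lin uea_act_add)
qed

end

lemma tensor_map_relations:
  assumes "lie_rep (rho :: sl3 \<Rightarrow> ('k \<Rightarrow>\<^sub>0 complex) \<Rightarrow> _)"
    and w: "\<And>x. x \<in> borel_sl3 \<Longrightarrow> rho x w = pm_scale (\<nu> (cartan_part x)) w"
    and p: "p \<in> verma_relations \<nu>"
  shows "lie_rep.tensor_map rho w p = 0"
proof -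
  interpret lie_rep rho by fact
  have rel: "tensor_map w r = 0" if "r \<in> tensor_relators borel_sl3 (weight_module \<nu>)" for r
    using that unfolding tensor_relators_def
    by (auto simp: tensor_map_lin tensor_map_pure uea_act_add_left uea_act_mult uea_act_uconst uea_act_ugen w uea_act_scale
      pm.scale_right_distrib pm.scale_left_distrib mult.commute)
  show ?thesis using p
    by (induction rule: pm.span_induct_alt) (simp_all add: tensor_map_def[of w 0] tensor_map_lin rel)
qed

section \<open>The Poincare--Birkhoff--Witt spanning set\<close>

text \<open>The weight \<open>\<nu>\<close> is the highest weight of the model with parameters \<open>N, K\<close> on which the Lie algebra acts through \<open>t\<close>.\<close>

definition has_top_weight :: "(sl3 \<Rightarrow> sl3) \<Rightarrow> complex \<Rightarrow> complex \<Rightarrow> weight \<Rightarrow> bool" where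
  "has_top_weight t N K \<nu> \<longleftrightarrow> (\<forall>x\<in>borel_sl3. \<nu> (cartan_part x) = wt_char N K (t x))"

lemma pure_mod_relations:
  shows "pure (u + u') v - (pure u v + pure u' v) \<in> verma_relations \<nu>"
    and "pure (uconst c * u) v - pm_scale c (pure u v) \<in> verma_relations \<nu>"
    and "pure u (c * v) - pm_scale c (pure u v) \<in> verma_relations \<nu>"
    and "x \<in> borel_sl3 \<Longrightarrow> pure (u * ugen x) v - pure u (\<nu> (cartan_part x) * v) \<in> verma_relations \<nu>"
proof -
  have "pure (u + u') v - pure u v - pure u' v \<in> tensor_relators borel_sl3 (weight_module \<nu>)"
    unfolding tensor_relators_def by (simp only: weight_module_simps) blast
  then show "pure (u + u') v - (pure u v + pure u' v) \<in> verma_relations \<nu>"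
    unfolding diff_diff_eq by (rule pm.span_base)
  have "pure (uconst c * u) v - pm_scale c (pure u v) \<in> tensor_relators borel_sl3 (weight_module \<nu>)"
    unfolding tensor_relators_def by (simp only: weight_module_simps) blast
  then show "pure (uconst c * u) v - pm_scale c (pure u v) \<in> verma_relations \<nu>" by (rule pm.span_base)
  have "pure u (mscale (weight_module \<nu>) c v) - pm_scale c (pure u v) \<in> tensor_relators borel_sl3 (weight_module \<nu>)"
    unfolding tensor_relators_def by (simp only: weight_module_simps) blast
  then show "pure u (c * v) - pm_scale c (pure u v) \<in> verma_relations \<nu>" by (intro pm.span_base) simp
  assume "x \<in> borel_sl3"
  then have "pure (u * ugen x) v - pure u (mact (weight_module \<nu>) x v) \<in> tensor_relators borel_sl3 (weight_module \<nu>)"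
    unfolding tensor_relators_def by (simp only: weight_module_simps) blast
  then show "pure (u * ugen x) v - pure u (\<nu> (cartan_part x) * v) \<in> verma_relations \<nu>" by (intro pm.span_base) simp
qed

text \<open>A left ideal of \<open>U(g)\<close>: the annihilator of the canonical generator \<open>1 \<otimes> 1\<close> of the induced module. It contains
  \<open>x - \<nu>(x)\<close> for \<open>x\<close> in the Borel subalgebra.\<close>

definition annih :: "weight \<Rightarrow> sl3 uea set" where
  "annih \<nu> = {u. pure u 1 \<in> verma_relations \<nu>}"

lemma span_trans: "p - q \<in> verma_relations \<nu> \<Longrightarrow> q \<in> verma_relations \<nu> \<Longrightarrow> p \<in> verma_relations \<nu>"
  using pm.span_add[of "p - q" _ q] by simp

lemma annih_add: "u \<in> annih \<nu> \<Longrightarrow> v \<in> annih \<nu> \<Longrightarrow> u + v \<in> annih \<nu>"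
  unfolding annih_def using span_trans[OF pure_mod_relations(1)] pm.span_add by blast

lemma annih_mult: "u \<in> annih \<nu> \<Longrightarrow> a * u \<in> annih \<nu>"
  unfolding annih_def using left_mult_span[of "pure u 1" _ _ a] by (simp add: left_mult_pure)

lemma uconst_minus: "uconst (- c) = - uconst c"
  using uconst_add[of c "- c"] by (simp add: eq_neg_iff_add_eq_0 add.commute)

lemma annih_zero: "0 \<in> annih \<nu>"
proof -
  have "pure (uconst 0 * 0) 1 - pm_scale 0 (pure 0 1) \<in> verma_relations \<nu>" by (rule pure_mod_relations)
  then show ?thesis by (simp add: annih_def)
qed

lemma annih_borel: "x \<in> borel_sl3 \<Longrightarrow> ugen x - uconst (\<nu> (cartan_part x)) \<in> annih \<nu>"
proof -
  assume x: "x \<in> borel_sl3"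
  let ?c = "\<nu> (cartan_part x)"
  have 1: "pure (1 * ugen x) 1 - pure 1 (?c * 1) \<in> verma_relations \<nu>" by (rule pure_mod_relations(4)[OF x])
  have 2: "pure 1 (?c * 1) - pm_scale ?c (pure 1 1) \<in> verma_relations \<nu>" by (rule pure_mod_relations(3))
  have 3: "pure (uconst (- ?c) * 1) 1 - pm_scale (- ?c) (pure 1 1) \<in> verma_relations \<nu>" by (rule pure_mod_relations(2))
  have 4: "pure (ugen x + uconst (- ?c)) 1 - (pure (ugen x) 1 + pure (uconst (- ?c)) 1) \<in> verma_relations \<nu>" by (rule pure_mod_relations(1))
  have "pure (ugen x + uconst (- ?c)) 1 = (pure (ugen x + uconst (- ?c)) 1 - (pure (ugen x) 1 + pure (uconst (- ?c)) 1))
     + (pure (1 * ugen x) 1 - pure 1 (?c * 1)) + (pure 1 (?c * 1) - pm_scale ?c (pure 1 1))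
     + (pure (uconst (- ?c) * 1) 1 - pm_scale (- ?c) (pure 1 1))"
    by (simp add: pm.scale_minus_left)
  also have "\<dots> \<in> verma_relations \<nu>" by (intro pm.span_add 1 2 3 4)
  finally show ?thesis by (simp add: annih_def uconst_minus)
qed

lemma mat_of_diff: "mat_of (x - y) $ i $ j = mat_of x $ i $ j - mat_of y $ i $ j"
  by transfer simp

lemma sl3_decomp: "\<exists>y\<in>borel_sl3. x = lscale (mat_of x $ 2 $ 1) (elem 2 1) + lscale (mat_of x $ 3 $ 2) (elem 3 2)
    + lscale (mat_of x $ 3 $ 1) (elem 3 1) + y"
proof -
  let ?f = "lscale (mat_of x $ 2 $ 1) (elem 2 1) + lscale (mat_of x $ 3 $ 2) (elem 3 2) + lscale (mat_of x $ 3 $ 1) (elem 3 1)"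
  have "x - ?f \<in> borel_sl3"
    unfolding borel_sl3_def by (simp add: mat_of_diff mat_of_simps mat_of_elem)
  then show ?thesis by (intro bexI[of _ "x - ?f"]) simp_all
qed

context sl3_involution begin

lemma lie_rep_act: "lie_rep (\<lambda>x. ract N K UNIV (t x))"
proof
  fix x y u
  show "ract N K UNIV (t (bracket x y)) u = ract N K UNIV (t x) (ract N K UNIV (t y) u) - ract N K UNIV (t y) (ract N K UNIV (t x) u)"
    using ract_bracket[OF admissible_UNIV, where N = N and K = K and x = "t x" and y = "t y" and u = u] by (simp add: t_bracket algebra_simps)
qed (simp_all add: ract_add ract_scale ract_add_left ract_scale_left t_add t_scale)

abbreviation "F1 \<equiv> ugen (t (elem 2 1))"
abbreviation "F2 \<equiv> ugen (t (elem 3 2))"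
abbreviation "F3 \<equiv> ugen (t (elem 3 1))"

lemma t_zero: "t 0 = 0" using t_add[of 0 0] by simp
lemma t_uminus: "t (- x) = - t x" using t_add[of x "- x"] t_zero by (simp add: eq_neg_iff_add_eq_0 add.commute)

lemma ugen_zero: "ugen 0 = 0" using ugen_add[of 0 0] by simp
lemma ugen_uminus: "ugen (- x) = - ugen x" using ugen_add[of "- x" x] by (simp add: eq_neg_iff_add_eq_0 ugen_zero)

lemma F_comm: "F2 * F1 = F1 * F2 + F3" "F3 * F1 = F1 * F3" "F3 * F2 = F2 * F3"
  using ugen_bracket[of "t (elem 2 1)" "t (elem 3 2)"] ugen_bracket[of "t (elem 2 1)" "t (elem 3 1)"]
    ugen_bracket[of "t (elem 3 2)" "t (elem 3 1)"]
  by (simp_all add: t_bracket[symmetric] bracket_elem t_zero t_uminus ugen_zero ugen_uminus)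

definition lowering_monomial :: "nat \<Rightarrow> nat \<Rightarrow> nat \<Rightarrow> sl3 uea" where
  "lowering_monomial i j l = F1 ^ i * F2 ^ j * F3 ^ l"

lemma F3_pow: "F3 * F1 ^ i = F1 ^ i * F3" "F3 * F2 ^ j = F2 ^ j * F3"
proof -
  show "F3 * F1 ^ i = F1 ^ i * F3"
    by (induction i) (simp_all add: mult.assoc F_comm(2)[THEN arg_cong[of _ _ "\<lambda>x. x * _"], unfolded mult.assoc])
  show "F3 * F2 ^ j = F2 ^ j * F3"
    by (induction j) (simp_all add: mult.assoc F_comm(3)[THEN arg_cong[of _ _ "\<lambda>x. x * _"], unfolded mult.assoc])
qed

lemma F2_pow: "F2 * F1 ^ Suc i = F1 ^ Suc i * F2 + of_nat (Suc i) * (F1 ^ i * F3)"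
proof (induction i)
  case 0 then show ?case by (simp add: F_comm)
next
  case (Suc i)
  have "F2 * F1 ^ Suc (Suc i) = (F1 * F2 + F3) * F1 ^ Suc i"
    by (simp add: F_comm(1)[symmetric] mult.assoc)
  also have "\<dots> = F1 * (F2 * F1 ^ Suc i) + F3 * F1 ^ Suc i" by (simp add: distrib_right mult.assoc)
  also have "\<dots> = F1 * (F1 ^ Suc i * F2 + of_nat (Suc i) * (F1 ^ i * F3)) + F1 ^ Suc i * F3"
    unfolding Suc F3_pow ..
  also have "F1 * (of_nat (Suc i) * (F1 ^ i * F3)) = of_nat (Suc i) * (F1 ^ Suc i * F3)"
    using mult_of_nat_commute[of "Suc i" F1] by (simp add: mult.assoc[symmetric])
  ultimately show ?case by (simp add: distrib_left distrib_right mult.assoc add.assoc add.commute)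
qed

lemma F_monomial: "F1 * lowering_monomial i j l = lowering_monomial (Suc i) j l" "F3 * lowering_monomial i j l = lowering_monomial i j (Suc l)"
  "F2 * lowering_monomial 0 j l = lowering_monomial 0 (Suc j) l"
  "F2 * lowering_monomial (Suc i) j l = lowering_monomial (Suc i) (Suc j) l + of_nat (Suc i) * lowering_monomial i j (Suc l)"
proof -
  show "F1 * lowering_monomial i j l = lowering_monomial (Suc i) j l" by (simp add: lowering_monomial_def mult.assoc)
  have "F3 * lowering_monomial i j l = (F3 * F1 ^ i) * F2 ^ j * F3 ^ l" by (simp add: lowering_monomial_def mult.assoc)
  also have "\<dots> = F1 ^ i * (F3 * F2 ^ j) * F3 ^ l" by (simp add: F3_pow mult.assoc)
  also have "\<dots> = lowering_monomial i j (Suc l)" by (simp add: F3_pow lowering_monomial_def mult.assoc)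
  finally show "F3 * lowering_monomial i j l = lowering_monomial i j (Suc l)" .
  show "F2 * lowering_monomial 0 j l = lowering_monomial 0 (Suc j) l" by (simp add: lowering_monomial_def mult.assoc)
  have "F2 * lowering_monomial (Suc i) j l = (F2 * F1 ^ Suc i) * F2 ^ j * F3 ^ l" by (simp add: lowering_monomial_def mult.assoc)
  also have "\<dots> = F1 ^ Suc i * F2 * F2 ^ j * F3 ^ l + of_nat (Suc i) * (F1 ^ i * (F3 * F2 ^ j) * F3 ^ l)"
    unfolding F2_pow by (simp only: distrib_right mult.assoc)
  also have "\<dots> = lowering_monomial (Suc i) (Suc j) l + of_nat (Suc i) * lowering_monomial i j (Suc l)"
    unfolding F3_pow by (simp add: lowering_monomial_def mult.assoc)
  finally show "F2 * lowering_monomial (Suc i) j l = lowering_monomial (Suc i) (Suc j) l + of_nat (Suc i) * lowering_monomial i j (Suc l)" .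
qed

text \<open>The element of \<open>U(g)\<close> that creates the vector \<open>c\<close> of the model from its highest weight vector (\<open>umap_pbw\<close>).\<close>

definition pbw :: "wvec \<Rightarrow> sl3 uea" where
  "pbw c = (\<Sum>(i, j, l)\<in>Poly_Mapping.keys c. uconst (lk c (i, j, l)) * lowering_monomial (nat i) (nat j) (nat l))"

lemma pbw_superset: "finite S \<Longrightarrow> Poly_Mapping.keys c \<subseteq> S \<Longrightarrow>
  pbw c = (\<Sum>(i, j, l)\<in>S. uconst (lk c (i, j, l)) * lowering_monomial (nat i) (nat j) (nat l))"
  unfolding pbw_def by (rule sum.mono_neutral_left) (auto simp: in_keys_iff)

lemma pbw_add: "pbw (u + v) = pbw u + pbw v"
proof -
  let ?S = "Poly_Mapping.keys u \<union> Poly_Mapping.keys v"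
  have "pbw (u + v) = (\<Sum>(i, j, l)\<in>?S. uconst (lk (u + v) (i, j, l)) * lowering_monomial (nat i) (nat j) (nat l))"
    by (rule pbw_superset) (auto simp: in_keys_iff lookup_add)
  also have "\<dots> = (\<Sum>(i, j, l)\<in>?S. uconst (lk u (i, j, l)) * lowering_monomial (nat i) (nat j) (nat l))
      + (\<Sum>(i, j, l)\<in>?S. uconst (lk v (i, j, l)) * lowering_monomial (nat i) (nat j) (nat l))"
    by (simp add: lookup_add uconst_add distrib_right sum.distrib case_prod_unfold)
  also have "\<dots> = pbw u + pbw v" by (subst (1 2) pbw_superset[of ?S]) auto
  finally show ?thesis .
qed

lemma pbw_scale: "pbw (pm_scale a u) = uconst a * pbw u"
proof -
  have "pbw (pm_scale a u) = (\<Sum>(i, j, l)\<in>Poly_Mapping.keys u. uconst (lk (pm_scale a u) (i, j, l)) * lowering_monomial (nat i) (nat j) (nat l))"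
    by (rule pbw_superset) (auto simp: in_keys_iff)
  then show ?thesis by (simp add: pbw_def sum_distrib_left uconst_mult mult.assoc case_prod_unfold)
qed

lemma pbw_single: "pbw (Poly_Mapping.single (int i, int j, int l) 1) = lowering_monomial i j l"
  by (subst pbw_superset[of "{(int i, int j, int l)}"]) auto

lemma pbw_zero: "pbw 0 = 0" by (simp add: pbw_def)

lemma single_vspace: "Poly_Mapping.single (int i, int j, int l) 1 \<in> vspace UNIV"
  by (rule vspaceI) (auto simp: lookup_single when_def)

definition pbw_span :: "weight \<Rightarrow> sl3 uea set" where
  "pbw_span \<nu> = {u. \<exists>c\<in>vspace UNIV. u - pbw c \<in> annih \<nu>}"

lemma pbw_spanI: "c \<in> vspace UNIV \<Longrightarrow> u - pbw c \<in> annih \<nu> \<Longrightarrow> u \<in> pbw_span \<nu>"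
  by (auto simp: pbw_span_def)

lemma span_monomial: "lowering_monomial i j l \<in> pbw_span \<nu>"
  by (rule pbw_spanI[OF single_vspace[of i j l]]) (simp add: pbw_single annih_zero)

lemma span_annih: "u \<in> annih \<nu> \<Longrightarrow> u \<in> pbw_span \<nu>"
  by (rule pbw_spanI[of 0]) (simp_all add: pbw_zero)

lemma span_add: "u \<in> pbw_span \<nu> \<Longrightarrow> v \<in> pbw_span \<nu> \<Longrightarrow> u + v \<in> pbw_span \<nu>"
proof -
  assume "u \<in> pbw_span \<nu>" "v \<in> pbw_span \<nu>"
  then obtain c d where cd: "c \<in> vspace UNIV" "d \<in> vspace UNIV" "u - pbw c \<in> annih \<nu>" "v - pbw d \<in> annih \<nu>"
    by (auto simp: pbw_span_def)
  have eq: "(u - pbw c) + (v - pbw d) = u + v - pbw (c + d)" by (simp add: pbw_add)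
  show ?thesis using annih_add[OF cd(3,4)] by (intro pbw_spanI[OF vspace_add[OF cd(1,2)]]) (simp only: eq)
qed

lemma span_scale: "u \<in> pbw_span \<nu> \<Longrightarrow> uconst a * u \<in> pbw_span \<nu>"
proof -
  assume "u \<in> pbw_span \<nu>"
  then obtain c where c: "c \<in> vspace UNIV" "u - pbw c \<in> annih \<nu>" by (auto simp: pbw_span_def)
  have "uconst a * (u - pbw c) = uconst a * u - pbw (pm_scale a c)" by (simp add: pbw_scale right_diff_distrib)
  then show ?thesis using annih_mult[OF c(2), of "uconst a"] by (intro pbw_spanI[OF vspace_scale[OF c(1), of a]]) simp
qed

lemma uconst_of_nat: "uconst (of_nat m) = of_nat m"
  by (induction m) (simp_all add: uconst_add)

lemma span_F_monomial: "F1 * lowering_monomial i j l \<in> pbw_span \<nu>" "F2 * lowering_monomial i j l \<in> pbw_span \<nu>" "F3 * lowering_monomial i j l \<in> pbw_span \<nu>"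
proof -
  show "F1 * lowering_monomial i j l \<in> pbw_span \<nu>" "F3 * lowering_monomial i j l \<in> pbw_span \<nu>" by (simp_all add: F_monomial span_monomial)
  show "F2 * lowering_monomial i j l \<in> pbw_span \<nu>"
  proof (cases i)
    case (Suc i')
    then show ?thesis using span_add[OF span_monomial span_scale[OF span_monomial, of "of_nat (Suc i')"]]
      by (simp only: F_monomial uconst_of_nat)
  qed (simp add: F_monomial span_monomial)
qed

lemma span_closed_F:
  assumes m: "\<And>i j l. f * lowering_monomial i j l \<in> pbw_span \<nu>" and u: "u \<in> pbw_span \<nu>"
  shows "f * u \<in> pbw_span \<nu>"
proof -
  obtain c where c: "c \<in> vspace UNIV" "u - pbw c \<in> annih \<nu>" using u by (auto simp: pbw_span_def)
  have "f * (\<Sum>(i, j, l)\<in>S. uconst (lk c (i, j, l)) * lowering_monomial (nat i) (nat j) (nat l)) \<in> pbw_span \<nu>" if "finite S" for S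
    using that
  proof (induction S rule: finite_induct)
    case empty then show ?case by (simp add: span_annih annih_zero)
  next
    case (insert k S)
    obtain i j l where k: "k = (i, j, l)" by (cases k rule: prod_cases3)
    have "f * (uconst (lk c k) * lowering_monomial (nat i) (nat j) (nat l)) = uconst (lk c k) * (f * lowering_monomial (nat i) (nat j) (nat l))"
      using uconst_commute[of "lk c k" f] by (simp add: mult.assoc[symmetric])
    then have "f * (uconst (lk c k) * lowering_monomial (nat i) (nat j) (nat l)) \<in> pbw_span \<nu>" using span_scale[OF m] by simp
    then show ?case using insert by (simp add: k distrib_left span_add)
  qed
  then have "f * pbw c \<in> pbw_span \<nu>" by (simp add: pbw_def)
  moreover have "f * (u - pbw c) \<in> pbw_span \<nu>" by (intro span_annih annih_mult c)
  ultimately have "f * pbw c + f * (u - pbw c) \<in> pbw_span \<nu>" by (rule span_add)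
  then show ?thesis by (simp add: distrib_left[symmetric])
qed

lemma span_ugen_one: "ugen x \<in> pbw_span \<nu>"
proof -
  obtain y where y: "y \<in> borel_sl3" and tx: "t x = lscale (mat_of (t x) $ 2 $ 1) (elem 2 1) + lscale (mat_of (t x) $ 3 $ 2) (elem 3 2)
    + lscale (mat_of (t x) $ 3 $ 1) (elem 3 1) + y" using sl3_decomp[of "t x"] by blast
  have "x = t (t x)" by simp
  also have "\<dots> = lscale (mat_of (t x) $ 2 $ 1) (t (elem 2 1)) + lscale (mat_of (t x) $ 3 $ 2) (t (elem 3 2))
    + lscale (mat_of (t x) $ 3 $ 1) (t (elem 3 1)) + t y"
    by (subst tx) (simp add: t_add t_scale)
  finally have "ugen x = uconst (mat_of (t x) $ 2 $ 1) * F1 + uconst (mat_of (t x) $ 3 $ 2) * F2 + uconst (mat_of (t x) $ 3 $ 1) * F3 + ugen (t y)"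
    using ugen_add ugen_scale by metis
  moreover have "ugen (t y) \<in> pbw_span \<nu>"
  proof -
    have "ugen (t y) - uconst (\<nu> (cartan_part (t y))) \<in> annih \<nu>" by (rule annih_borel[OF t_borel[OF y]])
    moreover have "uconst (\<nu> (cartan_part (t y))) \<in> pbw_span \<nu>"
      using span_scale[OF span_monomial[of 0 0 0]] by (simp add: lowering_monomial_def)
    ultimately have "(ugen (t y) - uconst (\<nu> (cartan_part (t y)))) + uconst (\<nu> (cartan_part (t y))) \<in> pbw_span \<nu>"
      by (rule span_add[OF span_annih])
    then show ?thesis by simp
  qed
  moreover have "F1 \<in> pbw_span \<nu>" "F2 \<in> pbw_span \<nu>" "F3 \<in> pbw_span \<nu>"
    using span_F_monomial[of 0 0 0] by (simp_all add: lowering_monomial_def)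
  ultimately show ?thesis by (simp add: span_add span_scale)
qed

text \<open>Induction on the length of the monomial. For a monomial \<open>f m\<close>, \<open>x f m = f (x m) + [x, f] m\<close>; the induction hypothesis
  covers \<open>x m\<close> and \<open>[x, f] m\<close>, and the span is closed under \<open>f\<close>.\<close>

lemma span_ugen_monomial: "ugen x * lowering_monomial i j l \<in> pbw_span \<nu>"
proof (induction "i + j + l" arbitrary: i j l x rule: less_induct)
  case less
  have step: "ugen x * (ugen f * lowering_monomial i' j' l') \<in> pbw_span \<nu>"
    if IH: "\<And>x. ugen x * lowering_monomial i' j' l' \<in> pbw_span \<nu>" and f: "\<And>u. u \<in> pbw_span \<nu> \<Longrightarrow> ugen f * u \<in> pbw_span \<nu>" for f i' j' l'
  proof -
    have "ugen x * (ugen f * lowering_monomial i' j' l') = ugen f * (ugen x * lowering_monomial i' j' l') + ugen (bracket x f) * lowering_monomial i' j' l'"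
      using ugen_bracket[of x f] by (simp add: mult.assoc[symmetric] distrib_right)
    then show ?thesis using IH f span_add by simp
  qed
  note F = span_closed_F[OF span_F_monomial(1)] span_closed_F[OF span_F_monomial(2)] span_closed_F[OF span_F_monomial(3)]
  show ?case
  proof (cases i)
    case (Suc i')
    have "ugen x * (F1 * lowering_monomial i' j l) \<in> pbw_span \<nu>" by (rule step[OF less F(1)]) (use Suc in auto)
    then show ?thesis by (simp add: F_monomial Suc)
  next
    case i: 0
    show ?thesis
    proof (cases j)
      case (Suc j')
      have "ugen x * (F2 * lowering_monomial 0 j' l) \<in> pbw_span \<nu>" by (rule step[OF less F(2)]) (use Suc i in auto)
      then show ?thesis by (simp add: F_monomial Suc i)
    next
      case j: 0
      show ?thesis
      proof (cases l)
        case (Suc l')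
        have "ugen x * (F3 * lowering_monomial 0 0 l') \<in> pbw_span \<nu>" by (rule step[OF less F(3)]) (use Suc i j in auto)
        then show ?thesis by (simp add: F_monomial Suc i j)
      next
        case 0
        then show ?thesis using span_ugen_one i j by (simp add: lowering_monomial_def)
      qed
    qed
  qed
qed

lemma span_all: "u \<in> pbw_span \<nu>"
proof (induction u rule: uea_induct)
  case 1 show ?case using span_monomial[of 0 0 0] by (simp add: lowering_monomial_def)
qed (auto intro: span_add span_scale span_closed_F[OF span_ugen_monomial])

text \<open>Half of the Poincare--Birkhoff--Witt theorem; linear independence of the monomials comes from the model.\<close>

lemma verma_spanned: "\<exists>c\<in>vspace UNIV. p - pure (pbw c) 1 \<in> verma_relations \<nu>"
proof (induction p rule: poly_mapping_single_induct)
  case (1 k b)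
  obtain u z where k: "k = (u, z)" by (cases k)
  obtain c where c: "c \<in> vspace UNIV" "u - pbw c \<in> annih \<nu>" using span_all[of u \<nu>] by (auto simp: pbw_span_def)
  have e: "Poly_Mapping.single k b = pm_scale b (pure u (z * 1))" by (simp add: k pure_def pm_scale_single)
  let ?d = "pm_scale (b * z) c"
  have 1: "pm_scale b (pure u (z * 1) - pm_scale z (pure u 1)) \<in> verma_relations \<nu>" by (intro pm.span_scale pure_mod_relations)
  have 2: "pure ((u - pbw c) + pbw c) 1 - (pure (u - pbw c) 1 + pure (pbw c) 1) \<in> verma_relations \<nu>" by (rule pure_mod_relations)
  have 3: "pure (u - pbw c) 1 \<in> verma_relations \<nu>" using c by (simp add: annih_def)
  have 23: "pm_scale (b * z) ((pure ((u - pbw c) + pbw c) 1 - (pure (u - pbw c) 1 + pure (pbw c) 1)) + pure (u - pbw c) 1) \<in> verma_relations \<nu>"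
    by (intro pm.span_scale pm.span_add 2 3)
  have 4: "pm_scale (- 1) (pure (uconst (b * z) * pbw c) 1 - pm_scale (b * z) (pure (pbw c) 1)) \<in> verma_relations \<nu>"
    by (intro pm.span_scale pure_mod_relations)
  have "Poly_Mapping.single k b - pure (pbw ?d) 1 = pm_scale b (pure u (z * 1) - pm_scale z (pure u 1))
    + pm_scale (b * z) ((pure ((u - pbw c) + pbw c) 1 - (pure (u - pbw c) 1 + pure (pbw c) 1)) + pure (u - pbw c) 1)
    + pm_scale (- 1) (pure (uconst (b * z) * pbw c) 1 - pm_scale (b * z) (pure (pbw c) 1))"
    unfolding e pbw_scale by (rule poly_mapping_eqI) (simp add: lookup_add lookup_minus algebra_simps)
  also have "\<dots> \<in> verma_relations \<nu>" by (intro pm.span_add 1 23 4)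
  finally show ?case using vspace_scale[OF c(1)] by blast
next
  case (2 p q)
  then obtain c d where cd: "c \<in> vspace UNIV" "p - pure (pbw c) 1 \<in> verma_relations \<nu>" "d \<in> vspace UNIV" "q - pure (pbw d) 1 \<in> verma_relations \<nu>" by blast
  have 3: "pm_scale (- 1) (pure (pbw c + pbw d) 1 - (pure (pbw c) 1 + pure (pbw d) 1)) \<in> verma_relations \<nu>" by (intro pm.span_scale pure_mod_relations)
  have "p + q - pure (pbw (c + d)) 1 = (p - pure (pbw c) 1) + (q - pure (pbw d) 1) + pm_scale (- 1) (pure (pbw c + pbw d) 1 - (pure (pbw c) 1 + pure (pbw d) 1))"
    unfolding pbw_add by (simp add: pm.scale_minus_left algebra_simps)
  also have "\<dots> \<in> verma_relations \<nu>" by (intro pm.span_add cd 3)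
  finally show ?case using vspace_add[OF cd(1,3)] by blast
qed

end

section \<open>Verma modules and their models\<close>

lemma roots_cartan_part: "root_alpha (cartan_part x) = root_alpha x" "root_beta (cartan_part x) = root_beta x"
  "wt_char N K (cartan_part x) = wt_char N K x"
  by (simp_all add: root_alpha_def root_beta_def wt_char_def mat_of_cartan_part)

text \<open>The commutator of \<open>e\<^sub>\<alpha>\<close> and \<open>e\<^sub>\<beta>\<close> also kills a singular vector, so the whole Borel subalgebra acts on it by its
  weight.\<close>

lemma singular_eigenvector:
  assumes s: "singular n k UNIV c" and h: "homog p q c" and x: "x \<in> borel_sl3"
  shows "sact n k UNIV x c = pm_scale (wt_char (of_int n) (of_int k) x - of_int p * root_alpha x - of_int q * root_beta x) c"
proof -
  interpret model n k UNIV by unfold_locales (rule admissible_UNIV)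
  have e: "E1 c = 0" "E2 c = 0" using s by (auto simp: singular_def)
  then have e3: "E3 c = 0" using E_comm(1)[of c] by simp
  have "sact n k UNIV x c = pm_scale (mat_of x $ 1 $ 2) (E1 c) + pm_scale (mat_of x $ 2 $ 3) (E2 c)
      + pm_scale (mat_of x $ 1 $ 3) (E3 c) + sact n k UNIV (cartan_part x) c"
    using arg_cong[OF borel_decomp[OF x], of "\<lambda>y. sact n k UNIV y c"] by (simp only: ract_add_left ract_scale_left)
  also have "\<dots> = sact n k UNIV (cartan_part x) c" by (simp add: e e3)
  also have "\<dots> = pm_scale (wt_char (of_int n) (of_int k) x - of_int p * root_alpha x - of_int q * root_beta x) c"
  proof (rule wvec_eqI)
    fix i j l
    show "lk (sact n k UNIV (cartan_part x) c) (i, j, l) = lk (pm_scale (wt_char (of_int n) (of_int k) x - of_int p * root_alpha x - of_int q * root_beta x) c) (i, j, l)"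
      using homogD[OF h, of i l j] by (cases "i + l = p \<and> j + l = q")
        (auto simp: lookup_ract lookup_act_cartan[OF cartan_part_cartan] roots_cartan_part)
  qed
  finally show ?thesis .
qed

lemma singular_topv: "0 \<in> R \<Longrightarrow> singular n k R topv"
proof -
  assume R: "0 \<in> R"
  have o: "a + 1 = 0 \<Longrightarrow> of_int a + 1 = (0 :: complex)" for a :: int by (metis of_int_0 of_int_1 of_int_add)
  have "sact n k R (elem 1 2) topv = 0" by (rule wvec_eqI) (auto simp: lookup_op lookup_topv o)
  moreover have "sact n k R (elem 2 3) topv = 0" by (rule wvec_eqI) (auto simp: lookup_op lookup_topv o)
  ultimately show ?thesis using topv_vspace[OF R] by (simp add: singular_def)
qed

lemma topv_eigenvector: "x \<in> borel_sl3 \<Longrightarrow> sact n k UNIV x topv = pm_scale (wt_char (of_int n) (of_int k) x) topv"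
  using singular_eigenvector[OF singular_topv[of UNIV n k] homog_topv, of x] by simp

text \<open>The representation axioms hold for the induced module because they hold in the model into which it embeds.\<close>

lemma lie_module_pullback:
  assumes l: "lin_module s M" and l': "lie_module s M'" and f: "module_hom s M M' f" and inj: "inj_on f (mcarrier M)"
    and closed: "\<And>x y. x \<in> s \<Longrightarrow> y \<in> s \<Longrightarrow> x + y \<in> s \<and> bracket x y \<in> s" "\<And>c x. x \<in> s \<Longrightarrow> lscale c x \<in> s"
  shows "lie_module s M"
proof -
  interpret M: lin_module s M by fact
  interpret L: lie_module s M' by fact
  note f' = f[unfolded module_hom_def]
  have fc: "u \<in> mcarrier M \<Longrightarrow> f u \<in> mcarrier M'" for u using f' by blast
  have fm: "u \<in> mcarrier M \<Longrightarrow> v \<in> mcarrier M \<Longrightarrow> f (madd M u v) = madd M' (f u) (f v)"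
    "u \<in> mcarrier M \<Longrightarrow> f (mscale M c u) = mscale M' c (f u)"
    "x \<in> s \<Longrightarrow> u \<in> mcarrier M \<Longrightarrow> f (mact M x u) = mact M' x (f u)" for u v c x using f' by blast+
  have eqI: "f u = f v \<Longrightarrow> u \<in> mcarrier M \<Longrightarrow> v \<in> mcarrier M \<Longrightarrow> u = v" for u v using inj_onD[OF inj] by blast
  show ?thesis
  proof (rule lie_module.intro; (rule M.zero_closed M.add_closed M.scale_closed M.act_closed M.add_assoc
      M.add_commute M.add_zero M.add_inverse M.scale_add_right M.scale_add_left M.scale_scale M.scale_one
      M.act_add M.act_scale; assumption)?)
    fix x y u assume a: "x \<in> s" "y \<in> s" "u \<in> mcarrier M"
    show "mact M (x + y) u = madd M (mact M x u) (mact M y u)"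
      by (rule eqI) (simp_all add: a fm closed fc L.act_add_left)
    show "madd M (mact M (bracket x y) u) (mact M y (mact M x u)) = mact M x (mact M y u)"
      by (rule eqI) (simp_all add: a fm closed fc L.act_bracket)
  next
    fix x u c assume a: "x \<in> s" "u \<in> mcarrier M"
    show "mact M (lscale c x) u = mscale M c (mact M x u)"
      by (rule eqI) (simp_all add: a fm closed fc L.act_scale_left)
  qed
qed

context sl3_involution begin

abbreviation "umap n k \<equiv> lie_rep.uea_act (\<lambda>x. sact n k UNIV (t x))"
abbreviation "tmap n k \<equiv> lie_rep.tensor_map (\<lambda>x. sact n k UNIV (t x))"

lemma umap_vspace:
  assumes w: "w \<in> vspace UNIV"
  shows "umap n k u w \<in> vspace UNIV"
proof -
  interpret lie_rep "\<lambda>x. sact n k UNIV (t x)" by (rule lie_rep_act)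
  show ?thesis
    by (induction u rule: uea_induct)
      (simp_all add: uea_act_one w uea_act_add_left vspace_add uea_act_mult uea_act_uconst vspace_scale uea_act_ugen vspace_ract)
qed

lemma tmap_vspace:
  assumes w: "w \<in> vspace UNIV"
  shows "tmap n k w p \<in> vspace UNIV"
proof -
  interpret lie_rep "\<lambda>x. sact n k UNIV (t x)" by (rule lie_rep_act)
  show ?thesis unfolding tensor_map_def lext_def
    by (intro vspace_sum vspace_scale) (auto intro!: vspace_scale umap_vspace w)
qed

lemma umap_monomial: "umap n k (lowering_monomial i j l) topv = Poly_Mapping.single (int i, int j, int l) 1"
proof -
  interpret lie_rep "\<lambda>x. sact n k UNIV (t x)" by (rule lie_rep_act)
  have 3: "uea_act (F3 ^ l) topv = Poly_Mapping.single (0, 0, int l) 1"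
    by (induction l) (simp_all add: uea_act_one topv_def uea_act_mult uea_act_ugen ract_single add.commute)
  have 2: "uea_act (F2 ^ j) (Poly_Mapping.single (0, 0, int l) 1) = Poly_Mapping.single (0, int j, int l) 1"
    by (induction j) (simp_all add: uea_act_one uea_act_mult uea_act_ugen ract_single add.commute)
  have 1: "uea_act (F1 ^ i) (Poly_Mapping.single (0, int j, int l) 1) = Poly_Mapping.single (int i, int j, int l) 1"
    by (induction i) (simp_all add: uea_act_one uea_act_mult uea_act_ugen ract_single add.commute)
  show ?thesis by (simp add: lowering_monomial_def uea_act_mult 1 2 3)
qed

lemma umap_pbw: "c \<in> vspace UNIV \<Longrightarrow> umap n k (pbw c) topv = c"
proof -
  assume c: "c \<in> vspace UNIV"
  interpret lie_rep "\<lambda>x. sact n k UNIV (t x)" by (rule lie_rep_act)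
  have z: "uea_act 0 topv = 0" using uea_act_uconst[of 0 topv] by simp
  have "uea_act (\<Sum>(i, j, l)\<in>S. uconst (lk c (i, j, l)) * lowering_monomial (nat i) (nat j) (nat l)) topv
     = (\<Sum>k\<in>S. pm_scale (lk c k) (Poly_Mapping.single k 1))" if "finite S" "S \<subseteq> Poly_Mapping.keys c" for S
    using that
  proof (induction S rule: finite_induct)
    case (insert \<kappa> S)
    obtain i j l where k: "\<kappa> = (i, j, l)" by (cases \<kappa> rule: prod_cases3)
    have "lk c (i, j, l) \<noteq> 0" using insert k by (auto simp: in_keys_iff)
    then have "0 \<le> i" "0 \<le> j" "0 \<le> l" using vspaceD[OF c] by (meson not_le)+
    then have "uea_act (uconst (lk c \<kappa>) * lowering_monomial (nat i) (nat j) (nat l)) topv = pm_scale (lk c \<kappa>) (Poly_Mapping.single \<kappa> 1)"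
      by (simp add: uea_act_mult umap_monomial uea_act_uconst k)
    then show ?case using insert by (simp add: k uea_act_add_left)
  qed (simp add: z)
  from this[of "Poly_Mapping.keys c"] show ?thesis using poly_mapping_decomp[of c] by (simp add: pbw_def)
qed

text \<open>Modulo the relations an element is \<open>pbw c \<otimes> 1\<close> for some \<open>c\<close>, and the map recovers \<open>c\<close>.\<close>

lemma tmap_kernel:
  assumes \<nu>: "has_top_weight t (of_int n) (of_int k) \<nu>"
  shows "tmap n k topv p = 0 \<longleftrightarrow> p \<in> verma_relations \<nu>"
proof
  interpret lie_rep "\<lambda>x. sact n k UNIV (t x)" by (rule lie_rep_act)
  have van: "tensor_map topv r = 0" if "r \<in> verma_relations \<nu>" for r
    using tensor_map_relations[OF lie_rep_act _ that, of "of_int n" "of_int k" topv] \<nu> topv_eigenvector t_borel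
    by (simp add: has_top_weight_def)
  then show "p \<in> verma_relations \<nu> \<Longrightarrow> tensor_map topv p = 0" .
  assume z: "tensor_map topv p = 0"
  obtain c where c: "c \<in> vspace UNIV" "p - pure (pbw c) 1 \<in> verma_relations \<nu>" using verma_spanned by blast
  have "tensor_map topv (p - pure (pbw c) 1) = 0" by (rule van[OF c(2)])
  then have "c = 0" using z by (simp add: tensor_map_lin tensor_map_pure umap_pbw[OF c(1)])
  then have "pbw c = 0" by (simp add: pbw_zero)
  moreover have "pure 0 1 \<in> verma_relations \<nu>" using annih_zero by (simp add: annih_def)
  ultimately show "p \<in> verma_relations \<nu>" using span_trans[OF c(2)] by simp
qed

lemma tmap_hom:
  assumes w: "w \<in> vspace UNIV"
  shows "module_hom UNIV (free_tensor_module (weight_module \<nu>)) (vmod t (of_int n) (of_int k) UNIV) (tmap n k w)"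
proof -
  interpret lie_rep "\<lambda>x. sact n k UNIV (t x)" by (rule lie_rep_act)
  show ?thesis unfolding module_hom_def
    by (auto simp: tensor_map_lin tmap_vspace[OF w] tensor_map_left_mult uea_act_ugen)
qed

lemma lie_vmod: "lie_module s (vmod t (of_int n) (of_int k) UNIV)"
  by (rule lie_module_vmod[OF admissible_UNIV])

lemma verma_iso:
  assumes \<nu>: "has_top_weight t (of_int n) (of_int k) \<nu>"
  obtains g where "module_hom UNIV (verma \<nu>) (vmod t (of_int n) (of_int k) UNIV) g" "bij_betw g (mcarrier (verma \<nu>)) (vspace UNIV)"
proof -
  interpret lie_rep "\<lambda>x. sact n k UNIV (t x)" by (rule lie_rep_act)
  interpret sub_lin_module UNIV "free_tensor_module (weight_module \<nu>)" "verma_relations \<nu>" by (rule sub_free)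
  have im: "tensor_map topv ` mcarrier (free_tensor_module (weight_module \<nu>)) = mcarrier (vmod t (of_int n) (of_int k) UNIV)"
  proof -
    have "c \<in> range (tensor_map topv)" if "c \<in> vspace UNIV" for c
      by (rule image_eqI[of _ _ "pure (pbw c) 1"]) (simp_all add: tensor_map_pure umap_pbw[OF that])
    then show ?thesis using tmap_vspace[OF topv_vspace] by auto
  qed
  obtain g where "module_hom UNIV Q (vmod t (of_int n) (of_int k) UNIV) g"
    "bij_betw g (mcarrier Q) (mcarrier (vmod t (of_int n) (of_int k) UNIV))"
    by (rule first_iso[OF tmap_hom[OF topv_vspace] lie_module_lin[OF lie_vmod] im]) (simp_all add: tmap_kernel[OF \<nu>])
  then show ?thesis using that[of g] by (simp add: verma_eq)
qed

lemma lie_module_verma: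
  assumes \<nu>: "has_top_weight t (of_int n) (of_int k) \<nu>"
  shows "lie_module UNIV (verma \<nu>)"
proof -
  obtain g where g: "module_hom UNIV (verma \<nu>) (vmod t (of_int n) (of_int k) UNIV) g" "bij_betw g (mcarrier (verma \<nu>)) (vspace UNIV)"
    using verma_iso[OF \<nu>] .
  have "lin_module UNIV (verma \<nu>)"
    unfolding verma_eq by (rule sub_lin_module.Q_lin_module[OF sub_free])
  then show ?thesis
    by (rule lie_module_pullback[OF _ lie_vmod g(1)]) (use g(2) in \<open>auto simp: bij_betw_def\<close>)
qed

end

interpretation trivial: sl3_involution "\<lambda>x. x" by unfold_locales simp_all

lemma wt_char_shift:
  "wt_char (of_int (n - 2 * p + q)) (of_int (k + p - 2 * q)) x = wt_char (of_int n) (of_int k) x - of_int p * root_alpha x - of_int q * root_beta x"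
proof -
  have t: "mat_of x $ 2 $ 2 = - mat_of x $ 1 $ 1 - mat_of x $ 3 $ 3"
    using mat_of_trace[of x] by (simp add: eq_neg_iff_add_eq_0 algebra_simps)
  show ?thesis unfolding wt_char_def root_alpha_def root_beta_def t by (simp add: algebra_simps)
qed

text \<open>The map \<open>pbw c \<mapsto> pbw c w\<close> commutes with the action since the relations of the induced module of the source also hold for
  \<open>w\<close>.\<close>

lemma exists_embedding:
  assumes s: "singular n k UNIV w" and h: "homog p q w" and lead: "lk w (p, q, 0) = 1"
  obtains \<iota> where "verma_embedding (n - 2 * p + q) (k + p - 2 * q) n k \<iota> w p q"
proof -
  define n' k' where nk: "n' = n - 2 * p + q" "k' = k + p - 2 * q"
  define \<nu> where "\<nu> = wt_char (of_int n') (of_int k')"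
  have \<nu>: "has_top_weight (\<lambda>x. x) (of_int n') (of_int k') \<nu>" by (simp add: has_top_weight_def \<nu>_def roots_cartan_part)
  interpret S: lie_rep "\<lambda>x. sact n' k' UNIV x" by (rule trivial.lie_rep_act)
  interpret T: lie_rep "\<lambda>x. sact n k UNIV x" by (rule trivial.lie_rep_act)
  have w: "w \<in> vspace UNIV" using s by (simp add: singular_def)
  define \<iota> where "\<iota> c = T.uea_act (trivial.pbw c) w" for c
  have van: "T.tensor_map w r = 0" if "r \<in> verma_relations \<nu>" for r
  proof (rule tensor_map_relations[OF trivial.lie_rep_act _ that])
    fix x assume x: "x \<in> borel_sl3"
    show "sact n k UNIV x w = pm_scale (\<nu> (cartan_part x)) w"
      unfolding singular_eigenvector[OF s h x] \<nu>_def nk roots_cartan_part wt_char_shift ..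
  qed
  have "verma_embedding n' k' n k \<iota> w p q"
  proof
    fix c u v :: wvec and a x
    show "\<iota> c \<in> vspace UNIV" unfolding \<iota>_def by (rule trivial.umap_vspace[OF w])
    show "\<iota> (u + v) = \<iota> u + \<iota> v" unfolding \<iota>_def trivial.pbw_add T.uea_act_add_left ..
    show "\<iota> (pm_scale a u) = pm_scale a (\<iota> u)" unfolding \<iota>_def trivial.pbw_scale T.uea_act_mult T.uea_act_uconst ..
    show "homog p q w" "lk w (p, q, 0) = 1" by fact+
    have "trivial.pbw topv = 1" using trivial.pbw_single[of 0 0 0] by (simp add: topv_def trivial.lowering_monomial_def)
    then show "\<iota> topv = w" by (simp add: \<iota>_def T.uea_act_one)
    assume u: "u \<in> vspace UNIV"
    let ?p = "pure (ugen x * trivial.pbw u) 1 - pure (trivial.pbw (sact n' k' UNIV x u)) 1"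
    have "S.tensor_map topv ?p = 0"
      by (simp add: S.tensor_map_lin S.tensor_map_pure S.uea_act_mult S.uea_act_ugen trivial.umap_pbw u vspace_ract)
    then have "?p \<in> verma_relations \<nu>" using trivial.tmap_kernel[OF \<nu>] by blast
    then have "T.tensor_map w ?p = 0" by (rule van)
    then show "\<iota> (sact n' k' UNIV x u) = sact n k UNIV x (\<iota> u)"
      by (simp add: \<iota>_def T.tensor_map_lin T.tensor_map_pure T.uea_act_mult T.uea_act_ugen)
  qed
  then show ?thesis using that unfolding nk by blast
qed

lemma eigenvector_homog:
  assumes c: "c \<in> vspace UNIV"
    and e: "sact n k UNIV hsep c = pm_scale (wt_char (of_int (n - 2 * p + q)) (of_int (k + p - 2 * q)) hsep) c"
  shows "homog p q c"
  unfolding homog_def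
proof (intro allI impI)
  fix i j l assume nz: "lk c (i, j, l) \<noteq> 0"
  have "lk (sact n k UNIV hsep c) (i, j, l) = wt_char (of_int (n - 2 * p + q)) (of_int (k + p - 2 * q)) hsep * lk c (i, j, l)"
    unfolding e by simp
  then have "of_int (i + l) + of_int (j + l) * \<i> = of_int p + of_int q * \<i>"
    unfolding lookup_ract_hsep[OF c] wt_char_shift hsep_roots mult_cancel_right using nz by (simp add: algebra_simps)
  then show "i + l = p \<and> j + l = q" unfolding sep_inj .
qed

text \<open>Singular vectors of a given weight in the full model form at most a line, since the coordinate at \<open>l = 0\<close> determines the
  others.\<close>

lemma singular_unique:
  assumes "singular n k UNIV w" "homog p q w" "lk w (p, q, 0) = 1" and c: "singular n k UNIV c" "homog p q c"
  shows "c = pm_scale (lk c (p, q, 0)) w"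
proof (rule ccontr)
  assume ne: "c \<noteq> pm_scale (lk c (p, q, 0)) w"
  let ?d = "c + pm_scale (- lk c (p, q, 0)) w"
  have "singular n k UNIV ?d" using assms unfolding singular_def by (simp only: vspace_add vspace_scale ract_add ract_scale) simp
  moreover have "homog p q ?d" unfolding homog_def
  proof (intro allI impI, rule ccontr)
    fix i j l assume "lk ?d (i, j, l) \<noteq> 0" and no: "\<not> (i + l = p \<and> j + l = q)"
    then show False using homogD[OF assms(2) no] homogD[OF c(2) no] by (simp add: lookup_add lookup_minus)
  qed
  moreover have "?d \<noteq> 0" using ne by (simp add: pm.scale_minus_left)
  ultimately have "lk ?d (p, q, 0) \<noteq> 0" by (intro singular_nz_coeff(1)[of n k UNIV]) auto
  then show False using assms(3) by (simp add: lookup_add lookup_minus)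
qed

section \<open>A singular vector for the non-simple positive root\<close>

text \<open>Absolute values of the coordinates of a singular vector of weight \<open>\<nu> - b (\<alpha> + \<beta>)\<close>; in closed form the binomial
  coefficient \<open>b\<close> over \<open>l\<close> times the rising factorial of \<open>a\<close>. The recursion is the one of \<open>singular_recursion\<close>.\<close>

primrec sing_coeff :: "nat \<Rightarrow> nat \<Rightarrow> nat \<Rightarrow> real" where
  "sing_coeff a b 0 = 1"
| "sing_coeff a b (Suc l) = (real a + real l) * (real b - real l) / (real l + 1) * sing_coeff a b l"

lemma sing_coeff_nonneg: "l \<le> b \<Longrightarrow> 0 \<le> sing_coeff a b l"
  by (induction l) auto

lemma sing_coeff_zero: "b < l \<Longrightarrow> sing_coeff a b l = 0"
proof (induction l)
  case (Suc l)
  then show ?case by (cases "l = b") auto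
qed simp

definition sing_coeff_int :: "nat \<Rightarrow> nat \<Rightarrow> int \<Rightarrow> complex" where
  "sing_coeff_int a b l = (if 0 \<le> l then (- 1) ^ nat l * of_real (sing_coeff a b (nat l)) else 0)"

lemma sing_coeff_int_rec:
  "(of_int l + 1) * sing_coeff_int a b (l + 1) = - (of_nat a + of_int l) * (of_nat b - of_int l) * sing_coeff_int a b l"
proof (cases "0 \<le> l")
  case True
  define m where "m = nat l"
  have l: "l = int m" using True by (simp add: m_def)
  have n: "nat (int m + 1) = Suc m" by simp
  have z: "real m + 1 \<noteq> 0" by linarith
  have "(real m + 1) * sing_coeff a b (Suc m) = (real a + real m) * (real b - real m) * sing_coeff a b m"
    using z by simp
  then have "complex_of_real ((real m + 1) * sing_coeff a b (Suc m)) = complex_of_real ((real a + real m) * (real b - real m) * sing_coeff a b m)" by simp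
  then have "(of_nat m + 1) * complex_of_real (sing_coeff a b (Suc m)) = (of_nat a + of_nat m) * (of_nat b - of_nat m) * complex_of_real (sing_coeff a b m)" by (simp del: sing_coeff.simps)
  then have "(- 1) ^ Suc m * ((of_nat m + 1) * complex_of_real (sing_coeff a b (Suc m))) = (- 1) ^ Suc m * ((of_nat a + of_nat m) * (of_nat b - of_nat m) * complex_of_real (sing_coeff a b m))" by simp
  then show ?thesis unfolding l sing_coeff_int_def n by (simp del: sing_coeff.simps add: algebra_simps)
next
  case False
  then show ?thesis by (cases "l = - 1") (auto simp: sing_coeff_int_def)
qed

definition sing_vec :: "nat \<Rightarrow> nat \<Rightarrow> wvec" where
  "sing_vec a b = (\<Sum>l\<le>b. Poly_Mapping.single (int b - int l, int b - int l, int l) (sing_coeff_int a b (int l)))"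

lemma lookup_sing_vec: "lk (sing_vec a b) (i, j, l) = (if i = int b - l \<and> j = int b - l then sing_coeff_int a b l else 0)"
proof -
  have "lk (sing_vec a b) (i, j, l) = (\<Sum>m\<le>b. if int m = l \<and> i = int b - l \<and> j = int b - l then sing_coeff_int a b l else 0)"
    unfolding sing_vec_def lookup_sum by (intro sum.cong) (auto simp: lookup_single when_def)
  also have "\<dots> = (if i = int b - l \<and> j = int b - l then sing_coeff_int a b l else 0)"
  proof (cases "0 \<le> l \<and> l \<le> int b \<and> i = int b - l \<and> j = int b - l")
    case True
    have "(\<Sum>m\<le>b. if int m = l \<and> i = int b - l \<and> j = int b - l then sing_coeff_int a b l else 0)
       = (\<Sum>m\<le>b. if m = nat l then sing_coeff_int a b l else 0)" using True by (intro sum.cong) auto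
    moreover have "nat l \<le> b" using True by linarith
    ultimately show ?thesis using True by simp
  next
    case False
    then have z: "sing_coeff_int a b l = 0" if "i = int b - l \<and> j = int b - l"
      using that sing_coeff_zero[of b "nat l" a] by (auto simp: sing_coeff_int_def)
    then show ?thesis using False by (auto intro!: sum.neutral)
  qed
  finally show ?thesis .
qed

lemma homog_sing_vec: "homog (int b) (int b) (sing_vec a b)"
  by (auto simp: homog_def lookup_sing_vec split: if_splits)

lemma sing_vec_lead: "lk (sing_vec a b) (int b, int b, 0) = 1"
  by (simp add: lookup_sing_vec sing_coeff_int_def)

lemma sing_vec_vspace: "sing_vec a b \<in> vspace UNIV"
proof (rule vspaceI)
  fix i j l :: int assume "i < 0 \<or> j < 0 \<or> l < 0 \<or> j \<notin> UNIV"
  then show "lk (sing_vec a b) (i, j, l) = 0"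
    using sing_coeff_zero[of b "nat l" a] by (auto simp: lookup_sing_vec sing_coeff_int_def)
qed

lemma singular_sing_vec: "singular (- int a) (int a + int b) UNIV (sing_vec a b)"
  unfolding singular_def
proof (intro conjI sing_vec_vspace wvec_eqI)
  fix i j l :: int
  note rec = sing_coeff_int_rec[of l a b]
  have c: "i + 1 = int b - l \<longleftrightarrow> i = int b - (l + 1)" "j - 1 = int b - (l + 1) \<longleftrightarrow> j = int b - l"
     "i - 1 = int b - (l + 1) \<longleftrightarrow> i = int b - l" "j + 1 = int b - l \<longleftrightarrow> j = int b - (l + 1)" by auto
  show "lk (sact (- int a) (int a + int b) UNIV (elem 1 2) (sing_vec a b)) (i, j, l) = lk 0 (i, j, l)"
  proof (cases "i = int b - (l + 1) \<and> j = int b - l")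
    case True
    then have i: "i = int b - (l + 1)" and j: "j = int b - l" by auto
    show ?thesis unfolding i j using rec by (simp add: lookup_op lookup_sing_vec; simp add: algebra_simps)
  next
    case False
    then show ?thesis by (auto simp add: lookup_op lookup_sing_vec c)
  qed
  show "lk (sact (- int a) (int a + int b) UNIV (elem 2 3) (sing_vec a b)) (i, j, l) = lk 0 (i, j, l)"
  proof (cases "j = int b - (l + 1) \<and> i = int b - l")
    case True
    then have i: "i = int b - l" and j: "j = int b - (l + 1)" by auto
    show ?thesis unfolding i j using rec by (simp add: lookup_op lookup_sing_vec; simp add: algebra_simps)
  next
    case False
    then show ?thesis by (auto simp add: lookup_op lookup_sing_vec c)
  qed
qed

text \<open>A functional on the weight space \<open>\<nu> - b \<alpha> - (b + m) \<beta>\<close>. For \<open>m = 0\<close> it defines \<open>r\<^sub>1\<close>; the family over \<open>m\<close> is chosen to be closed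
  under composition with \<open>e\<^sub>\<beta>\<close> up to scalars, so that the vanishing on the image of \<open>e\<^sub>\<beta>\<^sup>a\<close> can be read off from these
  scalars.\<close>

definition alternating_functional :: "nat \<Rightarrow> nat \<Rightarrow> wvec \<Rightarrow> complex" where
  "alternating_functional b m c = (\<Sum>l\<le>b. (- 1) ^ l * fact (b + m - l) * lk c (int b - int l, int b + int m - int l, int l))"

lemma alternating_functional_lin: "alternating_functional b m (u + v) = alternating_functional b m u + alternating_functional b m v"
  "alternating_functional b m (pm_scale x u) = x * alternating_functional b m u"
  by (simp_all add: alternating_functional_def lookup_add algebra_simps sum.distrib sum_distrib_left)

text \<open>Composition with \<open>e\<^sub>\<beta>\<close> leads from one functional to the next; the two terms of \<open>e\<^sub>\<beta>\<close> combine after a shift of the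
  summation index.\<close>

lemma alternating_functional_E2:
  assumes c: "c \<in> vspace UNIV"
  shows "alternating_functional b m (sact n (int a + int b) UNIV (elem 2 3) c) = (of_nat a - 1 - of_nat m) * alternating_functional b (Suc m) c"
proof -
  let ?c = "\<lambda>l. lk c (int b - int l, int b + int m + 1 - int l, int l)"
  let ?s = "\<lambda>l. (- 1) ^ l * fact (b + m - l) :: complex"
  have e: "lk (sact n (int a + int b) UNIV (elem 2 3) c) (int b - int l, int b + int m - int l, int l)
     = (of_nat a - 1 - of_nat m + of_nat l) * (of_nat (b + m + 1 - l)) * ?c l + (of_nat l + 1) * ?c (Suc l)" if "l \<le> b" for l
    using that by (simp add: lookup_op of_nat_diff algebra_simps)
  have f: "fact (b + m + 1 - l) = of_nat (b + m + 1 - l) * (fact (b + m - l) :: complex)" if "l \<le> b" for l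
  proof -
    have "b + m + 1 - l = Suc (b + m - l)" using that by simp
    then show ?thesis by (simp only: fact_Suc of_nat_mult)
  qed
  have last: "?c (Suc b) = 0" using vspaceD[OF c] by simp
  \<comment> \<open>The new summand at \<open>l = 0\<close> has the factor \<open>0\<close>, and the one at \<open>l = b + 1\<close> a negative index.\<close>
  have "(\<Sum>l\<le>b. ?s l * ((of_nat l + 1) * ?c (Suc l))) = (\<Sum>l\<le>Suc b. - (of_nat l * ((- 1) ^ l * fact (b + m + 1 - l)) * ?c l))"
    by (subst sum.atMost_Suc_shift) (simp add: algebra_simps)
  also have "\<dots> = (\<Sum>l\<le>b. - (of_nat l * ((- 1) ^ l * fact (b + m + 1 - l)) * ?c l))"
    by (simp only: sum.atMost_Suc last) simp
  finally have sh: "(\<Sum>l\<le>b. ?s l * ((of_nat l + 1) * ?c (Suc l))) = (\<Sum>l\<le>b. - (of_nat l * ((- 1) ^ l * fact (b + m + 1 - l)) * ?c l))" .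
  have "alternating_functional b m (sact n (int a + int b) UNIV (elem 2 3) c)
     = (\<Sum>l\<le>b. ?s l * ((of_nat a - 1 - of_nat m + of_nat l) * (of_nat (b + m + 1 - l)) * ?c l + (of_nat l + 1) * ?c (Suc l)))"
    unfolding alternating_functional_def by (intro sum.cong refl) (simp only: e atMost_iff)
  also have "\<dots> = (\<Sum>l\<le>b. ?s l * ((of_nat a - 1 - of_nat m + of_nat l) * (of_nat (b + m + 1 - l)) * ?c l))
      + (\<Sum>l\<le>b. - (of_nat l * ((- 1) ^ l * fact (b + m + 1 - l)) * ?c l))"
    by (simp only: distrib_left sum.distrib sh)
  also have "\<dots> = (\<Sum>l\<le>b. (of_nat a - 1 - of_nat m) * ((- 1) ^ l * fact (b + m + 1 - l) * ?c l))"
    unfolding sum.distrib[symmetric] by (intro sum.cong refl) (simp only: atMost_iff f, simp add: algebra_simps)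
  also have "\<dots> = (of_nat a - 1 - of_nat m) * alternating_functional b (Suc m) c"
    by (simp add: alternating_functional_def sum_distrib_left algebra_simps)
  finally show ?thesis .
qed

text \<open>The \<open>a\<close>-th factor \<open>a - 1 - m\<close>, at \<open>m = a - 1\<close>, is zero.\<close>

lemma alternating_functional_E2_pow:
  assumes c: "c \<in> vspace UNIV" and m: "a \<le> m"  and a: "0 < a"
  shows "alternating_functional b 0 ((sact n (int a + int b) UNIV (elem 2 3) ^^ m) c) = 0"
proof -
  interpret model n "int a + int b" UNIV by unfold_locales (rule admissible_UNIV)
  have "alternating_functional b r ((E2 ^^ m) c) = 0" if "r < a" "a \<le> r + m" for r m
    using that
  proof (induction m arbitrary: r)
    case (Suc m)
    have e: "alternating_functional b r ((E2 ^^ Suc m) c) = (of_nat a - 1 - of_nat r) * alternating_functional b (Suc r) ((E2 ^^ m) c)"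
      using alternating_functional_E2[OF pow_vspace[OF c]] by simp
    show ?case
    proof (cases "Suc r = a")
      case True then show ?thesis unfolding e by auto
    next
      case False then show ?thesis unfolding e using Suc by simp
    qed
  qed simp
  then show ?thesis using m a by simp
qed

text \<open>The alternating signs of the functional cancel those of the vector, so the value is a sum of nonnegative terms, the first of them positive.\<close>

lemma alternating_functional_sing_vec: "alternating_functional b 0 (sing_vec a b) \<noteq> 0"
proof -
  have "alternating_functional b 0 (sing_vec a b) = (\<Sum>l\<le>b. complex_of_real (fact (b - l) * sing_coeff a b l))"
    unfolding alternating_functional_def
  proof (intro sum.cong refl)
    fix l assume "l \<in> {..b}"
    have "(- 1) ^ l * ((- 1) ^ l * x) = (x :: complex)" for x by (simp add: mult.assoc[symmetric] power_mult_distrib[symmetric])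
    then show "(- 1) ^ l * fact (b + 0 - l) * lk (sing_vec a b) (int b - int l, int b + int 0 - int l, int l) = complex_of_real (fact (b - l) * sing_coeff a b l)"
      by (simp add: lookup_sing_vec sing_coeff_int_def mult_ac)
  qed
  also have "\<dots> = complex_of_real (\<Sum>l\<le>b. fact (b - l) * sing_coeff a b l)" by simp
  also have "\<dots> \<noteq> 0"
  proof -
    have "0 < (\<Sum>l\<le>b. fact (b - l) * sing_coeff a b l)"
      by (rule sum_pos2[of _ 0]) (auto simp: sing_coeff_nonneg)
    then show ?thesis using of_real_eq_0_iff by (metis less_irrefl)
  qed
  finally show ?thesis .
qed

lemma weight_functional:
  assumes x: "x \<in> cartan"
  shows "alternating_functional b 0 (sact n k UNIV x c) = wt_char (of_int (n - 2 * int b + int b)) (of_int (k + int b - 2 * int b)) x * alternating_functional b 0 c"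
  unfolding alternating_functional_def sum_distrib_left wt_char_shift
  by (intro sum.cong refl) (simp add: lookup_ract lookup_act_cartan[OF x])

section \<open>Splitting over the Borel subalgebra\<close>

lemma sact_UNIV: "ract N K UNIV x u = act N K x u" by (simp add: ract_def)

text \<open>The embedding \<open>\<iota>\<close> of \<open>M(\<mu>)\<close> into \<open>M(\<nu>)\<close> and the homomorphisms \<open>r\<^sub>1\<close>, \<open>r\<^sub>2\<close> over the Borel subalgebra, from
  \<open>M(\<nu>)\<close> to \<open>L(\<mu>)\<close> and to \<open>M(\<omega>)\<close>, each given by the functional that determines it.\<close>

locale verma_decomposition =
  fixes a b :: nat and \<iota> r1 r2 :: "wvec \<Rightarrow> wvec"
  assumes a: "0 < a" and b: "0 < b"
    and emb: "verma_embedding (- int a - int b) (int a) (- int a) (int a + int b) \<iota> (sing_vec a b) (int b) (int b)"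
    and r1: "c \<in> vspace UNIV \<Longrightarrow> r1 c \<in> vspace {..<int a}"
      "u \<in> vspace UNIV \<Longrightarrow> v \<in> vspace UNIV \<Longrightarrow> r1 (u + v) = r1 u + r1 v"
      "u \<in> vspace UNIV \<Longrightarrow> r1 (pm_scale z u) = pm_scale z (r1 u)"
      "x \<in> borel_sl3 \<Longrightarrow> u \<in> vspace UNIV \<Longrightarrow> r1 (sact (- int a) (int a + int b) UNIV x u) = sact (- int a - int b) (int a) {..<int a} x (r1 u)"
      "c \<in> vspace UNIV \<Longrightarrow> topc (r1 c) = alternating_functional b 0 c / alternating_functional b 0 (sing_vec a b)"
    and r2: "c \<in> vspace UNIV \<Longrightarrow> r2 c \<in> vspace UNIV"
      "u \<in> vspace UNIV \<Longrightarrow> v \<in> vspace UNIV \<Longrightarrow> r2 (u + v) = r2 u + r2 v"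
      "u \<in> vspace UNIV \<Longrightarrow> r2 (pm_scale z u) = pm_scale z (r2 u)"
      "x \<in> borel_sl3 \<Longrightarrow> u \<in> vspace UNIV \<Longrightarrow> r2 (sact (- int a) (int a + int b) UNIV x u) = sact (- int b) (- int a) UNIV x (r2 u)"
      "c \<in> vspace UNIV \<Longrightarrow> topc (r2 c) = lk c (int b, int a + int b, 0)"

lemma only_top_cut: "0 < a \<Longrightarrow> 0 < b \<Longrightarrow> only_top (- int a - int b) (int a) {..<int a}"
  by (simp add: only_top_def)
lemma only_top_antidominant: "0 < a \<Longrightarrow> 0 < b \<Longrightarrow> only_top (- int b) (- int a) UNIV"
  by (simp add: only_top_def)

lemma exists_decomposition:
  assumes a: "0 < a" and b: "0 < b"
  shows "\<exists>\<iota> r1 r2. verma_decomposition a b \<iota> r1 r2"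
proof -
  let ?n = "- int a" and ?k = "int a + int b"
  have e: "?n - 2 * int b + int b = - int a - int b" "?k + int b - 2 * int b = int a"
    "?n - 2 * int b + (int a + int b) = - int b" "?k + int b - 2 * (int a + int b) = - int a" by simp_all
  obtain \<iota> where "verma_embedding (?n - 2 * int b + int b) (?k + int b - 2 * int b) ?n ?k \<iota> (sing_vec a b) (int b) (int b)"
    using exists_embedding[OF singular_sing_vec homog_sing_vec sing_vec_lead] .
  moreover have "?n - 2 * int b + int b = - int a - int b" "?k + int b - 2 * int b = int a" by simp_all
  ultimately have emb: "verma_embedding (- int a - int b) (int a) ?n ?k \<iota> (sing_vec a b) (int b) (int b)" by metis
  let ?\<phi> = "\<lambda>c. alternating_functional b 0 c / alternating_functional b 0 (sing_vec a b)"
  have lin: "?\<phi> (u + v) = ?\<phi> u + ?\<phi> v" "?\<phi> (pm_scale z u) = z * ?\<phi> u" for u v z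
    by (simp_all add: alternating_functional_lin add_divide_distrib)
  have van: "?\<phi> ((sact ?n ?k UNIV (elem 2 3) ^^ j) c) = 0" if "c \<in> vspace UNIV" "int j \<notin> {..<int a}" for j c
    using alternating_functional_E2_pow[OF that(1), of a j b ?n] that(2) a by simp
  have wt: "?\<phi> (sact ?n ?k UNIV x c) = wt_char (of_int (- int a - int b)) (of_int (int a)) x * ?\<phi> c" if "x \<in> cartan" "c \<in> vspace UNIV" for x c
    unfolding weight_functional[OF that(1), of b ?n ?k c] e by (simp only: times_divide_eq_right)
  obtain r1 where r1: "\<And>c. c \<in> vspace UNIV \<Longrightarrow> r1 c \<in> vspace {..<int a}"
    "\<And>u v. u \<in> vspace UNIV \<Longrightarrow> v \<in> vspace UNIV \<Longrightarrow> r1 (u + v) = r1 u + r1 v"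
    "\<And>z u. u \<in> vspace UNIV \<Longrightarrow> r1 (pm_scale z u) = pm_scale z (r1 u)"
    "\<And>x u. x \<in> borel_sl3 \<Longrightarrow> u \<in> vspace UNIV \<Longrightarrow> r1 (sact ?n ?k UNIV x u) = sact (- int a - int b) (int a) {..<int a} x (r1 u)"
    "\<And>c. c \<in> vspace UNIV \<Longrightarrow> topc (r1 c) = ?\<phi> c"
    by (rule coinduced_hom[OF only_top_cut[OF a b], of ?\<phi> ?n ?k];
      (rule lin | (rule van; assumption) | (rule wt; assumption) | (rule that; assumption)))
  let ?\<phi>' = "\<lambda>c :: wvec. lk c (int b, int a + int b, 0)"
  have lin': "?\<phi>' (u + v) = ?\<phi>' u + ?\<phi>' v" "?\<phi>' (pm_scale z u) = z * ?\<phi>' u" for u v z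
    by (simp_all add: lookup_add)
  have van': "?\<phi>' ((sact ?n ?k UNIV (elem 2 3) ^^ j) c) = 0" if "c \<in> vspace UNIV" "int j \<notin> UNIV" for j c
    using that by simp
  have wt': "?\<phi>' (sact ?n ?k UNIV x c) = wt_char (of_int (- int b)) (of_int (- int a)) x * ?\<phi>' c" if "x \<in> cartan" "c \<in> vspace UNIV" for x c
    using wt_char_shift[of ?n "int b" "int a + int b" ?k x, unfolded e]
    by (simp only: lookup_ract lookup_act_cartan[OF that(1)] UNIV_I if_True add_0_right)
  obtain r2 where r2: "\<And>c. c \<in> vspace UNIV \<Longrightarrow> r2 c \<in> vspace UNIV"
    "\<And>u v. u \<in> vspace UNIV \<Longrightarrow> v \<in> vspace UNIV \<Longrightarrow> r2 (u + v) = r2 u + r2 v"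
    "\<And>z u. u \<in> vspace UNIV \<Longrightarrow> r2 (pm_scale z u) = pm_scale z (r2 u)"
    "\<And>x u. x \<in> borel_sl3 \<Longrightarrow> u \<in> vspace UNIV \<Longrightarrow> r2 (sact ?n ?k UNIV x u) = sact (- int b) (- int a) UNIV x (r2 u)"
    "\<And>c. c \<in> vspace UNIV \<Longrightarrow> topc (r2 c) = ?\<phi>' c"
    by (rule coinduced_hom[OF only_top_antidominant[OF a b], of ?\<phi>' ?n ?k];
      (rule lin' | (rule van'; assumption) | (rule wt'; assumption) | (rule that; assumption)))
  have "verma_decomposition a b \<iota> r1 r2"
    by (rule verma_decomposition.intro) (fact a b emb r1 r2)+
  then show ?thesis by blast
qed

text \<open>A submodule over the Borel subalgebra, without the twist by \<open>t\<close>: as \<open>t\<close> permutes the Borel subalgebra, the twist does not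
  change which subspaces are submodules.\<close>

definition bstable :: "int \<Rightarrow> int \<Rightarrow> int set \<Rightarrow> wvec set \<Rightarrow> bool" where
  "bstable n k R A \<longleftrightarrow> A \<subseteq> vspace R \<and> 0 \<in> A \<and> (\<forall>u\<in>A. \<forall>v\<in>A. u + v \<in> A) \<and> (\<forall>z. \<forall>u\<in>A. pm_scale z u \<in> A)
     \<and> (\<forall>x\<in>borel_sl3. \<forall>u\<in>A. sact n k R x u \<in> A)"

lemma bstableD:
  assumes "bstable n k R A"
  shows "u \<in> A \<Longrightarrow> u \<in> vspace R" "0 \<in> A" "u \<in> A \<Longrightarrow> v \<in> A \<Longrightarrow> u + v \<in> A" "u \<in> A \<Longrightarrow> pm_scale z u \<in> A"
    "x \<in> borel_sl3 \<Longrightarrow> u \<in> A \<Longrightarrow> sact n k R x u \<in> A"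
  using assms unfolding bstable_def by blast+

lemma bstable_diff: "bstable n k R A \<Longrightarrow> u \<in> A \<Longrightarrow> v \<in> A \<Longrightarrow> u - v \<in> A"
  using bstableD(3)[of n k R A u "pm_scale (- 1) v"] bstableD(4)[of n k R A v "- 1"] by simp

lemma bstable_wproj: "bstable n k R A \<Longrightarrow> u \<in> A \<Longrightarrow> wproj p q u \<in> A"
proof -
  assume A: "bstable n k R A" and u: "u \<in> A"
  have "A \<subseteq> vspace R" using A by (simp add: bstable_def)
  then show ?thesis
    by (rule wproj_in_stable[OF _ bstableD(3)[OF A] bstableD(4)[OF A] bstableD(5)[OF A hsep_borel] u])
qed

lemma bstable_topv:
  assumes "only_top n k R" "bstable n k R A" "A \<noteq> {0}"
  shows "topv \<in> A"
proof -
  obtain c where c: "c \<in> A" "c \<noteq> 0" using assms(3) bstableD(2)[OF assms(2)] by blast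
  show ?thesis
    by (rule only_top_stable[OF assms(1) subsetI[OF bstableD(1)[OF assms(2)]] bstableD(5)[OF assms(2) elem_borel(1)]
        bstableD(5)[OF assms(2) elem_borel(2)] bstableD(4)[OF assms(2)] c])
qed

lemma bstable_singular:
  assumes "bstable n k R A" "c \<in> A" "c \<noteq> 0"
  obtains s p q where "s \<in> A" "s \<noteq> 0" "singular n k R s" "homog p q s"
proof -
  obtain s where s: "s \<in> A" "s \<noteq> 0" "singular n k R s"
    by (rule exists_singular[OF subsetI[OF bstableD(1)[OF assms(1)]] bstableD(5)[OF assms(1) elem_borel(1)]
        bstableD(5)[OF assms(1) elem_borel(2)] assms(2,3)])
  obtain p q where "wproj p q s \<noteq> 0" using exists_wproj[OF s(2)] by blast
  then show ?thesis using that bstable_wproj[OF assms(1) s(1)] singular_wproj[OF s(3)] homog_wproj by blast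
qed

context verma_decomposition begin

abbreviation "S \<equiv> \<iota> ` vspace UNIV"
abbreviation "V \<equiv> vspace UNIV"
abbreviation "n \<equiv> - int a"
abbreviation "k \<equiv> int a + int b"

sublocale emb: verma_embedding "- int a - int b" "int a" n k \<iota> "sing_vec a b" "int b" "int b" by (rule emb)

lemma alt_wproj: "alternating_functional b 0 (wproj (int b) (int b) c) = alternating_functional b 0 c"
  unfolding alternating_functional_def by (intro sum.cong) (auto simp: lookup_wproj)

lemma r1_embed: "c \<in> V \<Longrightarrow> r1 (\<iota> c) = cut {..<int a} c"
proof (rule hom_unique[OF only_top_cut[OF a b], of UNIV "\<lambda>c. r1 (\<iota> c)" "cut {..<int a}" "- int a - int b" "int a"])
  show "topc (r1 (\<iota> u)) = topc (cut {..<int a} u)" if u: "u \<in> V" for u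
  proof -
    have "alternating_functional b 0 (\<iota> u) = topc u * alternating_functional b 0 (sing_vec a b)"
      using alt_wproj[of "\<iota> u"] by (simp add: emb.wproj_top[OF u] alternating_functional_lin)
    then show ?thesis using a by (simp add: r1(5) emb.closed u alternating_functional_sing_vec lookup_cut)
  qed
  have "admissible (of_int (int a)) {..<int a}" using a by (rule only_top_adm(1)[OF only_top_cut]) (rule b)
  then show "cut {..<int a} (sact (- int a - int b) (int a) UNIV x u) = sact (- int a - int b) (int a) {..<int a} x (cut {..<int a} u)" for x u
    by (simp add: ract_cut sact_UNIV)
  show "r1 (\<iota> (sact (- int a - int b) (int a) UNIV x u)) = sact (- int a - int b) (int a) {..<int a} x (r1 (\<iota> u))"
    if "x \<in> borel_sl3" "u \<in> V" for x u
    unfolding emb.equiv[OF that(2)] by (rule r1(4)[OF that(1) emb.closed[OF that(2)]])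
qed (simp_all add: r1 emb.closed emb.scale vspace_cut cut_scale)

lemma r2_embed: "c \<in> V \<Longrightarrow> r2 (\<iota> (shift_j (int a) c)) = c"
proof (rule hom_unique[OF only_top_antidominant[OF a b], of UNIV "\<lambda>c. r2 (\<iota> (shift_j (int a) c))" "\<lambda>c. c" "- int b" "- int a"])
  show "topc (r2 (\<iota> (shift_j (int a) u))) = topc u" if u: "u \<in> V" for u
  proof -
    have v: "shift_j (int a) u \<in> V" by (rule shift_j_vspace) (simp_all add: u)
    have "lk (\<iota> (shift_j (int a) u)) (0 + int b, int a + int b, 0) = lk (shift_j (int a) u) (0, int a, 0)"
      by (rule emb.leading_image[OF v]) (simp add: vspaceD[OF v])
    then show ?thesis by (simp add: r2(5) emb.closed v lookup_shift_j)
  qed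
  show "r2 (\<iota> (shift_j (int a) (sact (- int b) (- int a) UNIV x u))) = sact (- int b) (- int a) UNIV x (r2 (\<iota> (shift_j (int a) u)))"
    if "x \<in> borel_sl3" "u \<in> V" for x u
  proof -
    have v: "shift_j (int a) u \<in> V" by (rule shift_j_vspace) (simp_all add: that)
    have e: "- int b = (- int a - int b) + int a" by simp
    have "shift_j (int a) (sact (- int b) (- int a) UNIV x u) = sact (- int a - int b) (int a) UNIV x (shift_j (int a) u)"
      unfolding e by (rule shift_j_equiv)
    then show ?thesis by (simp only: emb.equiv[OF v] r2(4)[OF that(1) emb.closed[OF v]])
  qed
qed (simp_all add: r2 emb.closed emb.scale shift_j_scale shift_j_vspace)

text \<open>On \<open>M(\<mu>)\<close> the kernel of \<open>r\<^sub>1\<close> is \<open>M(\<omega>)\<close>, where \<open>r\<^sub>2\<close> is the identity.\<close>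

lemma joint_kernel: "c \<in> S \<Longrightarrow> r1 c = 0 \<Longrightarrow> r2 c = 0 \<Longrightarrow> c = 0"
proof -
  assume "c \<in> S" and z: "r1 c = 0" "r2 c = 0"
  then obtain d where d: "d \<in> V" "c = \<iota> d" by blast
  then have "cut {..<int a} d = 0" using r1_embed z by simp
  note sh = cut_zero_shift_j[OF d(1) this]
  have "shift_j (- int a) d = 0" using r2_embed[OF sh(1)] z(2) by (simp add: sh(2) d(2))
  then have "d = 0" using sh(2) by (metis shift_j_scale pm.scale_zero_left)
  then show ?thesis by (simp add: d(2))
qed

text \<open>Choose the component in \<open>L(\<mu>)\<close> first and correct the value of \<open>r\<^sub>2\<close> inside \<open>M(\<omega>)\<close>, the kernel of \<open>r\<^sub>1\<close>.\<close>

lemma joint_surj: "t1 \<in> vspace {..<int a} \<Longrightarrow> t2 \<in> V \<Longrightarrow> \<exists>c\<in>S. r1 c = t1 \<and> r2 c = t2"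
proof -
  assume t1: "t1 \<in> vspace {..<int a}" and t2: "t2 \<in> V"
  have t1': "t1 \<in> V" using vspace_UNIV[OF t1] .
  define y where "y = t2 + pm_scale (- 1) (r2 (\<iota> t1))"
  have y: "y \<in> V" unfolding y_def by (intro vspace_add vspace_scale t2 r2(1) emb.closed t1')
  have sy: "shift_j (int a) y \<in> V" by (rule shift_j_vspace) (simp_all add: y)
  let ?c = "\<iota> (t1 + shift_j (int a) y)"
  have c: "?c = \<iota> t1 + \<iota> (shift_j (int a) y)" by (rule emb.add[OF t1' sy])
  have "r1 ?c = t1" unfolding c by (simp add: r1 emb.closed t1' sy r1_embed cut_shift_j y vspace_cut_id[OF t1])
  moreover have "r2 ?c = t2" unfolding c by (simp add: r2 emb.closed t1' sy r2_embed y) (simp add: y_def)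
  moreover have "?c \<in> S" using vspace_add[OF t1' sy] by blast
  ultimately show ?thesis by blast
qed

lemma S_stable: "u \<in> S \<Longrightarrow> sact n k UNIV x u \<in> S"
proof -
  assume "u \<in> S"
  then obtain v where v: "v \<in> V" "u = \<iota> v" by blast
  show ?thesis unfolding v(2) emb.equiv[OF v(1), symmetric] by (rule imageI[OF vspace_ract[OF v(1)]])
qed

lemma S_bstable: "bstable n k UNIV S"
  unfolding bstable_def
proof (intro conjI ballI allI)
  show "S \<subseteq> V" using emb.closed by blast
  show "0 \<in> S" by (rule image_eqI[of _ _ 0]) simp_all
  fix u assume "u \<in> S"
  then obtain u' where u: "u' \<in> V" "u = \<iota> u'" by blast
  show "u + v \<in> S" if "v \<in> S" for v
  proof -
    obtain v' where v: "v' \<in> V" "v = \<iota> v'" using \<open>v \<in> S\<close> by blast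
    show ?thesis unfolding u(2) v(2) emb.add[OF u(1) v(1), symmetric] by (rule imageI[OF vspace_add[OF u(1) v(1)]])
  qed
  show "pm_scale z u \<in> S" for z
    unfolding u(2) emb.scale[OF u(1), symmetric] by (rule imageI[OF vspace_scale[OF u(1)]])
qed (rule S_stable)

end

section \<open>The quotient has no complement\<close>

text \<open>For \<open>m = k\<close> this is \<open>v\<^sub>1 = f\<^sub>\<beta>\<^bsup>a+b\<^esup> v\<^sub>0\<close>, the second singular vector of the quotient.\<close>

definition subtop :: "int \<Rightarrow> wvec" where "subtop m = Poly_Mapping.single (0, m, 0) 1"

lemma lookup_subtop: "lk (subtop m) x = (if x = (0, m, 0) then 1 else 0)"
  by (auto simp: subtop_def lookup_single when_def)

lemma homog_0_left: "c \<in> vspace UNIV \<Longrightarrow> homog 0 q c \<Longrightarrow> c = pm_scale (lk c (0, q, 0)) (subtop q)"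
proof (rule wvec_eqI)
  fix i j l assume c: "c \<in> vspace UNIV" "homog 0 q c"
  show "lk c (i, j, l) = lk (pm_scale (lk c (0, q, 0)) (subtop q)) (i, j, l)"
  proof (cases "(i, j, l) = (0, q, 0)")
    case False
    have "lk c (i, j, l) = 0"
    proof (rule ccontr)
      assume nz: "lk c (i, j, l) \<noteq> 0"
      then have "i + l = 0" "j + l = q" "0 \<le> i" "0 \<le> l"
        using homogD[OF c(2), of i l j] vspaceD[OF c(1), of i j l] by (auto simp: not_le[symmetric])
      then show False using False by auto
    qed
    then show ?thesis using False by (auto simp: lookup_subtop)
  qed (simp add: lookup_subtop)
qed

lemma bstable_scale_cancel: "bstable n k R A \<Longrightarrow> pm_scale z v \<in> A \<Longrightarrow> z \<noteq> 0 \<Longrightarrow> v \<in> A"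
  using bstableD(4)[of n k R A "pm_scale z v" "1 / z"] by simp

context verma_decomposition begin

\<comment> \<open>Keep \<open>of_int (- int a)\<close> in the form in which it occurs in the equivariance rules for \<open>r\<^sub>1\<close> and \<open>r\<^sub>2\<close>.\<close>
declare of_int_minus [simp del] of_int_of_nat_eq [simp del] of_int_add [simp del] of_int_diff [simp del]

lemma low_weights_S: "s \<in> S \<Longrightarrow> \<not> (int b \<le> P \<and> int b \<le> Q) \<Longrightarrow> wproj P Q s = 0"
  using emb.weights_image by blast

lemma S_subset: "S \<subseteq> V" using S_bstable by (simp add: bstable_def)

lemma r1_0: "r1 0 = 0" using r1(3)[of 0 0] by simp
lemma r2_0: "r2 0 = 0" using r2(3)[of 0 0] by simp

lemma topv_V: "topv \<in> V" by (rule topv_vspace) simp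

lemma topv_notin_S: "topv \<notin> S"
  using low_weights_S[of topv 0 0] b wproj_homog[OF homog_topv] by auto

lemma homog_subtop: "homog 0 m (subtop m)"
  by (auto simp: homog_def lookup_subtop split: if_splits)

lemma subtop_notin_S: "subtop m \<notin> S"
proof
  assume "subtop m \<in> S"
  then have "subtop m = 0" using low_weights_S[of "subtop m" 0 m] b wproj_homog[OF homog_subtop] by auto
  then show False by (metis lookup_subtop lookup_zero zero_neq_one)
qed

lemma singular_deep:
  assumes c: "singular n k UNIV c" "homog (int b) k c"
  shows "c \<in> S"
proof -
  let ?v = "shift_j (int a) topv"
  have v: "?v \<in> V" by (rule shift_j_vspace) (simp_all add: topv_V)
  have hv: "homog 0 (int a) ?v" unfolding homog_def lookup_shift_j lookup_topv by auto
  have e: "(- int a - int b) + int a = - int b" by simp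
  have E: "sact (- int a - int b) (int a) UNIV x ?v = 0" if "x = elem 1 2 \<or> x = elem 2 3" for x
  proof -
    have "sact (- int b) (- int a) UNIV x topv = 0" using singular_topv[of UNIV "- int b" "- int a"] that unfolding singular_def by auto
    then show ?thesis using shift_j_equiv[of "int a" "- int a - int b" x topv, unfolded e]
      by (metis shift_j_scale pm.scale_zero_left)
  qed
  have "singular n k UNIV (\<iota> ?v)"
    unfolding singular_def emb.equiv[OF v, symmetric] using E emb.closed[OF v] by simp
  moreover have "homog (int b) k (\<iota> ?v)"
    using emb.wproj_image[OF v, of 0 "int a"] wproj_homog[OF hv] homog_wproj[of "int b + 0" "int b + int a" "\<iota> ?v"]
    by (simp add: add.commute)
  moreover have "lk (\<iota> ?v) (int b, k, 0) = 1"
    using emb.leading_image[OF v, of 0 0 "int a"] vspaceD[OF v] by (simp add: lookup_shift_j lookup_topv)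
  ultimately have "c = pm_scale (lk c (int b, k, 0)) (\<iota> ?v)" using singular_unique c by blast
  then show ?thesis using bstableD(4)[OF S_bstable] imageI[OF v] by metis
qed

text \<open>The common kernel of \<open>r\<^sub>1\<close> and \<open>r\<^sub>2\<close> is a complement of \<open>S\<close>, so a submodule above \<open>S\<close> contains a singular vector of \<open>M(\<nu>)\<close>
  in this complement. Of the four singular vectors of \<open>M(\<nu>)\<close>, those of weights \<open>\<mu>\<close> and \<open>\<omega>\<close> lie in \<open>S\<close>.\<close>

lemma above_S:
  assumes D: "bstable n k UNIV D" and SD: "S \<subseteq> D" and ne: "D \<noteq> S"
  shows "topv \<in> D \<or> subtop k \<in> D"
proof -
  let ?C = "{c \<in> D. r1 c = 0 \<and> r2 c = 0}"
  have DV: "c \<in> V" if "c \<in> D" for c using bstableD(1)[OF D that] .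
  have C: "bstable n k UNIV ?C" unfolding bstable_def
    using bstableD[OF D] by (auto simp: r1 r2 DV r1_0 r2_0)
  obtain d where d: "d \<in> D" "d \<notin> S" using ne SD by blast
  obtain s where s: "s \<in> S" "r1 s = r1 d" "r2 s = r2 d" using joint_surj r1(1) r2(1) DV d(1) by metis
  have sD: "s \<in> D" using s(1) SD by blast
  let ?c = "d + pm_scale (- 1) s"
  have inC: "?c \<in> ?C" using d(1) sD s by (simp add: bstableD[OF D] r1 r2 DV vspace_scale del: pm.scale_minus_left) (simp add: bstable_diff[OF D])
  have nz: "?c \<noteq> 0" using d(2) s(1) by auto
  obtain c p q where c: "c \<in> ?C" "c \<noteq> 0" "singular n k UNIV c" "homog p q c"
    by (rule bstable_singular[OF C inC nz]) (rule that)
  have cV: "c \<in> V" using c(1) DV by blast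
  have notS: "c \<notin> S" using joint_kernel c(1,2) by blast
  have n: "n < 0" using a by simp
  have "(p, q) = (0, 0) \<or> (p, q) = (0, k) \<or> (p, q) = (int b, int b) \<or> (p, q) = (int b, k)"
  proof (cases "1 \<le> k \<and> k \<le> q")
    case True
    then show ?thesis using singular_weight_high[OF c(3,4) _ _ c(2) n] by auto
  next
    case False
    then show ?thesis using singular_weight_low[OF c(3,4) UNIV_I c(2) n] by auto
  qed
  then consider "(p, q) = (0, 0)" | "(p, q) = (0, k)" | "(p, q) = (int b, int b)" | "(p, q) = (int b, k)" by blast
  then show ?thesis
  proof cases
    case 1
    then have e: "c = pm_scale (topc c) topv" using homog_0[OF cV] c(4) by simp
    have "topc c \<noteq> 0"
    proof
      assume z: "topc c = 0"
      show False using c(2) e unfolding z by simp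
    qed
    moreover have "pm_scale (topc c) topv \<in> D" unfolding e[symmetric] using c(1) by blast
    ultimately show ?thesis using bstable_scale_cancel[OF D] by blast
  next
    case 2
    then have e: "c = pm_scale (lk c (0, k, 0)) (subtop k)" using homog_0_left[OF cV] c(4) by simp
    have "lk c (0, k, 0) \<noteq> 0"
    proof
      assume z: "lk c (0, k, 0) = 0"
      show False using c(2) e unfolding z by simp
    qed
    moreover have "pm_scale (lk c (0, k, 0)) (subtop k) \<in> D" unfolding e[symmetric] using c(1) by blast
    ultimately show ?thesis using bstable_scale_cancel[OF D] by blast
  next
    case 3
    then have "c = pm_scale (lk c (int b, int b, 0)) (sing_vec a b)"
      using singular_unique[OF singular_sing_vec homog_sing_vec sing_vec_lead c(3)] c(4) by simp
    moreover have "sing_vec a b \<in> S" using emb.top imageI[OF topv_V, of \<iota>] by simp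
    ultimately have "c \<in> S" using bstableD(4)[OF S_bstable] by metis
    then show ?thesis using notS by blast
  next
    case 4
    then show ?thesis using singular_deep[OF c(3)] c(4) notS by simp
  qed
qed

text \<open>The submodule generated by \<open>v\<^sub>1\<close>.\<close>

definition Y :: "wvec set" where "Y = {y \<in> V. \<forall>i j l. j < k \<longrightarrow> lk y (i, j, l) = 0}"

lemma Y_cut: "Y = {y \<in> V. cut {..<k} y = 0}"
proof -
  have "cut {..<k} y = 0 \<longleftrightarrow> (\<forall>i j l. j < k \<longrightarrow> lk y (i, j, l) = 0)" for y
  proof
    assume z: "cut {..<k} y = 0"
    show "\<forall>i j l. j < k \<longrightarrow> lk y (i, j, l) = 0"
    proof (intro allI impI)
      fix i j l assume "j < k"
      then have "lk y (i, j, l) = lk (cut {..<k} y) (i, j, l)" by (simp add: lookup_cut)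
      then show "lk y (i, j, l) = 0" by (simp add: z)
    qed
  next
    assume "\<forall>i j l. j < k \<longrightarrow> lk y (i, j, l) = 0"
    then show "cut {..<k} y = 0" by (intro wvec_eqI) (simp add: lookup_cut)
  qed
  then show ?thesis by (simp add: Y_def)
qed

lemma adm_cut: "admissible (of_int k) {..<k}"
  unfolding admissible_def using a by (intro disjI2 exI[of _ k]) simp

lemma Y_bstable: "bstable n k UNIV Y"
proof -
  have "cut {..<k} (sact n k UNIV x u) = 0" if "cut {..<k} u = 0" for x u
  proof -
    have "cut {..<k} (sact n k UNIV x u) = cut {..<k} (act (of_int n) (of_int k) x (cut {..<k} u))"
      unfolding cut_act_cut[OF adm_cut] sact_UNIV ..
    also have "act (of_int n) (of_int k) x (cut {..<k} u) = 0" unfolding that sact_UNIV[symmetric] by (rule ract_0)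
    finally show ?thesis by simp
  qed
  then show ?thesis unfolding bstable_def Y_cut
    by (auto simp: vspace_add vspace_scale cut_add cut_scale vspace_ract)
qed

lemma Y_weight: "y \<in> Y \<Longrightarrow> Q < k \<Longrightarrow> wproj P Q y = 0"
proof (rule wvec_eqI)
  fix i j l assume y: "y \<in> Y" and Q: "Q < k"
  then have V: "y \<in> V" by (simp add: Y_def)
  show "lk (wproj P Q y) (i, j, l) = lk 0 (i, j, l)"
  proof (cases "j < k")
    case True then show ?thesis using y by (simp add: lookup_wproj Y_def)
  next
    case False
    then show ?thesis using Q vspaceD[OF V, of i j l] by (force simp: lookup_wproj)
  qed
qed

lemma wproj_singleton: "u \<in> V \<Longrightarrow> wproj 0 0 u = pm_scale (topc u) topv"
  using homog_0[OF wproj_vspace[of u UNIV 0 0] homog_wproj] by (simp add: lookup_wproj)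

text \<open>Correct \<open>x\<close> by an element of \<open>S\<close> so that \<open>r\<^sub>1\<close> vanishes on it. If its image in \<open>M(\<nu>)/Y\<close> were nonzero, \<open>B\<close> would contain a
  vector that is singular modulo \<open>Y\<close>; this is either the highest weight vector, which \<open>B\<close> avoids, or the singular
  vector of weight \<open>\<mu>\<close>, on which \<open>r\<^sub>1\<close> does not vanish.\<close>

lemma contained_in_Y_plus_S:
  assumes B: "bstable n k UNIV B" and SB: "S \<subseteq> B" and top: "topv \<notin> B" and x: "x \<in> B"
  shows "\<exists>y\<in>Y. \<exists>s\<in>S. x = y + s"
proof -
  have BV: "u \<in> V" if "u \<in> B" for u using bstableD(1)[OF B that] .
  let ?B1 = "{u \<in> B. r1 u = 0}"
  have B1: "bstable n k UNIV ?B1" unfolding bstable_def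
    using bstableD[OF B] by (auto simp: r1 BV r1_0)
  let ?A = "cut {..<k} ` ?B1"
  have act: "cut {..<k} (sact n k UNIV x u) = sact n k {..<k} x (cut {..<k} u)" for x u
    unfolding ract_cut[OF adm_cut] sact_UNIV ..
  have A: "bstable n k {..<k} ?A" unfolding bstable_def
  proof (intro conjI ballI allI)
    show "?A \<subseteq> vspace {..<k}" using vspace_cut BV by auto
    show "0 \<in> ?A" by (rule image_eqI[OF _ bstableD(2)[OF B1]]) simp
    fix u assume "u \<in> ?A"
    then obtain u' where u: "u' \<in> ?B1" "u = cut {..<k} u'" by blast
    show "u + v \<in> ?A" if "v \<in> ?A" for v
    proof -
      obtain v' where v: "v' \<in> ?B1" "v = cut {..<k} v'" using \<open>v \<in> ?A\<close> by blast
      show ?thesis unfolding u(2) v(2) cut_add[symmetric] by (rule imageI[OF bstableD(3)[OF B1 u(1) v(1)]])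
    qed
    show "pm_scale z u \<in> ?A" for z
      unfolding u(2) cut_scale[symmetric] by (rule imageI[OF bstableD(4)[OF B1 u(1)]])
    show "sact n k {..<k} x u \<in> ?A" if "x \<in> borel_sl3" for x
      unfolding u(2) act[symmetric] by (rule imageI[OF bstableD(5)[OF B1 that u(1)]])
  qed
  have triv: "cut {..<k} u = 0" if uB1: "u \<in> ?B1" for u
  proof (rule ccontr)
    assume nz: "cut {..<k} u \<noteq> 0"
    obtain s p q where s: "s \<in> ?A" "s \<noteq> 0" "singular n k {..<k} s" "homog p q s"
      by (rule bstable_singular[OF A imageI[OF uB1] nz]) (rule that)
    obtain u' where u': "u' \<in> ?B1" "s = cut {..<k} u'" using s(1) by blast
    define v where "v = wproj p q u'"
    have v: "v \<in> ?B1" unfolding v_def by (rule bstable_wproj[OF B1 u'(1)])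
    have vV: "v \<in> V" using v BV by blast
    have hv: "homog p q v" by (simp add: v_def homog_wproj)
    have sv: "s = cut {..<k} v"
    proof (rule wvec_eqI)
      fix i j l show "lk s (i, j, l) = lk (cut {..<k} v) (i, j, l)"
        using homogD[OF s(4), of i l j] by (auto simp: u'(2) v_def lookup_cut lookup_wproj)
    qed
    have k0: "0 < k" using a by simp
    have qk: "q < k" using singular_weight_cut[OF s(3,4) k0] s(2) by force
    have R: "q - l \<in> {..<k}" if "0 \<le> l" for l using qk that by simp
    have pq: "p = 0 \<and> q = 0 \<or> p = int b \<and> q = int b"
      using singular_weight_low[OF s(3,4) R s(2)] a qk by auto
    have sveq: "s = v"
    proof (rule wvec_eqI)
      fix i j l show "lk s (i, j, l) = lk v (i, j, l)"
        using homogD[OF hv, of i l j] vspaceD[OF vV, of i j l] qk unfolding sv by (force simp: lookup_cut)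
    qed
    from pq show False
    proof
      assume "p = 0 \<and> q = 0"
      then have e: "v = pm_scale (topc v) topv" using homog_0[OF vV] hv by simp
      have "topc v \<noteq> 0"
      proof
        assume z: "topc v = 0"
        show False using s(2) e unfolding sveq z by simp
      qed
      moreover have "pm_scale (topc v) topv \<in> B" unfolding e[symmetric] using v by blast
      ultimately show False using bstable_scale_cancel[OF B] top by blast
    next
      assume pq: "p = int b \<and> q = int b"
      \<comment> \<open>Both vectors are singular of the same weight in the quotient, so their difference after scaling vanishes there; in this weight nothing is cut off.\<close>
      let ?w = "sing_vec a b"
      let ?\<delta> = "lk v (int b, int b, 0)"
      have cw: "singular n k {..<k} (cut {..<k} ?w)"
        unfolding singular_def act[symmetric] using singular_sing_vec[of a b] vspace_cut by (simp add: singular_def)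
      have hcw: "homog p q (cut {..<k} ?w)" using homog_sing_vec[of b a] pq by (auto simp: homog_def lookup_cut)
      let ?d = "s + pm_scale (- ?\<delta>) (cut {..<k} ?w)"
      have ds: "singular n k {..<k} ?d" using s(3) cw unfolding singular_def
        by (simp only: vspace_add vspace_scale ract_add ract_scale) simp
      have dh: "homog p q ?d" unfolding homog_def
      proof (intro allI impI, rule ccontr)
        fix i j l assume "lk ?d (i, j, l) \<noteq> 0" and no: "\<not> (i + l = p \<and> j + l = q)"
        then show False using homogD[OF s(4) no] homogD[OF hcw no] by (simp add: lookup_add lookup_minus)
      qed
      have R1: "q - l - 1 \<in> {..<k}" if "0 \<le> l" for l using qk that by simp
      have bk: "int b < k" using a by simp
      have "lk ?d (p, q, 0) = 0" using pq a sveq sing_vec_lead[of a b] bk by (simp add: lookup_add lookup_minus lookup_cut)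
      then have "?d = 0" using singular_nz_coeff(1)[OF ds dh R1] by blast
      then have sw: "s = pm_scale ?\<delta> (cut {..<k} ?w)" by simp
      then have dnz: "?\<delta> \<noteq> 0" using s(2) by (metis pm.scale_zero_left)
      have wj: "cut {..<k} ?w = ?w"
      proof (rule wvec_eqI)
        fix i j l show "lk (cut {..<k} ?w) (i, j, l) = lk ?w (i, j, l)"
          using vspaceD[OF sing_vec_vspace[of a b], of i j l] bk by (auto simp: lookup_cut lookup_sing_vec)
      qed
      have "r1 v = pm_scale ?\<delta> (r1 ?w)"
        using sw r1(3)[OF sing_vec_vspace] unfolding sveq wj by metis
      moreover have "r1 ?w = topv" using r1_embed[OF topv_V] vspace_cut_id[OF topv_vspace[of "{..<int a}"]] a emb.top by simp
      ultimately have "pm_scale ?\<delta> topv = 0" using v by simp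
      then show False using dnz by (simp add: pm.scale_eq_0_iff)
    qed
  qed
  obtain s where s: "s \<in> S" "r1 s = r1 x" using joint_surj[OF r1(1)[OF BV[OF x]] vspace_0] by blast
  have sB: "s \<in> B" using s(1) SB by blast
  let ?y = "x + pm_scale (- 1) s"
  have "r1 ?y = 0" unfolding r1(2)[OF BV[OF x] vspace_scale[OF BV[OF sB]]] r1(3)[OF BV[OF sB]] s(2) by simp
  moreover have yB: "?y \<in> B" by (intro bstableD(3)[OF B] bstableD(4)[OF B] x sB)
  ultimately have "cut {..<k} ?y = 0" by (intro triv) blast
  then have "?y \<in> Y" using BV[OF yB] by (simp add: Y_cut)
  then show ?thesis using s(1) by (intro bexI[of _ ?y] bexI[of _ s]) simp_all
qed

text \<open>The vector is \<open>f\<^sub>\<beta>\<^bsup>a+b\<^esup> f\<^sub>\<alpha>\<^sup>b v\<^sub>0\<close>: \<open>e\<^sub>\<alpha>\<close> commutes with \<open>f\<^sub>\<beta>\<close>, and the factors of \<open>e\<^sub>\<alpha>\<^sup>b f\<^sub>\<alpha>\<^sup>b v\<^sub>0\<close> are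
  nonzero since \<open>\<nu>\<close> is negative on the coroot of \<open>\<alpha>\<close>.\<close>

lemma raising_witness: "\<exists>u\<in>V. \<exists>\<kappa>. \<kappa> \<noteq> 0 \<and> (sact n k UNIV (elem 1 2) ^^ b) u = pm_scale \<kappa> (subtop k)"
proof -
  interpret model n k UNIV by unfold_locales (rule admissible_UNIV)
  let ?F2 = "sact n k UNIV (elem 3 2)"
  let ?x = "\<lambda>m::nat. Poly_Mapping.single (int m, 0, 0) (1::complex)"
  have o: "l + 1 = 0 \<Longrightarrow> of_int l + 1 = (0 :: complex)" for l :: int by (metis of_int_0 of_int_1 of_int_add)
  have E1: "E1 (?x (Suc m)) = pm_scale (of_int n - 1 - of_int (int m)) (pm_scale (of_nat (Suc m)) (?x m))" for m
    by (rule wvec_eqI) (auto simp: lookup_op lookup_single when_def of_int_minus of_int_of_nat_eq of_int_add of_int_diff o)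
  have nz: "(of_int n - 1 - of_int (int m)) * of_nat (Suc m) \<noteq> (0 :: complex)" for m
  proof -
    have "of_int n - 1 - of_int (int m) = (of_int (n - 1 - int m) :: complex)" by (simp add: of_int_diff)
    moreover have "n - 1 - int m \<noteq> 0" by simp
    ultimately show ?thesis by (simp del: of_nat_Suc)
  qed
  have pow: "\<exists>\<kappa>. \<kappa> \<noteq> 0 \<and> (E1 ^^ m) (?x m) = pm_scale \<kappa> (?x 0)" for m
  proof (induction m)
    case 0 show ?case by (intro exI[of _ 1]) simp
  next
    case (Suc m)
    then obtain \<kappa> where \<kappa>: "\<kappa> \<noteq> 0" "(E1 ^^ m) (?x m) = pm_scale \<kappa> (?x 0)" by blast
    have "(E1 ^^ Suc m) (?x (Suc m)) = (E1 ^^ m) (E1 (?x (Suc m)))" by (simp add: funpow_swap1)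
    also have "\<dots> = pm_scale ((of_int n - 1 - of_int (int m)) * of_nat (Suc m) * \<kappa>) (?x 0)"
      unfolding E1 by (simp only: pow_scale \<kappa>(2) pm.scale_scale mult.assoc)
    finally show ?case using nz[of m] \<kappa>(1) by (metis mult_eq_0_iff)
  qed
  have br: "bracket (elem 1 2) (elem 3 2) = 0"
    by (rule sl3_eqI) (simp add: mat_of_bracket matrix_matrix_mult_def sum_3 mat_of_elem mat_of_simps)
  have EF: "E1 (?F2 u) = ?F2 (E1 u)" for u
    using ract_bracket[OF admissible_UNIV, where N = "of_int n" and K = "of_int k" and x = "elem 1 2" and y = "elem 3 2" and u = u] by (simp add: br)
  have E1F2: "E1 ((?F2 ^^ j) u) = (?F2 ^^ j) (E1 u)" for j u by (induction j) (simp_all add: EF)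
  have EFpow: "(E1 ^^ i) ((?F2 ^^ j) u) = (?F2 ^^ j) ((E1 ^^ i) u)" for i j u by (induction i) (simp_all add: E1F2)
  have F2: "(?F2 ^^ j) (Poly_Mapping.single (0, 0, 0) 1) = Poly_Mapping.single (0, int j, 0) 1" for j
    by (induction j) (simp_all add: ract_single add.commute)
  obtain \<kappa> where \<kappa>: "\<kappa> \<noteq> 0" "(E1 ^^ b) (?x b) = pm_scale \<kappa> (?x 0)" using pow by blast
  let ?u = "(?F2 ^^ (a + b)) (?x b)"
  have "(E1 ^^ b) ?u = pm_scale \<kappa> (subtop k)"
    unfolding EFpow \<kappa>(2) pow_scale using F2[of "a + b"] by (simp add: subtop_def)
  moreover have "?u \<in> V" by (intro pow_vspace vspaceI) (auto simp: lookup_single when_def)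
  ultimately show ?thesis using \<kappa>(1) by blast
qed

lemma wproj_pow_E1: "wproj (P - int m) Q ((sact n k UNIV (elem 1 2) ^^ m) u) = (sact n k UNIV (elem 1 2) ^^ m) (wproj P Q u)"
proof (induction m)
  case (Suc m)
  have e: "P - int (Suc m) = P - int m - 1" by simp
  show ?case unfolding e using wproj_ract(1)[of "of_int n" "of_int k" UNIV "P - int m" Q "(sact n k UNIV (elem 1 2) ^^ m) u"] Suc by simp
qed simp

lemma complement_trivial:
  assumes A: "bstable n k UNIV A" and B: "bstable n k UNIV B" and AB: "A \<inter> B = S"
    and sum: "\<And>u. u \<in> V \<Longrightarrow> \<exists>x\<in>A. \<exists>y\<in>B. u = x + y" and top: "topv \<in> A"
  shows "B = S"
proof (rule ccontr)
  assume BS: "B \<noteq> S"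
  interpret model n k UNIV by unfold_locales (rule admissible_UNIV)
  have SA: "S \<subseteq> A" and SB: "S \<subseteq> B" using AB by auto
  have topB: "topv \<notin> B" using top AB topv_notin_S by blast
  then have v1B: "subtop k \<in> B" using above_S[OF B SB BS] by blast
  then have v1A: "subtop k \<notin> A" using AB subtop_notin_S by blast
  \<comment> \<open>The components in \<open>A\<close> of elements of \<open>Y\<close>. They form a submodule above \<open>S\<close> that contains neither \<open>v\<^sub>0\<close> nor \<open>v\<^sub>1\<close>, so it is \<open>S\<close>, and \<open>Y\<close> lies in \<open>B\<close>.\<close>
  let ?D = "{d \<in> A. \<exists>y\<in>Y. y + pm_scale (- 1) d \<in> B}"
  have D: "bstable n k UNIV ?D" unfolding bstable_def
  proof (intro conjI ballI allI)
    show "?D \<subseteq> V" using bstableD(1)[OF A] by blast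
    show "0 \<in> ?D" using bstableD(2)[OF A] bstableD(2)[OF B] bstableD(2)[OF Y_bstable] by (auto intro!: bexI[of _ 0])
    fix u assume u: "u \<in> ?D"
    then obtain y where y: "y \<in> Y" "y + pm_scale (- 1) u \<in> B" by blast
    show "u + v \<in> ?D" if v: "v \<in> ?D" for v
    proof -
      obtain y' where y': "y' \<in> Y" "y' + pm_scale (- 1) v \<in> B" using v by blast
      have "(y + y') + pm_scale (- 1) (u + v) = (y + pm_scale (- 1) u) + (y' + pm_scale (- 1) v)" by simp
      then have "(y + y') + pm_scale (- 1) (u + v) \<in> B" using bstableD(3)[OF B y(2) y'(2)] by metis
      then show ?thesis using u v bstableD(3)[OF A, of u v] bstableD(3)[OF Y_bstable y(1) y'(1)] by blast
    qed
    show "pm_scale z u \<in> ?D" for z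
    proof -
      have "pm_scale z y + pm_scale (- 1) (pm_scale z u) = pm_scale z (y + pm_scale (- 1) u)"
        by (simp only: pm.scale_right_distrib pm.scale_scale mult.commute)
      then have "pm_scale z y + pm_scale (- 1) (pm_scale z u) \<in> B" using bstableD(4)[OF B y(2)] by metis
      then show ?thesis using u bstableD(4)[OF A, of u z] bstableD(4)[OF Y_bstable y(1), of z] by blast
    qed
    show "sact n k UNIV x u \<in> ?D" if x: "x \<in> borel_sl3" for x
    proof -
      have "sact n k UNIV x y + pm_scale (- 1) (sact n k UNIV x u) = sact n k UNIV x (y + pm_scale (- 1) u)"
        by (simp only: ract_add ract_scale)
      then have "sact n k UNIV x y + pm_scale (- 1) (sact n k UNIV x u) \<in> B" using bstableD(5)[OF B x y(2)] by metis
      then show ?thesis using u bstableD(5)[OF A x, of u] bstableD(5)[OF Y_bstable x y(1)] by blast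
    qed
  qed
  have SD: "S \<subseteq> ?D"
  proof
    fix s assume s: "s \<in> S"
    have "0 + pm_scale (- 1) s \<in> B" using bstableD(4)[OF B subsetD[OF SB s], of "- 1"] by simp
    then show "s \<in> ?D" using s SA bstableD(2)[OF Y_bstable] by blast
  qed
  have topD: "topv \<notin> ?D"
  proof
    assume "topv \<in> ?D"
    then obtain y where y: "y \<in> Y" "y + pm_scale (- 1) topv \<in> B" by blast
    have "wproj 0 0 (y + pm_scale (- 1) topv) \<in> B" by (rule bstable_wproj[OF B y(2)])
    moreover have "wproj 0 0 (y + pm_scale (- 1) topv) = pm_scale (- 1) topv"
      unfolding wproj_add wproj_scale wproj_homog[OF homog_topv] using Y_weight[OF y(1), of 0 0] a by simp
    ultimately have "pm_scale (- 1) topv \<in> B" by metis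
    then show False using bstable_scale_cancel[OF B, of "- 1" topv] topB by simp
  qed
  have DS: "?D = S"
  proof (rule ccontr)
    assume "?D \<noteq> S"
    from above_S[OF D SD this] topD v1A show False by blast
  qed
  have YB: "Y \<subseteq> B"
  proof
    fix y assume y: "y \<in> Y"
    then have "y \<in> V" by (simp add: Y_def)
    then obtain u v where uv: "u \<in> A" "v \<in> B" "y = u + v" using sum by blast
    have "y + pm_scale (- 1) u = v" using uv(3) by simp
    then have "u \<in> ?D" using uv y by blast
    then have "u \<in> B" using DS SB by blast
    then show "y \<in> B" unfolding uv(3) using bstableD(3)[OF B] uv(2) by blast
  qed
  obtain u \<kappa> where u: "u \<in> V" "\<kappa> \<noteq> 0" "(E1 ^^ b) u = pm_scale \<kappa> (subtop k)" using raising_witness by blast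
  obtain uA uB where uAB: "uA \<in> A" "uB \<in> B" "u = uA + uB" using sum[OF u(1)] by blast
  obtain y s where ys: "y \<in> Y" "s \<in> S" "uB = y + s" using contained_in_Y_plus_S[OF B SB topB uAB(2)] by blast
  have yV: "y \<in> V" using ys(1) by (simp add: Y_def)
  have eq: "wproj 0 k ((E1 ^^ b) u) = wproj 0 k ((E1 ^^ b) uA) + (wproj 0 k ((E1 ^^ b) y) + wproj 0 k ((E1 ^^ b) s))"
    unfolding uAB(3) ys(3) pow_add wproj_add ..
  have powst: "(E1 ^^ m) v \<in> X" if "bstable n k UNIV X" "v \<in> X" for m v X
    by (induction m) (simp_all add: that(2) bstableD(5)[OF that(1) elem_borel(1)])
  \<comment> \<open>Both parts of \<open>uB\<close> contribute nothing in the weight of \<open>v\<^sub>1\<close>, so \<open>v\<^sub>1\<close> is a multiple of a component of \<open>e\<^sub>\<alpha>\<^sup>b uA\<close>.\<close>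
  have s0: "wproj 0 k ((E1 ^^ b) s) = 0"
    by (rule low_weights_S[OF powst[OF S_bstable ys(2)]]) (use b in simp)
  have y0: "wproj 0 k ((E1 ^^ b) y) = 0"
  proof -
    let ?y = "wproj (int b) k y"
    have z: "E1 ?y = 0"
    proof (rule wvec_eqI)
      fix i j l
      have nzero: "lk ?y (i', j', l') = 0" if "(i', j', l') \<noteq> (int b, k, 0)" for i' j' l'
      proof (cases "j' < k \<or> l' < 0")
        case True then show ?thesis using ys(1) vspaceD[OF yV, of i' j' l'] by (auto simp: lookup_wproj Y_def)
      next
        case False then show ?thesis using that by (auto simp: lookup_wproj)
      qed
      show "lk (E1 ?y) (i, j, l) = lk 0 (i, j, l)"
      proof (cases "(i + 1, j, l) = (int b, k, 0)")
        case True
        then have i: "i = int b - 1" "j = k" "l = 0" by auto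
        have "of_int n - 1 + of_int (j - l - i) = (of_int (n - 1 + (j - l - i)) :: complex)" by (simp only: of_int_add of_int_diff of_int_1)
        \<comment> \<open>In the weight of \<open>u\<close> the module \<open>Y\<close> is spanned by \<open>f\<^sub>\<alpha>\<^sup>b v\<^sub>1\<close>, where the coefficient of \<open>e\<^sub>\<alpha>\<close> is \<open>n + k - b = 0\<close>.\<close>
        also have "n - 1 + (j - l - i) = 0" using i by simp
        finally show ?thesis using nzero[of i "j - 1" "l + 1"] by (simp add: lookup_op i)
      next
        case False
        have "lk ?y (i + 1, j, l) = 0" by (rule nzero[OF False])
        moreover have "(of_int l + 1) * lk ?y (i, j - 1, l + 1) = 0"
        proof (cases "(i, j - 1, l + 1) = (int b, k, 0)")
          case True
          then have "l = - 1" by simp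
          then show ?thesis by (simp add: of_int_minus)
        qed (simp add: nzero)
        ultimately show ?thesis by (simp add: lookup_op)
      qed
    qed
    have "(E1 ^^ b) ?y = 0"
    proof -
      obtain b' where b': "b = Suc b'" using b by (cases b) auto
      have "(E1 ^^ b) ?y = (E1 ^^ b') (E1 ?y)" unfolding b' by (simp add: funpow_swap1)
      then show ?thesis unfolding z by simp
    qed
    then show ?thesis using wproj_pow_E1[of "int b" b k y] by simp
  qed
  have "wproj 0 k (pm_scale \<kappa> (subtop k)) = pm_scale \<kappa> (subtop k)"
    unfolding wproj_scale wproj_homog[OF homog_subtop] ..
  then have "pm_scale \<kappa> (subtop k) = wproj 0 k ((E1 ^^ b) uA)" using eq unfolding u(3) s0 y0 by simp
  moreover have "wproj 0 k ((E1 ^^ b) uA) \<in> A" by (intro bstable_wproj[OF A] powst[OF A uAB(1)])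
  ultimately have "subtop k \<in> A" using bstable_scale_cancel[OF A _ u(2)] by metis
  then show False using v1A by blast
qed

lemma quotient_indecomposable:
  assumes A: "bstable n k UNIV A" and B: "bstable n k UNIV B" and AB: "A \<inter> B = S"
    and sum: "\<And>u. u \<in> V \<Longrightarrow> \<exists>x\<in>A. \<exists>y\<in>B. u = x + y"
  shows "A = S \<or> B = S"
proof -
  obtain x y where xy: "x \<in> A" "y \<in> B" "topv = x + y" using sum[OF topv_V] by blast
  have V: "x \<in> V" "y \<in> V" using bstableD(1)[OF A xy(1)] bstableD(1)[OF B xy(2)] .
  have "1 = topc x + topc y" using arg_cong[OF xy(3), of topc] by (simp add: lookup_add lookup_topv)
  then have "topc x \<noteq> 0 \<or> topc y \<noteq> 0" by auto
  then show ?thesis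
  proof
    assume nz: "topc x \<noteq> 0"
    have "pm_scale (topc x) topv \<in> A" using bstable_wproj[OF A xy(1), of 0 0] unfolding wproj_singleton[OF V(1)] .
    then have "topv \<in> A" using bstable_scale_cancel[OF A _ nz] by blast
    then show ?thesis using complement_trivial[OF A B AB sum] by blast
  next
    assume nz: "topc y \<noteq> 0"
    have "pm_scale (topc y) topv \<in> B" using bstable_wproj[OF B xy(2), of 0 0] unfolding wproj_singleton[OF V(2)] .
    then have t: "topv \<in> B" using bstable_scale_cancel[OF B _ nz] by blast
    have "\<exists>x\<in>B. \<exists>y\<in>A. u = x + y" if "u \<in> V" for u using sum[OF that] by (metis add.commute)
    then show ?thesis using complement_trivial[OF B A _ _ t] AB by blast
  qed
qed

end

section \<open>Simple quotients and Verma submodules\<close>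

lemma borel_closed:
  shows "x \<in> borel_sl3 \<Longrightarrow> y \<in> borel_sl3 \<Longrightarrow> x + y \<in> borel_sl3 \<and> bracket x y \<in> borel_sl3"
    and "x \<in> borel_sl3 \<Longrightarrow> lscale c x \<in> borel_sl3"
  by (auto simp: borel_sl3_def mat_of_simps mat_of_bracket matrix_matrix_mult_def sum_3)

context sl3_involution begin

abbreviation "mdl n k R \<equiv> vmod t (of_int n) (of_int k) R"

lemma submodule_borel_iff: "submodule borel_sl3 (mdl n k R) A \<longleftrightarrow> bstable n k R A"
proof -
  have "(\<forall>x\<in>borel_sl3. \<forall>u\<in>A. sact n k R (t x) u \<in> A) \<longleftrightarrow> (\<forall>x\<in>borel_sl3. \<forall>u\<in>A. sact n k R x u \<in> A)"
    using t_t t_borel by metis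
  then show ?thesis unfolding submodule_def bstable_def by simp
qed

lemma submodule_UNIV_ract: "submodule UNIV (mdl n k R) A \<Longrightarrow> u \<in> A \<Longrightarrow> sact n k R x u \<in> A"
  using submoduleD(5)[of UNIV "mdl n k R" A "t x" u] by simp

lemma submodule_UNIV_bstable: "submodule UNIV (mdl n k R) A \<Longrightarrow> bstable n k R A"
  unfolding submodule_borel_iff[symmetric] by (rule submodule_restrict[OF _ subset_UNIV])

lemma submodule_top:
  assumes A: "submodule UNIV (mdl n k R) A" and top: "topv \<in> A" and R: "R = UNIV \<or> (\<exists>J. R = {..<J} \<and> 0 < J)"
  shows "A = vspace R"
proof
  show "A \<subseteq> vspace R" using A by (simp add: submodule_def)
  note B = submodule_UNIV_bstable[OF A]
  show "vspace R \<subseteq> A"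
    by (rule subsetI, rule generated[OF bstableD(2)[OF B] bstableD(3)[OF B] bstableD(4)[OF B]
      submodule_UNIV_ract[OF A] submodule_UNIV_ract[OF A] submodule_UNIV_ract[OF A] top R])
qed

lemma only_top_R: "only_top n k R \<Longrightarrow> R = UNIV \<or> (\<exists>J. R = {..<J} \<and> 0 < J)"
  by (auto simp: only_top_def)

lemma mdl_nontrivial: "only_top n k R \<Longrightarrow> vspace R \<noteq> {0}"
  using topv_vspace[OF only_top_adm(2)] topv_nz by blast

lemma mdl_simple:
  assumes ot: "only_top n k R"
  shows "simple_module UNIV (mdl n k R)"
  unfolding simple_module_def
proof (intro conjI allI impI)
  show "lie_module UNIV (mdl n k R)" by (rule lie_module_vmod[OF only_top_adm(1)[OF ot]])
  show "mcarrier (mdl n k R) \<noteq> {mzero (mdl n k R)}" using mdl_nontrivial[OF ot] by simp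
  fix A assume A: "submodule UNIV (mdl n k R) A"
  show "A = {mzero (mdl n k R)} \<or> A = mcarrier (mdl n k R)"
    using bstable_topv[OF ot submodule_UNIV_bstable[OF A]] submodule_top[OF A _ only_top_R[OF ot]] by auto
qed

lemma mdl_indecomposable:
  assumes ot: "only_top n k R"
  shows "indecomposable borel_sl3 (mdl n k R)"
  unfolding indecomposable_def
proof (intro conjI notI)
  show "lie_module borel_sl3 (mdl n k R)" by (rule lie_module_vmod[OF only_top_adm(1)[OF ot]])
  show False if "mcarrier (mdl n k R) = {mzero (mdl n k R)}" using that mdl_nontrivial[OF ot] by simp
  assume "\<exists>A B. submodule borel_sl3 (mdl n k R) A \<and> submodule borel_sl3 (mdl n k R) B \<and> A \<noteq> {mzero (mdl n k R)} \<and>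
     B \<noteq> {mzero (mdl n k R)} \<and> A \<inter> B = {mzero (mdl n k R)} \<and> mcarrier (mdl n k R) = {madd (mdl n k R) a b |a b. a \<in> A \<and> b \<in> B}"
  then obtain A B where "bstable n k R A" "bstable n k R B" "A \<noteq> {0}" "B \<noteq> {0}" "A \<inter> B = {0}"
    unfolding submodule_borel_iff by auto
  then have "topv \<in> {0}" using bstable_topv[OF ot] by blast
  then show False by simp
qed

lemma cut_module_hom:
  assumes "admissible (of_int k) R"
  shows "module_hom s (mdl n k UNIV) (mdl n k R) (cut R)"
  unfolding module_hom_def
  by (auto simp: vspace_cut cut_add cut_scale ract_cut[OF assms] sact_UNIV)

text \<open>A proper submodule of \<open>M(\<nu>)\<close> is mapped to zero in the simple module: otherwise its image would contain the highest weight
  vector, a preimage of which has \<open>topv\<close> as its component of weight zero.\<close>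

lemma simple_hw_iso:
  assumes ot: "only_top n k R" and \<nu>: "has_top_weight t (of_int n) (of_int k) \<nu>"
  shows "module_iso UNIV (simple_hw_module \<nu>) (mdl n k R)" "lie_module UNIV (simple_hw_module \<nu>)"
proof -
  obtain g where g: "module_hom UNIV (verma \<nu>) (mdl n k UNIV) g" "bij_betw g (mcarrier (verma \<nu>)) (vspace UNIV)"
    using verma_iso[OF \<nu>] .
  let ?f = "cut R \<circ> g"
  have lV: "lie_module UNIV (verma \<nu>)" by (rule lie_module_verma[OF \<nu>])
  interpret L: lin_module UNIV "verma \<nu>" by (rule lie_module_lin[OF lV])
  have f: "module_hom UNIV (verma \<nu>) (mdl n k R) ?f"
    by (rule module_hom_compose[OF g(1) cut_module_hom[OF only_top_adm(1)[OF ot]]])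
  have "cut R ` vspace UNIV = vspace R"
  proof
    show "cut R ` vspace UNIV \<subseteq> vspace R" using vspace_cut by blast
    show "vspace R \<subseteq> cut R ` vspace UNIV"
    proof
      fix c assume c: "c \<in> vspace R"
      show "c \<in> cut R ` vspace UNIV" by (rule image_eqI[of _ _ c]) (simp_all add: vspace_cut_id[OF c] vspace_UNIV[OF c])
    qed
  qed
  then have im: "?f ` mcarrier (verma \<nu>) = mcarrier (mdl n k R)"
    using g(2) unfolding image_comp[symmetric] by (simp add: bij_betw_def)
  have max: "N \<subseteq> {u \<in> mcarrier (verma \<nu>). ?f u = mzero (mdl n k R)}"
    if N: "submodule UNIV (verma \<nu>) N" "N \<noteq> mcarrier (verma \<nu>)" for N
  proof (rule ccontr)
    assume no: "\<not> N \<subseteq> {u \<in> mcarrier (verma \<nu>). ?f u = mzero (mdl n k R)}"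
    have NV: "N \<subseteq> mcarrier (verma \<nu>)" using N(1) by (simp add: submodule_def)
    let ?N = "g ` N"
    have N': "submodule UNIV (mdl n k UNIV) ?N" by (rule L.submodule_image[OF g(1) lie_module_lin[OF lie_vmod] N(1)])
    have lR: "lin_module UNIV (mdl n k R)" by (rule lie_module_lin[OF lie_module_vmod[OF only_top_adm(1)[OF ot]]])
    have fN: "submodule UNIV (mdl n k R) (?f ` N)" by (rule L.submodule_image[OF f lR N(1)])
    have "?f ` N \<noteq> {0}" using no NV by auto
    then have "topv \<in> ?f ` N" using bstable_topv[OF ot submodule_UNIV_bstable[OF fN]] by blast
    then obtain x where x: "x \<in> N" "topv = ?f x" by blast
    define c where "c = g x"
    have c: "c \<in> ?N" "cut R c = topv" using x by (simp_all add: c_def)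
    have cV: "c \<in> vspace UNIV" using c(1) N' by (auto simp: submodule_def)
    have "topc c = 1" using arg_cong[OF c(2), of topc] only_top_adm(2)[OF ot] by (simp add: lookup_cut lookup_topv)
    then have "wproj 0 0 c = topv"
      using homog_0[OF wproj_vspace[OF cV, of 0 0] homog_wproj] by (simp add: lookup_wproj)
    then have "topv \<in> ?N" using bstable_wproj[OF submodule_UNIV_bstable[OF N'] c(1), of 0 0] by simp
    then have "?N = vspace UNIV" by (rule submodule_top[OF N']) simp
    then have "g ` N = g ` mcarrier (verma \<nu>)" using g(2) by (simp add: bij_betw_def)
    moreover have "inj_on g (mcarrier (verma \<nu>))" using g(2) by (simp add: bij_betw_def)
    ultimately have "N = mcarrier (verma \<nu>)" using inj_on_image_eq_iff[OF _ NV order_refl] by blast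
    then show False using N(2) by simp
  qed
  show "module_iso UNIV (simple_hw_module \<nu>) (mdl n k R)" "lie_module UNIV (simple_hw_module \<nu>)"
    unfolding simple_hw_module_def using simple_quotient_iso[OF lV mdl_simple[OF ot] f im max] by blast+
qed

text \<open>A homomorphism between Verma modules maps the highest weight vector to a singular vector of the same weight, and these form a
  line.\<close>

lemma embedding_image_unique:
  assumes emb: "verma_embedding (n - 2 * p + q) (k + p - 2 * q) n k \<iota> w p q" and sing: "singular n k UNIV w"
    and h: "module_hom UNIV (mdl (n - 2 * p + q) (k + p - 2 * q) UNIV) (mdl n k UNIV) h" and inj: "inj_on h (vspace UNIV)"
  shows "h ` vspace UNIV = \<iota> ` vspace UNIV"
proof -
  define n' k' where nk: "n' = n - 2 * p + q" "k' = k + p - 2 * q"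
  interpret E: verma_embedding n' k' n k \<iota> w p q using emb by (simp add: nk)
  have h': "module_hom UNIV (mdl n' k' UNIV) (mdl n k UNIV) h" using h by (simp only: nk)
  have hc: "h u \<in> vspace UNIV" if "u \<in> vspace UNIV" for u using h that unfolding module_hom_def by auto
  have ha: "h (u + v) = h u + h v" if "u \<in> vspace UNIV" "v \<in> vspace UNIV" for u v using h that unfolding module_hom_def by auto
  have hs: "h (pm_scale z u) = pm_scale z (h u)" if "u \<in> vspace UNIV" for u z using h that unfolding module_hom_def by auto
  have he: "h (sact n' k' UNIV x u) = sact n k UNIV x (h u)" if "u \<in> vspace UNIV" for x u
  proof -
    have "h (mact (mdl n' k' UNIV) (t x) u) = mact (mdl n k UNIV) (t x) (h u)"
      using h' that unfolding module_hom_def by (simp del: t_t vmod_simps(5))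
    then show ?thesis by simp
  qed
  have h0: "h 0 = 0" using hs[of 0 0] by simp
  let ?u = "h topv"
  have u: "?u \<in> vspace UNIV" by (rule hc[OF E.topv_U])
  have "sact n' k' UNIV (elem 1 2) topv = 0" "sact n' k' UNIV (elem 2 3) topv = 0"
    using singular_topv[of UNIV n' k'] by (auto simp: singular_def)
  then have su: "singular n k UNIV ?u"
    unfolding singular_def using he[OF E.topv_U, of "elem 1 2"] he[OF E.topv_U, of "elem 2 3"] u h0 by simp
  have "sact n k UNIV hsep ?u = pm_scale (wt_char (of_int n') (of_int k') hsep) ?u"
    using he[OF E.topv_U, of hsep] unfolding topv_eigenvector[OF hsep_borel] hs[OF E.topv_U] by simp
  then have hu: "homog p q ?u" unfolding nk by (rule eigenvector_homog[OF u])
  let ?z = "lk ?u (p, q, 0)"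
  have uw: "?u = pm_scale ?z w" by (rule singular_unique[OF sing E.homog_w E.lead_w su hu])
  have z: "?z \<noteq> 0"
  proof
    assume "?z = 0"
    then have "h topv = h 0" using uw h0 by (metis pm.scale_zero_left)
    then show False using inj_onD[OF inj, of topv 0] E.topv_U by simp
  qed
  have hi: "h c = pm_scale ?z (\<iota> c)" if c: "c \<in> vspace UNIV" for c
  proof -
    let ?A = "{c \<in> vspace UNIV. h c = pm_scale ?z (\<iota> c)}"
    have st: "sact n' k' UNIV x v \<in> ?A" if "v \<in> ?A" for x v
      using that by (simp add: vspace_ract he E.equiv ract_scale)
    have "c \<in> ?A"
    proof (rule generated[of ?A "of_int n'" "of_int k'" UNIV, OF _ _ _ st st st _ _ c])
      show "topv \<in> ?A" using uw E.topv_U E.top by simp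
    qed (auto simp: h0 ha hs E.add E.scale vspace_add vspace_scale pm.scale_right_distrib mult.commute)
    then show ?thesis by blast
  qed
  show ?thesis
  proof
    show "h ` vspace UNIV \<subseteq> \<iota> ` vspace UNIV"
    proof
      fix y assume "y \<in> h ` vspace UNIV"
      then obtain c where c: "c \<in> vspace UNIV" "y = h c" by blast
      show "y \<in> \<iota> ` vspace UNIV" unfolding c(2) hi[OF c(1)] E.scale[OF c(1), symmetric] by (rule imageI[OF vspace_scale[OF c(1)]])
    qed
    show "\<iota> ` vspace UNIV \<subseteq> h ` vspace UNIV"
    proof
      fix y assume "y \<in> \<iota> ` vspace UNIV"
      then obtain c where c: "c \<in> vspace UNIV" "y = \<iota> c" by blast
      have "h (pm_scale (1 / ?z) c) = y" using z by (simp add: hi vspace_scale c E.scale)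
      then show "y \<in> h ` vspace UNIV" using vspace_scale[OF c(1)] by blast
    qed
  qed
qed

lemma verma_submodule_eq:
  assumes emb: "verma_embedding n' k' n k \<iota> w p q" and sing: "singular n k UNIV w"
    and nk: "n' = n - 2 * p + q" "k' = k + p - 2 * q"
    and \<nu>: "has_top_weight t (of_int n) (of_int k) \<nu>" and \<mu>: "has_top_weight t (of_int n') (of_int k') \<mu>"
    and g: "module_hom UNIV (verma \<nu>) (mdl n k UNIV) g" "bij_betw g (mcarrier (verma \<nu>)) (vspace UNIV)"
  shows "verma_submodule \<mu> \<nu> = {u \<in> mcarrier (verma \<nu>). g u \<in> \<iota> ` vspace UNIV}"
proof -
  interpret E: verma_embedding n' k' n k \<iota> w p q by (rule emb)
  obtain f where f: "module_hom UNIV (verma \<mu>) (mdl n' k' UNIV) f" "bij_betw f (mcarrier (verma \<mu>)) (vspace UNIV)"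
    using verma_iso[OF \<mu>] .
  interpret L\<nu>: lin_module UNIV "verma \<nu>" by (rule lie_module_lin[OF lie_module_verma[OF \<nu>]])
  interpret L\<mu>: lin_module UNIV "verma \<mu>" by (rule lie_module_lin[OF lie_module_verma[OF \<mu>]])
  \<comment> \<open>Embeddings of Verma modules correspond to embeddings of models by conjugation with the isomorphisms \<open>f\<close> and \<open>g\<close>.\<close>
  let ?gi = "inv_into (mcarrier (verma \<nu>)) g" and ?fi = "inv_into (mcarrier (verma \<mu>)) f"
  have gi: "module_hom UNIV (mdl n k UNIV) (verma \<nu>) ?gi" "bij_betw ?gi (vspace UNIV) (mcarrier (verma \<nu>))"
    using L\<nu>.inv_hom[OF g(1)] g(2) bij_betw_inv_into[OF g(2)] by auto
  have fi: "module_hom UNIV (mdl n' k' UNIV) (verma \<mu>) ?fi" "bij_betw ?fi (vspace UNIV) (mcarrier (verma \<mu>))"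
    using L\<mu>.inv_hom[OF f(1)] f(2) bij_betw_inv_into[OF f(2)] by auto
  have \<iota>: "module_hom UNIV (mdl n' k' UNIV) (mdl n k UNIV) \<iota>"
    unfolding module_hom_def by (auto simp: E.closed E.add E.scale E.equiv)
  let ?j = "?gi \<circ> (\<iota> \<circ> f)"
  have j: "module_hom UNIV (verma \<mu>) (verma \<nu>) ?j"
    by (intro module_hom_compose[OF _ gi(1)] module_hom_compose[OF f(1) \<iota>])
  have fim: "f ` mcarrier (verma \<mu>) = vspace UNIV" using f(2) by (simp add: bij_betw_def)
  have jinj: "inj_on ?j (mcarrier (verma \<mu>))"
  proof (intro comp_inj_on)
    show "inj_on f (mcarrier (verma \<mu>))" using f(2) by (simp add: bij_betw_def)
    show "inj_on \<iota> (f ` mcarrier (verma \<mu>))" unfolding fim by (rule E.inj)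
    show "inj_on ?gi ((\<iota> \<circ> f) ` mcarrier (verma \<mu>))"
      by (rule inj_on_subset[of _ "vspace UNIV"]) (use gi(2) E.closed fim in \<open>auto simp: bij_betw_def\<close>)
  qed
  have pre: "?gi ` (\<iota> ` vspace UNIV) = {u \<in> mcarrier (verma \<nu>). g u \<in> \<iota> ` vspace UNIV}"
  proof (intro set_eqI iffI)
    fix u assume "u \<in> ?gi ` (\<iota> ` vspace UNIV)"
    then obtain y where y: "y \<in> \<iota> ` vspace UNIV" "u = ?gi y" by blast
    have yV: "y \<in> vspace UNIV" using y(1) E.closed by blast
    then have "g u = y" unfolding y(2) using bij_betw_inv_into_right[OF g(2)] by blast
    moreover have "u \<in> mcarrier (verma \<nu>)" unfolding y(2) using bij_betwE[OF gi(2)] yV by blast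
    ultimately show "u \<in> {u \<in> mcarrier (verma \<nu>). g u \<in> \<iota> ` vspace UNIV}" using y(1) by blast
  next
    fix u assume u: "u \<in> {u \<in> mcarrier (verma \<nu>). g u \<in> \<iota> ` vspace UNIV}"
    then have "?gi (g u) = u" using bij_betw_inv_into_left[OF g(2)] by blast
    then show "u \<in> ?gi ` (\<iota> ` vspace UNIV)" using u by (metis (mono_tags, lifting) imageI mem_Collect_eq)
  qed
  show ?thesis unfolding verma_submodule_def
  proof (rule the_equality)
    show "\<exists>j. module_embedding UNIV (verma \<mu>) (verma \<nu>) j \<and> {u \<in> mcarrier (verma \<nu>). g u \<in> \<iota> ` vspace UNIV} = j ` mcarrier (verma \<mu>)"
      unfolding module_embedding_def pre[symmetric] using j jinj by (intro exI[of _ ?j]) (simp only: image_comp[symmetric] fim)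
    fix N assume "\<exists>j. module_embedding UNIV (verma \<mu>) (verma \<nu>) j \<and> N = j ` mcarrier (verma \<mu>)"
    then obtain j where j: "module_hom UNIV (verma \<mu>) (verma \<nu>) j" "inj_on j (mcarrier (verma \<mu>))" "N = j ` mcarrier (verma \<mu>)"
      unfolding module_embedding_def by blast
    have jc: "j ` mcarrier (verma \<mu>) \<subseteq> mcarrier (verma \<nu>)" using j(1) by (simp add: module_hom_def)
    let ?h = "g \<circ> (j \<circ> ?fi)"
    have fiim: "?fi ` vspace UNIV = mcarrier (verma \<mu>)" using fi(2) by (simp add: bij_betw_def)
    have h: "module_hom UNIV (mdl n' k' UNIV) (mdl n k UNIV) ?h"
      by (intro module_hom_compose[OF _ g(1)] module_hom_compose[OF fi(1) j(1)])
    have "inj_on ?h (vspace UNIV)"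
    proof (intro comp_inj_on)
      show "inj_on ?fi (vspace UNIV)" using fi(2) by (simp add: bij_betw_def)
      show "inj_on j (?fi ` vspace UNIV)" unfolding fiim by (rule j(2))
      show "inj_on g ((j \<circ> ?fi) ` vspace UNIV)"
        by (rule inj_on_subset[of _ "mcarrier (verma \<nu>)"]) (use g(2) jc fiim in \<open>auto simp: bij_betw_def\<close>)
    qed
    then have "?h ` vspace UNIV = \<iota> ` vspace UNIV"
      using embedding_image_unique[of n p q k \<iota> w ?h] emb sing h unfolding nk by blast
    then have gN: "g ` N = \<iota> ` vspace UNIV" unfolding image_comp[symmetric] by (simp add: fiim j(3))
    have "?gi ` (g ` N) = N" using inv_into_image_cancel[of g "mcarrier (verma \<nu>)" N] g(2) jc j(3) by (simp add: bij_betw_def)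
    then show "N = {u \<in> mcarrier (verma \<nu>). g u \<in> \<iota> ` vspace UNIV}" using gN pre by simp
  qed
qed

end

section \<open>The decompositions\<close>

context sl3_involution begin

context
  fixes a b :: nat and \<iota> r1 r2
  assumes vd: "verma_decomposition a b \<iota> r1 r2"
begin

interpretation D: verma_decomposition a b \<iota> r1 r2 by (rule vd)

lemma model_decomposition:
  "module_iso borel_sl3 (mdl (- int a) (int a + int b) UNIV)
     ((mdl (- int a) (int a + int b) UNIV //\<^sub>m D.S) \<oplus>\<^sub>m mdl (- int a - int b) (int a) {..<int a} \<oplus>\<^sub>m mdl (- int b) (- int a) UNIV)"
proof -
  let ?M = "mdl (- int a) (int a + int b) UNIV"
  interpret M: lin_module borel_sl3 ?M by (rule lie_module_lin[OF lie_vmod])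
  interpret S: sub_lin_module borel_sl3 ?M D.S
    by unfold_locales (simp only: submodule_borel_iff D.S_bstable)
  let ?f = "\<lambda>c. (coset ?M D.S c, r1 c, r2 c)"
  have hom: "module_hom borel_sl3 ?M ((?M //\<^sub>m D.S) \<oplus>\<^sub>m mdl (- int a - int b) (int a) {..<int a} \<oplus>\<^sub>m mdl (- int b) (- int a) UNIV) ?f"
    unfolding module_hom_def
  proof (intro conjI ballI allI)
    show "?f ` mcarrier ?M \<subseteq> mcarrier ((?M //\<^sub>m D.S) \<oplus>\<^sub>m mdl (- int a - int b) (int a) {..<int a} \<oplus>\<^sub>m mdl (- int b) (- int a) UNIV)"
      by (auto simp: S.Q_carrier D.r1(1) D.r2(1))
  next
    fix u v assume "u \<in> mcarrier ?M" "v \<in> mcarrier ?M"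
    then show "?f (madd ?M u v) = madd ((?M //\<^sub>m D.S) \<oplus>\<^sub>m mdl (- int a - int b) (int a) {..<int a} \<oplus>\<^sub>m mdl (- int b) (- int a) UNIV) (?f u) (?f v)"
      by (simp add: S.Q_add del: vmod_simps(3)) (simp add: D.r1(2) D.r2(2))
  next
    fix z u assume "u \<in> mcarrier ?M"
    then show "?f (mscale ?M z u) = mscale ((?M //\<^sub>m D.S) \<oplus>\<^sub>m mdl (- int a - int b) (int a) {..<int a} \<oplus>\<^sub>m mdl (- int b) (- int a) UNIV) z (?f u)"
      by (simp add: S.Q_scale del: vmod_simps(4)) (simp add: D.r1(3) D.r2(3))
  next
    fix x u assume xu: "x \<in> borel_sl3" "u \<in> mcarrier ?M"
    then have u: "u \<in> vspace UNIV" by simp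
    show "?f (mact ?M x u) = mact ((?M //\<^sub>m D.S) \<oplus>\<^sub>m mdl (- int a - int b) (int a) {..<int a} \<oplus>\<^sub>m mdl (- int b) (- int a) UNIV) x (?f u)"
      unfolding direct_sum_simps S.Q_act[OF xu(2,1)] unfolding vmod_simps D.r1(4)[OF t_borel[OF xu(1)] u] D.r2(4)[OF t_borel[OF xu(1)] u] ..
  qed
  have inj: "inj_on ?f (mcarrier ?M)"
  proof (rule inj_onI)
    fix u v assume uv: "u \<in> mcarrier ?M" "v \<in> mcarrier ?M" and eq: "?f u = ?f v"
    then have V: "u \<in> vspace UNIV" "v \<in> vspace UNIV" by simp_all
    have "madd ?M u (mscale ?M (- 1) v) \<in> D.S" using S.coset_eq_iff[OF uv] eq by simp
    then have S: "u + pm_scale (- 1) v \<in> D.S" by simp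
    have "r1 (u + pm_scale (- 1) v) = 0" "r2 (u + pm_scale (- 1) v) = 0"
      unfolding D.r1(2)[OF V(1) vspace_scale[OF V(2)]] D.r2(2)[OF V(1) vspace_scale[OF V(2)]] D.r1(3)[OF V(2)] D.r2(3)[OF V(2)]
      using eq by simp_all
    then have "u + pm_scale (- 1) v = 0" by (rule D.joint_kernel[OF S])
    then show "u = v" by simp
  qed
  have surj: "?f ` mcarrier ?M = mcarrier ((?M //\<^sub>m D.S) \<oplus>\<^sub>m mdl (- int a - int b) (int a) {..<int a} \<oplus>\<^sub>m mdl (- int b) (- int a) UNIV)"
  proof
    show "?f ` mcarrier ?M \<subseteq> mcarrier ((?M //\<^sub>m D.S) \<oplus>\<^sub>m mdl (- int a - int b) (int a) {..<int a} \<oplus>\<^sub>m mdl (- int b) (- int a) UNIV)"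
      using hom by (simp only: module_hom_def)
    show "mcarrier ((?M //\<^sub>m D.S) \<oplus>\<^sub>m mdl (- int a - int b) (int a) {..<int a} \<oplus>\<^sub>m mdl (- int b) (- int a) UNIV) \<subseteq> ?f ` mcarrier ?M"
    proof
      fix z assume "z \<in> mcarrier ((?M //\<^sub>m D.S) \<oplus>\<^sub>m mdl (- int a - int b) (int a) {..<int a} \<oplus>\<^sub>m mdl (- int b) (- int a) UNIV)"
      then obtain X t1 t2 where z: "z = (X, t1, t2)" "X \<in> mcarrier (?M //\<^sub>m D.S)" "t1 \<in> vspace {..<int a}" "t2 \<in> vspace UNIV"
        by (cases z rule: prod_cases3) auto
      then obtain u where u: "u \<in> mcarrier ?M" "X = coset ?M D.S u" by (auto simp: S.Q_carrier)
      then have uV: "u \<in> vspace UNIV" by simp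
      have v: "t1 + pm_scale (- 1) (r1 u) \<in> vspace {..<int a}" "t2 + pm_scale (- 1) (r2 u) \<in> vspace UNIV"
        by (intro vspace_add vspace_scale z D.r1(1)[OF uV] D.r2(1)[OF uV])+
      obtain s where s: "s \<in> D.S" "r1 s = t1 + pm_scale (- 1) (r1 u)" "r2 s = t2 + pm_scale (- 1) (r2 u)"
        using D.joint_surj[OF v] by blast
      have sV: "s \<in> vspace UNIV" using s(1) D.S_subset by blast
      have "coset ?M D.S (madd ?M u s) = coset ?M D.S u" by (rule S.coset_add_N[OF u(1) s(1)])
      then have "?f (u + s) = z" by (simp add: z(1) u(2) D.r1(2)[OF uV sV] D.r2(2)[OF uV sV] s(2,3))
      moreover have "u + s \<in> mcarrier ?M" using vspace_add[OF uV sV] by simp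
      ultimately show "z \<in> ?f ` mcarrier ?M" by blast
    qed
  qed
  show ?thesis unfolding module_iso_def using hom inj surj unfolding bij_betw_def by blast
qed

lemma model_decomposition_small:
  "module_iso borel_sl3 (mdl (- int a - int b) (int a) UNIV) (mdl (- int a - int b) (int a) {..<int a} \<oplus>\<^sub>m mdl (- int b) (- int a) UNIV)"
proof -
  let ?N = "mdl (- int a - int b) (int a) UNIV"
  let ?T = "mdl (- int a - int b) (int a) {..<int a} \<oplus>\<^sub>m mdl (- int b) (- int a) UNIV"
  let ?f = "\<lambda>c. (r1 (\<iota> c), r2 (\<iota> c))"
  have hom: "module_hom borel_sl3 ?N ?T ?f"
    unfolding module_hom_def
  proof (intro conjI ballI allI)
    show "?f ` mcarrier ?N \<subseteq> mcarrier ?T" by (auto simp: D.r1(1) D.r2(1) D.emb.closed)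
  next
    fix u v assume "u \<in> mcarrier ?N" "v \<in> mcarrier ?N"
    then show "?f (madd ?N u v) = madd ?T (?f u) (?f v)" by (simp add: D.r1(2) D.r2(2) D.emb.add D.emb.closed)
  next
    fix z u assume "u \<in> mcarrier ?N"
    then show "?f (mscale ?N z u) = mscale ?T z (?f u)" by (simp add: D.r1(3) D.r2(3) D.emb.scale D.emb.closed)
  next
    fix x u assume xu: "x \<in> borel_sl3" "u \<in> mcarrier ?N"
    then have u: "u \<in> vspace UNIV" by simp
    show "?f (mact ?N x u) = mact ?T x (?f u)"
      unfolding direct_sum_simps vmod_simps D.emb.equiv[OF u]
        D.r1(4)[OF t_borel[OF xu(1)] D.emb.closed[OF u]] D.r2(4)[OF t_borel[OF xu(1)] D.emb.closed[OF u]] ..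
  qed
  have inj: "inj_on ?f (mcarrier ?N)"
  proof (rule inj_onI)
    fix u v assume uv: "u \<in> mcarrier ?N" "v \<in> mcarrier ?N" and eq: "?f u = ?f v"
    then have V: "u \<in> vspace UNIV" "v \<in> vspace UNIV" by simp_all
    have d: "u + pm_scale (- 1) v \<in> vspace UNIV" by (intro vspace_add vspace_scale V)
    have "r1 (\<iota> (u + pm_scale (- 1) v)) = 0" "r2 (\<iota> (u + pm_scale (- 1) v)) = 0"
      unfolding D.emb.add[OF V(1) vspace_scale[OF V(2)]] D.emb.scale[OF V(2)]
        D.r1(2)[OF D.emb.closed[OF V(1)] vspace_scale[OF D.emb.closed[OF V(2)]]] D.r2(2)[OF D.emb.closed[OF V(1)] vspace_scale[OF D.emb.closed[OF V(2)]]]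
        D.r1(3)[OF D.emb.closed[OF V(2)]] D.r2(3)[OF D.emb.closed[OF V(2)]]
      using eq by simp_all
    then have "\<iota> (u + pm_scale (- 1) v) = 0" by (rule D.joint_kernel[OF imageI[OF d]])
    then have "u + pm_scale (- 1) v = 0" by (rule D.emb.inj_zero[OF d])
    then show "u = v" by simp
  qed
  have surj: "?f ` mcarrier ?N = mcarrier ?T"
  proof
    show "?f ` mcarrier ?N \<subseteq> mcarrier ?T" using hom by (simp only: module_hom_def)
    show "mcarrier ?T \<subseteq> ?f ` mcarrier ?N"
    proof
      fix z assume "z \<in> mcarrier ?T"
      then obtain t1 t2 where z: "z = (t1, t2)" "t1 \<in> vspace {..<int a}" "t2 \<in> vspace UNIV" by (cases z) auto
      then show "z \<in> ?f ` mcarrier ?N" using D.joint_surj[OF z(2,3)] by auto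
    qed
  qed
  show ?thesis unfolding module_iso_def using hom inj surj unfolding bij_betw_def by blast
qed

lemma model_quotient_indecomposable:
  "indecomposable borel_sl3 (mdl (- int a) (int a + int b) UNIV //\<^sub>m D.S)"
proof (rule indecomposable_quotient[OF lie_vmod])
  show "submodule borel_sl3 (mdl (- int a) (int a + int b) UNIV) D.S"
    by (simp only: submodule_borel_iff D.S_bstable)
  show "D.S \<noteq> mcarrier (mdl (- int a) (int a + int b) UNIV)" using D.topv_notin_S D.topv_V by auto
  fix A B
  assume A: "submodule borel_sl3 (mdl (- int a) (int a + int b) UNIV) A" and B: "submodule borel_sl3 (mdl (- int a) (int a + int b) UNIV) B"
    and AB: "A \<inter> B = D.S" and sum: "mcarrier (mdl (- int a) (int a + int b) UNIV) = {madd (mdl (- int a) (int a + int b) UNIV) x y |x y. x \<in> A \<and> y \<in> B}"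
  show "A = D.S \<or> B = D.S"
  proof (rule D.quotient_indecomposable[OF _ _ AB])
    show "\<exists>x\<in>A. \<exists>y\<in>B. u = x + y" if "u \<in> vspace UNIV" for u using that sum by auto
  qed (use A B in \<open>simp_all only: submodule_borel_iff\<close>)
qed (use borel_closed in blast)+

end

lemma verma_module_iso:
  assumes \<nu>: "has_top_weight t (of_int n) (of_int k) \<nu>"
  shows "module_iso s (verma \<nu>) (mdl n k UNIV)"
proof -
  obtain f where f: "module_hom UNIV (verma \<nu>) (mdl n k UNIV) f" "bij_betw f (mcarrier (verma \<nu>)) (vspace UNIV)"
    using verma_iso[OF \<nu>] .
  then have "module_iso UNIV (verma \<nu>) (mdl n k UNIV)" unfolding module_iso_def by (intro exI[of _ f]) simp
  then show ?thesis by (rule module_iso_restrict[OF _ subset_UNIV])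
qed

lemma verma_decompositions:
  assumes ab: "0 < a" "0 < (b :: nat)"
    and \<nu>: "has_top_weight t (of_int (- int a)) (of_int (int a + int b)) \<nu>"
    and \<mu>: "has_top_weight t (of_int (- int a - int b)) (of_int (int a)) \<mu>"
    and \<omega>: "has_top_weight t (of_int (- int b)) (of_int (- int a)) \<omega>"
  shows "module_iso borel_sl3 (verma \<nu>) ((verma \<nu> //\<^sub>m verma_submodule \<mu> \<nu>) \<oplus>\<^sub>m simple_hw_module \<mu> \<oplus>\<^sub>m verma \<omega>)"
    and "module_iso borel_sl3 (verma \<mu>) (simple_hw_module \<mu> \<oplus>\<^sub>m verma \<omega>)"
    and "indecomposable borel_sl3 (verma \<nu> //\<^sub>m verma_submodule \<mu> \<nu>)"
    and "indecomposable borel_sl3 (simple_hw_module \<mu>)"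
    and "indecomposable borel_sl3 (verma \<omega>)"
proof -
  obtain \<iota> r1 r2 where vd: "verma_decomposition a b \<iota> r1 r2" using exists_decomposition[OF ab] by blast
  interpret D: verma_decomposition a b \<iota> r1 r2 by (rule vd)
  let ?M = "mdl (- int a) (int a + int b) UNIV" and ?N = "mdl (- int a - int b) (int a) UNIV"
  let ?T1 = "mdl (- int a - int b) (int a) {..<int a}" and ?T2 = "mdl (- int b) (- int a) UNIV"
  obtain g where g: "module_hom UNIV (verma \<nu>) ?M g" "bij_betw g (mcarrier (verma \<nu>)) (vspace UNIV)"
    using verma_iso[OF \<nu>] .
  have l\<nu>: "lie_module UNIV (verma \<nu>)" "lie_module borel_sl3 (verma \<nu>)"
    using lie_module_verma[OF \<nu>] lie_module_restrict[OF _ subset_UNIV] by blast+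
  have l\<mu>: "lie_module borel_sl3 (verma \<mu>)" using lie_module_restrict[OF lie_module_verma[OF \<mu>] subset_UNIV] .
  have l\<omega>: "lie_module borel_sl3 (verma \<omega>)" using lie_module_restrict[OF lie_module_verma[OF \<omega>] subset_UNIV] .
  note iso = verma_module_iso[OF \<nu>, of borel_sl3] and iso\<mu> = verma_module_iso[OF \<mu>, of borel_sl3]
    and iso\<omega> = verma_module_iso[OF \<omega>, of borel_sl3]
  note ot = only_top_cut[OF ab] and ot2 = only_top_antidominant[OF ab]
  have isoL: "module_iso borel_sl3 (simple_hw_module \<mu>) ?T1" and lL: "lie_module borel_sl3 (simple_hw_module \<mu>)"
    using simple_hw_iso[OF ot \<mu>] module_iso_restrict[OF _ subset_UNIV] lie_module_restrict[OF _ subset_UNIV] by blast+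
  have e: "- int a - int b = - int a - 2 * int b + int b" "int a = int a + int b + int b - 2 * int b" by simp_all
  have vs: "verma_submodule \<mu> \<nu> = {u \<in> mcarrier (verma \<nu>). g u \<in> D.S}"
    by (rule verma_submodule_eq[OF D.emb singular_sing_vec e \<nu> \<mu> g])
  have subS: "submodule borel_sl3 ?M D.S" by (simp only: submodule_borel_iff D.S_bstable)
  have g': "module_hom borel_sl3 (verma \<nu>) ?M g" "bij_betw g (mcarrier (verma \<nu>)) (mcarrier ?M)"
    using g module_hom_restrict[OF g(1) subset_UNIV] by simp_all
  have isoQ: "module_iso borel_sl3 (verma \<nu> //\<^sub>m verma_submodule \<mu> \<nu>) (?M //\<^sub>m D.S)"
    unfolding vs by (rule quotient_iso_quotient[OF l\<nu>(2) lie_vmod g' subS borel_closed])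
  interpret V: lin_module borel_sl3 "verma \<nu>" by (rule lie_module_lin[OF l\<nu>(2)])
  have subV: "submodule borel_sl3 (verma \<nu>) (verma_submodule \<mu> \<nu>)"
    unfolding vs by (rule V.submodule_vimage[OF g'(1) lie_module_lin[OF lie_vmod] subS])
  interpret VS: sub_lin_module borel_sl3 "verma \<nu>" "verma_submodule \<mu> \<nu>" by unfold_locales (rule subV)
  have lQ: "lie_module borel_sl3 (verma \<nu> //\<^sub>m verma_submodule \<mu> \<nu>)" by (rule VS.Q_lie_module[OF l\<nu>(2) borel_closed])
  have isoL': "module_iso borel_sl3 ?T1 (simple_hw_module \<mu>)" by (rule lin_module.module_iso_sym[OF lie_module_lin[OF lL] isoL])
  have iso\<omega>': "module_iso borel_sl3 ?T2 (verma \<omega>)" by (rule lin_module.module_iso_sym[OF lie_module_lin[OF l\<omega>] iso\<omega>])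
  have isoQ': "module_iso borel_sl3 (?M //\<^sub>m D.S) (verma \<nu> //\<^sub>m verma_submodule \<mu> \<nu>)"
    by (rule lin_module.module_iso_sym[OF lie_module_lin[OF lQ] isoQ])
  show "module_iso borel_sl3 (verma \<nu>) ((verma \<nu> //\<^sub>m verma_submodule \<mu> \<nu>) \<oplus>\<^sub>m simple_hw_module \<mu> \<oplus>\<^sub>m verma \<omega>)"
    by (rule module_iso_trans[OF iso module_iso_trans[OF model_decomposition[OF vd]
      module_iso_direct_sum[OF isoQ' module_iso_direct_sum[OF isoL' iso\<omega>']]]])
  show "module_iso borel_sl3 (verma \<mu>) (simple_hw_module \<mu> \<oplus>\<^sub>m verma \<omega>)"
    by (rule module_iso_trans[OF iso\<mu> module_iso_trans[OF model_decomposition_small[OF vd] module_iso_direct_sum[OF isoL' iso\<omega>']]])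
  show "indecomposable borel_sl3 (verma \<nu> //\<^sub>m verma_submodule \<mu> \<nu>)"
    by (rule indecomposable_iso[OF lQ isoQ model_quotient_indecomposable[OF vd]])
  show "indecomposable borel_sl3 (simple_hw_module \<mu>)"
    by (rule indecomposable_iso[OF lL isoL mdl_indecomposable[OF ot]])
  show "indecomposable borel_sl3 (verma \<omega>)"
    by (rule indecomposable_iso[OF l\<omega> iso\<omega> mdl_indecomposable[OF ot2]])
qed

end

text \<open>The diagram automorphism: up to signs the reflection in the antidiagonal. The signs are chosen so that it maps \<open>E\<^sub>1\<^sub>2\<close> to
  \<open>E\<^sub>2\<^sub>3\<close> and \<open>E\<^sub>2\<^sub>1\<close> to \<open>E\<^sub>3\<^sub>2\<close>.\<close>

lift_definition diagram_flip :: "sl3 \<Rightarrow> sl3" is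
  "\<lambda>A. \<chi> i j. (if i = 1 \<and> j = 1 then - A$3$3 else if i = 1 \<and> j = 2 then A$2$3 else if i = 1 \<and> j = 3 then - A$1$3
    else if i = 2 \<and> j = 1 then A$3$2 else if i = 2 \<and> j = 2 then - A$2$2 else if i = 2 \<and> j = 3 then A$1$2
    else if i = 3 \<and> j = 1 then - A$3$1 else if i = 3 \<and> j = 2 then A$2$1 else - A$1$1)"
  by (simp add: trace_def sum_3; algebra)

lemma mat_of_flip: "mat_of (diagram_flip x) $ 1 $ 1 = - mat_of x $ 3 $ 3" "mat_of (diagram_flip x) $ 1 $ 2 = mat_of x $ 2 $ 3"
  "mat_of (diagram_flip x) $ 1 $ 3 = - mat_of x $ 1 $ 3" "mat_of (diagram_flip x) $ 2 $ 1 = mat_of x $ 3 $ 2"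
  "mat_of (diagram_flip x) $ 2 $ 2 = - mat_of x $ 2 $ 2" "mat_of (diagram_flip x) $ 2 $ 3 = mat_of x $ 1 $ 2"
  "mat_of (diagram_flip x) $ 3 $ 1 = - mat_of x $ 3 $ 1" "mat_of (diagram_flip x) $ 3 $ 2 = mat_of x $ 2 $ 1"
  "mat_of (diagram_flip x) $ 3 $ 3 = - mat_of x $ 1 $ 1"
  by (transfer; simp)+

lemma sl3_eqI_all: "(\<forall>i j. mat_of x $ i $ j = mat_of y $ i $ j) \<Longrightarrow> x = y"
  using sl3_eqI by blast

interpretation flip: sl3_involution diagram_flip
proof
  fix x y c
  show "diagram_flip (x + y) = diagram_flip x + diagram_flip y"
    by (rule sl3_eqI_all) (simp add: forall_3 mat_of_flip mat_of_simps)
  show "diagram_flip (lscale c x) = lscale c (diagram_flip x)"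
    by (rule sl3_eqI_all) (simp add: forall_3 mat_of_flip mat_of_simps)
  show "diagram_flip (bracket x y) = bracket (diagram_flip x) (diagram_flip y)"
    by (rule sl3_eqI_all) (simp add: forall_3 mat_of_flip mat_of_bracket matrix_matrix_mult_def sum_3)
  show "diagram_flip (diagram_flip x) = x"
    by (rule sl3_eqI_all) (simp add: forall_3 mat_of_flip)
  show "diagram_flip x \<in> borel_sl3" if "x \<in> borel_sl3"
    using that by (simp add: borel_sl3_def mat_of_flip)
qed

lemma mat_of_coroots: "mat_of coroot_alpha $ i $ j = (if i = j then (if i = 1 then 1 else if i = 2 then - 1 else 0) else 0)"
  "mat_of coroot_beta $ i $ j = (if i = j then (if i = 2 then 1 else if i = 3 then - 1 else 0) else 0)"
  by (transfer; simp)+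

lemma weight_on_cartan:
  assumes \<nu>: "is_weight \<nu>" and x: "x \<in> cartan"
  shows "\<nu> x = \<nu> coroot_alpha * mat_of x $ 1 $ 1 - \<nu> coroot_beta * mat_of x $ 3 $ 3"
proof -
  have z: "mat_of x $ i $ j = 0" if "i \<noteq> j" for i j using x that by (simp add: cartan_def)
  have t: "mat_of x $ 2 $ 2 = - mat_of x $ 1 $ 1 - mat_of x $ 3 $ 3"
    using mat_of_trace[of x] by (simp add: eq_neg_iff_add_eq_0 algebra_simps)
  have c: "coroot_alpha \<in> cartan" "coroot_beta \<in> cartan" by (auto simp: cartan_def mat_of_coroots)
  have c': "lscale z coroot_alpha \<in> cartan" "lscale z coroot_beta \<in> cartan" for z
    using c by (auto simp: cartan_def mat_of_simps)
  have "x = lscale (mat_of x $ 1 $ 1) coroot_alpha + lscale (- mat_of x $ 3 $ 3) coroot_beta"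
    by (rule sl3_eqI_all) (simp add: forall_3 mat_of_simps mat_of_coroots z t)
  then have "\<nu> x = \<nu> (lscale (mat_of x $ 1 $ 1) coroot_alpha + lscale (- mat_of x $ 3 $ 3) coroot_beta)" by simp
  also have "\<dots> = mat_of x $ 1 $ 1 * \<nu> coroot_alpha + (- mat_of x $ 3 $ 3) * \<nu> coroot_beta"
    using \<nu> c c' unfolding is_weight_def by metis
  finally show ?thesis by (simp add: algebra_simps)
qed

lemma dot_on_diagonal:
  assumes \<nu>: "is_weight \<nu>" and a: "\<nu> coroot_alpha = A - 1" and b: "\<nu> coroot_beta = B - 1"
  shows "(s_alpha \<cdot>\<^sub>W \<nu>) (cartan_part x) = wt_char (- A) (A + B) x"
    "(s_beta \<cdot>\<^sub>W \<nu>) (cartan_part x) = wt_char (A + B) (- B) x"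
    "((s_alpha \<circ> s_beta) \<cdot>\<^sub>W \<nu>) (cartan_part x) = wt_char (- A - B) A x"
    "((s_beta \<circ> s_alpha) \<cdot>\<^sub>W \<nu>) (cartan_part x) = wt_char B (- A - B) x"
    "(w0 \<cdot>\<^sub>W \<nu>) (cartan_part x) = wt_char (- B) (- A) x"
proof -
  let ?x = "cartan_part x"
  have nx: "\<nu> ?x = (A - 1) * mat_of x $ 1 $ 1 - (B - 1) * mat_of x $ 3 $ 3"
    using weight_on_cartan[OF \<nu> cartan_part_cartan[of x]] by (simp add: a b mat_of_cartan_part)
  have t: "mat_of x $ 2 $ 2 = - mat_of x $ 1 $ 1 - mat_of x $ 3 $ 3"
    using mat_of_trace[of x] by (simp add: eq_neg_iff_add_eq_0 algebra_simps)
  have r: "root_alpha ?x = 2 * mat_of x $ 1 $ 1 + mat_of x $ 3 $ 3" "root_beta ?x = - mat_of x $ 1 $ 1 - 2 * mat_of x $ 3 $ 3"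
    by (simp_all add: root_alpha_def root_beta_def mat_of_cartan_part t)
  have c: "root_alpha coroot_alpha = 2" "root_beta coroot_beta = 2" "root_alpha coroot_beta = - 1" "root_beta coroot_alpha = - 1"
    by (simp_all add: root_alpha_def root_beta_def mat_of_coroots)
  note d = dot_def s_alpha_def s_beta_def weyl_rho_def w0_def comp_def r c a b nx wt_char_def
  show "(s_alpha \<cdot>\<^sub>W \<nu>) (cartan_part x) = wt_char (- A) (A + B) x"
    "(s_beta \<cdot>\<^sub>W \<nu>) (cartan_part x) = wt_char (A + B) (- B) x"
    "((s_alpha \<circ> s_beta) \<cdot>\<^sub>W \<nu>) (cartan_part x) = wt_char (- A - B) A x"
    "((s_beta \<circ> s_alpha) \<cdot>\<^sub>W \<nu>) (cartan_part x) = wt_char B (- A - B) x"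
    "(w0 \<cdot>\<^sub>W \<nu>) (cartan_part x) = wt_char (- B) (- A) x"
    unfolding d by (simp_all add: algebra_simps)
qed

lemma wt_char_flip: "wt_char N K (diagram_flip x) = wt_char K N x"
  by (simp add: wt_char_def mat_of_flip)

theorem proposition10:
  fixes lam :: weight
  assumes "dominant_integral lam"
  shows
    "module_iso borel_sl3
       (verma (s_alpha \<cdot>\<^sub>W lam))
       ((verma (s_alpha \<cdot>\<^sub>W lam) //\<^sub>m
           verma_submodule ((s_alpha \<circ> s_beta) \<cdot>\<^sub>W lam) (s_alpha \<cdot>\<^sub>W lam))
         \<oplus>\<^sub>m simple_hw_module ((s_alpha \<circ> s_beta) \<cdot>\<^sub>W lam)
         \<oplus>\<^sub>m verma (w0 \<cdot>\<^sub>W lam))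
   \<and> module_iso borel_sl3
       (verma (s_beta \<cdot>\<^sub>W lam))
       ((verma (s_beta \<cdot>\<^sub>W lam) //\<^sub>m
           verma_submodule ((s_beta \<circ> s_alpha) \<cdot>\<^sub>W lam) (s_beta \<cdot>\<^sub>W lam))
         \<oplus>\<^sub>m simple_hw_module ((s_beta \<circ> s_alpha) \<cdot>\<^sub>W lam)
         \<oplus>\<^sub>m verma (w0 \<cdot>\<^sub>W lam))
   \<and> module_iso borel_sl3
       (verma ((s_alpha \<circ> s_beta) \<cdot>\<^sub>W lam))
       (simple_hw_module ((s_alpha \<circ> s_beta) \<cdot>\<^sub>W lam) \<oplus>\<^sub>m verma (w0 \<cdot>\<^sub>W lam))
   \<and> module_iso borel_sl3
       (verma ((s_beta \<circ> s_alpha) \<cdot>\<^sub>W lam))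
       (simple_hw_module ((s_beta \<circ> s_alpha) \<cdot>\<^sub>W lam) \<oplus>\<^sub>m verma (w0 \<cdot>\<^sub>W lam))
   \<and> indecomposable borel_sl3
       (verma (s_alpha \<cdot>\<^sub>W lam) //\<^sub>m
          verma_submodule ((s_alpha \<circ> s_beta) \<cdot>\<^sub>W lam) (s_alpha \<cdot>\<^sub>W lam))
   \<and> indecomposable borel_sl3
       (verma (s_beta \<cdot>\<^sub>W lam) //\<^sub>m
          verma_submodule ((s_beta \<circ> s_alpha) \<cdot>\<^sub>W lam) (s_beta \<cdot>\<^sub>W lam))
   \<and> indecomposable borel_sl3 (simple_hw_module ((s_alpha \<circ> s_beta) \<cdot>\<^sub>W lam))
   \<and> indecomposable borel_sl3 (simple_hw_module ((s_beta \<circ> s_alpha) \<cdot>\<^sub>W lam))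
   \<and> indecomposable borel_sl3 (verma (w0 \<cdot>\<^sub>W lam))"
proof -
  have w: "is_weight lam" using assms by (simp add: dominant_integral_def)
  obtain a' b' :: nat where "lam coroot_alpha = of_nat a'" "lam coroot_beta = of_nat b'"
    using assms unfolding dominant_integral_def by (auto elim!: Nats_cases)
  then have v: "lam coroot_alpha = of_nat (Suc a') - 1" "lam coroot_beta = of_nat (Suc b') - 1" by simp_all
  define a b where "a = Suc a'" "b = Suc b'"
  have ab: "0 < a" "0 < b" by (simp_all add: a_b_def)
  note dots = dot_on_diagonal[OF w v, folded a_b_def]
  have 1: "has_top_weight (\<lambda>x. x) (of_int (- int a)) (of_int (int a + int b)) (s_alpha \<cdot>\<^sub>W lam)"
    "has_top_weight (\<lambda>x. x) (of_int (- int a - int b)) (of_int (int a)) ((s_alpha \<circ> s_beta) \<cdot>\<^sub>W lam)"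
    "has_top_weight (\<lambda>x. x) (of_int (- int b)) (of_int (- int a)) (w0 \<cdot>\<^sub>W lam)"
    unfolding has_top_weight_def dots by simp_all
  have 2: "has_top_weight diagram_flip (of_int (- int b)) (of_int (int b + int a)) (s_beta \<cdot>\<^sub>W lam)"
    "has_top_weight diagram_flip (of_int (- int b - int a)) (of_int (int b)) ((s_beta \<circ> s_alpha) \<cdot>\<^sub>W lam)"
    "has_top_weight diagram_flip (of_int (- int a)) (of_int (- int b)) (w0 \<cdot>\<^sub>W lam)"
  proof -
    have e: "of_int (int b + int a) = (of_nat a + of_nat b :: complex)"
      "of_int (- int b - int a) = (- of_nat a - of_nat b :: complex)"
      "of_int (- int b) = (- of_nat b :: complex)" "of_int (- int a) = (- of_nat a :: complex)" by simp_all
    show "has_top_weight diagram_flip (of_int (- int b)) (of_int (int b + int a)) (s_beta \<cdot>\<^sub>W lam)"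
      "has_top_weight diagram_flip (of_int (- int b - int a)) (of_int (int b)) ((s_beta \<circ> s_alpha) \<cdot>\<^sub>W lam)"
      "has_top_weight diagram_flip (of_int (- int a)) (of_int (- int b)) (w0 \<cdot>\<^sub>W lam)"
      unfolding has_top_weight_def dots wt_char_flip e of_int_of_nat_eq by (rule ballI, rule refl)+
  qed
  show ?thesis
    using trivial.verma_decompositions[OF ab 1] flip.verma_decompositions[OF ab(2,1) 2] by (intro conjI)
qed

end
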